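(* Let $\alpha>0$, $L>0$, $0<r<s\le 2$. Assume Assumption (N) and Assumption (ND) hold and $\Phi^{\varepsilon}(u)\neq 0$ for all $u\in\mathbb{R}$. Let $\hat f_n$ be the kernel estimator with bandwidth $h_n=h_*$, or, if $r<s/2$, with bandwidth $h_n=h_n^{a}=\left(\frac{\log n}{2\beta}-\sqrt{\frac{\log n}{2\beta}}\right)^{-1/s}$. Then for every $x\in\mathbb{R}$, $$\lim_{n\to\infty} R_n(x,\hat f_n,\mathcal{A}_{\alpha,r}(L))\,\varphi_n^{-2}=\lim_{n\to\infty}\inf_{T_n} R_n(x,T_n,\mathcal{A}_{\alpha,r}(L))\,\varphi_n^{-2}=1,$$ and $$\lim_{n\to\infty} R_n(\mathbb{L}_2,\hat f_n,\mathcal{A}_{\alpha,r}(L))\,\varphi_n^{-2}(\mathbb{L}_2)=\lim_{n\to\infty}\inf_{T_n} R_n(\mathbb{L}_2,T_n,\mathcal{A}_{\alpha,r}(L))\,\varphi_n^{-2}(\mathbb{L}_2)=1,$$ where $\inf_{T_n}$ is over all estimators (measurable functions of $Y_1,\dots,Y_n$).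
   Context: Observations $Y_i=X_i+\varepsilon_i$, $i=1,\dots,n$, where $X_1,\dots,X_n$ are i.i.d. with unknown probability density $f$ on $\mathbb{R}$, $\varepsilon_1,\dots,\varepsilon_n$ are i.i.d. with known density $f^\varepsilon$, and $(\varepsilon_i)$ is independent of $(X_i)$. For integrable $g$, $\Phi^g(u)=\int g(x)e^{ixu}dx$; $\Phi^\varepsilon$ is the characteristic function of $\varepsilon_1$. The class $\mathcal{A}_{\alpha,r}(L)$ is the set of probability densities $f$ on $\mathbb{R}$ with $\int|\Phi^f(u)|^2\exp(2\alpha|u|^r)du\le 2\pi L$. Assumption (N): there are constants $u_0>0,\beta>0,s>0,b_{\min}>0,b_{\max}>0,\gamma,\gamma'\in\mathbb{R}$ with $b_{\min}|u|^{\gamma}e^{-\beta|u|^s}\le|\Phi^\varepsilon(u)|\le b_{\max}|u|^{\gamma'}e^{-\beta|u|^s}$ for $|u|\ge u_0$. Assumption (ND): there are $u_1>0$, $B>0$, $\gamma_1\in\mathbb{R}$ such that $\Phi^\varepsilon$ is twice continuously differentiable on $|u|\ge u_1$ and $\max\{|(\Phi^\varepsilon)'(u)|,|(\Phi^\varepsilon)''(u)|\}\le B|u|^{\gamma_1}e^{-\beta|u|^s}$ there, with the same $\beta,s$ as in (N). The kernel estimator is $\hat f_n(x)=\frac{1}{nh_n}\sum_{i=1}^n K_n\big(\frac{x-Y_i}{h_n}\big)$, where $h_n>0$ and $K_n$ is the inverse Fourier transform of $\Phi^{K_n}(u)=I(|u|\le1)/\Phi^\varepsilon(u/h_n)$.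 For $n\ge3$, $h_*=h_*(n)$ is the unique solution of $\frac{2\beta}{h_*^s}+\frac{2\alpha}{h_*^r}=\log n-(\log\log n)^2$. Rates: $\varphi_n^2=\frac{L}{2\pi\alpha r}h_*^{r-1}\exp(-2\alpha/h_*^r)$ and $\varphi_n^2(\mathbb{L}_2)=L\exp(-2\alpha/h_*^r)$. Risks: $R_n(x,T_n,\mathcal{A}_{\alpha,r}(L))=\sup_{f\in\mathcal{A}_{\alpha,r}(L)}E_f|T_n(x)-f(x)|^2$ and $R_n(\mathbb{L}_2,T_n,\mathcal{A}_{\alpha,r}(L))=\sup_{f\in\mathcal{A}_{\alpha,r}(L)}E_f\|T_n-f\|_2^2$, where $E_f$ is expectation under the joint law of $Y_1,\dots,Y_n$ when $X_i$ have density $f$.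
   Formalization: The class A_{α,r}(L) is taken to consist of continuous densities (each density in it has a unique continuous version); otherwise changing f at the single point x would make the pointwise risk infinite. The L2 risk is unaffected by this choice. *)

theory Defs
  imports "HOL-Probability.Probability"
begin

definition fourier :: "(real \<Rightarrow> real) \<Rightarrow> real \<Rightarrow> complex" where
  "fourier g u = (LINT x|lborel. complex_of_real (g x) * cis (x * u))"

definition prob_density :: "(real \<Rightarrow> real) \<Rightarrow> bool" where
  "prob_density g \<longleftrightarrow> g \<in> borel_measurable borel \<and> (\<forall>x. 0 \<le> g x)
      \<and> integrable lborel g \<and> (LINT x|lborel. g x) = 1"

definition dens_class :: "real \<Rightarrow> real \<Rightarrow> real \<Rightarrow> (real \<Rightarrow> real) set" where
  "dens_class \<alpha> r L = {f. prob_density f \<and> continuous_on UNIV f \<and>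
      (\<integral>\<^sup>+ u. ennreal ((cmod (fourier f u))\<^sup>2 * exp (2 * \<alpha> * \<bar>u\<bar> powr r)) \<partial>lborel)
        \<le> ennreal (2 * pi * L)}"

definition assumption_N :: "real \<Rightarrow> real \<Rightarrow> (real \<Rightarrow> complex) \<Rightarrow> bool" where
  "assumption_N \<beta> s \<Phi> \<longleftrightarrow> 0 < \<beta> \<and> 0 < s \<and>
     (\<exists>u0 bmin bmax \<gamma> \<gamma>'. 0 < u0 \<and> 0 < bmin \<and> 0 < bmax \<and>
        (\<forall>u. u0 \<le> \<bar>u\<bar> \<longrightarrow>
            bmin * \<bar>u\<bar> powr \<gamma> * exp (- \<beta> * \<bar>u\<bar> powr s) \<le> cmod (\<Phi> u) \<and>
            cmod (\<Phi> u) \<le> bmax * \<bar>u\<bar> powr \<gamma>' * exp (- \<beta> * \<bar>u\<bar> powr s)))"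

definition assumption_ND :: "real \<Rightarrow> real \<Rightarrow> (real \<Rightarrow> complex) \<Rightarrow> bool" where
  "assumption_ND \<beta> s \<Phi> \<longleftrightarrow>
     (\<exists>u1 B \<gamma>1 (D1 :: real \<Rightarrow> complex) (D2 :: real \<Rightarrow> complex). 0 < u1 \<and> 0 < B \<and>
        (\<forall>u. u1 \<le> \<bar>u\<bar> \<longrightarrow>
            (\<Phi> has_vector_derivative D1 u) (at u within {v. u1 \<le> \<bar>v\<bar>}) \<and>
            (D1 has_vector_derivative D2 u) (at u within {v. u1 \<le> \<bar>v\<bar>}) \<and>
            max (cmod (D1 u)) (cmod (D2 u)) \<le> B * \<bar>u\<bar> powr \<gamma>1 * exp (- \<beta> * \<bar>u\<bar> powr s)) \<and>
        continuous_on {v. u1 \<le> \<bar>v\<bar>} D2)"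

definition law_Y :: "(real \<Rightarrow> real) \<Rightarrow> (real \<Rightarrow> real) \<Rightarrow> real measure" where
  "law_Y f fe = distr (density lborel f \<Otimes>\<^sub>M density lborel fe) borel (\<lambda>(x, e). x + e)"

definition sample_law :: "(real \<Rightarrow> real) \<Rightarrow> (real \<Rightarrow> real) \<Rightarrow> nat \<Rightarrow> (nat \<Rightarrow> real) measure" where
  "sample_law f fe n = PiM {..<n} (\<lambda>_. law_Y f fe)"

definition estimators :: "nat \<Rightarrow> ((nat \<Rightarrow> real) \<Rightarrow> real \<Rightarrow> real) set" where
  "estimators n = {T. (\<lambda>(Y, x). T Y x) \<in> borel_measurable (PiM {..<n} (\<lambda>_. borel) \<Otimes>\<^sub>M borel)}"

definition risk_pt :: "(real \<Rightarrow> real) \<Rightarrow> real \<Rightarrow> real \<Rightarrow> real \<Rightarrow> nat \<Rightarrow> real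
    \<Rightarrow> ((nat \<Rightarrow> real) \<Rightarrow> real \<Rightarrow> real) \<Rightarrow> ennreal" where
  "risk_pt fe \<alpha> r L n x T =
     (SUP f \<in> dens_class \<alpha> r L. \<integral>\<^sup>+ Y. ennreal ((T Y x - f x)\<^sup>2) \<partial>sample_law f fe n)"

definition risk_L2 :: "(real \<Rightarrow> real) \<Rightarrow> real \<Rightarrow> real \<Rightarrow> real \<Rightarrow> nat
    \<Rightarrow> ((nat \<Rightarrow> real) \<Rightarrow> real \<Rightarrow> real) \<Rightarrow> ennreal" where
  "risk_L2 fe \<alpha> r L n T =
     (SUP f \<in> dens_class \<alpha> r L.
        \<integral>\<^sup>+ Y. (\<integral>\<^sup>+ z. ennreal ((T Y z - f z)\<^sup>2) \<partial>lborel) \<partial>sample_law f fe n)"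

definition dkernel :: "(real \<Rightarrow> real) \<Rightarrow> real \<Rightarrow> real \<Rightarrow> complex" where
  "dkernel fe h z = complex_of_real (1 / (2 * pi)) *
     (LINT u|lborel. complex_of_real (indicator {-1..1} u) * cis (- (u * z)) / fourier fe (u / h))"

text \<open>K_n is real-valued (Phi^eps(-u) = conj Phi^eps(u)); we take the real part.\<close>
definition kernel_est :: "(real \<Rightarrow> real) \<Rightarrow> nat \<Rightarrow> real \<Rightarrow> (nat \<Rightarrow> real) \<Rightarrow> real \<Rightarrow> real" where
  "kernel_est fe n h Y x =
     Re ((\<Sum>i<n. dkernel fe h ((x - Y i) / h)) / complex_of_real (real n * h))"

definition h_star :: "real \<Rightarrow> real \<Rightarrow> real \<Rightarrow> real \<Rightarrow> nat \<Rightarrow> real" where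
  "h_star \<alpha> \<beta> r s n = (THE h. 0 < h \<and>
      2 * \<beta> / h powr s + 2 * \<alpha> / h powr r = ln (real n) - (ln (ln (real n)))\<^sup>2)"

definition h_a :: "real \<Rightarrow> real \<Rightarrow> nat \<Rightarrow> real" where
  "h_a \<beta> s n = (ln (real n) / (2 * \<beta>) - sqrt (ln (real n) / (2 * \<beta>))) powr (- 1 / s)"

definition rate_pt :: "real \<Rightarrow> real \<Rightarrow> real \<Rightarrow> real \<Rightarrow> real \<Rightarrow> nat \<Rightarrow> real" where
  "rate_pt \<alpha> \<beta> r s L n = L / (2 * pi * \<alpha> * r) * h_star \<alpha> \<beta> r s n powr (r - 1)
      * exp (- 2 * \<alpha> / h_star \<alpha> \<beta> r s n powr r)"

definition rate_L2 :: "real \<Rightarrow> real \<Rightarrow> real \<Rightarrow> real \<Rightarrow> real \<Rightarrow> nat \<Rightarrow> real" where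
  "rate_L2 \<alpha> \<beta> r s L n = L * exp (- 2 * \<alpha> / h_star \<alpha> \<beta> r s n powr r)"

end

theory Submission
  imports Defs "HOL-Real_Asymp.Real_Asymp"
begin

text \<open>
  Write \<open>a = 1/h\<close>. For a density of the class, Cauchy-Schwarz (pointwise) and Plancherel (in \<open>L\<^sub>2\<close>) bound the squared
  bias of the kernel estimator by \<open>(L/2\<pi>) \<integral>\<^bsub>|u|>a\<^esub> exp(-2\<alpha>|u|\<^sup>r) du\<close> and \<open>L exp(-2\<alpha>a\<^sup>r)\<close>, which are asymptotically the
  rates; the variance is a power of \<open>a\<close> times \<open>exp(2\<beta>a\<^sup>s)/n\<close>, hence negligible for both bandwidths.

  The lower bounds use two hypotheses \<open>f\<^sub>0 \<plusminus> G\<close>. The density \<open>f\<^sub>0\<close> is a dilated sum of two Fejer kernels, one shifted by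
  \<open>\<pi>\<close> so that their zeros do not meet: its characteristic function has compact support, its weighted norm is as small as
  we like, and \<open>f\<^sub>0(y) \<ge> c/(1+y\<^sup>2)\<close>. The Fourier transform of \<open>G\<close> is supported in \<open>a \<le> |u| \<le> b\<close> and proportional there to
  a smooth cut-off times \<open>exp(-2\<alpha>|u|\<^sup>r)\<close>, the extremal shape in Cauchy-Schwarz; \<open>b = 2a\<close> is used pointwise, a narrow band
  \<open>b = a + 1/a\<close> in \<open>L\<^sub>2\<close>. Integrating by parts twice shows that \<open>G\<close> and its convolution with the noise density decay like
  \<open>1/(1+y\<^sup>2)\<close>, which gives positivity of \<open>f\<^sub>0 \<plusminus> G\<close> and a bound for the chi-square distance. If \<open>2\<beta>a\<^sup>s + 2\<alpha>a\<^sup>r\<close>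
  exceeds \<open>log n + (log log n)\<^sup>2\<close>, the product laws merge, while replacing \<open>1/h\<^sub>*\<close> by this \<open>a\<close> changes \<open>a\<^sup>r\<close> by \<open>o(1)\<close>
  only, because \<open>r < s\<close>.
\<close>

section \<open>Fourier inversion and the Plancherel inequality\<close>

text \<open>The constant 1 survives both bounds. In the two-point bound (T - f0 - G)^2 + (T - f0 +
  G)^2 \<ge> 2 G^2, so once the product laws merge the maximal risk is at least G^2 itself. Here G
  carries a norm budget L1 < L and the rest is spent on f0, which gives every fraction L1/L of the
  rate and hence the limit. The obstacle is that G must be dominated by f0 pointwise on the whole
  line. This forces decay of G, hence a cut-off that vanishes to second order at the ends of the
  band. Its transition zones have width about 1/a^2, thin compared with the scale a^(1-r) on which
  exp(-2\<alpha>u^r) varies, since r < 2. Smoothing therefore leaves the integrals asymptotically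
  unchanged and costs only powers of a in the derivative bounds. Powers of a are at most powers of
  log n, and these are what the term (log log n)^2 in the bandwidth equation pays for: exp(-(log log
  n)^2) beats each of them. This slack is why crude constants and a sup-norm bound for the variance
  suffice.\<close>

lemma integrable_pair_mult_bounded:
  fixes g :: "'a \<Rightarrow> complex" and k :: "'b \<Rightarrow> complex"
  assumes sf: "sigma_finite_measure M" "sigma_finite_measure N"
    and g: "integrable M g" and k: "integrable N k"
    and b[measurable]: "(\<lambda>(x, u). b x u) \<in> borel_measurable (M \<Otimes>\<^sub>M N)"
    and b1: "\<And>x u. cmod (b x u) \<le> 1"
  shows "integrable (M \<Otimes>\<^sub>M N) (\<lambda>(x, u). g x * k u * b x u)"
proof -
  interpret M: sigma_finite_measure M by fact
  interpret N: sigma_finite_measure N by fact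
  interpret P: pair_sigma_finite M N ..
  note [measurable] = borel_measurable_integrable[OF g] borel_measurable_integrable[OF k]
  have 1: "integrable (M \<Otimes>\<^sub>M N) (\<lambda>(x, u). g x * k u)"
  proof (rule P.Fubini_integrable)
    show "integrable M (\<lambda>x. \<integral>y. cmod (case (x, y) of (x, u) \<Rightarrow> g x * k u) \<partial>N)"
      using g by (simp add: norm_mult)
    show "AE x in M. integrable N (\<lambda>y. case (x, y) of (x, u) \<Rightarrow> g x * k u)"
      using k by simp
  qed measurable
  show ?thesis
    by (rule Bochner_Integration.integrable_bound[OF 1])
       (auto simp: norm_mult intro!: AE_I2 mult_right_le_one_le mult_nonneg_nonneg b1)
qed

text \<open>Most interchanges of complex integrals below have this shape: integrable factors in
  separate variables, coupled only by an exponential of modulus 1.\<close>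

lemma Fubini_mult_bounded:
  fixes g :: "'a \<Rightarrow> complex" and k :: "'b \<Rightarrow> complex"
  assumes sf: "sigma_finite_measure M" "sigma_finite_measure N"
    and g: "integrable M g" and k: "integrable N k"
    and b: "(\<lambda>(x, u). b x u) \<in> borel_measurable (M \<Otimes>\<^sub>M N)"
    and b1: "\<And>x u. cmod (b x u) \<le> 1"
  shows "(LINT u|N. LINT x|M. g x * k u * b x u) = (LINT x|M. LINT u|N. g x * k u * b x u)"
proof -
  interpret M: sigma_finite_measure M by fact
  interpret N: sigma_finite_measure N by fact
  interpret P: pair_sigma_finite M N ..
  show ?thesis
    using P.Fubini_integral[OF integrable_pair_mult_bounded[OF assms]] by simp
qed

section \<open>Fourier inversion and Plancherel through Gaussian regularisation\<close>

text \<open>\<open>fourier\<close> takes real functions only, while inversion integrates complex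
  ones. Inversion is the same integral at \<open>- y\<close>, divided by 2\<pi>, so one transform
  serves both directions.\<close>

definition cft :: "(real \<Rightarrow> complex) \<Rightarrow> real \<Rightarrow> complex" where
  "cft g u = (LINT x|lborel. g x * cis (x * u))"

lemma fourier_eq_cft: "fourier g u = cft (\<lambda>x. complex_of_real (g x)) u"
  by (simp add: fourier_def cft_def)

lemma borel_measurable_cis[measurable]: "cis \<in> borel_measurable borel"
  by (intro borel_measurable_continuous_onI continuous_intros)

lemma integrable_mult_cis:
  assumes "integrable M g" and [measurable]: "p \<in> borel_measurable M"
  shows "integrable M (\<lambda>x. g x * cis (p x))"
  using assms(1) by (rule Bochner_Integration.integrable_bound)
    (use assms(1) in \<open>auto simp: norm_mult\<close>)

lemma norm_cft_le:
  assumes "integrable lborel g"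
  shows "cmod (cft g u) \<le> (LINT x|lborel. cmod (g x))"
  unfolding cft_def using integral_norm_bound[of lborel "\<lambda>x. g x * cis (x * u)"]
  by (simp add: norm_mult)

lemma isCont_integral_cis:
  assumes g: "integrable M g" and [measurable]: "p \<in> borel_measurable M"
  shows "isCont (\<lambda>u. LINT x|M. g x * cis (p x * u)) u"
proof (rule continuous_at_sequentiallyI)
  fix X :: "nat \<Rightarrow> real" assume X: "X \<longlonglongrightarrow> u"
  have [measurable]: "g \<in> borel_measurable M" using g by auto
  show "(\<lambda>n. LINT x|M. g x * cis (p x * X n)) \<longlonglongrightarrow> (LINT x|M. g x * cis (p x * u))"
  proof (rule integral_dominated_convergence[where w="\<lambda>x. cmod (g x)"])
    have "isCont cis z" for z
      using continuous_on_cis[of UNIV "\<lambda>x. x"] by (simp add: continuous_on_eq_continuous_at)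
    then show "AE x in M. (\<lambda>n. g x * cis (p x * X n)) \<longlonglongrightarrow> g x * cis (p x * u)"
      by (intro AE_I2 tendsto_intros isCont_tendsto_compose[of _ cis] X) auto
  qed (use g in \<open>auto simp: norm_mult\<close>)
qed

lemma continuous_on_cft: "integrable lborel g \<Longrightarrow> continuous_on S (cft g)"
  unfolding cft_def
  by (intro continuous_at_imp_continuous_on ballI) (rule isCont_integral_cis[where p="\<lambda>x. x"], auto)

lemma borel_measurable_cft: "integrable lborel g \<Longrightarrow> cft g \<in> borel_measurable borel"
  by (intro borel_measurable_continuous_onI continuous_on_cft)

lemma integrable_std_normal_density_scaled:
  assumes "0 < \<sigma>" shows "integrable lborel (\<lambda>u. std_normal_density (\<sigma> * u))"
  using lborel_integrable_real_affine[of std_normal_density \<sigma> 0] assms by auto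

lemma integral_std_normal_density_cis:
  assumes "0 < \<sigma>"
  shows "(LINT u|lborel. complex_of_real (std_normal_density (\<sigma> * u)) * cis (u * t))
    = complex_of_real (exp (- (t / \<sigma>)\<^sup>2 / 2) / \<sigma>)"
proof -
  have "(LINT x|lborel. complex_of_real (std_normal_density x) * cis ((t / \<sigma>) * x))
      = char std_normal_distribution (t / \<sigma>)"
    unfolding char_def
    by (subst integral_density) (auto simp: cis_conv_exp scaleR_conv_of_real)
  also have "\<dots> = complex_of_real (exp (- (t / \<sigma>)\<^sup>2 / 2))"
    by (simp add: char_std_normal_distribution)
  also have "(LINT x|lborel. complex_of_real (std_normal_density x) * cis ((t / \<sigma>) * x))
     = \<sigma> *\<^sub>R (LINT u|lborel. complex_of_real (std_normal_density (\<sigma> * u)) * cis (u * t))"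
    using assms by (subst lborel_integral_real_affine[where c=\<sigma> and t=0]) (auto simp: field_simps)
  finally show ?thesis using assms by (simp add: field_simps scaleR_conv_of_real)
qed

text \<open>A Gaussian factor makes the inversion integral absolutely convergent; after Fubini its
  own transform, a Gaussian of width \<sigma>, appears as a smoothing kernel at \<open>y\<close>.
  Both inversion and Plancherel let \<sigma> tend to 0 in this identity.\<close>

lemma integral_cft_gaussian:
  assumes g: "integrable lborel g" and "0 < \<sigma>"
  shows "(LINT u|lborel. cft g u * cis (- (u * y)) * complex_of_real (std_normal_density (\<sigma> * u)))
    = (LINT x|lborel. g x * complex_of_real (exp (- ((x - y) / \<sigma>)\<^sup>2 / 2) / \<sigma>))"
proof -
  let ?p = "\<lambda>u. complex_of_real (std_normal_density (\<sigma> * u))"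
  have "(LINT u|lborel. cft g u * cis (- (u * y)) * ?p u)
      = (LINT u|lborel. LINT x|lborel. g x * ?p u * cis (u * (x - y)))"
    unfolding cft_def
    apply (subst integral_mult_left_zero[symmetric])+
    apply (intro Bochner_Integration.integral_cong refl)
    by (auto simp: cis_mult algebra_simps)
  also have "\<dots> = (LINT x|lborel. LINT u|lborel. g x * ?p u * cis (u * (x - y)))"
    by (rule Fubini_mult_bounded)
       (use g integrable_std_normal_density_scaled[OF \<open>0 < \<sigma>\<close>] in \<open>auto intro!: lborel.sigma_finite_measure_axioms\<close>)
  also have "\<dots> = (LINT x|lborel. g x * complex_of_real (exp (- ((x - y) / \<sigma>)\<^sup>2 / 2) / \<sigma>))"
    by (simp add: mult.assoc integral_std_normal_density_cis[OF \<open>0 < \<sigma>\<close>])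
  finally show ?thesis .
qed


lemma exp_half_square_eq: "exp (- t\<^sup>2 / 2) = sqrt (2 * pi) * std_normal_density t"
  by (simp add: normal_density_def)

lemma exp_half_square_eq': "exp (- (t\<^sup>2 / 2)) = sqrt (2 * pi) * std_normal_density t"
  using exp_half_square_eq[of t] by simp

lemma std_normal_density_le_1: "std_normal_density t \<le> 1"
proof -
  have "1 \<le> sqrt (2 * pi)" using pi_ge_two by auto
  moreover have "sqrt (2 * pi) * std_normal_density t \<le> 1"
    by (subst exp_half_square_eq[symmetric]) simp
  moreover have "std_normal_density t \<le> sqrt (2 * pi) * std_normal_density t"
    using mult_right_mono[OF calculation(1) normal_density_nonneg[of 0 1 t]] by simp
  ultimately show ?thesis by linarith
qed

text \<open>The two sides of \<open>integral_cft_gaussian\<close> are passed to the limit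
  separately: the frequency side by dominated convergence with majorant |cft g|, the other side as
  an approximate identity. The normal density at 0 contributes 1/sqrt(2\<pi>) to the first, the mass
  of the kernel sqrt(2\<pi>) to the second, whence 2\<pi>.\<close>

lemma fourier_inversion:
  fixes g :: "real \<Rightarrow> complex"
  assumes g: "integrable lborel g" and cont: "isCont g y" and G: "integrable lborel (cft g)"
  shows "(LINT u|lborel. cft g u * cis (- (u * y))) = 2 * pi * g y"
proof -
  have [measurable]: "g \<in> borel_measurable borel" "cft g \<in> borel_measurable borel"
    using g G by auto
  define \<sigma> where "\<sigma> n = 1 / real (Suc n)" for n
  have \<sigma>0: "0 < \<sigma> n" for n by (simp add: \<sigma>_def)
  have \<sigma>lim: "\<sigma> \<longlonglongrightarrow> 0" unfolding \<sigma>_def by (rule LIMSEQ_Suc[OF lim_1_over_n])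
  have nd: "isCont std_normal_density z" for z
    unfolding normal_density_def by (intro continuous_intros) auto
  obtain \<delta> where \<delta>: "\<delta> > 0" "\<And>x. \<bar>x - y\<bar> < \<delta> \<Longrightarrow> cmod (g x - g y) < 1"
    using cont[unfolded continuous_at_eps_delta] by (metis dist_norm real_norm_def zero_less_one)
  have gb: "cmod (g x) \<le> cmod (g y) + 1" if "\<bar>x - y\<bar> < \<delta>" for x
    using \<delta>(2)[OF that] norm_triangle_sub[of "g x" "g y"] by linarith
  \<comment> \<open>Continuity at \<open>y\<close> controls \<open>g\<close> only near
    \<open>y\<close>. The near part is bounded, so dominated convergence works after rescaling; the
    far part is merely integrable, but the kernel there is at most
    exp(-(\<delta>/\<sigma>)^2/2)/\<sigma>.\<close>
  define g1 where "g1 x = (if \<bar>x - y\<bar> < \<delta> then g x else 0)" for x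
  define g2 where "g2 x = (if \<bar>x - y\<bar> < \<delta> then 0 else g x)" for x
  have g1i: "integrable lborel g1" and g2i: "integrable lborel g2"
    by (rule Bochner_Integration.integrable_bound[OF g]; simp add: g1_def[abs_def] g2_def[abs_def])+
  have g12: "g x = g1 x + g2 x" for x by (simp add: g1_def g2_def)
  let ?K = "\<lambda>n x. complex_of_real (exp (- ((x - y) / \<sigma> n)\<^sup>2 / 2) / \<sigma> n)"
  have Kb: "exp (- ((x - y) / \<sigma> n)\<^sup>2 / 2) \<le> 1" for n x by simp
  have Ki: "integrable lborel (\<lambda>x. q x * ?K n x)" if "integrable lborel q" for q n
  proof -
    have "integrable lborel (\<lambda>x. q x * complex_of_real (1 / \<sigma> n))" using that by simp
    then show ?thesis
      by (rule Bochner_Integration.integrable_bound)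
         (use that \<sigma>0[of n] in \<open>auto simp: norm_mult norm_divide intro!: AE_I2 divide_right_mono mult_left_le\<close>)
  qed
  have "(\<lambda>n. LINT u|lborel. cft g u * cis (- (u * y)) * complex_of_real (std_normal_density (\<sigma> n * u)))
     \<longlonglongrightarrow> (LINT u|lborel. cft g u * cis (- (u * y)) * complex_of_real (std_normal_density (0 * u)))"
  proof (rule integral_dominated_convergence[where w="\<lambda>u. cmod (cft g u)"])
    show "AE u in lborel. (\<lambda>n. cft g u * cis (- (u * y)) * complex_of_real (std_normal_density (\<sigma> n * u)))
        \<longlonglongrightarrow> cft g u * cis (- (u * y)) * complex_of_real (std_normal_density (0 * u))"
      by (intro AE_I2 tendsto_intros isCont_tendsto_compose[OF nd] \<sigma>lim)
    show "AE u in lborel. cmod (cft g u * cis (- (u * y)) * complex_of_real (std_normal_density (\<sigma> n * u))) \<le> cmod (cft g u)" for n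
      using std_normal_density_le_1 by (auto simp: norm_mult intro!: mult_left_le)
  qed (use G in auto)
  moreover have "(\<lambda>n. (LINT x|lborel. g1 x * ?K n x) + (LINT x|lborel. g2 x * ?K n x))
     \<longlonglongrightarrow> g y * sqrt (2 * pi) + 0"
  proof (rule tendsto_add)
    have "(LINT x|lborel. g1 x * ?K n x) =
       (LINT z|lborel. g1 (y + \<sigma> n * z) * complex_of_real (sqrt (2 * pi) * std_normal_density z))" for n
    proof -
      have K: "?K n (y + \<sigma> n * z) = complex_of_real (sqrt (2 * pi) * std_normal_density z) / \<sigma> n" for z
        using \<sigma>0[of n] by (simp add: exp_half_square_eq')
      show ?thesis
        unfolding lborel_integral_real_affine[where c="\<sigma> n" and t=y and f="\<lambda>x. g1 x * ?K n x", OF less_imp_neq[OF \<sigma>0, symmetric]] K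
        using \<sigma>0[of n] by (simp add: scaleR_conv_of_real)
    qed
    moreover have "(\<lambda>n. LINT z|lborel. g1 (y + \<sigma> n * z) * complex_of_real (sqrt (2 * pi) * std_normal_density z))
      \<longlonglongrightarrow> (LINT z|lborel. g y * complex_of_real (sqrt (2 * pi) * std_normal_density z))"
    proof (rule integral_dominated_convergence[where w="\<lambda>z. (cmod (g y) + 1) * (sqrt (2 * pi) * std_normal_density z)"])
      show "AE z in lborel. (\<lambda>n. g1 (y + \<sigma> n * z) * complex_of_real (sqrt (2 * pi) * std_normal_density z))
         \<longlonglongrightarrow> g y * complex_of_real (sqrt (2 * pi) * std_normal_density z)"
      proof (intro AE_I2 tendsto_intros)
        fix z
        have 1: "(\<lambda>n. y + \<sigma> n * z) \<longlonglongrightarrow> y + 0 * z" by (intro tendsto_intros \<sigma>lim)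
        then have "\<forall>\<^sub>F n in sequentially. dist (y + \<sigma> n * z) (y + 0 * z) < \<delta>"
          using \<delta>(1) by (rule tendstoD)
        then have "\<forall>\<^sub>F n in sequentially. g (y + \<sigma> n * z) = g1 (y + \<sigma> n * z)"
          by eventually_elim (simp add: g1_def dist_real_def)
        moreover have "(\<lambda>n. g (y + \<sigma> n * z)) \<longlonglongrightarrow> g y"
          using isCont_tendsto_compose[OF cont] 1 by simp
        ultimately show "(\<lambda>n. g1 (y + \<sigma> n * z)) \<longlonglongrightarrow> g y"
          by (blast intro: Lim_transform_eventually)
      qed
      have "cmod (g1 x) \<le> cmod (g y) + 1" for x
        using gb[of x] by (auto simp: g1_def add_nonneg_nonneg)
      then show "AE z in lborel. cmod (g1 (y + \<sigma> n * z) * complex_of_real (sqrt (2 * pi) * std_normal_density z)) \<le> (cmod (g y) + 1) * (sqrt (2 * pi) * std_normal_density z)" for n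
        by (auto simp: norm_mult intro!: AE_I2 mult_right_mono)
    qed (auto simp: g1_def)
    moreover have "(LINT z|lborel. g y * complex_of_real (sqrt (2 * pi) * std_normal_density z)) = g y * sqrt (2 * pi)"
      by simp
    ultimately show "(\<lambda>n. LINT x|lborel. g1 x * ?K n x) \<longlonglongrightarrow> g y * sqrt (2 * pi)" by simp
  next
    have "cmod (LINT x|lborel. g2 x * ?K n x) \<le> (LINT x|lborel. cmod (g x)) * (exp (- (\<delta> / \<sigma> n)\<^sup>2 / 2) / \<sigma> n)" for n
    proof -
      have "cmod (LINT x|lborel. g2 x * ?K n x) \<le> (LINT x|lborel. cmod (g2 x * ?K n x))"
        by (rule integral_norm_bound)
      also have "\<dots> \<le> (LINT x|lborel. cmod (g x) * (exp (- (\<delta> / \<sigma> n)\<^sup>2 / 2) / \<sigma> n))"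
      proof (rule integral_mono)
        fix x
        have "\<delta>\<^sup>2 \<le> (x - y)\<^sup>2" if "\<not> \<bar>x - y\<bar> < \<delta>"
          using that \<delta>(1) by (metis abs_le_square_iff abs_of_pos not_less)
        then show "cmod (g2 x * ?K n x) \<le> cmod (g x) * (exp (- (\<delta> / \<sigma> n)\<^sup>2 / 2) / \<sigma> n)"
          using \<sigma>0[of n] by (auto simp: g2_def norm_mult norm_divide power_divide intro!: mult_left_mono divide_right_mono)
      qed (use g Ki[OF g2i] in auto)
      finally show ?thesis by simp
    qed
    moreover have "(\<lambda>n. (LINT x|lborel. cmod (g x)) * (exp (- (\<delta> / \<sigma> n)\<^sup>2 / 2) / \<sigma> n)) \<longlonglongrightarrow> (LINT x|lborel. cmod (g x)) * 0"
    proof (rule tendsto_mult_left)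
      have "((\<lambda>x::real. exp (- (\<delta>\<^sup>2 / 2) * x\<^sup>2) * x) \<longlongrightarrow> 0) at_top"
        using \<delta>(1) by real_asymp
      then have "(\<lambda>n. exp (- (\<delta>\<^sup>2 / 2) * (real (Suc n))\<^sup>2) * real (Suc n)) \<longlonglongrightarrow> 0"
        by (rule filterlim_compose[OF _ filterlim_compose[OF filterlim_real_sequentially filterlim_Suc]])
      then show "(\<lambda>n. exp (- (\<delta> / \<sigma> n)\<^sup>2 / 2) / \<sigma> n) \<longlonglongrightarrow> 0"
        by (simp add: \<sigma>_def power_mult_distrib)
    qed
    ultimately show "(\<lambda>n. LINT x|lborel. g2 x * ?K n x) \<longlonglongrightarrow> 0"
      unfolding mult_zero_right by - (rule Lim_null_comparison, rule always_eventually, rule allI)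
  qed
  moreover have "(LINT u|lborel. cft g u * cis (- (u * y)) * complex_of_real (std_normal_density (\<sigma> n * u)))
     = (LINT x|lborel. g1 x * ?K n x) + (LINT x|lborel. g2 x * ?K n x)" for n
    unfolding integral_cft_gaussian[OF g \<sigma>0] g12 ring_distribs
    by (rule Bochner_Integration.integral_add[OF Ki[OF g1i] Ki[OF g2i]])
  ultimately have "(LINT u|lborel. cft g u * cis (- (u * y)) * complex_of_real (std_normal_density (0 * u)))
     = g y * sqrt (2 * pi)"
    by (simp only: LIMSEQ_unique add_0_right)
  moreover have "std_normal_density 0 = 1 / sqrt (2 * pi)" by (simp add: normal_density_def)
  ultimately have "(LINT u|lborel. cft g u * cis (- (u * y))) * complex_of_real (1 / sqrt (2 * pi)) = g y * sqrt (2 * pi)"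
    by simp
  then have "(LINT u|lborel. cft g u * cis (- (u * y))) = g y * (complex_of_real (sqrt (2 * pi)) * complex_of_real (sqrt (2 * pi)))"
    by (simp add: field_simps)
  then show ?thesis by (simp flip: of_real_mult)
qed

lemma ennreal_norm_integral_le: "ennreal (norm (integral\<^sup>L M f)) \<le> (\<integral>\<^sup>+x. ennreal (norm (f x)) \<partial>M)"
  by (cases "integrable M f") (auto simp: integral_norm_bound_ennreal not_integrable_integral_eq)

lemma nn_integral_cmult_cmult:
  fixes k :: "'a \<Rightarrow> real"
  assumes "0 \<le> c" "0 \<le> a" and [measurable]: "k \<in> borel_measurable M"
    and I: "(\<integral>\<^sup>+x. ennreal (k x) \<partial>M) = ennreal d"
  shows "(\<integral>\<^sup>+x. ennreal (c * (a * k x)) \<partial>M) = ennreal (c * a * d)"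
proof -
  have "(\<integral>\<^sup>+x. ennreal (c * (a * k x)) \<partial>M) = (\<integral>\<^sup>+x. ennreal (c * a) * ennreal (k x) \<partial>M)"
    using assms(1,2) by (simp add: ennreal_mult'[symmetric] mult.assoc)
  also have "\<dots> = ennreal (c * a) * ennreal d" by (simp add: nn_integral_cmult I)
  also have "\<dots> = ennreal (c * a * d)" using assms(1,2) by (simp add: ennreal_mult')
  finally show ?thesis .
qed

text \<open>The upper bound suffices for the L2 risk and can be had without approximating
  \<open>g\<close>: with a Gaussian weight the left side is a double integral of
  \<open>cnj (g x) * g t\<close> against a symmetric kernel of mass sqrt(2\<pi>) in each variable.
  The inequality 2|g x||g t| \<le> |g x|^2 + |g t|^2 separates the variables, and Fatou removes the
  weight.\<close>

lemma plancherel_le: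
  fixes g :: "real \<Rightarrow> complex"
  assumes g: "integrable lborel g" and g2: "integrable lborel (\<lambda>x. (cmod (g x))\<^sup>2)"
  shows "(\<integral>\<^sup>+y. ennreal ((cmod (cft g y))\<^sup>2) \<partial>lborel) \<le> ennreal (2 * pi * (LINT x|lborel. (cmod (g x))\<^sup>2))"
proof -
  have [measurable]: "g \<in> borel_measurable borel" "cft g \<in> borel_measurable borel"
    using g borel_measurable_cft[OF g] by auto
  define I where "I = (LINT x|lborel. (cmod (g x))\<^sup>2)"
  have I: "(\<integral>\<^sup>+x. ennreal ((cmod (g x))\<^sup>2) \<partial>lborel) = ennreal I"
    unfolding I_def by (rule nn_integral_eq_integral[OF g2]) simp
  have I0: "0 \<le> I" unfolding I_def by simp
  have *: "(\<integral>\<^sup>+y. ennreal ((cmod (cft g y))\<^sup>2 * exp (- (\<sigma> * y)\<^sup>2 / 2)) \<partial>lborel) \<le> ennreal (2 * pi * I)" if "0 < \<sigma>" for \<sigma>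
  proof -
    define k where "k y = cft g y * complex_of_real (exp (- (\<sigma> * y)\<^sup>2 / 2))" for y
    define C where "C = (LINT x|lborel. cmod (g x))"
    have [simp]: "0 \<le> C" by (simp add: C_def)
    have Cb: "cmod (cft g y) \<le> C" for y unfolding C_def by (rule norm_cft_le[OF g])
    have gi: "integrable lborel (\<lambda>y. exp (- (\<sigma> * y)\<^sup>2 / 2))"
      unfolding exp_half_square_eq using integrable_std_normal_density_scaled[OF that] by simp
    have k: "integrable lborel k"
    proof (rule Bochner_Integration.integrable_bound)
      show "integrable lborel (\<lambda>y. C * exp (- (\<sigma> * y)\<^sup>2 / 2))" using gi by simp
      show "AE x in lborel. cmod (k x) \<le> norm (C * exp (- (\<sigma> * x)\<^sup>2 / 2))"
        using Cb by (auto simp: k_def norm_mult intro!: AE_I2 mult_right_mono)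
    qed (simp add: k_def[abs_def])
    have J: "integrable lborel (\<lambda>y. (cmod (cft g y))\<^sup>2 * exp (- (\<sigma> * y)\<^sup>2 / 2))"
    proof (rule Bochner_Integration.integrable_bound)
      show "integrable lborel (\<lambda>y. C\<^sup>2 * exp (- (\<sigma> * y)\<^sup>2 / 2))" using gi by simp
      show "AE x in lborel. norm ((cmod (cft g x))\<^sup>2 * exp (- (\<sigma> * x)\<^sup>2 / 2)) \<le> norm (C\<^sup>2 * exp (- (\<sigma> * x)\<^sup>2 / 2))"
        using Cb by (auto intro!: AE_I2 mult_right_mono power_mono simp: abs_mult)
    qed simp
    let ?K = "\<lambda>x t. exp (- ((t - x) / \<sigma>)\<^sup>2 / 2) / \<sigma>"
    \<comment> \<open>Only the conjugated factor is expanded into an integral; the other one keeps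
      the Gaussian, so that \<open>integral_cft_gaussian\<close> evaluates the inner
      integral.\<close>
    have "complex_of_real (LINT y|lborel. (cmod (cft g y))\<^sup>2 * exp (- (\<sigma> * y)\<^sup>2 / 2))
       = (LINT y|lborel. cnj (cft g y) * k y)"
      by (subst integral_complex_of_real[symmetric])
         (auto intro!: Bochner_Integration.integral_cong simp: k_def complex_norm_square mult_ac simp del: of_real_power)
    also have "\<dots> = (LINT y|lborel. LINT x|lborel. cnj (g x) * k y * cis (- (y * x)))"
      unfolding cft_def
      by (subst Bochner_Integration.integral_cnj[symmetric], subst integral_mult_left_zero[symmetric])
         (intro Bochner_Integration.integral_cong refl, simp add: cis_cnj mult_ac)
    also have "\<dots> = (LINT x|lborel. LINT y|lborel. cnj (g x) * k y * cis (- (y * x)))"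
      by (rule Fubini_mult_bounded) (use g k in \<open>auto intro!: lborel.sigma_finite_measure_axioms\<close>)
    also have "\<dots> = (LINT x|lborel. cnj (g x) * (sqrt (2 * pi) * (LINT t|lborel. g t * complex_of_real (?K x t))))"
      unfolding integral_cft_gaussian[OF g that, symmetric] k_def exp_half_square_eq[of "\<sigma> * _"]
      by (simp add: mult_ac flip: integral_mult_right_zero)
    finally have eq: "complex_of_real (LINT y|lborel. (cmod (cft g y))\<^sup>2 * exp (- (\<sigma> * y)\<^sup>2 / 2))
       = (LINT x|lborel. cnj (g x) * (sqrt (2 * pi) * (LINT t|lborel. g t * complex_of_real (?K x t))))" .
    have "0 \<le> (LINT y|lborel. (cmod (cft g y))\<^sup>2 * exp (- (\<sigma> * y)\<^sup>2 / 2))" by simp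
    then have "(\<integral>\<^sup>+y. ennreal ((cmod (cft g y))\<^sup>2 * exp (- (\<sigma> * y)\<^sup>2 / 2)) \<partial>lborel)
       = ennreal (cmod (LINT x|lborel. cnj (g x) * (sqrt (2 * pi) * (LINT t|lborel. g t * complex_of_real (?K x t)))))"
      unfolding eq[symmetric] norm_of_real by (subst nn_integral_eq_integral[OF J]) auto
    also have "\<dots> \<le> (\<integral>\<^sup>+x. ennreal (cmod (cnj (g x) * (sqrt (2 * pi) * (LINT t|lborel. g t * complex_of_real (?K x t))))) \<partial>lborel)"
      by (rule ennreal_norm_integral_le)
    also have "\<dots> \<le> (\<integral>\<^sup>+x. (\<integral>\<^sup>+t. ennreal (sqrt (2 * pi) * (cmod (g x) * cmod (g t) * ?K x t)) \<partial>lborel) \<partial>lborel)"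
    proof (rule nn_integral_mono)
      fix x
      have "ennreal (cmod (LINT t|lborel. g t * complex_of_real (?K x t))) \<le> (\<integral>\<^sup>+t. ennreal (cmod (g t * complex_of_real (?K x t))) \<partial>lborel)"
        by (rule ennreal_norm_integral_le)
      then have "ennreal (sqrt (2 * pi) * cmod (g x)) * ennreal (cmod (LINT t|lborel. g t * complex_of_real (?K x t))) \<le> ennreal (sqrt (2 * pi) * cmod (g x)) * (\<integral>\<^sup>+t. ennreal (cmod (g t * complex_of_real (?K x t))) \<partial>lborel)"
        by (rule mult_left_mono) simp
      then show "ennreal (cmod (cnj (g x) * (sqrt (2 * pi) * (LINT t|lborel. g t * complex_of_real (?K x t)))))
        \<le> (\<integral>\<^sup>+t. ennreal (sqrt (2 * pi) * (cmod (g x) * cmod (g t) * ?K x t)) \<partial>lborel)"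
        using that by (simp add: norm_mult norm_divide ennreal_mult'[symmetric] mult_ac flip: nn_integral_cmult)
    qed
    also have "\<dots> \<le> (\<integral>\<^sup>+x. (\<integral>\<^sup>+t. ennreal (sqrt (2 * pi) / 2 * ((cmod (g x))\<^sup>2 * ?K x t)) + ennreal (sqrt (2 * pi) / 2 * ((cmod (g t))\<^sup>2 * ?K x t)) \<partial>lborel) \<partial>lborel)"
    proof (intro nn_integral_mono)
      fix x t
      have "0 \<le> (cmod (g x) - cmod (g t))\<^sup>2" by simp
      then have "cmod (g x) * cmod (g t) \<le> ((cmod (g x))\<^sup>2 + (cmod (g t))\<^sup>2) / 2"
        by (simp add: power2_eq_square algebra_simps)
      then have "sqrt (2 * pi) * (cmod (g x) * cmod (g t) * ?K x t) \<le> sqrt (2 * pi) * (((cmod (g x))\<^sup>2 + (cmod (g t))\<^sup>2) / 2 * ?K x t)"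
        using that by (intro mult_left_mono mult_right_mono) auto
      also have "\<dots> = sqrt (2 * pi) / 2 * ((cmod (g x))\<^sup>2 * ?K x t) + sqrt (2 * pi) / 2 * ((cmod (g t))\<^sup>2 * ?K x t)"
        by (simp add: add_divide_distrib ring_distribs)
      finally show "ennreal (sqrt (2 * pi) * (cmod (g x) * cmod (g t) * ?K x t)) \<le> ennreal (sqrt (2 * pi) / 2 * ((cmod (g x))\<^sup>2 * ?K x t)) + ennreal (sqrt (2 * pi) / 2 * ((cmod (g t))\<^sup>2 * ?K x t))"
        using that by (subst ennreal_plus[symmetric]) (auto simp del: ennreal_plus intro!: ennreal_leI)
    qed
    also have "\<dots> = (\<integral>\<^sup>+x. (\<integral>\<^sup>+t. ennreal (sqrt (2 * pi) / 2 * ((cmod (g x))\<^sup>2 * ?K x t)) \<partial>lborel) \<partial>lborel) + (\<integral>\<^sup>+x. (\<integral>\<^sup>+t. ennreal (sqrt (2 * pi) / 2 * ((cmod (g t))\<^sup>2 * ?K x t)) \<partial>lborel) \<partial>lborel)"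
      by (subst nn_integral_add[symmetric], measurable) (intro nn_integral_cong nn_integral_add, measurable)
    also have "(\<integral>\<^sup>+x. (\<integral>\<^sup>+t. ennreal (sqrt (2 * pi) / 2 * ((cmod (g t))\<^sup>2 * ?K x t)) \<partial>lborel) \<partial>lborel) = (\<integral>\<^sup>+t. (\<integral>\<^sup>+x. ennreal (sqrt (2 * pi) / 2 * ((cmod (g t))\<^sup>2 * ?K x t)) \<partial>lborel) \<partial>lborel)"
      by (rule lborel_pair.Fubini') simp
    also have "(\<integral>\<^sup>+t. (\<integral>\<^sup>+x. ennreal (sqrt (2 * pi) / 2 * ((cmod (g t))\<^sup>2 * ?K x t)) \<partial>lborel) \<partial>lborel) = ennreal (pi * I)"
    proof -
      have "(\<integral>\<^sup>+x. ennreal (?K x t) \<partial>lborel) = ennreal (sqrt (2 * pi))" for t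
      proof -
        have "(\<integral>\<^sup>+x. ennreal (?K x t) \<partial>lborel) = ennreal \<sigma> * (\<integral>\<^sup>+z. ennreal (sqrt (2 * pi) / \<sigma> * std_normal_density z) \<partial>lborel)"
          using that by (subst nn_integral_real_affine[where c="\<sigma>" and t=t]) (auto simp: exp_half_square_eq')
        also have "\<dots> = ennreal \<sigma> * ennreal (LINT z|lborel. sqrt (2 * pi) / \<sigma> * std_normal_density z)"
          using that by (subst nn_integral_eq_integral) auto
        also have "\<dots> = ennreal (sqrt (2 * pi))" using that by (subst ennreal_mult'[symmetric]) auto
        finally show ?thesis .
      qed
      then have "(\<integral>\<^sup>+x. ennreal (sqrt (2 * pi) / 2 * ((cmod (g t))\<^sup>2 * ?K x t)) \<partial>lborel) = ennreal (sqrt (2 * pi) / 2 * (cmod (g t))\<^sup>2 * sqrt (2 * pi))" for t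
        by (intro nn_integral_cmult_cmult) auto
      moreover have "sqrt (2 * pi) / 2 * (cmod (g t))\<^sup>2 * sqrt (2 * pi) = pi * (1 * (cmod (g t))\<^sup>2)" for t
        by simp
      moreover have "(\<integral>\<^sup>+t. ennreal (pi * (1 * (cmod (g t))\<^sup>2)) \<partial>lborel) = ennreal (pi * 1 * I)"
        by (rule nn_integral_cmult_cmult) (auto simp: I)
      ultimately show ?thesis by (simp only: mult_1 mult_1_right)
    qed
    also have "(\<integral>\<^sup>+x. (\<integral>\<^sup>+t. ennreal (sqrt (2 * pi) / 2 * ((cmod (g x))\<^sup>2 * ?K x t)) \<partial>lborel) \<partial>lborel) = ennreal (pi * I)"
    proof -
      have "(\<integral>\<^sup>+t. ennreal (?K x t) \<partial>lborel) = ennreal (sqrt (2 * pi))" for x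
      proof -
        have "(\<integral>\<^sup>+t. ennreal (?K x t) \<partial>lborel) = ennreal \<sigma> * (\<integral>\<^sup>+z. ennreal (sqrt (2 * pi) / \<sigma> * std_normal_density z) \<partial>lborel)"
          using that by (subst nn_integral_real_affine[where c="\<sigma>" and t=x]) (auto simp: exp_half_square_eq')
        also have "\<dots> = ennreal \<sigma> * ennreal (LINT z|lborel. sqrt (2 * pi) / \<sigma> * std_normal_density z)"
          using that by (subst nn_integral_eq_integral) auto
        also have "\<dots> = ennreal (sqrt (2 * pi))" using that by (subst ennreal_mult'[symmetric]) auto
        finally show ?thesis .
      qed
      then have "(\<integral>\<^sup>+t. ennreal (sqrt (2 * pi) / 2 * ((cmod (g x))\<^sup>2 * ?K x t)) \<partial>lborel) = ennreal (sqrt (2 * pi) / 2 * (cmod (g x))\<^sup>2 * sqrt (2 * pi))" for x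
        by (intro nn_integral_cmult_cmult) auto
      moreover have "sqrt (2 * pi) / 2 * (cmod (g x))\<^sup>2 * sqrt (2 * pi) = pi * (1 * (cmod (g x))\<^sup>2)" for x
        by simp
      moreover have "(\<integral>\<^sup>+x. ennreal (pi * (1 * (cmod (g x))\<^sup>2)) \<partial>lborel) = ennreal (pi * 1 * I)"
        by (rule nn_integral_cmult_cmult) (auto simp: I)
      ultimately show ?thesis by (simp only: mult_1 mult_1_right)
    qed
    also have "ennreal (pi * I) + ennreal (pi * I) = ennreal (2 * pi * I)"
      using I0 by (subst ennreal_plus[symmetric]) (auto simp del: ennreal_plus)
    finally show ?thesis .
  qed
  have lim: "(\<lambda>n. ennreal ((cmod (cft g y))\<^sup>2 * exp (- (1 / real (Suc n) * y)\<^sup>2 / 2))) \<longlonglongrightarrow> ennreal ((cmod (cft g y))\<^sup>2 * exp (- (0 * y)\<^sup>2 / 2))" for y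
    by (intro tendsto_intros LIMSEQ_Suc[OF lim_1_over_n]) auto
  have "(\<integral>\<^sup>+y. ennreal ((cmod (cft g y))\<^sup>2) \<partial>lborel)
     = (\<integral>\<^sup>+y. liminf (\<lambda>n. ennreal ((cmod (cft g y))\<^sup>2 * exp (- (1 / real (Suc n) * y)\<^sup>2 / 2))) \<partial>lborel)"
    using lim_imp_Liminf[OF _ lim] by simp
  also have "\<dots> \<le> liminf (\<lambda>n. \<integral>\<^sup>+y. ennreal ((cmod (cft g y))\<^sup>2 * exp (- (1 / real (Suc n) * y)\<^sup>2 / 2)) \<partial>lborel)"
    by (rule nn_integral_liminf) measurable
  also have "\<dots> \<le> liminf (\<lambda>n. ennreal (2 * pi * I))"
    by (rule Liminf_mono, rule always_eventually, rule allI, rule *) simp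
  finally show ?thesis by (simp add: I_def Liminf_const)
qed

section \<open>Risk of the kernel estimator\<close>

lemma prob_densityD:
  assumes "prob_density f"
  shows "f \<in> borel_measurable borel" "0 \<le> f x" "integrable lborel f" "(LINT x|lborel. f x) = 1"
  using assms by (auto simp: prob_density_def)

lemma prob_space_prob_density:
  assumes "prob_density f" shows "prob_space (density lborel f)"
proof (rule prob_spaceI)
  note [measurable] = prob_densityD(1)[OF assms]
  have "(\<integral>\<^sup>+x. ennreal (f x) \<partial>lborel) = ennreal 1"
    using prob_densityD[OF assms] by (subst nn_integral_eq_integral) auto
  then show "emeasure (density lborel f) (space (density lborel f)) = 1"
    by (simp add: emeasure_density)
qed

lemma law_Y_convolution: "law_Y f fe = (density lborel f \<star> density lborel fe)"
  by (simp add: law_Y_def convolution_def)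

lemma sets_law_Y[simp, measurable_cong]: "sets (law_Y f fe) = sets borel"
  by (simp add: law_Y_def)

lemma space_law_Y[simp]: "space (law_Y f fe) = UNIV"
  by (simp add: law_Y_def)

lemma prob_space_law_Y:
  assumes "prob_density f" "prob_density fe" shows "prob_space (law_Y f fe)"
proof -
  interpret M: prob_space "density lborel f" by (rule prob_space_prob_density) fact
  interpret N: prob_space "density lborel fe" by (rule prob_space_prob_density) fact
  interpret P: pair_prob_space "density lborel f" "density lborel fe" ..
  show ?thesis unfolding law_Y_def by (rule P.prob_space_distr) simp
qed

lemma fourier_eq_integral_density:
  assumes "prob_density f"
  shows "(LINT x|density lborel f. cis (u * x)) = fourier f u"
  using prob_densityD[OF assms] unfolding fourier_def
  by (subst integral_density) (auto simp: scaleR_conv_of_real mult.commute)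

lemma integral_cis_law_Y:
  assumes f: "prob_density f" and fe: "prob_density fe"
  shows "(LINT y|law_Y f fe. cis (u * y)) = fourier f u * fourier fe u"
proof -
  interpret M: prob_space "density lborel f" by (rule prob_space_prob_density) fact
  interpret N: prob_space "density lborel fe" by (rule prob_space_prob_density) fact
  interpret P: pair_prob_space "density lborel f" "density lborel fe" ..
  have int: "integrable (density lborel f \<Otimes>\<^sub>M density lborel fe) (\<lambda>(x, e). cis (u * (x + e)))"
    by (rule P.integrable_const_bound[where B=1]) auto
  have "(LINT y|law_Y f fe. cis (u * y)) = integral\<^sup>L (density lborel f \<Otimes>\<^sub>M density lborel fe) (\<lambda>(x, e). cis (u * (x + e)))"
    unfolding law_Y_def by (subst integral_distr) (auto simp: case_prod_beta')
  also have "\<dots> = (LINT x|density lborel f. LINT e|density lborel fe. cis (u * (x + e)))"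
    using P.integral_fst[OF int] by simp
  also have "\<dots> = (LINT x|density lborel f. LINT e|density lborel fe. cis (u * x) * cis (u * e))"
    by (simp add: cis_mult ring_distribs)
  also have "\<dots> = fourier f u * fourier fe u"
    by (simp add: fourier_eq_integral_density f fe)
  finally show ?thesis .
qed

text \<open>Bias-variance decomposition with the variance replaced by the second moment; the cruder
  form is enough because the variance term will be negligible.\<close>

lemma mean_square_error_PiM:
  fixes Z :: "'a \<Rightarrow> real"
  assumes "prob_space Q" and [measurable]: "Z \<in> borel_measurable Q"
    and B: "\<And>y. \<bar>Z y\<bar> \<le> B" and n: "0 < n"
  shows "(\<integral>\<^sup>+Y. ennreal (((\<Sum>i<n. Z (Y i)) / real n - c)\<^sup>2) \<partial>PiM {..<n} (\<lambda>_. Q))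
    \<le> ennreal ((LINT y|Q. (Z y)\<^sup>2) / real n + ((LINT y|Q. Z y) - c)\<^sup>2)"
proof -
  interpret Q: prob_space Q by fact
  interpret P: product_prob_space "\<lambda>_. Q" "{..<n}" ..
  let ?P = "PiM {..<n} (\<lambda>_. Q)"
  have P1: "measure ?P (space ?P) = 1" by (rule prob_space.prob_space[OF prob_space_PiM]) (rule Q.prob_space_axioms)
  define \<mu> where "\<mu> = (LINT y|Q. Z y)"
  define W where "W y = Z y - \<mu>" for y
  have Zi: "integrable Q Z" by (rule Q.integrable_const_bound[where B=B]) (use B in auto)
  have Z2i: "integrable Q (\<lambda>y. (Z y)\<^sup>2)"
    by (rule Q.integrable_const_bound[where B="B\<^sup>2"]) (use B in \<open>auto intro!: AE_I2 power2_le_iff_abs_le[THEN iffD2] simp: order_trans[OF abs_ge_zero B]\<close>)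
  have [measurable]: "W \<in> borel_measurable Q" unfolding W_def by simp
  have Wb: "\<bar>W y\<bar> \<le> B + \<bar>\<mu>\<bar>" for y using B[of y] unfolding W_def by linarith
  have W0: "0 \<le> B + \<bar>\<mu>\<bar>" using order_trans[OF abs_ge_zero Wb] by auto
  have Wi: "integrable Q W" unfolding W_def using Zi by simp
  have W2i: "integrable Q (\<lambda>y. (W y)\<^sup>2)"
    by (rule Q.integrable_const_bound[where B="(B + \<bar>\<mu>\<bar>)\<^sup>2"]) (use Wb W0 in \<open>auto intro!: AE_I2 power2_le_iff_abs_le[THEN iffD2]\<close>)
  have EW: "(LINT y|Q. W y) = 0" unfolding W_def using Zi by (simp add: \<mu>_def Q.prob_space)
  have EW2: "(LINT y|Q. (W y)\<^sup>2) = (LINT y|Q. (Z y)\<^sup>2) - \<mu>\<^sup>2"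
    using Q.variance_eq[OF Zi Z2i] by (simp add: W_def \<mu>_def)
  \<comment> \<open>\<open>W (Y i) * W (Y j)\<close> is written as a product over all n coordinates,
    so that independence enters through the product formula. For i = j both factors fall on the same
    coordinate, which yields the square.\<close>
  define \<phi> where "\<phi> i j k y = (if k = i then W y else 1) * (if k = j then W y else (1::real))" for i j k :: nat and y
  have WW: "integrable ?P (\<lambda>Y. W (Y i) * W (Y j)) \<and> (LINT Y|?P. W (Y i) * W (Y j)) = (if i = j then (LINT y|Q. (W y)\<^sup>2) else 0)"
    if ij: "i < n" "j < n" for i j
  proof -
    have \<phi>i: "integrable Q (\<phi> i j k)" for k
      using Wi W2i by (cases "k = i"; cases "k = j") (auto simp: \<phi>_def[abs_def] power2_eq_square)
    have "(\<Prod>k<n. \<phi> i j k (Y k)) = W (Y i) * W (Y j)" for Y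
      using ij by (simp add: \<phi>_def prod.distrib)
    moreover have "(\<Prod>k<n. LINT y|Q. \<phi> i j k y) = (if i = j then (LINT y|Q. (W y)\<^sup>2) else 0)"
    proof (cases "i = j")
      case True
      have "(LINT y|Q. \<phi> i j k y) = (if k = i then (LINT y|Q. (W y)\<^sup>2) else 1)" for k
        using True by (auto simp: \<phi>_def power2_eq_square Q.prob_space)
      then show ?thesis using True ij by simp
    next
      case False
      then have "(LINT y|Q. \<phi> i j i y) = 0" by (simp add: \<phi>_def EW)
      then have "(\<Prod>k<n. LINT y|Q. \<phi> i j k y) = 0" using ij by (intro prod_zero) auto
      then show ?thesis using False by simp
    qed
    ultimately show ?thesis
      using P.product_integrable_prod[of "{..<n}" "\<phi> i j"] P.product_integral_prod[of "{..<n}" "\<phi> i j"] \<phi>i by simp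
  qed
  have W1: "integrable ?P (\<lambda>Y. W (Y i)) \<and> (LINT Y|?P. W (Y i)) = 0" if i: "i < n" for i
  proof -
    define \<psi> where "\<psi> k y = (if k = i then W y else (1::real))" for k :: nat and y
    have \<psi>i: "integrable Q (\<psi> k)" for k
      using Wi by (cases "k = i") (auto simp: \<psi>_def[abs_def])
    have "(\<Prod>k<n. \<psi> k (Y k)) = W (Y i)" for Y
      using i by (simp add: \<psi>_def)
    moreover have "(\<Prod>k<n. LINT y|Q. \<psi> k y) = 0"
      using i by (intro prod_zero) (auto simp: \<psi>_def EW intro!: bexI[of _ i])
    ultimately show ?thesis
      using P.product_integrable_prod[of "{..<n}" \<psi>] P.product_integral_prod[of "{..<n}" \<psi>] \<psi>i by simp
  qed
  have eq: "((\<Sum>i<n. Z (Y i)) / real n - c)\<^sup>2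
      = (\<Sum>i<n. \<Sum>j<n. W (Y i) * W (Y j)) / (real n)\<^sup>2 + 2 * (\<mu> - c) / real n * (\<Sum>i<n. W (Y i)) + (\<mu> - c)\<^sup>2" for Y
  proof -
    have "(\<Sum>i<n. Z (Y i)) = (\<Sum>i<n. W (Y i)) + real n * \<mu>" by (simp add: W_def sum_subtractf)
    then show ?thesis using n
      by (simp add: sum_product[symmetric] power2_eq_square field_simps)
  qed
  let ?R = "\<lambda>Y. (\<Sum>i<n. \<Sum>j<n. W (Y i) * W (Y j)) / (real n)\<^sup>2 + 2 * (\<mu> - c) / real n * (\<Sum>i<n. W (Y i)) + (\<mu> - c)\<^sup>2"
  have Ri: "integrable ?P ?R" using WW W1 by (intro Bochner_Integration.integrable_add integrable_divide integrable_mult_right Bochner_Integration.integrable_sum) auto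
  have "(LINT Y|?P. ?R Y) = (\<Sum>i<n. \<Sum>j<n. (LINT Y|?P. W (Y i) * W (Y j))) / (real n)\<^sup>2 + (\<mu> - c)\<^sup>2"
  proof -
    have 1: "integrable ?P (\<lambda>Y. (\<Sum>i<n. \<Sum>j<n. W (Y i) * W (Y j)) / (real n)\<^sup>2)"
      using WW by (intro integrable_divide Bochner_Integration.integrable_sum) auto
    have 2: "integrable ?P (\<lambda>Y. 2 * (\<mu> - c) / real n * (\<Sum>i<n. W (Y i)))"
      using W1 by (intro integrable_mult_right Bochner_Integration.integrable_sum) auto
    have 3: "(LINT Y|?P. (\<Sum>i<n. \<Sum>j<n. W (Y i) * W (Y j))) = (\<Sum>i<n. \<Sum>j<n. (LINT Y|?P. W (Y i) * W (Y j)))"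
      using WW by (subst Bochner_Integration.integral_sum) (auto intro!: Bochner_Integration.integrable_sum sum.cong Bochner_Integration.integral_sum)
    have 4: "(LINT Y|?P. (\<Sum>i<n. W (Y i))) = 0"
      using W1 by (subst Bochner_Integration.integral_sum) auto
    show ?thesis
      by (subst Bochner_Integration.integral_add[OF Bochner_Integration.integrable_add[OF 1 2]], simp, subst Bochner_Integration.integral_add[OF 1 2])
         (simp only: 3 4 integral_divide_zero integral_mult_right_zero lebesgue_integral_const, simp add: P1)
  qed
  also have "(\<Sum>i<n. \<Sum>j<n. (LINT Y|?P. W (Y i) * W (Y j))) = real n * (LINT y|Q. (W y)\<^sup>2)"
    using WW by simp
  finally have "(LINT Y|?P. ?R Y) = (LINT y|Q. (W y)\<^sup>2) / real n + (\<mu> - c)\<^sup>2"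
    using n by (simp add: power2_eq_square)
  moreover have "0 \<le> ?R Y" for Y unfolding eq[symmetric] by simp
  ultimately have "(\<integral>\<^sup>+Y. ennreal (?R Y) \<partial>?P) = ennreal ((LINT y|Q. (W y)\<^sup>2) / real n + (\<mu> - c)\<^sup>2)"
    by (subst nn_integral_eq_integral[OF Ri]) auto
  also have "(\<integral>\<^sup>+Y. ennreal (?R Y) \<partial>?P) = (\<integral>\<^sup>+Y. ennreal (((\<Sum>i<n. Z (Y i)) / real n - c)\<^sup>2) \<partial>?P)"
    by (intro nn_integral_cong arg_cong[where f=ennreal] eq[symmetric])
  also have "ennreal ((LINT y|Q. (W y)\<^sup>2) / real n + (\<mu> - c)\<^sup>2) \<le> ennreal ((LINT y|Q. (Z y)\<^sup>2) / real n + (\<mu> - c)\<^sup>2)"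
    unfolding EW2 by (intro ennreal_leI add_mono divide_right_mono) auto
  finally show ?thesis unfolding \<mu>_def .
qed

section \<open>Integrable majorants\<close>

lemma integrable_inverse_one_plus_square: "integrable lborel (\<lambda>x::real. 1 / (1 + x\<^sup>2))"
proof -
  have "set_integrable lborel {0<..} (\<lambda>x::real. 1 / (1 + x\<^sup>2))"
    using integrable_I0i_1_div_plus_square by (simp add: interval_lebesgue_integrable_def einterval_def greaterThan_def)
  then have i: "integrable lborel (\<lambda>x::real. indicator {0<..} x * (1 / (1 + x\<^sup>2)))"
    by (simp add: set_integrable_def)
  from lborel_integrable_real_affine[OF this, of "-1" 0]
  have "integrable lborel (\<lambda>x::real. indicator {0<..} (-x) * (1 / (1 + x\<^sup>2)))" by simp
  with i have "integrable lborel (\<lambda>x::real. indicator {0<..} x * (1 / (1 + x\<^sup>2)) + indicator {0<..} (-x) * (1 / (1 + x\<^sup>2)))"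
    by (rule Bochner_Integration.integrable_add)
  moreover have "AE x in lborel. x \<noteq> (0::real)" by (rule AE_lborel_singleton)
  then have "AE x in lborel. indicator {0<..} x * (1 / (1 + x\<^sup>2)) + indicator {0<..} (-x) * (1 / (1 + x\<^sup>2)) = 1 / (1 + (x::real)\<^sup>2)"
    by eventually_elim (auto simp: indicator_def)
  ultimately show ?thesis
    by (subst (asm) integrable_cong_AE) auto
qed

text \<open>The exponential outgrows the N-th power of its argument, and N \<ge> 2/r makes that
  power at least of order u^2; so 1/(1 + u^2) is a majorant up to a constant for every r >
  0.\<close>

lemma integrable_exp_neg_powr:
  fixes c r :: real assumes "0 < c" "0 < r"
  shows "integrable lborel (\<lambda>u::real. exp (- c * \<bar>u\<bar> powr r))"
proof -
  obtain N where N: "2 \<le> real N * r"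
    using reals_Archimedean3[OF \<open>0 < r\<close>] by (meson less_imp_le)
  define C where "C = fact N / c ^ N"
  have C0: "0 < C" using assms by (simp add: C_def)
  have b: "exp (- c * \<bar>u\<bar> powr r) \<le> 2 * (1 + C) * (1 / (1 + u\<^sup>2))" for u :: real
  proof (cases "\<bar>u\<bar> \<le> 1")
    case True
    then have "u\<^sup>2 \<le> 1" by (simp add: abs_square_le_1)
    then have "1 \<le> 2 * (1 / (1 + u\<^sup>2))" by (auto simp: field_simps add_pos_nonneg)
    also have "\<dots> \<le> 2 * (1 + C) * (1 / (1 + u\<^sup>2))" using C0 by (intro mult_right_mono) auto
    finally have "1 \<le> 2 * (1 + C) * (1 / (1 + u\<^sup>2))" .
    moreover have "exp (- c * \<bar>u\<bar> powr r) \<le> 1" using assms by simp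
    ultimately show ?thesis by linarith
  next
    case False
    define t where "t = c * \<bar>u\<bar> powr r"
    have t0: "0 < t" using False assms by (simp add: t_def)
    have "t ^ N / fact N \<le> exp t"
      using sum_le_suminf[OF summable_exp_generic[of t], of "{N}"] t0
      by (simp add: exp_def divide_inverse mult.commute)
    then have "exp (- t) \<le> fact N / t ^ N" using t0 by (simp add: exp_minus field_simps)
    also have "t ^ N = c ^ N * \<bar>u\<bar> powr (real N * r)"
      using False by (simp add: t_def power_mult_distrib powr_power mult.commute)
    also have "fact N / (c ^ N * \<bar>u\<bar> powr (real N * r)) \<le> fact N / (c ^ N * \<bar>u\<bar> powr 2)"
      using False assms N by (intro divide_left_mono mult_left_mono powr_mono) (auto intro!: mult_pos_pos)
    also have "\<dots> = C * (1 / u\<^sup>2)" using False by (simp add: C_def)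
    also have "\<dots> \<le> C * (2 * (1 / (1 + u\<^sup>2)))"
    proof (rule mult_left_mono)
      have "1 \<le> u\<^sup>2" using False by (metis abs_square_le_1 linorder_le_cases)
      moreover have "0 < u\<^sup>2" using calculation by linarith
      ultimately show "1 / u\<^sup>2 \<le> 2 * (1 / (1 + u\<^sup>2))" by (simp add: divide_simps)
    qed (use C0 in simp)
    also have "\<dots> = 2 * C * (1 / (1 + u\<^sup>2))" by simp
    also have "\<dots> \<le> 2 * (1 + C) * (1 / (1 + u\<^sup>2))" by (intro mult_right_mono) auto
    finally show ?thesis by (simp add: t_def)
  qed
  show ?thesis
  proof (rule Bochner_Integration.integrable_bound)
    show "integrable lborel (\<lambda>u::real. 2 * (1 + C) * (1 / (1 + u\<^sup>2)))"
      using integrable_inverse_one_plus_square by (rule integrable_mult_right)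
    show "AE u in lborel. norm (exp (- c * \<bar>u\<bar> powr r)) \<le> norm (2 * (1 + C) * (1 / (1 + u\<^sup>2)))"
    proof (rule AE_I2)
      fix u :: real
      show "norm (exp (- c * \<bar>u\<bar> powr r)) \<le> norm (2 * (1 + C) * (1 / (1 + u\<^sup>2)))"
        using b[of u] by (metis abs_ge_self abs_exp_cancel order_trans real_norm_def)
    qed
  qed measurable
qed


section \<open>The deconvolution kernel\<close>

text \<open>This is \<open>dkernel fe h (z / h) / h\<close> for \<open>a = 1 / h\<close>. Bias and
  variance depend on the bandwidth only through this cut-off frequency, so the estimates are stated
  in \<open>a\<close>.\<close>

definition deconv_kernel :: "(real \<Rightarrow> real) \<Rightarrow> real \<Rightarrow> real \<Rightarrow> complex" where
  "deconv_kernel fe a z = cft (\<lambda>u. indicator {-a..a} u / fourier fe u) (- z) / (2 * pi)"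

lemma dkernel_eq_deconv_kernel:
  assumes "0 < h"
  shows "dkernel fe h (z / h) / h = deconv_kernel fe (1 / h) z"
proof -
  have ind: "indicator {- (1 / h)..1 / h} (u / h) = (indicator {-1..1} u :: complex)" for u
    using assms by (simp add: indicator_def field_simps)
  show ?thesis
    unfolding dkernel_def deconv_kernel_def cft_def
    using assms by (subst lborel_integral_real_affine[where c="1 / h" and t=0])
      (auto simp: ind scaleR_conv_of_real mult_ac of_real_indicator)
qed

lemma kernel_est_eq:
  assumes "0 < h"
  shows "kernel_est fe n h Y x = (\<Sum>i<n. Re (deconv_kernel fe (1 / h) (x - Y i))) / real n"
proof -
  have "(\<Sum>i<n. dkernel fe h ((x - Y i) / h)) / complex_of_real (real n * h)
     = (\<Sum>i<n. dkernel fe h ((x - Y i) / h) / h) / complex_of_real (real n)"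
    by (simp add: sum_divide_distrib mult.commute)
  then show ?thesis
    unfolding kernel_est_def by (simp add: dkernel_eq_deconv_kernel[OF assms] Re_divide_of_real)
qed

lemma integrable_indicator_inverse_fourier:
  assumes fe: "prob_density fe" and M: "\<And>u. \<bar>u\<bar> \<le> a \<Longrightarrow> 1 / cmod (fourier fe u) \<le> M"
  shows "integrable lborel (\<lambda>u. indicator {-a..a} u / fourier fe u)" (is "integrable _ ?g")
    and "integrable lborel (\<lambda>u. (cmod (indicator {-a..a} u / fourier fe u))\<^sup>2)"
proof -
  have [measurable]: "fourier fe \<in> borel_measurable borel"
    using borel_measurable_cft[of "\<lambda>x. complex_of_real (fe x)"] prob_densityD[OF fe]
    by (simp add: fourier_eq_cft[abs_def])
  have i: "integrable lborel (\<lambda>u. c * indicator {-a..a} u)" for c :: real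
    by (cases "-a \<le> a") auto
  have b: "cmod (?g u) \<le> M * indicator {-a..a} u" for u
    using M[of u] by (auto simp: indicator_def norm_divide)
  show "integrable lborel ?g"
    by (rule Bochner_Integration.integrable_bound[OF i[of M]])
       (use b in \<open>auto intro!: AE_I2 order_trans[OF b] simp del: norm_divide\<close>)
  have b2: "(cmod (?g u))\<^sup>2 \<le> M\<^sup>2 * indicator {-a..a} u" for u
    using power_mono[OF b[of u] norm_ge_zero, of 2] by (cases "u \<in> {-a..a}") auto
  show "integrable lborel (\<lambda>u. (cmod (?g u))\<^sup>2)"
    by (rule Bochner_Integration.integrable_bound[OF i[of "M\<^sup>2"]])
       (use b2 in \<open>auto intro!: AE_I2 simp: abs_mult simp del: norm_divide\<close>)
qed

context
  fixes fe :: "real \<Rightarrow> real" and a M :: real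
  assumes fe: "prob_density fe" and M: "\<And>u. \<bar>u\<bar> \<le> a \<Longrightarrow> 1 / cmod (fourier fe u) \<le> M" and a: "0 < a"
begin

lemma continuous_on_deconv_kernel: "continuous_on UNIV (deconv_kernel fe a)"
  unfolding deconv_kernel_def
  by (intro continuous_intros continuous_on_compose2[OF continuous_on_cft[OF integrable_indicator_inverse_fourier(1)[OF fe M]]]) auto

lemma borel_measurable_deconv_kernel: "deconv_kernel fe a \<in> borel_measurable borel"
  using continuous_on_deconv_kernel by (rule borel_measurable_continuous_onI)

lemma norm_indicator_inverse_fourier_le: "cmod (indicator {-a..a} u / fourier fe u) \<le> M * indicator {-a..a} u"
  using M[of u] by (auto simp: indicator_def norm_divide)

text \<open>Serves as the variance bound at a point; what the sup norm may lose is a power of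
  \<open>a\<close>, which the asymptotics absorb.\<close>

lemma norm_deconv_kernel_le: "cmod (deconv_kernel fe a z) \<le> a * M / pi"
proof -
  have "cmod (cft (\<lambda>u. indicator {-a..a} u / fourier fe u) (- z)) \<le> (LINT u|lborel. cmod (indicator {-a..a} u / fourier fe u))"
    by (rule norm_cft_le[OF integrable_indicator_inverse_fourier(1)[OF fe M]])
  also have "\<dots> \<le> (LINT u|lborel. M * indicator {-a..a} u)"
    using integrable_indicator_inverse_fourier(1)[OF fe M] a
    by (intro integral_mono norm_indicator_inverse_fourier_le) auto
  also have "\<dots> = 2 * a * M" using a by simp
  finally show ?thesis unfolding deconv_kernel_def by (simp add: norm_divide field_simps)
qed

lemma nn_integral_deconv_kernel_le: "(\<integral>\<^sup>+z. ennreal ((cmod (deconv_kernel fe a z))\<^sup>2) \<partial>lborel) \<le> ennreal (a * M\<^sup>2 / pi)"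
proof -
  let ?g = "\<lambda>u. indicator {-a..a} u / fourier fe u"
  note gi = integrable_indicator_inverse_fourier[OF fe M]
  have [measurable]: "cft ?g \<in> borel_measurable borel" by (rule borel_measurable_cft[OF gi(1)])
  have "(\<integral>\<^sup>+z. ennreal ((cmod (deconv_kernel fe a z))\<^sup>2) \<partial>lborel) = (\<integral>\<^sup>+z. ennreal (1 / (2 * pi)\<^sup>2) * ennreal ((cmod (cft ?g (- z)))\<^sup>2) \<partial>lborel)"
    unfolding deconv_kernel_def by (intro nn_integral_cong) (simp add: norm_divide power_divide norm_mult flip: ennreal_mult)
  also have "\<dots> = ennreal (1 / (2 * pi)\<^sup>2) * (\<integral>\<^sup>+z. ennreal ((cmod (cft ?g (- z)))\<^sup>2) \<partial>lborel)"
    by (rule nn_integral_cmult) measurable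
  also have "(\<integral>\<^sup>+z. ennreal ((cmod (cft ?g (- z)))\<^sup>2) \<partial>lborel) = (\<integral>\<^sup>+z. ennreal ((cmod (cft ?g z))\<^sup>2) \<partial>lborel)"
    by (subst (2) nn_integral_real_affine[where c="-1" and t=0]) auto
  also have "\<dots> \<le> ennreal (2 * pi * (LINT u|lborel. (cmod (?g u))\<^sup>2))"
    by (rule plancherel_le[OF gi])
  also have "(LINT u|lborel. (cmod (?g u))\<^sup>2) \<le> (LINT u|lborel. M\<^sup>2 * indicator {-a..a} u)"
  proof (rule integral_mono[OF gi(2)])
    fix u show "(cmod (?g u))\<^sup>2 \<le> M\<^sup>2 * indicator {-a..a} u"
      using power_mono[OF norm_indicator_inverse_fourier_le[of u] norm_ge_zero, of 2] by (cases "u \<in> {-a..a}") auto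
  qed (use a in auto)
  also have "\<dots> = 2 * a * M\<^sup>2" using a by simp
  finally have "(\<integral>\<^sup>+z. ennreal ((cmod (deconv_kernel fe a z))\<^sup>2) \<partial>lborel) \<le> ennreal (1 / (2 * pi)\<^sup>2) * ennreal (2 * pi * (2 * a * M\<^sup>2))"
    by (simp add: mult_left_mono ennreal_leI)
  also have "\<dots> = ennreal (a * M\<^sup>2 / pi)"
    using a by (subst ennreal_mult[symmetric]) (auto simp: power2_eq_square)
  finally show ?thesis .
qed

text \<open>The characteristic function of an observation is
  \<open>fourier f u * fourier fe u\<close>, and the kernel divides by the second factor. The
  estimator is therefore unbiased for the inversion integral truncated at \<open>a\<close>, and the
  noise enters only the variance.\<close>

lemma expectation_deconv_kernel:
  assumes f: "prob_density f" and \<Phi>0: "\<And>u. fourier fe u \<noteq> 0"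
  shows "(LINT y|law_Y f fe. deconv_kernel fe a (x - y))
    = (LINT u|lborel. indicator {-a..a} u * fourier f u * cis (- (u * x))) / (2 * pi)"
proof -
  let ?g = "\<lambda>u. indicator {-a..a} u / fourier fe u"
  interpret Q: prob_space "law_Y f fe" by (rule prob_space_law_Y[OF f fe])
  have "(LINT y|law_Y f fe. deconv_kernel fe a (x - y))
      = (LINT y|law_Y f fe. LINT u|lborel. ?g u * 1 * cis (u * (y - x))) / (2 * pi)"
    unfolding deconv_kernel_def cft_def by simp
  also have "(LINT y|law_Y f fe. LINT u|lborel. ?g u * 1 * cis (u * (y - x)))
      = (LINT u|lborel. LINT y|law_Y f fe. ?g u * 1 * cis (u * (y - x)))"
    by (rule Fubini_mult_bounded)
       (auto intro!: lborel.sigma_finite_measure_axioms Q.sigma_finite_measure_axioms integrable_indicator_inverse_fourier(1)[OF fe M])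
  also have "\<dots> = (LINT u|lborel. LINT y|law_Y f fe. ?g u * cis (- (u * x)) * cis (u * y))"
  proof -
    have "cis (u * (y - x)) = cis (- (u * x)) * cis (u * y)" for u y by (simp add: cis_mult algebra_simps)
    then show ?thesis by (simp add: mult.assoc)
  qed
  also have "\<dots> = (LINT u|lborel. indicator {-a..a} u * fourier f u * cis (- (u * x)))"
    by (intro Bochner_Integration.integral_cong refl) (simp add: integral_cis_law_Y[OF f fe] \<Phi>0)
  finally show ?thesis .
qed

end

section \<open>Spectral tails in the class and the bias\<close>

text \<open>The factor that Cauchy-Schwarz leaves over in the squared bias at a point.\<close>

definition exp_tail :: "real \<Rightarrow> real \<Rightarrow> real \<Rightarrow> real" where
  "exp_tail c r a = (LINT u|lborel. indicator {u. a < \<bar>u\<bar>} u * exp (- c * \<bar>u\<bar> powr r))"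

lemma integrable_exp_tail:
  fixes c r :: real assumes "0 < c" "0 < r"
  shows "integrable lborel (\<lambda>u. indicator {u. a < \<bar>u\<bar>} u * exp (- c * \<bar>u\<bar> powr r))"
proof (rule Bochner_Integration.integrable_bound[OF integrable_exp_neg_powr[OF assms]])
  show "AE u in lborel. norm (indicator {u. a < \<bar>u\<bar>} u * exp (- c * \<bar>u\<bar> powr r)) \<le> norm (exp (- c * \<bar>u\<bar> powr r))"
    by (intro AE_I2) (simp split: split_indicator)
qed measurable

lemma exp_tail_nonneg: "0 \<le> exp_tail c r a"
  unfolding exp_tail_def by simp

text \<open>At a point: Cauchy-Schwarz after splitting 1 = exp(\<alpha>|u|^r) exp(-\<alpha>|u|^r).
  In L2: beyond \<open>a\<close> the weight of the class is at least exp(2\<alpha>a^r). Neither step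
  loses a constant, as a sharp limit requires.\<close>

lemma dens_class_fourier_tail:
  assumes f: "f \<in> dens_class \<alpha> r L" and "0 < \<alpha>" "0 < r" "0 < L"
  shows "integrable lborel (\<lambda>u. indicator {u. a < \<bar>u\<bar>} u * fourier f u)" (is "integrable _ ?D")
    and "(LINT u|lborel. cmod (indicator {u. a < \<bar>u\<bar>} u * fourier f u))\<^sup>2 \<le> 2 * pi * L * exp_tail (2 * \<alpha>) r a"
    and "integrable lborel (\<lambda>u. (cmod (indicator {u. a < \<bar>u\<bar>} u * fourier f u))\<^sup>2)"
    and "0 \<le> a \<Longrightarrow> (LINT u|lborel. (cmod (indicator {u. a < \<bar>u\<bar>} u * fourier f u))\<^sup>2) \<le> 2 * pi * L * exp (- 2 * \<alpha> * a powr r)"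
proof -
  have fp: "prob_density f" and W: "(\<integral>\<^sup>+ u. ennreal ((cmod (fourier f u))\<^sup>2 * exp (2 * \<alpha> * \<bar>u\<bar> powr r)) \<partial>lborel) \<le> ennreal (2 * pi * L)"
    using f by (auto simp: dens_class_def)
  have [measurable]: "fourier f \<in> borel_measurable borel"
    using borel_measurable_cft[of "\<lambda>x. complex_of_real (f x)"] prob_densityD[OF fp]
    by (simp add: fourier_eq_cft[abs_def])
  have [measurable]: "{u. a < \<bar>u\<bar>} \<in> sets borel" by measurable
  let ?I = "indicator {u. a < \<bar>u\<bar>} :: real \<Rightarrow> real"
  \<comment> \<open>Cauchy-Schwarz is applied to nonnegative integrals, because integrability of the
    tail is itself one of the conclusions.\<close>
  have sq: "(\<integral>\<^sup>+u. ennreal (cmod (?D u)) \<partial>lborel)\<^sup>2 \<le> ennreal (2 * pi * L * exp_tail (2 * \<alpha>) r a)"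
  proof -
    have e: "exp (\<alpha> * \<bar>u\<bar> powr r) * exp (- \<alpha> * \<bar>u\<bar> powr r) = 1" for u
      by (simp flip: exp_add)
    have 1: "(\<integral>\<^sup>+u. ennreal (cmod (?D u)) \<partial>lborel) = (\<integral>\<^sup>+u. ennreal (cmod (fourier f u) * exp (\<alpha> * \<bar>u\<bar> powr r)) * ennreal (?I u * exp (- \<alpha> * \<bar>u\<bar> powr r)) \<partial>lborel)"
    proof (rule nn_integral_cong)
      fix u
      have "cmod (?D u) = cmod (fourier f u) * exp (\<alpha> * \<bar>u\<bar> powr r) * (?I u * exp (- \<alpha> * \<bar>u\<bar> powr r))"
        using e[of u] by (simp add: norm_mult mult_ac split: split_indicator)
      then show "ennreal (cmod (?D u)) = ennreal (cmod (fourier f u) * exp (\<alpha> * \<bar>u\<bar> powr r)) * ennreal (?I u * exp (- \<alpha> * \<bar>u\<bar> powr r))"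
        by (simp add: ennreal_mult)
    qed
    have 2: "(\<integral>\<^sup>+u. (ennreal (cmod (fourier f u) * exp (\<alpha> * \<bar>u\<bar> powr r)))\<^sup>2 \<partial>lborel) = (\<integral>\<^sup>+ u. ennreal ((cmod (fourier f u))\<^sup>2 * exp (2 * \<alpha> * \<bar>u\<bar> powr r)) \<partial>lborel)"
      by (intro nn_integral_cong) (simp add: ennreal_power power_mult_distrib exp_double[symmetric] mult.assoc)
    have 3: "(\<integral>\<^sup>+u. (ennreal (?I u * exp (- \<alpha> * \<bar>u\<bar> powr r)))\<^sup>2 \<partial>lborel) = (\<integral>\<^sup>+u. ennreal (?I u * exp (- (2 * \<alpha>) * \<bar>u\<bar> powr r)) \<partial>lborel)"
      by (intro nn_integral_cong) (simp add: ennreal_power power_mult_distrib exp_double[symmetric] mult.assoc split: split_indicator)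
    have 4: "(\<integral>\<^sup>+u. ennreal (?I u * exp (- (2 * \<alpha>) * \<bar>u\<bar> powr r)) \<partial>lborel) = ennreal (exp_tail (2 * \<alpha>) r a)"
      unfolding exp_tail_def using assms by (intro nn_integral_eq_integral integrable_exp_tail) auto
    have "(\<integral>\<^sup>+u. ennreal (cmod (?D u)) \<partial>lborel)\<^sup>2 \<le> (\<integral>\<^sup>+ u. ennreal ((cmod (fourier f u))\<^sup>2 * exp (2 * \<alpha> * \<bar>u\<bar> powr r)) \<partial>lborel) * ennreal (exp_tail (2 * \<alpha>) r a)"
      unfolding 1 2[symmetric] 4[symmetric] 3[symmetric]
      by (rule Cauchy_Schwarz_nn_integral) measurable
    also have "\<dots> \<le> ennreal (2 * pi * L) * ennreal (exp_tail (2 * \<alpha>) r a)"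
      using W by (intro mult_right_mono) auto
    finally show ?thesis using \<open>0 < L\<close> by (simp add: ennreal_mult')
  qed
  have fin: "(\<integral>\<^sup>+u. ennreal (cmod (?D u)) \<partial>lborel) < \<infinity>"
  proof (rule ccontr)
    assume "\<not> ?thesis"
    then have "(\<integral>\<^sup>+u. ennreal (cmod (?D u)) \<partial>lborel) = \<infinity>" by (simp add: not_less top_unique)
    then show False using sq by (simp add: power2_eq_square ennreal_mult_eq_top_iff top_unique)
  qed
  show Di: "integrable lborel ?D" by (rule integrableI_bounded[OF _ fin]) measurable
  have "(\<integral>\<^sup>+u. ennreal (cmod (?D u)) \<partial>lborel) = ennreal (LINT u|lborel. cmod (?D u))"
    using Di by (intro nn_integral_eq_integral) auto
  with sq show "(LINT u|lborel. cmod (?D u))\<^sup>2 \<le> 2 * pi * L * exp_tail (2 * \<alpha>) r a"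
    using \<open>0 < L\<close> exp_tail_nonneg by (simp add: ennreal_power)
  \<comment> \<open>The choice \<open>b = 0\<close> gives square integrability for every
    \<open>a\<close>, the choice \<open>b = a\<close> gives the bound.\<close>
  have D2: "(\<integral>\<^sup>+u. ennreal ((cmod (?D u))\<^sup>2) \<partial>lborel) \<le> ennreal (2 * pi * L * exp (- 2 * \<alpha> * b powr r))" if "0 \<le> b" "b \<le> a \<or> b = 0" for b
  proof -
    have "(cmod (?D u))\<^sup>2 \<le> exp (- 2 * \<alpha> * b powr r) * ((cmod (fourier f u))\<^sup>2 * exp (2 * \<alpha> * \<bar>u\<bar> powr r))" for u
    proof (cases "a < \<bar>u\<bar>")
      case True
      then have "b powr r \<le> \<bar>u\<bar> powr r" using that \<open>0 < r\<close> by (intro powr_mono2) auto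
      then have "1 \<le> exp (2 * \<alpha> * (\<bar>u\<bar> powr r - b powr r))" using \<open>0 < \<alpha>\<close> by simp
      then have "1 * (cmod (fourier f u))\<^sup>2 \<le> exp (2 * \<alpha> * (\<bar>u\<bar> powr r - b powr r)) * (cmod (fourier f u))\<^sup>2"
        by (rule mult_right_mono) simp
      also have "exp (2 * \<alpha> * (\<bar>u\<bar> powr r - b powr r)) = exp (- 2 * \<alpha> * b powr r) * exp (2 * \<alpha> * \<bar>u\<bar> powr r)"
        by (simp add: algebra_simps flip: exp_add)
      finally show ?thesis using True by (simp add: norm_mult mult_ac)
    next
      case False
      then have "?D u = 0" by simp
      then have "(cmod (?D u))\<^sup>2 = 0" by (simp only: norm_zero zero_power2)
      also have "0 \<le> exp (- 2 * \<alpha> * b powr r) * ((cmod (fourier f u))\<^sup>2 * exp (2 * \<alpha> * \<bar>u\<bar> powr r))"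
        by (intro mult_nonneg_nonneg) auto
      finally show ?thesis .
    qed
    then have "(\<integral>\<^sup>+u. ennreal ((cmod (?D u))\<^sup>2) \<partial>lborel) \<le> (\<integral>\<^sup>+u. ennreal (exp (- 2 * \<alpha> * b powr r)) * ennreal ((cmod (fourier f u))\<^sup>2 * exp (2 * \<alpha> * \<bar>u\<bar> powr r)) \<partial>lborel)"
      by (intro nn_integral_mono) (simp flip: ennreal_mult' add: ennreal_leI)
    also have "\<dots> = ennreal (exp (- 2 * \<alpha> * b powr r)) * (\<integral>\<^sup>+u. ennreal ((cmod (fourier f u))\<^sup>2 * exp (2 * \<alpha> * \<bar>u\<bar> powr r)) \<partial>lborel)"
      by (rule nn_integral_cmult) measurable
    also have "\<dots> \<le> ennreal (exp (- 2 * \<alpha> * b powr r)) * ennreal (2 * pi * L)"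
      by (intro mult_left_mono W) auto
    finally show ?thesis using \<open>0 < L\<close> by (simp add: ennreal_mult'[symmetric] mult_ac)
  qed
  show i2: "integrable lborel (\<lambda>u. (cmod (?D u))\<^sup>2)"
  proof (rule integrableI_bounded)
    show "(\<integral>\<^sup>+u. ennreal (norm ((cmod (?D u))\<^sup>2)) \<partial>lborel) < \<infinity>"
      using D2[of 0] by (simp add: order_le_less_trans)
  qed measurable
  assume "0 \<le> a"
  then have "ennreal (LINT u|lborel. (cmod (?D u))\<^sup>2) \<le> ennreal (2 * pi * L * exp (- 2 * \<alpha> * a powr r))"
    using D2[of a] nn_integral_eq_integral[OF i2] by simp
  then show "(LINT u|lborel. (cmod (?D u))\<^sup>2) \<le> 2 * pi * L * exp (- 2 * \<alpha> * a powr r)"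
    using \<open>0 < L\<close> by (simp add: ennreal_le_iff)
qed


text \<open>Inversion at every point uses the continuity built into the class and an integrable
  transform: it is bounded by 1 up to \<open>a\<close> and integrable beyond by the tail estimate.
  Hence the bias is exactly minus the inversion integral over |u| > a.\<close>

lemma dens_class_truncated_inversion:
  assumes f: "f \<in> dens_class \<alpha> r L" and "0 < \<alpha>" "0 < r" "0 < L" "0 < a"
  shows "(LINT u|lborel. indicator {-a..a} u * fourier f u * cis (- (u * x))) / (2 * pi) - f x
    = - cft (\<lambda>u. indicator {u. a < \<bar>u\<bar>} u * fourier f u) (- x) / (2 * pi)"
proof -
  have fp: "prob_density f" and fc: "continuous_on UNIV f" using f by (auto simp: dens_class_def)
  let ?f = "\<lambda>x. complex_of_real (f x)"
  let ?D = "\<lambda>u. indicator {u. a < \<bar>u\<bar>} u * fourier f u"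
  have fi: "integrable lborel ?f" using prob_densityD[OF fp] by simp
  have Di: "integrable lborel ?D" by (rule dens_class_fourier_tail[OF assms(1-4)])
  have b: "cmod (fourier f u) \<le> 1" for u
    unfolding fourier_eq_cft using norm_cft_le[OF fi, of u] prob_densityD[OF fp] by simp
  have [measurable]: "fourier f \<in> borel_measurable borel"
    using borel_measurable_cft[OF fi] by (simp add: fourier_eq_cft[abs_def])
  have Bi: "integrable lborel (\<lambda>u. indicator {-a..a} u * fourier f u)"
  proof (rule Bochner_Integration.integrable_bound)
    show "integrable lborel (indicator {-a..a} :: real \<Rightarrow> real)" using \<open>0 < a\<close> by auto
    show "AE u in lborel. cmod (indicator {-a..a} u * fourier f u) \<le> norm (indicator {-a..a} u :: real)"
      using b by (auto simp: indicator_def)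
  qed measurable
  have split: "fourier f u = indicator {-a..a} u * fourier f u + ?D u" for u
    by (auto simp: indicator_def abs_le_iff)
  have \<Phi>: "integrable lborel (fourier f)"
    using Bochner_Integration.integrable_add[OF Bi Di] unfolding split[symmetric] .
  have "isCont ?f x" using fc by (intro continuous_intros) (auto simp: continuous_on_eq_continuous_at)
  from fourier_inversion[OF fi this] \<Phi>
  have inv: "(LINT u|lborel. fourier f u * cis (- (u * x))) = 2 * pi * ?f x"
    by (simp add: fourier_eq_cft[abs_def])
  have "(LINT u|lborel. fourier f u * cis (- (u * x))) = (LINT u|lborel. indicator {-a..a} u * fourier f u * cis (- (u * x)) + ?D u * cis (- (u * x)))"
  proof (rule Bochner_Integration.integral_cong[OF refl])
    fix u
    show "fourier f u * cis (- (u * x)) = indicator {-a..a} u * fourier f u * cis (- (u * x)) + ?D u * cis (- (u * x))"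
      using arg_cong[where f="\<lambda>z. z * cis (- (u * x))", OF split[of u]] unfolding distrib_right .
  qed
  also have "\<dots> = (LINT u|lborel. indicator {-a..a} u * fourier f u * cis (- (u * x))) + cft ?D (- x)"
    unfolding cft_def using integrable_mult_cis[OF Bi, of "\<lambda>u. - (u * x)"] integrable_mult_cis[OF Di, of "\<lambda>u. - (u * x)"]
    by (subst Bochner_Integration.integral_add) auto
  finally show ?thesis unfolding inv by (simp add: field_simps)
qed

section \<open>Risk bounds for the kernel estimator\<close>

context
  fixes fe :: "real \<Rightarrow> real" and \<alpha> r L h M :: real and n :: nat
  assumes fe: "prob_density fe" and M: "\<And>u. \<bar>u\<bar> \<le> 1 / h \<Longrightarrow> 1 / cmod (fourier fe u) \<le> M"
    and \<Phi>0: "\<And>u. fourier fe u \<noteq> 0" and h: "0 < h" and n: "0 < n"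
    and \<alpha>: "0 < \<alpha>" and r: "0 < r" and L: "0 < L"
begin

lemma kernel_est_in_estimators: "(\<lambda>Y z. kernel_est fe n h Y z) \<in> estimators n"
proof -
  have a: "0 < 1 / h" using h by simp
  note [measurable] = borel_measurable_deconv_kernel[OF fe M a]
  show ?thesis
    unfolding estimators_def kernel_est_eq[OF h] by simp
qed

text \<open>Passing to real parts decreases moduli, both of the kernel and of the bias, so the
  estimates for the complex kernel apply to the real estimator.\<close>

lemma kernel_est_mse_le:
  assumes f: "f \<in> dens_class \<alpha> r L"
  shows "(\<integral>\<^sup>+Y. ennreal ((kernel_est fe n h Y x - f x)\<^sup>2) \<partial>sample_law f fe n)
    \<le> ennreal ((LINT y|law_Y f fe. (cmod (deconv_kernel fe (1 / h) (x - y)))\<^sup>2) / real n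
        + (cmod (cft (\<lambda>u. indicator {u. 1 / h < \<bar>u\<bar>} u * fourier f u) (- x)) / (2 * pi))\<^sup>2)"
proof -
  have fp: "prob_density f" using f by (auto simp: dens_class_def)
  have a: "0 < 1 / h" using h by simp
  note [measurable] = borel_measurable_deconv_kernel[OF fe M a]
  interpret Q: prob_space "law_Y f fe" by (rule prob_space_law_Y[OF fp fe])
  let ?K = "\<lambda>y. deconv_kernel fe (1 / h) (x - y)"
  have Kb: "cmod (?K y) \<le> (1 / h) * M / pi" for y by (rule norm_deconv_kernel_le[OF fe M a])
  have Rb: "\<bar>Re (?K y)\<bar> \<le> (1 / h) * M / pi" for y using abs_Re_le_cmod[of "?K y"] Kb[of y] by linarith
  have Ki: "integrable (law_Y f fe) ?K" by (rule Q.integrable_const_bound[OF AE_I2[OF Kb]]) measurable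
  have sqi: "integrable (law_Y f fe) q" if "q \<in> borel_measurable (law_Y f fe)" "\<And>y. \<bar>q y\<bar> \<le> ((1 / h) * M / pi)\<^sup>2" for q :: "real \<Rightarrow> real"
    by (rule Q.integrable_const_bound[OF AE_I2]) (use that in auto)
  have "(\<integral>\<^sup>+Y. ennreal ((kernel_est fe n h Y x - f x)\<^sup>2) \<partial>sample_law f fe n)
     \<le> ennreal ((LINT y|law_Y f fe. (Re (?K y))\<^sup>2) / real n + ((LINT y|law_Y f fe. Re (?K y)) - f x)\<^sup>2)"
    unfolding kernel_est_eq[OF h] sample_law_def
    by (rule mean_square_error_PiM[OF Q.prob_space_axioms _ Rb n]) measurable
  also have "\<dots> \<le> ennreal ((LINT y|law_Y f fe. (cmod (?K y))\<^sup>2) / real n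
        + (cmod (cft (\<lambda>u. indicator {u. 1 / h < \<bar>u\<bar>} u * fourier f u) (- x)) / (2 * pi))\<^sup>2)"
  proof (intro ennreal_leI add_mono divide_right_mono integral_mono)
    have "(LINT y|law_Y f fe. Re (?K y)) = Re (LINT y|law_Y f fe. ?K y)" using Ki by (rule integral_Re)
    then have "(LINT y|law_Y f fe. Re (?K y)) - f x = Re ((LINT y|law_Y f fe. ?K y) - f x)" by simp
    also have "(LINT y|law_Y f fe. ?K y) - f x = - cft (\<lambda>u. indicator {u. 1 / h < \<bar>u\<bar>} u * fourier f u) (- x) / (2 * pi)"
      using expectation_deconv_kernel[OF fe M a fp \<Phi>0, of x] dens_class_truncated_inversion[OF f \<alpha> r L a, of x] by simp
    finally have "\<bar>(LINT y|law_Y f fe. Re (?K y)) - f x\<bar> \<le> cmod (- cft (\<lambda>u. indicator {u. 1 / h < \<bar>u\<bar>} u * fourier f u) (- x) / (2 * pi))"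
      by (simp only: abs_Re_le_cmod)
    also have "\<dots> = cmod (cft (\<lambda>u. indicator {u. 1 / h < \<bar>u\<bar>} u * fourier f u) (- x)) / (2 * pi)"
      by (simp add: norm_divide norm_mult)
    finally show "((LINT y|law_Y f fe. Re (?K y)) - f x)\<^sup>2 \<le> (cmod (cft (\<lambda>u. indicator {u. 1 / h < \<bar>u\<bar>} u * fourier f u) (- x)) / (2 * pi))\<^sup>2"
      by (rule abs_le_square_iff[THEN iffD1, OF order_trans[OF _ abs_ge_self]])
    show "(Re (?K y))\<^sup>2 \<le> (cmod (?K y))\<^sup>2" for y
      using abs_Re_le_cmod[of "?K y"] by (simp add: abs_le_square_iff[symmetric])
    show "integrable (law_Y f fe) (\<lambda>y. (Re (?K y))\<^sup>2)"
      using power_mono[OF Rb abs_ge_zero, of _ 2] by (intro sqi) auto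
    show "integrable (law_Y f fe) (\<lambda>y. (cmod (?K y))\<^sup>2)"
      using power_mono[OF Kb norm_ge_zero, of _ 2] by (intro sqi) auto
  qed simp
  finally show ?thesis .
qed

lemma risk_pt_kernel_est_le:
  "risk_pt fe \<alpha> r L n x (\<lambda>Y z. kernel_est fe n h Y z)
    \<le> ennreal ((1 / h * M / pi)\<^sup>2 / real n + L / (2 * pi) * exp_tail (2 * \<alpha>) r (1 / h))"
  unfolding risk_pt_def
proof (rule SUP_least)
  fix f assume f: "f \<in> dens_class \<alpha> r L"
  have fp: "prob_density f" using f by (auto simp: dens_class_def)
  have a: "0 < 1 / h" using h by simp
  note [measurable] = borel_measurable_deconv_kernel[OF fe M a]
  interpret Q: prob_space "law_Y f fe" by (rule prob_space_law_Y[OF fp fe])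
  let ?K = "\<lambda>y. deconv_kernel fe (1 / h) (x - y)"
  let ?D = "\<lambda>u. indicator {u. 1 / h < \<bar>u\<bar>} u * fourier f u"
  have Kb: "cmod (?K y) \<le> (1 / h) * M / pi" for y by (rule norm_deconv_kernel_le[OF fe M a])
  have K2: "(cmod (?K y))\<^sup>2 \<le> (1 / h * M / pi)\<^sup>2" for y by (rule power_mono[OF Kb norm_ge_zero])
  have "(LINT y|law_Y f fe. (cmod (?K y))\<^sup>2) \<le> (LINT y|law_Y f fe. (1 / h * M / pi)\<^sup>2)"
    using K2 by (intro integral_mono Q.integrable_const_bound[where B="(1 / h * M / pi)\<^sup>2"]) auto
  then have 1: "(LINT y|law_Y f fe. (cmod (?K y))\<^sup>2) \<le> (1 / h * M / pi)\<^sup>2" by (simp add: Q.prob_space[unfolded space_law_Y])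
  have Di: "integrable lborel ?D" by (rule dens_class_fourier_tail(1)[OF f \<alpha> r L])
  have "(cmod (cft ?D (- x)))\<^sup>2 \<le> (LINT u|lborel. cmod (?D u))\<^sup>2"
    by (intro power_mono norm_cft_le Di) auto
  also have "\<dots> \<le> 2 * pi * L * exp_tail (2 * \<alpha>) r (1 / h)"
    by (rule dens_class_fourier_tail(2)[OF f \<alpha> r L])
  finally have 2: "(cmod (cft ?D (- x)) / (2 * pi))\<^sup>2 \<le> L / (2 * pi) * exp_tail (2 * \<alpha>) r (1 / h)"
    by (simp add: power_divide field_simps power2_eq_square)
  show "(\<integral>\<^sup>+Y. ennreal ((kernel_est fe n h Y x - f x)\<^sup>2) \<partial>sample_law f fe n)
    \<le> ennreal ((1 / h * M / pi)\<^sup>2 / real n + L / (2 * pi) * exp_tail (2 * \<alpha>) r (1 / h))"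
    by (rule order_trans[OF kernel_est_mse_le[OF f]]) (intro ennreal_leI add_mono divide_right_mono 1 2, simp)
qed

text \<open>The pointwise bound is integrated over \<open>z\<close>. In the variance the integral of
  |K(z - y)|^2 over \<open>z\<close> does not depend on the observation \<open>y\<close>, so the L2
  norm of the kernel replaces its sup norm; Plancherel bounds both this norm and the bias.\<close>

lemma risk_L2_kernel_est_le:
  "risk_L2 fe \<alpha> r L n (\<lambda>Y z. kernel_est fe n h Y z)
    \<le> ennreal ((1 / h * M\<^sup>2 / pi) / real n + L * exp (- 2 * \<alpha> * (1 / h) powr r))"
  unfolding risk_L2_def
proof (rule SUP_least)
  fix f assume f: "f \<in> dens_class \<alpha> r L"
  have fp: "prob_density f" and [measurable]: "f \<in> borel_measurable borel" using f prob_densityD(1) by (auto simp: dens_class_def)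
  have a: "0 < 1 / h" using h by simp
  note [measurable] = borel_measurable_deconv_kernel[OF fe M a]
  interpret Q: prob_space "law_Y f fe" by (rule prob_space_law_Y[OF fp fe])
  interpret P: product_prob_space "\<lambda>_. law_Y f fe" "{..<n}" ..
  let ?P = "sample_law f fe n"
  interpret PQ: pair_sigma_finite ?P lborel
    unfolding sample_law_def by standard
  let ?K = "\<lambda>z. deconv_kernel fe (1 / h) z"
  let ?D = "\<lambda>u. indicator {u. 1 / h < \<bar>u\<bar>} u * fourier f u"
  note Di = dens_class_fourier_tail(1)[OF f \<alpha> r L, of "1 / h"] and D2i = dens_class_fourier_tail(3)[OF f \<alpha> r L, of "1 / h"]
  note [measurable] = borel_measurable_cft[OF Di]
  have Kb: "cmod (?K y) \<le> (1 / h) * M / pi" for y by (rule norm_deconv_kernel_le[OF fe M a])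
  have Ki: "integrable (law_Y f fe) (\<lambda>y. (cmod (?K (z - y)))\<^sup>2)" for z
    using power_mono[OF Kb norm_ge_zero, of _ 2]
    by (intro Q.integrable_const_bound[where B="((1 / h) * M / pi)\<^sup>2"]) auto
  have "(\<integral>\<^sup>+Y. (\<integral>\<^sup>+z. ennreal ((kernel_est fe n h Y z - f z)\<^sup>2) \<partial>lborel) \<partial>?P)
      = (\<integral>\<^sup>+z. (\<integral>\<^sup>+Y. ennreal ((kernel_est fe n h Y z - f z)\<^sup>2) \<partial>?P) \<partial>lborel)"
    by (rule PQ.Fubini'[symmetric]) (simp add: kernel_est_eq[OF h] sample_law_def)
  also have "\<dots> \<le> (\<integral>\<^sup>+z. ennreal ((LINT y|law_Y f fe. (cmod (?K (z - y)))\<^sup>2) / real n + (cmod (cft ?D (- z)) / (2 * pi))\<^sup>2) \<partial>lborel)"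
    by (intro nn_integral_mono kernel_est_mse_le f)
  also have "\<dots> = (\<integral>\<^sup>+z. ennreal (1 / real n) * (\<integral>\<^sup>+y. ennreal ((cmod (?K (z - y)))\<^sup>2) \<partial>law_Y f fe) + ennreal (1 / (2 * pi)\<^sup>2) * ennreal ((cmod (cft ?D (- z)))\<^sup>2) \<partial>lborel)"
    using nn_integral_eq_integral[OF Ki]
    by (intro nn_integral_cong) (simp add: ennreal_plus[symmetric] ennreal_mult'[symmetric] power_divide del: ennreal_plus)
  also have "\<dots> = ennreal (1 / real n) * (\<integral>\<^sup>+z. (\<integral>\<^sup>+y. ennreal ((cmod (?K (z - y)))\<^sup>2) \<partial>law_Y f fe) \<partial>lborel) + ennreal (1 / (2 * pi)\<^sup>2) * (\<integral>\<^sup>+z. ennreal ((cmod (cft ?D (- z)))\<^sup>2) \<partial>lborel)"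
    by (subst nn_integral_add, measurable) (subst nn_integral_cmult, measurable, subst nn_integral_cmult, measurable)
  also have "(\<integral>\<^sup>+z. (\<integral>\<^sup>+y. ennreal ((cmod (?K (z - y)))\<^sup>2) \<partial>law_Y f fe) \<partial>lborel) \<le> ennreal (1 / h * M\<^sup>2 / pi)"
  proof -
    interpret LQ: pair_sigma_finite "law_Y f fe" lborel ..
    have "(\<integral>\<^sup>+z. (\<integral>\<^sup>+y. ennreal ((cmod (?K (z - y)))\<^sup>2) \<partial>law_Y f fe) \<partial>lborel) = (\<integral>\<^sup>+y. (\<integral>\<^sup>+z. ennreal ((cmod (?K (z - y)))\<^sup>2) \<partial>lborel) \<partial>law_Y f fe)"
      by (rule LQ.Fubini') measurable
    also have "\<dots> = (\<integral>\<^sup>+y. (\<integral>\<^sup>+z. ennreal ((cmod (?K z))\<^sup>2) \<partial>lborel) \<partial>law_Y f fe)"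
    proof (rule nn_integral_cong)
      fix y show "(\<integral>\<^sup>+z. ennreal ((cmod (?K (z - y)))\<^sup>2) \<partial>lborel) = (\<integral>\<^sup>+z. ennreal ((cmod (?K z))\<^sup>2) \<partial>lborel)"
        by (subst nn_integral_real_affine[where c=1 and t=y]) auto
    qed
    also have "\<dots> \<le> (\<integral>\<^sup>+y. ennreal (1 / h * M\<^sup>2 / pi) \<partial>law_Y f fe)"
      by (intro nn_integral_mono nn_integral_deconv_kernel_le[OF fe M a])
    finally show ?thesis by (simp add: Q.emeasure_space_1[unfolded space_law_Y])
  qed
  also have "(\<integral>\<^sup>+z. ennreal ((cmod (cft ?D (- z)))\<^sup>2) \<partial>lborel) \<le> ennreal (2 * pi * (2 * pi * L * exp (- 2 * \<alpha> * (1 / h) powr r)))"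
  proof -
    have "(\<integral>\<^sup>+z. ennreal ((cmod (cft ?D (- z)))\<^sup>2) \<partial>lborel) = (\<integral>\<^sup>+z. ennreal ((cmod (cft ?D z))\<^sup>2) \<partial>lborel)"
      by (subst (2) nn_integral_real_affine[where c="-1" and t=0]) auto
    also have "\<dots> \<le> ennreal (2 * pi * (LINT u|lborel. (cmod (?D u))\<^sup>2))"
      by (rule plancherel_le[OF Di D2i])
    also have "\<dots> \<le> ennreal (2 * pi * (2 * pi * L * exp (- 2 * \<alpha> * (1 / h) powr r)))"
      using a by (intro ennreal_leI mult_left_mono dens_class_fourier_tail(4)[OF f \<alpha> r L]) auto
    finally show ?thesis .
  qed
  finally have "(\<integral>\<^sup>+Y. (\<integral>\<^sup>+z. ennreal ((kernel_est fe n h Y z - f z)\<^sup>2) \<partial>lborel) \<partial>?P)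
     \<le> ennreal (1 / real n) * ennreal (1 / h * M\<^sup>2 / pi) + ennreal (1 / (2 * pi)\<^sup>2) * ennreal (2 * pi * (2 * pi * L * exp (- 2 * \<alpha> * (1 / h) powr r)))"
    by (simp add: add_mono mult_left_mono)
  also have "\<dots> = ennreal ((1 / h * M\<^sup>2 / pi) / real n + L * exp (- 2 * \<alpha> * (1 / h) powr r))"
    using h L by (simp add: ennreal_plus[symmetric] ennreal_mult[symmetric] power2_eq_square del: ennreal_plus)
  finally show "(\<integral>\<^sup>+Y. (\<integral>\<^sup>+z. ennreal ((kernel_est fe n h Y z - f z)\<^sup>2) \<partial>lborel) \<partial>?P) \<le> ennreal ((1 / h * M\<^sup>2 / pi) / real n + L * exp (- 2 * \<alpha> * (1 / h) powr r))" .
qed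

end

section \<open>Two-point lower bound\<close>

text \<open>Expresses both hypotheses as densities with respect to one product law, under which
  their likelihood ratios can be compared.\<close>

lemma PiM_density:
  assumes Q: "prob_space Q" and [measurable]: "l \<in> borel_measurable Q"
    and D: "prob_space (density Q (\<lambda>y. ennreal (l y)))"
  shows "PiM {..<n::nat} (\<lambda>_. density Q (\<lambda>y. ennreal (l y)))
    = density (PiM {..<n} (\<lambda>_. Q)) (\<lambda>Y. \<Prod>i<n. ennreal (l (Y i)))"
proof -
  interpret Q: prob_space Q by fact
  interpret D: prob_space "density Q (\<lambda>y. ennreal (l y))" by fact
  interpret PQ: product_sigma_finite "\<lambda>_::nat. Q" ..
  interpret PD: product_sigma_finite "\<lambda>_::nat. density Q (\<lambda>y. ennreal (l y))" ..
  show ?thesis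
  proof (rule PD.PiM_eqI[symmetric])
    show "sets (density (PiM {..<n} (\<lambda>_. Q)) (\<lambda>Y. \<Prod>i<n. ennreal (l (Y i)))) = sets (PiM {..<n} (\<lambda>_. density Q (\<lambda>y. ennreal (l y))))"
      by (auto intro!: sets_PiM_cong)
    fix A :: "nat \<Rightarrow> 'a set" assume A: "\<And>i. i \<in> {..<n} \<Longrightarrow> A i \<in> sets (density Q (\<lambda>y. ennreal (l y)))"
    then have A'[measurable]: "\<And>i. i \<in> {..<n} \<Longrightarrow> A i \<in> sets Q" by simp
    have S: "Pi\<^sub>E {..<n} A \<in> sets (PiM {..<n} (\<lambda>_. Q))" using A' by (intro sets_PiM_I_finite) auto
    have ind: "indicator (Pi\<^sub>E {..<n} A) Y = (\<Prod>i<n. indicator (A i) (Y i) :: ennreal)" if Y: "Y \<in> space (PiM {..<n} (\<lambda>_. Q))" for Y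
    proof (cases "Y \<in> Pi\<^sub>E {..<n} A")
      case False
      then obtain i where "i < n" "Y i \<notin> A i" using Y unfolding space_PiM PiE_iff by auto
      then have "(\<Prod>i<n. indicator (A i) (Y i) :: ennreal) = 0" by (intro prod_zero bexI[of _ i]) auto
      then show ?thesis using False by simp
    next
      case True
      then have "(\<Prod>i<n. indicator (A i) (Y i) :: ennreal) = (\<Prod>i<n. 1)" by (intro prod.cong) (auto simp: PiE_iff)
      then show ?thesis using True by simp
    qed
    have "emeasure (density (PiM {..<n} (\<lambda>_. Q)) (\<lambda>Y. \<Prod>i<n. ennreal (l (Y i)))) (Pi\<^sub>E {..<n} A)
       = (\<integral>\<^sup>+Y. (\<Prod>i<n. ennreal (l (Y i))) * indicator (Pi\<^sub>E {..<n} A) Y \<partial>PiM {..<n} (\<lambda>_. Q))"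
      using S by (subst emeasure_density) auto
    also have "\<dots> = (\<integral>\<^sup>+Y. (\<Prod>i<n. ennreal (l (Y i)) * indicator (A i) (Y i)) \<partial>PiM {..<n} (\<lambda>_. Q))"
      by (intro nn_integral_cong) (simp add: ind prod.distrib)
    also have "\<dots> = (\<Prod>i<n. (\<integral>\<^sup>+y. ennreal (l y) * indicator (A i) y \<partial>Q))"
      using A' by (intro PQ.product_nn_integral_prod) auto
    also have "\<dots> = (\<Prod>i<n. emeasure (density Q (\<lambda>y. ennreal (l y))) (A i))"
      using A' by (intro prod.cong refl emeasure_density[symmetric]) auto
    finally show "emeasure (density (PiM {..<n} (\<lambda>_. Q)) (\<lambda>Y. \<Prod>i<n. ennreal (l (Y i)))) (Pi\<^sub>E {..<n} A)
       = (\<Prod>i<n. emeasure (density Q (\<lambda>y. ennreal (l y))) (A i))" .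
  qed auto
qed

text \<open>Since \<open>g\<close> has mean 0 under \<open>Q\<close>, the moments of the likelihood
  ratio l factor over the coordinates: E l = 1 and E l^2 = (1 + E g^2)^n. Hence E (l - 1)^2 = (1 + E
  g^2)^n - 1, and nonnegativity of a variance turns this into a bound for E |l - 1|.\<close>

lemma expectation_likelihood_ratio_le:
  fixes g :: "'a \<Rightarrow> real"
  assumes Q: "prob_space Q" and [measurable]: "g \<in> borel_measurable Q"
    and g1: "\<And>y. \<bar>g y\<bar> \<le> 1" and g0: "(LINT y|Q. g y) = 0"
  shows "integrable (PiM {..<n::nat} (\<lambda>_. Q)) (\<lambda>Y. \<bar>(\<Prod>i<n. 1 + g (Y i)) - 1\<bar>)"
    and "(LINT Y|PiM {..<n} (\<lambda>_. Q). \<bar>(\<Prod>i<n. 1 + g (Y i)) - 1\<bar>) \<le> sqrt ((1 + (LINT y|Q. (g y)\<^sup>2)) ^ n - 1)"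
proof -
  interpret Q: prob_space Q by fact
  interpret PQ: product_sigma_finite "\<lambda>_::nat. Q" ..
  let ?P = "PiM {..<n} (\<lambda>_. Q)"
  interpret P: prob_space ?P by (rule prob_space_PiM) (rule Q)
  let ?l = "\<lambda>Y. \<Prod>i<n. 1 + g (Y i)"
  have gi: "integrable Q g" by (rule Q.integrable_const_bound[where B=1]) (use g1 in auto)
  have g2i: "integrable Q (\<lambda>y. (g y)\<^sup>2)"
    by (rule Q.integrable_const_bound[where B=1]) (use g1 in \<open>auto simp: abs_square_le_1\<close>)
  have li: "integrable ?P ?l" using gi by (intro PQ.product_integrable_prod[where f="\<lambda>_ y. 1 + g y"]) auto
  have l1: "(LINT Y|?P. ?l Y) = 1"
    using gi g0 by (subst PQ.product_integral_prod[where f="\<lambda>_ y. 1 + g y"]) (auto simp: Q.prob_space)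
  have sq: "(1 + g y)\<^sup>2 = 1 + 2 * g y + (g y)\<^sup>2" for y by (simp add: power2_eq_square algebra_simps)
  have l2i: "integrable ?P (\<lambda>Y. (?l Y)\<^sup>2)"
    unfolding prod_power_distrib sq
    using gi g2i by (intro PQ.product_integrable_prod[where f="\<lambda>_ y. 1 + 2 * g y + (g y)\<^sup>2"]) auto
  have l2: "(LINT Y|?P. (?l Y)\<^sup>2) = (1 + (LINT y|Q. (g y)\<^sup>2)) ^ n"
    unfolding prod_power_distrib sq
    using gi g2i g0 by (subst PQ.product_integral_prod[where f="\<lambda>_ y. 1 + 2 * g y + (g y)\<^sup>2"]) (auto simp: Q.prob_space)
  show ai: "integrable ?P (\<lambda>Y. \<bar>?l Y - 1\<bar>)" using li by simp
  have s: "\<bar>?l Y - 1\<bar>\<^sup>2 = (?l Y)\<^sup>2 - 2 * ?l Y + 1" for Y by (simp add: power2_eq_square algebra_simps)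
  have a2i: "integrable ?P (\<lambda>Y. \<bar>?l Y - 1\<bar>\<^sup>2)" unfolding s using li l2i by simp
  have "(LINT Y|?P. \<bar>?l Y - 1\<bar>\<^sup>2) = (1 + (LINT y|Q. (g y)\<^sup>2)) ^ n - 1"
    unfolding s using li l2i by (simp add: l1 l2 P.prob_space)
  moreover have "(LINT Y|?P. \<bar>?l Y - 1\<bar>)\<^sup>2 \<le> (LINT Y|?P. \<bar>?l Y - 1\<bar>\<^sup>2)"
    using P.variance_eq[OF ai a2i] P.variance_positive[of "\<lambda>Y. \<bar>?l Y - 1\<bar>"] by linarith
  ultimately show "(LINT Y|?P. \<bar>?l Y - 1\<bar>) \<le> sqrt ((1 + (LINT y|Q. (g y)\<^sup>2)) ^ n - 1)"
    by (intro real_le_rsqrt) simp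
qed

text \<open>Le Cam's argument under the middle law \<open>Q\<close>: the sum of the two risks is at
  least d times the expectation of the smaller likelihood ratio, which is at least 1 minus the
  distances of both ratios from 1. The losses are linked only by W1 + W2 \<ge> d, so one statement
  serves squared errors at a point and in L2.\<close>

lemma two_point_lower_bound:
  fixes g :: "'a \<Rightarrow> real" and W1 W2 :: "(nat \<Rightarrow> 'a) \<Rightarrow> ennreal"
  assumes Q: "prob_space Q" and [measurable]: "g \<in> borel_measurable Q"
    and g1: "\<And>y. \<bar>g y\<bar> \<le> 1" and g0: "(LINT y|Q. g y) = 0"
    and [measurable]: "W1 \<in> borel_measurable (PiM {..<n} (\<lambda>_. Q))" "W2 \<in> borel_measurable (PiM {..<n} (\<lambda>_. Q))"
    and W: "\<And>Y. Y \<in> space (PiM {..<n} (\<lambda>_. Q)) \<Longrightarrow> ennreal d \<le> W1 Y + W2 Y" and d: "0 \<le> d"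
  shows "ennreal (d * (1 - 2 * sqrt ((1 + (LINT y|Q. (g y)\<^sup>2)) ^ n - 1)))
    \<le> (\<integral>\<^sup>+Y. W1 Y \<partial>PiM {..<n} (\<lambda>_. density Q (\<lambda>y. ennreal (1 + g y))))
      + (\<integral>\<^sup>+Y. W2 Y \<partial>PiM {..<n} (\<lambda>_. density Q (\<lambda>y. ennreal (1 - g y))))"
proof -
  interpret Q: prob_space Q by fact
  let ?P = "PiM {..<n} (\<lambda>_. Q)"
  interpret P: prob_space ?P by (rule prob_space_PiM) (rule Q)
  have pd: "prob_space (density Q (\<lambda>y. ennreal (1 + k y)))"
    if [measurable]: "k \<in> borel_measurable Q" and k1: "\<And>y. \<bar>k y\<bar> \<le> 1" and k0: "(LINT y|Q. k y) = 0" for k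
  proof (rule prob_spaceI)
    have ki: "integrable Q k" by (rule Q.integrable_const_bound[where B=1]) (use k1 in auto)
    have "0 \<le> 1 + k y" for y using k1[of y] by linarith
    then have "(\<integral>\<^sup>+y. ennreal (1 + k y) \<partial>Q) = ennreal (LINT y|Q. 1 + k y)"
      using ki by (intro nn_integral_eq_integral) auto
    then show "emeasure (density Q (\<lambda>y. ennreal (1 + k y))) (space (density Q (\<lambda>y. ennreal (1 + k y)))) = 1"
      using ki k0 by (simp add: emeasure_density Q.prob_space nn_integral_cong[of Q "\<lambda>y. ennreal (1 + k y) * indicator (space Q) y" "\<lambda>y. ennreal (1 + k y)"])
  qed
  have g1': "\<bar>- g y\<bar> \<le> 1" for y using g1[of y] by simp
  have g0': "(LINT y|Q. - g y) = 0" using g0 by simp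
  let ?lp = "\<lambda>Y. \<Prod>i<n. 1 + g (Y i)" and ?lm = "\<lambda>Y. \<Prod>i<n. 1 + - g (Y i)"
  have pos: "0 \<le> 1 + g y" "0 \<le> 1 + - g y" for y using g1[of y] by linarith+
  define \<rho> where "\<rho> = sqrt ((1 + (LINT y|Q. (g y)\<^sup>2)) ^ n - 1)"
  have ep: "integrable ?P (\<lambda>Y. \<bar>?lp Y - 1\<bar>)" "(LINT Y|?P. \<bar>?lp Y - 1\<bar>) \<le> \<rho>"
    using expectation_likelihood_ratio_le[OF Q _ g1 g0, of n] by (auto simp: \<rho>_def)
  have em: "integrable ?P (\<lambda>Y. \<bar>?lm Y - 1\<bar>)" "(LINT Y|?P. \<bar>?lm Y - 1\<bar>) \<le> \<rho>"
    using expectation_likelihood_ratio_le[OF Q _ g1' g0', of n] by (simp_all add: \<rho>_def)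
  have Rp: "(\<integral>\<^sup>+Y. W1 Y \<partial>PiM {..<n} (\<lambda>_. density Q (\<lambda>y. ennreal (1 + g y)))) = (\<integral>\<^sup>+Y. ennreal (?lp Y) * W1 Y \<partial>?P)"
    using pos by (subst PiM_density[OF Q _ pd[OF _ g1 g0]]) (auto simp: nn_integral_density prod_ennreal)
  have Rm: "(\<integral>\<^sup>+Y. W2 Y \<partial>PiM {..<n} (\<lambda>_. density Q (\<lambda>y. ennreal (1 + - g y)))) = (\<integral>\<^sup>+Y. ennreal (?lm Y) * W2 Y \<partial>?P)"
    using pos by (subst PiM_density[OF Q _ pd[OF _ g1' g0']]) (auto simp: nn_integral_density prod_ennreal)
  let ?m = "\<lambda>Y. 1 - \<bar>?lp Y - 1\<bar> - \<bar>?lm Y - 1\<bar>"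
  have mi: "integrable ?P ?m" using ep em by simp
  have "1 - 2 * \<rho> \<le> (LINT Y|?P. ?m Y)" using ep em by (simp add: P.prob_space)
  then have "d * (1 - 2 * \<rho>) \<le> d * (LINT Y|?P. ?m Y)" using d by (rule mult_left_mono)
  also have "\<dots> = (LINT Y|?P. d * ?m Y)" by simp
  finally have "ennreal (d * (1 - 2 * \<rho>)) \<le> ennreal (LINT Y|?P. d * ?m Y)" by (rule ennreal_leI)
  \<comment> \<open>\<open>?m\<close> can be negative; \<open>ennreal\<close> truncates it at 0,
    which only increases the integral.\<close>
  also have "\<dots> \<le> (\<integral>\<^sup>+Y. ennreal (d * ?m Y) \<partial>?P)"
  proof -
    have "(LINT Y|?P. d * ?m Y) \<le> (LINT Y|?P. max 0 (d * ?m Y))" using mi by (intro integral_mono) auto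
    then have "ennreal (LINT Y|?P. d * ?m Y) \<le> ennreal (LINT Y|?P. max 0 (d * ?m Y))" by (rule ennreal_leI)
    also have "\<dots> = (\<integral>\<^sup>+Y. ennreal (max 0 (d * ?m Y)) \<partial>?P)" using mi by (intro nn_integral_eq_integral[symmetric]) auto
    also have "\<dots> = (\<integral>\<^sup>+Y. ennreal (d * ?m Y) \<partial>?P)" by (intro nn_integral_cong) (auto simp: max_def ennreal_neg)
    finally show ?thesis .
  qed
  also have "\<dots> \<le> (\<integral>\<^sup>+Y. ennreal (?lp Y) * W1 Y + ennreal (?lm Y) * W2 Y \<partial>?P)"
  proof (rule nn_integral_mono)
    fix Y assume Y: "Y \<in> space ?P"
    define k where "k = min (?lp Y) (?lm Y)"
    have k0: "0 \<le> k" using pos by (auto simp: k_def intro!: prod_nonneg)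
    have "?m Y \<le> k" unfolding k_def by (auto simp: min_def)
    then have "ennreal (d * ?m Y) \<le> ennreal k * ennreal d"
      using d by (subst ennreal_mult'[symmetric]) (auto intro!: ennreal_leI mult_left_mono simp: k0 mult.commute[of k])
    also have "\<dots> \<le> ennreal k * (W1 Y + W2 Y)" by (rule mult_left_mono[OF W[OF Y]]) simp
    also have "\<dots> = ennreal k * W1 Y + ennreal k * W2 Y" by (simp add: distrib_left)
    also have "\<dots> \<le> ennreal (?lp Y) * W1 Y + ennreal (?lm Y) * W2 Y"
      by (intro add_mono mult_right_mono ennreal_leI) (auto simp: k_def)
    finally show "ennreal (d * ?m Y) \<le> ennreal (?lp Y) * W1 Y + ennreal (?lm Y) * W2 Y" .
  qed
  also have "\<dots> = (\<integral>\<^sup>+Y. ennreal (?lp Y) * W1 Y \<partial>?P) + (\<integral>\<^sup>+Y. ennreal (?lm Y) * W2 Y \<partial>?P)"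
    by (rule nn_integral_add) measurable
  finally show ?thesis unfolding Rp[symmetric] Rm[symmetric] \<rho>_def by simp
qed


section \<open>Convolution with the noise density and the chi-square bound\<close>

definition conv :: "(real \<Rightarrow> real) \<Rightarrow> (real \<Rightarrow> real) \<Rightarrow> real \<Rightarrow> real" where
  "conv f fe y = (LINT e|lborel. f (y - e) * fe e)"

lemma integrable_conv:
  assumes fe: "prob_density fe" and [measurable]: "f \<in> borel_measurable borel" and B: "\<And>y. \<bar>f y\<bar> \<le> B"
  shows "integrable lborel (\<lambda>e. f (y - e) * fe e)"
proof (rule Bochner_Integration.integrable_bound)
  show "integrable lborel (\<lambda>e. B * fe e)" using prob_densityD[OF fe] by simp
  note [measurable] = prob_densityD(1)[OF fe]
  show "(\<lambda>e. f (y - e) * fe e) \<in> borel_measurable lborel" by measurable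
  have "0 \<le> B" using B[of 0] by linarith
  then show "AE e in lborel. norm (f (y - e) * fe e) \<le> norm (B * fe e)"
    using B prob_densityD(2)[OF fe] by (intro AE_I2) (simp add: abs_mult mult_right_mono)
qed

lemma borel_measurable_conv:
  assumes fe: "prob_density fe" and [measurable]: "f \<in> borel_measurable borel"
  shows "conv f fe \<in> borel_measurable borel"
  using prob_densityD(1)[OF fe] unfolding conv_def by measurable

lemma law_Y_eq_density_conv:
  assumes f: "prob_density f" and fe: "prob_density fe" and B: "\<And>y. f y \<le> B"
  shows "law_Y f fe = density lborel (\<lambda>y. ennreal (conv f fe y))"
proof -
  note [measurable] = prob_densityD(1)[OF fe] prob_densityD(1)[OF f]
  have fin: "finite_measure (density lborel f)" "finite_measure (density lborel fe)"
    using prob_space_prob_density[OF f] prob_space_prob_density[OF fe] by (auto simp: prob_space_def)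
  have "\<bar>f y\<bar> \<le> B" for y using B[of y] prob_densityD(2)[OF f, of y] by simp
  then have "(\<integral>\<^sup>+e. ennreal (f (y - e)) * ennreal (fe e) \<partial>lborel) = ennreal (conv f fe y)" for y
    unfolding conv_def using prob_densityD(2)[OF f] prob_densityD(2)[OF fe]
    by (subst nn_integral_eq_integral[symmetric]) (auto simp: ennreal_mult intro!: integrable_conv[OF fe, of f B])
  then show ?thesis unfolding law_Y_convolution by (subst convolution_density) (auto simp: fin)
qed

lemma prob_density_tight:
  assumes fe: "prob_density fe"
  obtains m where "0 < m" "1 / 2 \<le> (LINT e|lborel. indicator {-m..m} e * fe e)"
proof -
  note [measurable] = prob_densityD(1)[OF fe]
  have "(\<lambda>n. LINT e|lborel. indicator {-real n..real n} e * fe e) \<longlonglongrightarrow> (LINT e|lborel. fe e)"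
  proof (rule integral_dominated_convergence[where w=fe])
    show "AE e in lborel. (\<lambda>n. indicator {-real n..real n} e * fe e) \<longlonglongrightarrow> fe e"
    proof (rule AE_I2)
      fix e
      obtain N where N: "\<bar>e\<bar> \<le> real N" using real_arch_simple by blast
      have "\<forall>\<^sub>F n in sequentially. indicator {-real n..real n} e * fe e = fe e"
        using eventually_ge_at_top[of N] by eventually_elim (use N in \<open>auto simp: indicator_def abs_le_iff\<close>)
      then show "(\<lambda>n. indicator {-real n..real n} e * fe e) \<longlonglongrightarrow> fe e" by (rule tendsto_eventually)
    qed
    show "AE e in lborel. norm (indicator {-real n..real n} e * fe e) \<le> fe e" for n
      using prob_densityD(2)[OF fe] by (intro AE_I2) (simp split: split_indicator)
  qed (use prob_densityD(3)[OF fe] in auto)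
  then have "\<forall>\<^sub>F n in sequentially. 1 / 2 < (LINT e|lborel. indicator {-real n..real n} e * fe e)"
    using prob_densityD(4)[OF fe] by (intro order_tendstoD) auto
  then obtain N where N: "\<And>n. N \<le> n \<Longrightarrow> 1 / 2 < (LINT e|lborel. indicator {-real n..real n} e * fe e)"
    unfolding eventually_sequentially by auto
  show ?thesis by (rule that[of "real (Suc N)"]) (use N[of "Suc N"] in auto)
qed

text \<open>A tail of order 1/y^2 survives convolution with any noise: at least half of the noise
  mass lies in \<open>{-m..m}\<close>, and a shift by at most \<open>m\<close> costs the factor 2(1
  + m^2).\<close>

lemma conv_lower_bound:
  assumes fe: "prob_density fe" and m: "0 < m" "1 / 2 \<le> (LINT e|lborel. indicator {-m..m} e * fe e)"
    and [measurable]: "f \<in> borel_measurable borel" and B: "\<And>y. f y \<le> B" and c: "0 < c"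
    and f: "\<And>y. c / (1 + (y - x)\<^sup>2) \<le> f y"
  shows "c / (4 * (1 + m\<^sup>2)) / (1 + (y - x)\<^sup>2) \<le> conv f fe y"
proof -
  note [measurable] = prob_densityD(1)[OF fe]
  define c' where "c' = c / (2 * (1 + m\<^sup>2)) / (1 + (y - x)\<^sup>2)"
  have sq1: "0 < 1 + t\<^sup>2" for t :: real by (simp add: add_pos_nonneg)
  have c'0: "0 \<le> c'" using c sq1 by (simp add: c'_def less_imp_le)
  have f0: "0 \<le> f z" for z using order_trans[OF _ f[of z], of 0] c sq1[of "z - x"] by (simp add: less_imp_le)
  have fB: "\<bar>f z\<bar> \<le> B" for z using f0[of z] B[of z] by simp
  have "c / (4 * (1 + m\<^sup>2)) / (1 + (y - x)\<^sup>2) = c' * (1 / 2)" by (simp add: c'_def)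
  also have "\<dots> \<le> c' * (LINT e|lborel. indicator {-m..m} e * fe e)" using c'0 m(2) by (rule mult_left_mono[rotated])
  also have "\<dots> = (LINT e|lborel. c' * (indicator {-m..m} e * fe e))" by simp
  also have "\<dots> \<le> (LINT e|lborel. f (y - e) * fe e)"
  proof (rule integral_mono)
    have "integrable lborel (\<lambda>e. fe e * indicator {-m..m} e)"
      using prob_densityD(3)[OF fe] by (intro integrable_real_mult_indicator) auto
    then show "integrable lborel (\<lambda>e. c' * (indicator {-m..m} e * fe e))" by (simp add: mult.commute)
    show "integrable lborel (\<lambda>e. f (y - e) * fe e)" by (rule integrable_conv[OF fe _ fB]) measurable
    fix e
    show "c' * (indicator {-m..m} e * fe e) \<le> f (y - e) * fe e"
    proof (cases "e \<in> {-m..m}")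
      case True
      then have em: "e\<^sup>2 \<le> m\<^sup>2" using m(1) by (intro power2_le_iff_abs_le[THEN iffD2]) auto
      have "1 + (y - e - x)\<^sup>2 \<le> 2 * (1 + m\<^sup>2) * (1 + (y - x)\<^sup>2)"
      proof -
        have "0 \<le> ((y - x) + e)\<^sup>2" by simp
        then have "(y - e - x)\<^sup>2 \<le> 2 * (y - x)\<^sup>2 + 2 * e\<^sup>2" by (simp add: power2_eq_square algebra_simps)
        moreover have "0 \<le> m\<^sup>2 * (y - x)\<^sup>2" by simp
        moreover have "2 * (1 + m\<^sup>2) * (1 + (y - x)\<^sup>2) = 2 + 2 * m\<^sup>2 + 2 * (y - x)\<^sup>2 + 2 * (m\<^sup>2 * (y - x)\<^sup>2)"
          by (simp add: algebra_simps)
        ultimately show ?thesis using em by linarith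
      qed
      then have "c / (2 * (1 + m\<^sup>2) * (1 + (y - x)\<^sup>2)) \<le> c / (1 + (y - e - x)\<^sup>2)"
        using c sq1 by (intro divide_left_mono mult_pos_pos) (auto simp: add_pos_nonneg)
      also have "\<dots> \<le> f (y - e)" by (rule f)
      finally have "c' \<le> f (y - e)" by (simp add: c'_def)
      then show ?thesis using True prob_densityD(2)[OF fe, of e] by (simp add: mult_right_mono)
    next
      case False
      then show ?thesis using f0[of "y - e"] prob_densityD(2)[OF fe, of e] by simp
    qed
  qed
  finally show ?thesis by (simp add: conv_def)
qed


text \<open>Bounds the chi-square integral of (conv G fe)^2 / conv f0 fe: the numerator is at most
  E^2/(1 + y^2)^2 and the denominator at least the bound of \<open>conv_lower_bound\<close>. With
  lighter tails of \<open>f0\<close>, such as y^(-4), the quotient of these bounds would not be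
  integrable.\<close>

definition chi_bound :: "real \<Rightarrow> real \<Rightarrow> real \<Rightarrow> real" where
  "chi_bound c m E = E\<^sup>2 * (4 * (1 + m\<^sup>2) / c) * (LINT y|lborel. 1 / (1 + y\<^sup>2))"

context
  fixes f0 G fe :: "real \<Rightarrow> real" and B c m x E :: real and n :: nat
  assumes fe: "prob_density fe" and f0: "prob_density f0"
    and fp: "prob_density (\<lambda>y. f0 y + G y)" and fm: "prob_density (\<lambda>y. f0 y - G y)"
    and B: "\<And>y. f0 y \<le> B" and c: "0 < c" and f0c: "\<And>y. c / (1 + (y - x)\<^sup>2) \<le> f0 y"
    and m: "0 < m" "1 / 2 \<le> (LINT e|lborel. indicator {-m..m} e * fe e)"
    and E: "\<And>y. \<bar>conv G fe y\<bar> \<le> E / (1 + (y - x)\<^sup>2)"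
begin

text \<open>Reduction to \<open>two_point_lower_bound\<close>, with the law under \<open>f0\<close>
  in the middle and the ratio of \<open>conv G fe\<close> to \<open>conv f0 fe\<close> as relative
  perturbation.\<close>

lemma two_densities_lower_bound:
  assumes [measurable]: "W1 \<in> borel_measurable (PiM {..<n} (\<lambda>_. borel))" "W2 \<in> borel_measurable (PiM {..<n} (\<lambda>_. borel))"
    and W: "\<And>Y. Y \<in> space (PiM {..<n} (\<lambda>_. borel :: real measure)) \<Longrightarrow> ennreal d \<le> W1 Y + W2 Y" and d: "0 \<le> d"
  shows "ennreal (d * (1 - 2 * sqrt ((1 + chi_bound c m E) ^ n - 1)))
    \<le> (\<integral>\<^sup>+Y. W1 Y \<partial>sample_law (\<lambda>y. f0 y + G y) fe n) + (\<integral>\<^sup>+Y. W2 Y \<partial>sample_law (\<lambda>y. f0 y - G y) fe n)"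
proof -
  note [measurable] = prob_densityD(1)[OF fe] prob_densityD(1)[OF f0]
  have Gm[measurable]: "G \<in> borel_measurable borel"
    using borel_measurable_diff[OF prob_densityD(1)[OF fp] prob_densityD(1)[OF f0]] by simp
  have Gb: "\<bar>G y\<bar> \<le> f0 y" for y using prob_densityD(2)[OF fp, of y] prob_densityD(2)[OF fm, of y] by linarith
  have GB: "\<bar>G y\<bar> \<le> B" for y using Gb[of y] B[of y] by linarith
  have f0B: "\<bar>f0 y\<bar> \<le> B" for y using prob_densityD(2)[OF f0, of y] B[of y] by simp
  define q where "q = conv f0 fe"
  define k where "k = conv G fe"
  have [measurable]: "q \<in> borel_measurable borel" "k \<in> borel_measurable borel"
    unfolding q_def k_def by (auto intro: borel_measurable_conv[OF fe])
  have i0: "integrable lborel (\<lambda>e. f0 (y - e) * fe e)" and iG: "integrable lborel (\<lambda>e. G (y - e) * fe e)" for y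
    by (rule integrable_conv[OF fe _ f0B], measurable) (rule integrable_conv[OF fe _ GB], measurable)
  have cp: "conv (\<lambda>y. f0 y + G y) fe y = q y + k y" and cm: "conv (\<lambda>y. f0 y - G y) fe y = q y - k y" for y
    unfolding conv_def q_def k_def distrib_right left_diff_distrib using i0[of y] iG[of y] by simp_all
  have cn: "0 \<le> conv f fe y" if "\<And>y. 0 \<le> f y" for f y
    unfolding conv_def using that prob_densityD(2)[OF fe] by (intro integral_nonneg_AE AE_I2 mult_nonneg_nonneg) auto
  \<comment> \<open>Both hypotheses are densities, so their convolutions with the noise are
    nonnegative; this yields |g| \<le> 1 for the ratio \<open>g\<close> below.\<close>
  have kq: "\<bar>k y\<bar> \<le> q y" for y
    using cn[of "\<lambda>y. f0 y + G y" y, OF prob_densityD(2)[OF fp]] cn[of "\<lambda>y. f0 y - G y" y, OF prob_densityD(2)[OF fm]]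
    unfolding cp cm by linarith
  define c1 where "c1 = c / (4 * (1 + m\<^sup>2))"
  have c1: "0 < c1" using c by (simp add: c1_def add_pos_nonneg)
  have sq1: "0 < 1 + t\<^sup>2" for t :: real by (simp add: add_pos_nonneg)
  have qc: "c1 / (1 + (y - x)\<^sup>2) \<le> q y" for y
    unfolding q_def c1_def by (rule conv_lower_bound[OF fe m _ B c f0c]) measurable
  have q0: "0 < q y" for y using qc[of y] c1 sq1[of "y - x"] by (meson divide_pos_pos less_le_trans)
  define g where "g y = k y / q y" for y
  have [measurable]: "g \<in> borel_measurable borel" unfolding g_def[abs_def] by measurable
  have g1: "\<bar>g y\<bar> \<le> 1" for y using kq[of y] q0[of y] by (simp add: g_def)
  have Q: "law_Y f0 fe = density lborel (\<lambda>y. ennreal (q y))"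
    unfolding q_def by (rule law_Y_eq_density_conv[OF f0 fe B])
  have Qp: "law_Y (\<lambda>y. f0 y + G y) fe = density (law_Y f0 fe) (\<lambda>y. ennreal (1 + g y))"
  proof -
    have "law_Y (\<lambda>y. f0 y + G y) fe = density lborel (\<lambda>y. ennreal (q y + k y))"
      unfolding cp[symmetric] by (rule law_Y_eq_density_conv[OF fp fe, of "2 * B"]) (use f0B GB in \<open>smt (verit)\<close>)
    also have "\<dots> = density lborel (\<lambda>y. ennreal (q y) * ennreal (1 + g y))"
    proof (rule density_cong)
      show "AE y in lborel. ennreal (q y + k y) = ennreal (q y) * ennreal (1 + g y)"
      proof (rule AE_I2)
        fix y
        have "q y + k y = q y * (1 + g y)" using q0[of y] by (simp add: g_def field_simps)
        then show "ennreal (q y + k y) = ennreal (q y) * ennreal (1 + g y)" using q0[of y] by (simp add: ennreal_mult')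
      qed
    qed measurable
    also have "\<dots> = density (density lborel (\<lambda>y. ennreal (q y))) (\<lambda>y. ennreal (1 + g y))"
      by (rule density_density_eq[symmetric]) measurable
    finally show ?thesis unfolding Q .
  qed
  have Qm: "law_Y (\<lambda>y. f0 y - G y) fe = density (law_Y f0 fe) (\<lambda>y. ennreal (1 - g y))"
  proof -
    have "law_Y (\<lambda>y. f0 y - G y) fe = density lborel (\<lambda>y. ennreal (q y - k y))"
      unfolding cm[symmetric] by (rule law_Y_eq_density_conv[OF fm fe, of "2 * B"]) (use f0B GB in \<open>smt (verit)\<close>)
    also have "\<dots> = density lborel (\<lambda>y. ennreal (q y) * ennreal (1 - g y))"
    proof (rule density_cong)
      show "AE y in lborel. ennreal (q y - k y) = ennreal (q y) * ennreal (1 - g y)"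
      proof (rule AE_I2)
        fix y
        have "q y - k y = q y * (1 - g y)" using q0[of y] by (simp add: g_def field_simps)
        then show "ennreal (q y - k y) = ennreal (q y) * ennreal (1 - g y)" using q0[of y] by (simp add: ennreal_mult')
      qed
    qed measurable
    also have "\<dots> = density (density lborel (\<lambda>y. ennreal (q y))) (\<lambda>y. ennreal (1 - g y))"
      by (rule density_density_eq[symmetric]) measurable
    finally show ?thesis unfolding Q .
  qed
  have one: "integrable lborel p \<and> (LINT y|lborel. p y) = 1"
    if "prob_space (density lborel (\<lambda>y. ennreal (p y)))" "\<And>y. 0 \<le> p y" and [measurable]: "p \<in> borel_measurable borel" for p :: "real \<Rightarrow> real"
  proof -
    interpret prob_space "density lborel (\<lambda>y. ennreal (p y))" by fact
    have "(\<integral>\<^sup>+y. ennreal (p y) \<partial>lborel) = ennreal 1"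
      using emeasure_space_1 by (simp add: emeasure_density)
    then show ?thesis using that(2) nn_integral_eq_integrable[of p lborel 1] by simp
  qed
  have qi: "integrable lborel q" "(LINT y|lborel. q y) = 1"
    using one[of q] prob_space_law_Y[OF f0 fe] less_imp_le[OF q0] unfolding Q by auto
  \<comment> \<open>\<open>q\<close> and \<open>q + k\<close> are both densities of probability
    laws, so \<open>k\<close> integrates to 0; this gives \<open>g\<close> mean 0.\<close>
  have qki: "integrable lborel (\<lambda>y. q y + k y)" "(LINT y|lborel. q y + k y) = 1"
  proof -
    have "law_Y (\<lambda>y. f0 y + G y) fe = density lborel (\<lambda>y. ennreal (q y + k y))"
      unfolding cp[symmetric] by (rule law_Y_eq_density_conv[OF fp fe, of "2 * B"]) (use f0B GB in \<open>smt (verit)\<close>)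
    moreover have "0 \<le> q y + k y" for y using kq[of y] by linarith
    ultimately show "integrable lborel (\<lambda>y. q y + k y)" "(LINT y|lborel. q y + k y) = 1"
      using one[of "\<lambda>y. q y + k y"] prob_space_law_Y[OF fp fe] by auto
  qed
  have ki: "integrable lborel k" using Bochner_Integration.integrable_diff[OF qki(1) qi(1)] by simp
  have k0: "(LINT y|lborel. k y) = 0" using qki(2) Bochner_Integration.integral_add[OF qi(1) ki] qi(2) by simp
  have gk: "q y * g y = k y" for y using q0[of y] by (simp add: g_def)
  have g0: "(LINT y|law_Y f0 fe. g y) = 0"
    unfolding Q using less_imp_le[OF q0] by (subst integral_density) (auto simp: gk k0)
  have g2: "(LINT y|law_Y f0 fe. (g y)\<^sup>2) \<le> chi_bound c m E"
  proof -
    have E0: "0 \<le> E" using order_trans[OF abs_ge_zero E[of x]] by simp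
    have "(LINT y|law_Y f0 fe. (g y)\<^sup>2) = (LINT y|lborel. q y * (g y)\<^sup>2)"
      unfolding Q using less_imp_le[OF q0] by (subst integral_density) auto
    also have "\<dots> \<le> (LINT y|lborel. E\<^sup>2 / c1 * (1 / (1 + (y - x)\<^sup>2)))"
    proof (rule integral_mono)
      have ii: "integrable lborel (\<lambda>y::real. E\<^sup>2 / c1 * (1 / (1 + (y - x)\<^sup>2)))"
        using lborel_integrable_real_affine[OF integrable_inverse_one_plus_square, of 1 "-x"]
        by (intro integrable_mult_right) (simp add: add.commute)
      have b: "q y * (g y)\<^sup>2 \<le> E\<^sup>2 / c1 * (1 / (1 + (y - x)\<^sup>2))" for y
      proof -
        have "q y * (g y)\<^sup>2 = (k y)\<^sup>2 / q y" using q0[of y] by (simp add: g_def power2_eq_square)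
        also have "\<dots> \<le> (E / (1 + (y - x)\<^sup>2))\<^sup>2 / (c1 / (1 + (y - x)\<^sup>2))"
          using E[of y] qc[of y] c1 sq1[of "y - x"] unfolding k_def[symmetric]
          by (intro frac_le) (auto simp: abs_le_square_iff[symmetric] abs_of_nonneg[OF E0])
        also have "\<dots> = E\<^sup>2 / c1 * (1 / (1 + (y - x)\<^sup>2))"
        proof -
          have "(E / t)\<^sup>2 / (c1 / t) = E\<^sup>2 / c1 * (1 / t)" if "0 < t" for t
            using that c1 by (simp add: power2_eq_square field_simps)
          then show ?thesis using sq1[of "y - x"] by blast
        qed
        finally show ?thesis .
      qed
      show "integrable lborel (\<lambda>y. E\<^sup>2 / c1 * (1 / (1 + (y - x)\<^sup>2)))" by (rule ii)
      show "integrable lborel (\<lambda>y. q y * (g y)\<^sup>2)"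
      proof (rule Bochner_Integration.integrable_bound[OF ii])
        show "AE y in lborel. norm (q y * (g y)\<^sup>2) \<le> norm (E\<^sup>2 / c1 * (1 / (1 + (y - x)\<^sup>2)))"
        proof (rule AE_I2)
          fix y
          have "0 \<le> q y * (g y)\<^sup>2" using q0[of y] by simp
          with b[of y] show "norm (q y * (g y)\<^sup>2) \<le> norm (E\<^sup>2 / c1 * (1 / (1 + (y - x)\<^sup>2)))" unfolding real_norm_def by linarith
        qed
      qed measurable
      show "q y * (g y)\<^sup>2 \<le> E\<^sup>2 / c1 * (1 / (1 + (y - x)\<^sup>2))" for y by (rule b)
    qed
    also have "\<dots> = E\<^sup>2 / c1 * (LINT y|lborel. 1 / (1 + (y - x)\<^sup>2))" by (rule integral_mult_right_zero)
    also have "(LINT y|lborel. 1 / (1 + (y - x)\<^sup>2)) = (LINT y|lborel. 1 / (1 + y\<^sup>2))"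
      by (subst lborel_integral_real_affine[where c=1 and t=x]) auto
    finally show ?thesis by (simp add: chi_bound_def c1_def mult_ac)
  qed
  have sq: "sqrt ((1 + (LINT y|law_Y f0 fe. (g y)\<^sup>2)) ^ n - 1) \<le> sqrt ((1 + chi_bound c m E) ^ n - 1)"
    using g2 by (intro real_sqrt_le_mono diff_right_mono power_mono) auto
  have "ennreal (d * (1 - 2 * sqrt ((1 + chi_bound c m E) ^ n - 1)))
      \<le> ennreal (d * (1 - 2 * sqrt ((1 + (LINT y|law_Y f0 fe. (g y)\<^sup>2)) ^ n - 1)))"
    using sq d by (intro ennreal_leI mult_left_mono) auto
  also have "\<dots> \<le> (\<integral>\<^sup>+Y. W1 Y \<partial>sample_law (\<lambda>y. f0 y + G y) fe n) + (\<integral>\<^sup>+Y. W2 Y \<partial>sample_law (\<lambda>y. f0 y - G y) fe n)"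
  proof -
    have "sets (PiM {..<n} (\<lambda>_. law_Y f0 fe)) = sets (PiM {..<n} (\<lambda>_. borel))" by (intro sets_PiM_cong) auto
    then have "borel_measurable (PiM {..<n} (\<lambda>_. law_Y f0 fe)) = (borel_measurable (PiM {..<n} (\<lambda>_. borel)) :: ((nat \<Rightarrow> real) \<Rightarrow> ennreal) set)"
      by (intro measurable_cong_sets) auto
    then show ?thesis
      unfolding sample_law_def Qp Qm
      by (intro two_point_lower_bound prob_space_law_Y[OF f0 fe] g1 g0 W d) (auto simp: space_PiM)
  qed
  finally show ?thesis .
qed

text \<open>Parallelogram identity: the squared errors under the two hypotheses add up to 2(T -
  f0)^2 + 2 G^2. The maximal risk is at least half of the sum, so G^2 appears with constant 1, and
  this makes a two-point argument sharp.\<close>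

lemma risk_pt_lower_bound:
  assumes cl: "(\<lambda>y. f0 y + G y) \<in> dens_class \<alpha> r L" "(\<lambda>y. f0 y - G y) \<in> dens_class \<alpha> r L" and T: "T \<in> estimators n"
  shows "ennreal ((G z)\<^sup>2 * (1 - 2 * sqrt ((1 + chi_bound c m E) ^ n - 1))) \<le> risk_pt fe \<alpha> r L n z T"
proof -
  have "(\<lambda>(Y, x). T Y x) \<in> borel_measurable (PiM {..<n} (\<lambda>_. borel) \<Otimes>\<^sub>M borel)" using T by (simp add: estimators_def)
  from measurable_compose[OF measurable_Pair2'[of z] this]
  have [measurable]: "(\<lambda>Y. T Y z) \<in> borel_measurable (PiM {..<n} (\<lambda>_. borel))" by simp
  let ?I = "\<lambda>f. \<integral>\<^sup>+Y. ennreal ((T Y z - f z)\<^sup>2) \<partial>sample_law f fe n"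
  have "ennreal ((2 * (G z)\<^sup>2) * (1 - 2 * sqrt ((1 + chi_bound c m E) ^ n - 1)))
     \<le> ?I (\<lambda>y. f0 y + G y) + ?I (\<lambda>y. f0 y - G y)"
  proof (rule two_densities_lower_bound)
    fix Y
    have "2 * (G z)\<^sup>2 \<le> (T Y z - (f0 z + G z))\<^sup>2 + (T Y z - (f0 z - G z))\<^sup>2"
    proof -
      have "(T Y z - (f0 z + G z))\<^sup>2 + (T Y z - (f0 z - G z))\<^sup>2 = 2 * (T Y z - f0 z)\<^sup>2 + 2 * (G z)\<^sup>2"
        by (simp add: power2_eq_square algebra_simps)
      then show ?thesis by simp
    qed
    then show "ennreal (2 * (G z)\<^sup>2) \<le> ennreal ((T Y z - (f0 z + G z))\<^sup>2) + ennreal ((T Y z - (f0 z - G z))\<^sup>2)"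
      by (subst ennreal_plus[symmetric]) (auto simp del: ennreal_plus intro!: ennreal_leI)
  qed auto
  also have "\<dots> \<le> risk_pt fe \<alpha> r L n z T + risk_pt fe \<alpha> r L n z T"
    unfolding risk_pt_def using cl by (intro add_mono SUP_upper2[OF cl(1)] SUP_upper2[OF cl(2)]) auto
  finally show ?thesis
    by (cases "risk_pt fe \<alpha> r L n z T") (auto simp: ennreal_plus[symmetric] ennreal_le_iff2 simp del: ennreal_plus)
qed

lemma risk_L2_lower_bound:
  assumes cl: "(\<lambda>y. f0 y + G y) \<in> dens_class \<alpha> r L" "(\<lambda>y. f0 y - G y) \<in> dens_class \<alpha> r L" and T: "T \<in> estimators n"
    and G2: "integrable lborel (\<lambda>z. (G z)\<^sup>2)"
  shows "ennreal ((LINT z|lborel. (G z)\<^sup>2) * (1 - 2 * sqrt ((1 + chi_bound c m E) ^ n - 1))) \<le> risk_L2 fe \<alpha> r L n T"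
proof -
  note [measurable] = prob_densityD(1)[OF fp] prob_densityD(1)[OF fm] prob_densityD(1)[OF f0]
  have Gm[measurable]: "G \<in> borel_measurable borel"
    using borel_measurable_diff[OF prob_densityD(1)[OF fp] prob_densityD(1)[OF f0]] by simp
  have [measurable]: "(\<lambda>(Y, x). T Y x) \<in> borel_measurable (PiM {..<n} (\<lambda>_. borel) \<Otimes>\<^sub>M borel)" using T by (simp add: estimators_def)
  define J where "J = (LINT z|lborel. (G z)\<^sup>2)"
  have J0: "0 \<le> J" by (simp add: J_def)
  let ?I = "\<lambda>f. \<integral>\<^sup>+Y. (\<integral>\<^sup>+z. ennreal ((T Y z - f z)\<^sup>2) \<partial>lborel) \<partial>sample_law f fe n"
  have "ennreal ((2 * J) * (1 - 2 * sqrt ((1 + chi_bound c m E) ^ n - 1)))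
     \<le> ?I (\<lambda>y. f0 y + G y) + ?I (\<lambda>y. f0 y - G y)"
  proof (rule two_densities_lower_bound)
    show "(\<lambda>Y. \<integral>\<^sup>+z. ennreal ((T Y z - (f0 z + G z))\<^sup>2) \<partial>lborel) \<in> borel_measurable (PiM {..<n} (\<lambda>_. borel))" by measurable
    show "(\<lambda>Y. \<integral>\<^sup>+z. ennreal ((T Y z - (f0 z - G z))\<^sup>2) \<partial>lborel) \<in> borel_measurable (PiM {..<n} (\<lambda>_. borel))" by measurable
    fix Y :: "nat \<Rightarrow> real" assume "Y \<in> space (PiM {..<n} (\<lambda>_. borel))"
    then have TY[measurable]: "T Y \<in> borel_measurable borel"
      using measurable_compose[OF measurable_Pair1' \<open>(\<lambda>(Y, x). T Y x) \<in> _\<close>] by simp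
    have "ennreal (2 * J) = (\<integral>\<^sup>+z. ennreal (2 * (G z)\<^sup>2) \<partial>lborel)"
      unfolding J_def using G2 by (subst nn_integral_eq_integral) auto
    also have "\<dots> \<le> (\<integral>\<^sup>+z. ennreal ((T Y z - (f0 z + G z))\<^sup>2) \<partial>lborel) + (\<integral>\<^sup>+z. ennreal ((T Y z - (f0 z - G z))\<^sup>2) \<partial>lborel)"
    proof (subst nn_integral_add[symmetric], measurable, rule nn_integral_mono)
      fix z
      have "(T Y z - (f0 z + G z))\<^sup>2 + (T Y z - (f0 z - G z))\<^sup>2 = 2 * (T Y z - f0 z)\<^sup>2 + 2 * (G z)\<^sup>2"
        by (simp add: power2_eq_square algebra_simps)
      then show "ennreal (2 * (G z)\<^sup>2) \<le> ennreal ((T Y z - (f0 z + G z))\<^sup>2) + ennreal ((T Y z - (f0 z - G z))\<^sup>2)"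
        by (subst ennreal_plus[symmetric]) (auto simp del: ennreal_plus intro!: ennreal_leI)
    qed
    finally show "ennreal (2 * J) \<le> (\<integral>\<^sup>+z. ennreal ((T Y z - (f0 z + G z))\<^sup>2) \<partial>lborel) + (\<integral>\<^sup>+z. ennreal ((T Y z - (f0 z - G z))\<^sup>2) \<partial>lborel)" .
  qed (use J0 in auto)
  also have "\<dots> \<le> risk_L2 fe \<alpha> r L n T + risk_L2 fe \<alpha> r L n T"
    unfolding risk_L2_def using cl by (intro add_mono SUP_upper2[OF cl(1)] SUP_upper2[OF cl(2)]) auto
  finally show ?thesis unfolding J_def[symmetric]
    by (cases "risk_L2 fe \<alpha> r L n T") (auto simp: ennreal_plus[symmetric] ennreal_le_iff2 simp del: ennreal_plus)
qed

end

section \<open>Oscillatory integrals and a base density with heavy tails\<close>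

lemma has_vector_derivative_cis_mult:
  "((\<lambda>u. cis (- (u * y))) has_vector_derivative (- \<i> * y * cis (- (u * y)))) (at u within S)"
proof -
  have "((\<lambda>z. exp (- \<i> * y * z)) has_field_derivative (- \<i> * y * exp (- \<i> * y * complex_of_real u))) (at (complex_of_real u))"
    by (auto intro!: derivative_eq_intros)
  from has_vector_derivative_real_field[OF this]
  show ?thesis by (simp add: cis_conv_exp mult_ac)
qed

lemma integrable_indicator_Icc:
  fixes w :: "real \<Rightarrow> complex"
  assumes "continuous_on {a..b} w"
  shows "integrable lborel (\<lambda>u. indicator {a..b} u *\<^sub>R w u)"
  using borel_integrable_compact[OF _ assms] by auto

text \<open>Two integrations by parts in one application of the fundamental theorem of calculus: the function
  \<open>(w' + \<i> y w) e^{-\<i>uy}\<close> has derivative \<open>(w'' + y\<^sup>2 w) e^{-\<i>uy}\<close> and vanishes at both end points.\<close>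

lemma oscillatory_integral_bound:
  fixes w w1 w2 :: "real \<Rightarrow> complex"
  assumes ab: "a \<le> b"
    and w: "\<And>u. u \<in> {a..b} \<Longrightarrow> (w has_vector_derivative w1 u) (at u within {a..b})"
    and w1: "\<And>u. u \<in> {a..b} \<Longrightarrow> (w1 has_vector_derivative w2 u) (at u within {a..b})"
    and w2: "continuous_on {a..b} w2"
    and z: "w a = 0" "w b = 0" "w1 a = 0" "w1 b = 0"
    and B: "\<And>u. u \<in> {a..b} \<Longrightarrow> cmod (w u) \<le> B" "\<And>u. u \<in> {a..b} \<Longrightarrow> cmod (w2 u) \<le> B"
  shows "cmod (LINT u|lborel. indicator {a..b} u *\<^sub>R (w u * cis (- (u * y)))) \<le> 2 * B * (b - a) / (1 + y\<^sup>2)"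
proof -
  have wc: "continuous_on {a..b} w" using w by (rule continuous_on_vector_derivative)
  let ?F = "\<lambda>u. (w1 u + \<i> * y * w u) * cis (- (u * y))"
  have cc: "continuous_on {a..b} (\<lambda>u. cis (- (u * y)))" by (intro continuous_intros)
  have "(LINT u|lborel. indicator {a..b} u *\<^sub>R ((w2 u + y\<^sup>2 * w u) * cis (- (u * y)))) = ?F b - ?F a"
  proof (rule integral_FTC_Icc[OF ab])
    fix u assume "a \<le> u" "u \<le> b"
    then have u: "u \<in> {a..b}" by simp
    show "(?F has_vector_derivative ((w2 u + y\<^sup>2 * w u) * cis (- (u * y)))) (at u within {a..b})"
      by (rule has_vector_derivative_eq_rhs[OF has_vector_derivative_mult[OF has_vector_derivative_add[OF w1[OF u] has_vector_derivative_mult_right[OF w[OF u]]] has_vector_derivative_cis_mult]])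
         (simp add: algebra_simps power2_eq_square)
  qed (intro continuous_intros wc w2)
  then have 0: "(LINT u|lborel. indicator {a..b} u *\<^sub>R ((w2 u + y\<^sup>2 * w u) * cis (- (u * y)))) = 0" using z by simp
  let ?I = "\<lambda>v. LINT u|lborel. indicator {a..b} u *\<^sub>R (v u * cis (- (u * y)))"
  have i: "integrable lborel (\<lambda>u. indicator {a..b} u *\<^sub>R (v u * cis (- (u * y))))" if "continuous_on {a..b} v" for v
    by (intro integrable_indicator_Icc continuous_intros that)
  have b: "cmod (?I v) \<le> B * (b - a)" if "continuous_on {a..b} v" "\<And>u. u \<in> {a..b} \<Longrightarrow> cmod (v u) \<le> B" for v
  proof -
    have "cmod (?I v) \<le> (LINT u|lborel. cmod (indicator {a..b} u *\<^sub>R (v u * cis (- (u * y)))))" by (rule integral_norm_bound)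
    also have "\<dots> \<le> (LINT u|lborel. B * indicator {a..b} u)"
      using that(2) ab by (intro integral_mono integrable_norm i that(1)) (auto simp: norm_mult split: split_indicator)
    also have "\<dots> = B * (b - a)" using ab by simp
    finally show ?thesis .
  qed
  have "?I w2 + y\<^sup>2 * ?I w = (LINT u|lborel. indicator {a..b} u *\<^sub>R (w2 u * cis (- (u * y))) + y\<^sup>2 * (indicator {a..b} u *\<^sub>R (w u * cis (- (u * y)))))"
    by (simp only: Bochner_Integration.integral_add[OF i[OF w2] integrable_mult_right[OF i[OF wc]]] integral_mult_right_zero)
  also have "\<dots> = (LINT u|lborel. indicator {a..b} u *\<^sub>R ((w2 u + y\<^sup>2 * w u) * cis (- (u * y))))"
    by (intro Bochner_Integration.integral_cong refl) (simp split: split_indicator add: algebra_simps)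
  finally have "y\<^sup>2 * ?I w = - ?I w2" unfolding 0 by (simp add: eq_neg_iff_add_eq_0 add.commute)
  then have "cmod (y\<^sup>2 * ?I w) = cmod (?I w2)" by (simp only: norm_minus_cancel)
  then have "y\<^sup>2 * cmod (?I w) = cmod (?I w2)" by (simp add: norm_mult norm_power)
  then have "(1 + y\<^sup>2) * cmod (?I w) \<le> 2 * B * (b - a)" using b[OF wc B(1)] b[OF w2 B(2)] by (simp add: algebra_simps)
  then show ?thesis by (simp add: field_simps add_pos_nonneg)
qed

text \<open>\<open>B\<close> is the size and \<open>k\<close> the price of one derivative: the j-th
  derivative is at most B k^j for j \<le> 2. This form is stable under the Leibniz rule: in products
  the sizes multiply and the prices add, the second derivative being covered by the binomial formula
  for (k + k')^2.\<close>

definition C2_bound :: "real set \<Rightarrow> real \<Rightarrow> real \<Rightarrow> (real \<Rightarrow> complex) \<Rightarrow> (real \<Rightarrow> complex) \<Rightarrow> (real \<Rightarrow> complex) \<Rightarrow> bool" where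
  "C2_bound S B k f f1 f2 \<longleftrightarrow> 0 \<le> B \<and> 0 \<le> k \<and> continuous_on S f2 \<and>
    (\<forall>u\<in>S. (f has_vector_derivative f1 u) (at u within S) \<and> (f1 has_vector_derivative f2 u) (at u within S) \<and>
      cmod (f u) \<le> B \<and> cmod (f1 u) \<le> B * k \<and> cmod (f2 u) \<le> B * k\<^sup>2)"

lemma C2_bound_mult:
  assumes f: "C2_bound S B k f f1 f2" and g: "C2_bound S B' k' g g1 g2"
  shows "C2_bound S (B * B') (k + k') (\<lambda>u. f u * g u) (\<lambda>u. f u * g1 u + f1 u * g u)
    (\<lambda>u. f u * g2 u + 2 * (f1 u * g1 u) + f2 u * g u)"
proof -
  have c: "continuous_on S f" "continuous_on S f1" "continuous_on S f2" "continuous_on S g" "continuous_on S g1" "continuous_on S g2"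
    using f g unfolding C2_bound_def by (auto intro: continuous_on_vector_derivative)
  have nn: "0 \<le> B" "0 \<le> k" "0 \<le> B'" "0 \<le> k'" using f g by (auto simp: C2_bound_def)
  have "((\<lambda>u. f u * g u) has_vector_derivative (f u * g1 u + f1 u * g u)) (at u within S)
    \<and> ((\<lambda>u. f u * g1 u + f1 u * g u) has_vector_derivative (f u * g2 u + 2 * (f1 u * g1 u) + f2 u * g u)) (at u within S)
    \<and> cmod (f u * g u) \<le> B * B' \<and> cmod (f u * g1 u + f1 u * g u) \<le> B * B' * (k + k')
    \<and> cmod (f u * g2 u + 2 * (f1 u * g1 u) + f2 u * g u) \<le> B * B' * (k + k')\<^sup>2" if u: "u \<in> S" for u
  proof (intro conjI)
    have d: "(f has_vector_derivative f1 u) (at u within S)" "(f1 has_vector_derivative f2 u) (at u within S)"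
      "(g has_vector_derivative g1 u) (at u within S)" "(g1 has_vector_derivative g2 u) (at u within S)"
      and b: "cmod (f u) \<le> B" "cmod (f1 u) \<le> B * k" "cmod (f2 u) \<le> B * k\<^sup>2" "cmod (g u) \<le> B'" "cmod (g1 u) \<le> B' * k'" "cmod (g2 u) \<le> B' * k'\<^sup>2"
      using f g u by (auto simp: C2_bound_def)
    show "((\<lambda>u. f u * g u) has_vector_derivative (f u * g1 u + f1 u * g u)) (at u within S)"
      by (rule has_vector_derivative_mult[OF d(1,3)])
    show "((\<lambda>u. f u * g1 u + f1 u * g u) has_vector_derivative (f u * g2 u + 2 * (f1 u * g1 u) + f2 u * g u)) (at u within S)"
      by (rule has_vector_derivative_eq_rhs[OF has_vector_derivative_add[OF has_vector_derivative_mult[OF d(1,4)] has_vector_derivative_mult[OF d(2,3)]]]) simp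
    have m: "cmod (p * q) \<le> P * Q" if "cmod p \<le> P" "cmod q \<le> Q" for p q P Q
      unfolding norm_mult using that by (intro mult_mono) (auto intro: order_trans[OF norm_ge_zero])
    show "cmod (f u * g u) \<le> B * B'" by (rule m[OF b(1,4)])
    have "cmod (f u * g1 u + f1 u * g u) \<le> B * (B' * k') + (B * k) * B'"
      by (rule norm_triangle_le[OF add_mono[OF m[OF b(1,5)] m[OF b(2,4)]]])
    then show "cmod (f u * g1 u + f1 u * g u) \<le> B * B' * (k + k')" by (simp add: algebra_simps)
    have "cmod (f u * g2 u + 2 * (f1 u * g1 u) + f2 u * g u) \<le> B * (B' * k'\<^sup>2) + 2 * (B * k * (B' * k')) + B * k\<^sup>2 * B'"
      by (intro norm_triangle_le add_mono m b) simp
    then show "cmod (f u * g2 u + 2 * (f1 u * g1 u) + f2 u * g u) \<le> B * B' * (k + k')\<^sup>2"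
      by (simp add: algebra_simps power2_eq_square)
  qed
  then show ?thesis using nn c unfolding C2_bound_def by (auto intro!: continuous_intros)
qed

section \<open>The Fejer kernel and the base density\<close>

definition tri :: "real \<Rightarrow> complex" where "tri u = complex_of_real (max 0 (1 - \<bar>u\<bar>))"

text \<open>Fejer's kernel, normalised to total mass 1 and continuously extended to 0; its
  characteristic function is \<open>tri\<close>.\<close>

definition fejer :: "real \<Rightarrow> real" where
  "fejer y = (if y = 0 then 1 / (2 * pi) else (1 - cos y) / (pi * y\<^sup>2))"

lemma isCont_tri: "isCont tri y"
  unfolding tri_def by (intro continuous_intros)

lemma integrable_tri: "integrable lborel tri"
proof (rule Bochner_Integration.integrable_bound)
  show "integrable lborel (indicator {-1..1} :: real \<Rightarrow> real)" by auto
  show "tri \<in> borel_measurable lborel" unfolding tri_def by measurable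
  show "AE u in lborel. cmod (tri u) \<le> norm (indicator {-1..1} u :: real)"
    by (intro AE_I2) (auto simp: tri_def split: split_indicator)
qed

text \<open>On each half of the support an explicit antiderivative is available. It divides by
  \<open>y\<close>, so y = 0 is treated separately.\<close>

lemma cft_tri: "cft tri y = 2 * pi * fejer y"
proof (cases "y = 0")
  case True
  have ci: "integrable lborel (\<lambda>u. indicator {a..b} u *\<^sub>R (f u))" if "continuous_on {a..b} f" for a b and f :: "real \<Rightarrow> complex"
    by (rule integrable_indicator_Icc[OF that])
  \<comment> \<open>At u = 0 both closed halves contribute, so the decomposition holds only off a
    null set.\<close>
  have e: "tri u = indicator {-1..0} u *\<^sub>R complex_of_real (1 + u) + indicator {0..1} u *\<^sub>R complex_of_real (1 - u)" if "u \<noteq> 0" for u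
    using that by (auto simp: tri_def split: split_indicator)
  have "cft tri y = (LINT u|lborel. indicator {-1..0} u *\<^sub>R complex_of_real (1 + u) + indicator {0..1} u *\<^sub>R complex_of_real (1 - u))"
    unfolding cft_def True
  proof (rule integral_cong_AE)
    have "AE u in lborel. u \<noteq> (0::real)" by (rule AE_lborel_singleton)
    then show "AE u in lborel. tri u * cis (u * 0) = indicator {-1..0} u *\<^sub>R complex_of_real (1 + u) + indicator {0..1} u *\<^sub>R complex_of_real (1 - u)"
      by eventually_elim (simp add: e)
  qed (auto simp: tri_def)
  also have "\<dots> = (LINT u|lborel. indicator {-1..0} u *\<^sub>R complex_of_real (1 + u)) + (LINT u|lborel. indicator {0..1} u *\<^sub>R complex_of_real (1 - u))"
    by (intro Bochner_Integration.integral_add ci continuous_intros)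
  also have "(LINT u|lborel. indicator {-1..0} u *\<^sub>R complex_of_real (1 + u)) = complex_of_real (0 + 0\<^sup>2 / 2) - complex_of_real (-1 + (-1)\<^sup>2 / 2)"
  proof (rule integral_FTC_Icc[where F="\<lambda>u. complex_of_real (u + u\<^sup>2 / 2)"])
    fix u
    have "((\<lambda>u. u + u\<^sup>2 / 2) has_real_derivative (1 + u)) (at u within S)" for S by (auto intro!: derivative_eq_intros)
    from has_vector_derivative_of_real[OF this]
    show "((\<lambda>u. complex_of_real (u + u\<^sup>2 / 2)) has_vector_derivative complex_of_real (1 + u)) (at u within {-1..0})" .
  qed (auto intro!: continuous_intros)
  also have "(LINT u|lborel. indicator {0..1} u *\<^sub>R complex_of_real (1 - u)) = complex_of_real (1 - 1\<^sup>2 / 2) - complex_of_real (0 - 0\<^sup>2 / 2)"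
  proof (rule integral_FTC_Icc[where F="\<lambda>u. complex_of_real (u - u\<^sup>2 / 2)"])
    fix u
    have "((\<lambda>u. u - u\<^sup>2 / 2) has_real_derivative (1 - u)) (at u within S)" for S by (auto intro!: derivative_eq_intros)
    from has_vector_derivative_of_real[OF this]
    show "((\<lambda>u. complex_of_real (u - u\<^sup>2 / 2)) has_vector_derivative complex_of_real (1 - u)) (at u within {0..1})" .
  qed (auto intro!: continuous_intros)
  finally show ?thesis using True by (simp add: fejer_def)
next
  case False
  have ci: "integrable lborel (\<lambda>u. indicator {a..b} u *\<^sub>R (f u))" if "continuous_on {a..b} f" for a b and f :: "real \<Rightarrow> complex"
    by (rule integrable_indicator_Icc[OF that])
  let ?E = "\<lambda>u. cis (- (u * (- y)))"
  have dE: "(?E has_vector_derivative (\<i> * y * ?E u)) (at u within S)" for u S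
    using has_vector_derivative_cis_mult[of "-y" u S] by simp
  have k: "\<i> * complex_of_real y * E / (complex_of_real y)\<^sup>2 = - (E / (\<i> * complex_of_real y))" for E
    using False by (simp add: field_simps power2_eq_square)
  have dlp: "((\<lambda>u. complex_of_real (1 + u)) has_vector_derivative complex_of_real 1) (at u within S)"
    and dlm: "((\<lambda>u. complex_of_real (1 - u)) has_vector_derivative complex_of_real (-1)) (at u within S)" for u S
    by (rule has_vector_derivative_of_real, auto intro!: derivative_eq_intros)+
  have e: "tri u * cis (u * y) = indicator {-1..0} u *\<^sub>R (complex_of_real (1 + u) * ?E u) + indicator {0..1} u *\<^sub>R (complex_of_real (1 - u) * ?E u)" if "u \<noteq> 0" for u
    using that by (auto simp: tri_def split: split_indicator)
  have "cft tri y = (LINT u|lborel. indicator {-1..0} u *\<^sub>R (complex_of_real (1 + u) * ?E u) + indicator {0..1} u *\<^sub>R (complex_of_real (1 - u) * ?E u))"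
    unfolding cft_def
  proof (rule integral_cong_AE)
    have "AE u in lborel. u \<noteq> (0::real)" by (rule AE_lborel_singleton)
    then show "AE u in lborel. tri u * cis (u * y) = indicator {-1..0} u *\<^sub>R (complex_of_real (1 + u) * ?E u) + indicator {0..1} u *\<^sub>R (complex_of_real (1 - u) * ?E u)"
      by eventually_elim (rule e)
  qed (auto simp: tri_def)
  also have "\<dots> = (LINT u|lborel. indicator {-1..0} u *\<^sub>R (complex_of_real (1 + u) * ?E u)) + (LINT u|lborel. indicator {0..1} u *\<^sub>R (complex_of_real (1 - u) * ?E u))"
    by (intro Bochner_Integration.integral_add ci continuous_intros)
  also have "(LINT u|lborel. indicator {-1..0} u *\<^sub>R (complex_of_real (1 + u) * ?E u))
     = (complex_of_real (1 + 0) * (?E 0 / (\<i> * y)) + ?E 0 / y\<^sup>2) - (complex_of_real (1 + -1) * (?E (-1) / (\<i> * y)) + ?E (-1) / y\<^sup>2)"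
  proof (rule integral_FTC_Icc)
    fix u
    show "((\<lambda>u. complex_of_real (1 + u) * (?E u / (\<i> * y)) + ?E u / y\<^sup>2) has_vector_derivative complex_of_real (1 + u) * ?E u) (at u within {-1..0})"
      by (rule has_vector_derivative_eq_rhs[OF has_vector_derivative_add[OF has_vector_derivative_mult[OF dlp has_vector_derivative_divide[OF dE]] has_vector_derivative_divide[OF dE]]])
         (simp add: k False)
  qed (auto intro!: continuous_intros)
  also have "(LINT u|lborel. indicator {0..1} u *\<^sub>R (complex_of_real (1 - u) * ?E u))
     = (complex_of_real (1 - 1) * (?E 1 / (\<i> * y)) - ?E 1 / y\<^sup>2) - (complex_of_real (1 - 0) * (?E 0 / (\<i> * y)) - ?E 0 / y\<^sup>2)"
  proof (rule integral_FTC_Icc)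
    fix u
    show "((\<lambda>u. complex_of_real (1 - u) * (?E u / (\<i> * y)) - ?E u / y\<^sup>2) has_vector_derivative complex_of_real (1 - u) * ?E u) (at u within {0..1})"
      by (rule has_vector_derivative_eq_rhs[OF has_vector_derivative_diff[OF has_vector_derivative_mult[OF dlm has_vector_derivative_divide[OF dE]] has_vector_derivative_divide[OF dE]]])
         (simp add: k False)
  qed (auto intro!: continuous_intros)
  finally have "cft tri y = (2 - (cis y + cis (- y))) / y\<^sup>2" by (simp add: diff_divide_distrib add_divide_distrib)
  also have "cis y + cis (- y) = complex_of_real (2 * cos y)" by (simp add: complex_eq_iff)
  finally have "cft tri y = complex_of_real ((2 - 2 * cos y) / y\<^sup>2)" by simp
  also have "(2 - 2 * cos y) / y\<^sup>2 = 2 * pi * fejer y" using False by (simp add: fejer_def field_simps)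
  finally show ?thesis by simp
qed


lemma fejer_nonneg: "0 \<le> fejer y"
  by (simp add: fejer_def)

lemma fejer_le: "fejer y \<le> 2 / (1 + y\<^sup>2)"
proof (cases "\<bar>y\<bar> \<le> 1")
  case True
  have "cmod (cft tri y) \<le> (LINT u|lborel. cmod (tri u))" by (rule norm_cft_le[OF integrable_tri])
  also have "\<dots> \<le> (LINT u|lborel. indicator {-1..1::real} u)"
    by (intro integral_mono integrable_norm integrable_tri) (auto simp: tri_def split: split_indicator)
  finally have "2 * pi * fejer y \<le> 2" unfolding cft_tri using fejer_nonneg[of y] by (simp add: norm_mult)
  then have "pi * fejer y \<le> 1" by simp
  moreover have "fejer y \<le> pi * fejer y" using mult_right_mono[OF _ fejer_nonneg[of y], of 1 pi] pi_ge_two by simp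
  moreover have "y\<^sup>2 \<le> 1" using True by (simp add: abs_square_le_1)
  then have "1 \<le> 2 / (1 + y\<^sup>2)" by (auto simp: field_simps add_pos_nonneg)
  ultimately show ?thesis by linarith
next
  case False
  then have "y \<noteq> 0" by auto
  have "1 \<le> y\<^sup>2" using False by (metis abs_square_le_1 linorder_le_cases)
  have "fejer y = (1 - cos y) / (pi * y\<^sup>2)" using \<open>y \<noteq> 0\<close> by (simp add: fejer_def)
  also have "\<dots> \<le> 2 / (2 * y\<^sup>2)"
    using cos_ge_minus_one[of y] pi_ge_two \<open>1 \<le> y\<^sup>2\<close> by (intro frac_le mult_right_mono) (auto simp del: cos_ge_minus_one)
  also have "\<dots> \<le> 2 / (1 + y\<^sup>2)" using \<open>1 \<le> y\<^sup>2\<close> by (intro divide_left_mono) (auto intro!: mult_pos_pos simp: add_pos_nonneg)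
  finally show ?thesis .
qed

lemma continuous_on_fejer: "continuous_on S fejer"
proof -
  have "fejer y = Re (cft tri y) / (2 * pi)" for y by (simp add: cft_tri)
  then have eq: "fejer = (\<lambda>y. Re (cft tri y) / (2 * pi))" by auto
  show ?thesis unfolding eq by (intro continuous_intros continuous_on_cft integrable_tri) auto
qed

lemma integrable_fejer: "integrable lborel fejer"
proof (rule Bochner_Integration.integrable_bound)
  show "integrable lborel (\<lambda>y::real. 2 * (1 / (1 + y\<^sup>2)))"
    by (rule integrable_mult_right[OF integrable_inverse_one_plus_square])
  show "fejer \<in> borel_measurable lborel"
    using borel_measurable_continuous_onI[OF continuous_on_fejer] by simp
  show "AE y in lborel. norm (fejer y) \<le> norm (2 * (1 / (1 + y\<^sup>2)))"
  proof (rule AE_I2)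
    fix y
    have "fejer y \<le> 2 * (1 / (1 + y\<^sup>2))" using fejer_le[of y] by simp
    then show "norm (fejer y) \<le> norm (2 * (1 / (1 + y\<^sup>2)))"
      using fejer_nonneg[of y] unfolding real_norm_def by linarith
  qed
qed

lemma fourier_fejer: "fourier fejer u = tri u"
proof -
  have c: "cft tri = (\<lambda>y. 2 * pi * fejer y)" by (rule ext) (simp add: cft_tri)
  have "(LINT y|lborel. cft tri y * cis (- (y * - u))) = 2 * pi * tri (- u)"
    by (rule fourier_inversion[OF integrable_tri isCont_tri]) (simp add: c integrable_fejer)
  then have "2 * pi * (LINT y|lborel. fejer y * cis (y * u)) = 2 * pi * tri (- u)"
    by (simp add: c mult.assoc)
  then show ?thesis by (simp add: fourier_def tri_def)
qed

text \<open>A single kernel has zeros because 1 - cos z vanishes periodically, but (1 - cos z) + (1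
  - cos(z - \<pi>)) = 2. A shift multiplies the transform by a factor of modulus 1 and leaves its
  support alone; dilation by \<sigma> shrinks the support to |u| \<le> 1/\<sigma>, and this makes
  the weighted norm small.\<close>

lemma exists_base_density:
  fixes \<alpha> r \<eta> :: real
  assumes \<alpha>: "0 < \<alpha>" and r: "0 < r" and \<eta>: "0 < \<eta>"
  obtains f0 c B where "prob_density f0" "continuous_on UNIV f0" "0 < c" "\<And>y. c / (1 + y\<^sup>2) \<le> f0 y" "\<And>y. f0 y \<le> B"
    "\<And>u. 1 < \<bar>u\<bar> \<Longrightarrow> fourier f0 u = 0"
    "(\<integral>\<^sup>+ u. ennreal ((cmod (fourier f0 u))\<^sup>2 * exp (2 * \<alpha> * \<bar>u\<bar> powr r)) \<partial>lborel) \<le> ennreal \<eta>"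
proof -
  \<comment> \<open>The weighted norm will be at most exp(2\<alpha>) times the length 2/\<sigma> of
    the support. The condition \<sigma> \<ge> 1 keeps the support inside |u| \<le> 1, where the
    weight is at most exp(2\<alpha>).\<close>
  define \<sigma> where "\<sigma> = max 1 (2 * exp (2 * \<alpha>) / \<eta>)"
  have \<sigma>: "1 \<le> \<sigma>" "2 * exp (2 * \<alpha>) / \<eta> \<le> \<sigma>" by (auto simp: \<sigma>_def)
  define f0 where "f0 y = (fejer (y / \<sigma>) + fejer (y / \<sigma> - pi)) / (2 * \<sigma>)" for y
  have [measurable]: "fejer \<in> borel_measurable borel"
    using borel_measurable_continuous_onI[OF continuous_on_fejer] by simp
  have i: "integrable lborel (\<lambda>y. fejer (y / \<sigma> - t))" for t
    using lborel_integrable_real_affine[OF integrable_fejer, of "1 / \<sigma>" "-t"] \<sigma> by simp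
  have ft: "(LINT y|lborel. complex_of_real (fejer (y / \<sigma> - t)) * cis (y * u)) = \<sigma> * cis (\<sigma> * t * u) * tri (\<sigma> * u)" for t u
  proof -
    have "(LINT y|lborel. complex_of_real (fejer (y / \<sigma> - t)) * cis (y * u)) = \<sigma> * (LINT z|lborel. complex_of_real (fejer z) * cis ((\<sigma> * t + \<sigma> * z) * u))"
      using \<sigma> by (subst lborel_integral_real_affine[where c=\<sigma> and t="\<sigma> * t"]) (auto simp: scaleR_conv_of_real add_divide_distrib)
    also have "(LINT z|lborel. complex_of_real (fejer z) * cis ((\<sigma> * t + \<sigma> * z) * u)) = (LINT z|lborel. cis (\<sigma> * t * u) * (complex_of_real (fejer z) * cis (z * (\<sigma> * u))))"
      by (intro Bochner_Integration.integral_cong refl) (simp add: cis_mult algebra_simps)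
    also have "\<dots> = cis (\<sigma> * t * u) * tri (\<sigma> * u)"
      by (simp add: fourier_fejer[unfolded fourier_def])
    finally show ?thesis by simp
  qed
  have F: "fourier f0 u = (tri (\<sigma> * u) + cis (\<sigma> * pi * u) * tri (\<sigma> * u)) / 2" for u
  proof -
    have "fourier f0 u = (LINT y|lborel. (complex_of_real (fejer (y / \<sigma> - 0)) * cis (y * u) + complex_of_real (fejer (y / \<sigma> - pi)) * cis (y * u)) / (2 * \<sigma>))"
      unfolding fourier_def f0_def by (intro Bochner_Integration.integral_cong refl) (simp add: algebra_simps add_divide_distrib)
    also have "\<dots> = (\<sigma> * cis (\<sigma> * 0 * u) * tri (\<sigma> * u) + \<sigma> * cis (\<sigma> * pi * u) * tri (\<sigma> * u)) / (2 * \<sigma>)"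
      unfolding integral_divide_zero ft[symmetric]
      by (subst Bochner_Integration.integral_add) (use i[of 0] i[of pi] in \<open>auto intro!: integrable_mult_cis simp del: diff_zero\<close>)
    finally show ?thesis using \<sigma> by (simp add: add_divide_distrib)
  qed
  have Fb: "cmod (fourier f0 u) \<le> cmod (tri (\<sigma> * u))" for u
  proof -
    have "cmod (tri (\<sigma> * u) + cis (\<sigma> * pi * u) * tri (\<sigma> * u)) \<le> cmod (tri (\<sigma> * u)) + cmod (cis (\<sigma> * pi * u) * tri (\<sigma> * u))" by (rule norm_triangle_ineq)
    then show ?thesis unfolding F by (simp add: norm_mult norm_divide)
  qed
  have fi: "integrable lborel f0" unfolding f0_def using i[of 0] i[of pi] by auto
  have f0n: "0 \<le> f0 y" for y unfolding f0_def using \<sigma> fejer_nonneg by (intro divide_nonneg_nonneg add_nonneg_nonneg) auto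
  have "complex_of_real (LINT y|lborel. f0 y) = fourier f0 0" by (simp add: fourier_def)
  also have "\<dots> = 1" unfolding F by (simp add: tri_def)
  finally have f01: "(LINT y|lborel. f0 y) = 1" by (simp only: of_real_eq_1_iff)
  have tri0: "cmod (tri (\<sigma> * u)) \<le> indicator {-(1 / \<sigma>)..1 / \<sigma>} u" for u
  proof (cases "u \<in> {-(1 / \<sigma>)..1 / \<sigma>}")
    case False
    then have "1 \<le> \<bar>\<sigma> * u\<bar>" using \<sigma> by (auto simp: abs_mult field_simps abs_if)
    then show ?thesis by (simp add: tri_def)
  qed (simp add: tri_def)
  show ?thesis
  proof (rule that[of f0 "1 / (2 * pi ^ 3 * \<sigma>)" "4 / (2 * \<sigma>)"])
    show "prob_density f0" unfolding prob_density_def using fi f0n f01 by auto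
    show "continuous_on UNIV f0"
      unfolding f0_def by (intro continuous_intros continuous_on_compose2[OF continuous_on_fejer[of UNIV]]) (use \<sigma> in auto)
    show "0 < 1 / (2 * pi ^ 3 * \<sigma>)" using \<sigma> by simp
    show "f0 y \<le> 4 / (2 * \<sigma>)" for y
    proof -
      have "fejer z \<le> 2" for z
        using fejer_le[of z] by (rule order_trans) (simp add: divide_le_eq add_pos_nonneg)
      then have "fejer (y / \<sigma>) + fejer (y / \<sigma> - pi) \<le> 4" by (smt (verit))
      then show ?thesis unfolding f0_def using \<sigma> by (intro divide_right_mono) auto
    qed
    show "fourier f0 u = 0" if "1 < \<bar>u\<bar>" for u
    proof -
      have "1 / \<sigma> \<le> 1" using \<sigma> by simp
      then have "u \<notin> {-(1 / \<sigma>)..1 / \<sigma>}" using that by (auto simp: abs_if split: if_splits)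
      then show ?thesis using Fb[of u] tri0[of u] by simp
    qed
    show "1 / (2 * pi ^ 3 * \<sigma>) / (1 + y\<^sup>2) \<le> f0 y" for y
    proof -
      define z where "z = y / \<sigma>"
      \<comment> \<open>Enlarging both denominators to the common value \<pi>(|z| + \<pi>)^2 allows
        the two numerators to be added.\<close>
      have fz: "(1 - cos t) / (pi * d\<^sup>2) \<le> fejer t" if "\<bar>t\<bar> \<le> d" "0 < d" for t d
      proof (cases "t = 0")
        case False
        have "t\<^sup>2 \<le> d\<^sup>2" using that by (intro power2_le_iff_abs_le[THEN iffD2]) auto
        then show ?thesis unfolding fejer_def using False
          by (simp, intro divide_left_mono mult_left_mono) (auto intro!: mult_pos_pos simp: that)
      qed (simp add: fejer_nonneg)
      have d: "0 < \<bar>z\<bar> + pi" by (simp add: add_nonneg_pos)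
      have "(1 - cos z) / (pi * (\<bar>z\<bar> + pi)\<^sup>2) + (1 - cos (z - pi)) / (pi * (\<bar>z\<bar> + pi)\<^sup>2) \<le> fejer z + fejer (z - pi)"
        by (intro add_mono fz d; use pi_gt_zero in linarith)
      also have "(1 - cos z) / (pi * (\<bar>z\<bar> + pi)\<^sup>2) + (1 - cos (z - pi)) / (pi * (\<bar>z\<bar> + pi)\<^sup>2) = 2 / (pi * (\<bar>z\<bar> + pi)\<^sup>2)"
        by (simp add: cos_diff flip: add_divide_distrib)
      finally have 1: "2 / (pi * (\<bar>z\<bar> + pi)\<^sup>2) \<le> fejer z + fejer (z - pi)" .
      have 2: "(\<bar>z\<bar> + pi)\<^sup>2 \<le> 2 * pi\<^sup>2 * (1 + y\<^sup>2)"
      proof -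
        have "\<bar>y\<bar> / \<bar>\<sigma>\<bar> \<le> \<bar>y\<bar> / 1" using \<sigma> by (intro divide_left_mono) auto
        then have "\<bar>z\<bar> \<le> \<bar>y\<bar>" by (simp add: z_def abs_divide)
        then have "z\<^sup>2 \<le> y\<^sup>2" by (simp add: abs_le_square_iff)
        have "1 \<le> pi\<^sup>2" using pi_ge_two by (intro one_le_power) linarith
        have "0 \<le> (\<bar>z\<bar> - pi)\<^sup>2" by simp
        then have "(\<bar>z\<bar> + pi)\<^sup>2 \<le> 2 * z\<^sup>2 + 2 * pi\<^sup>2" by (simp add: power2_eq_square algebra_simps)
        also have "\<dots> \<le> 2 * (pi\<^sup>2 * y\<^sup>2) + 2 * pi\<^sup>2"
          using \<open>z\<^sup>2 \<le> y\<^sup>2\<close> mult_right_mono[OF \<open>1 \<le> pi\<^sup>2\<close>, of "y\<^sup>2"] by simp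
        finally show ?thesis by (simp add: algebra_simps)
      qed
      have "1 / (2 * pi ^ 3 * \<sigma>) / (1 + y\<^sup>2) = (2 / (pi * (2 * pi\<^sup>2 * (1 + y\<^sup>2)))) / (2 * \<sigma>)"
        by (simp add: power3_eq_cube power2_eq_square)
      also have "\<dots> \<le> (2 / (pi * (\<bar>z\<bar> + pi)\<^sup>2)) / (2 * \<sigma>)"
        using 2 d \<sigma> by (intro divide_right_mono divide_left_mono mult_left_mono) (auto intro!: mult_pos_pos simp: add_pos_nonneg)
      also have "\<dots> \<le> f0 y" unfolding f0_def z_def[symmetric] using 1 \<sigma> by (intro divide_right_mono) auto
      finally show ?thesis .
    qed
    show "(\<integral>\<^sup>+ u. ennreal ((cmod (fourier f0 u))\<^sup>2 * exp (2 * \<alpha> * \<bar>u\<bar> powr r)) \<partial>lborel) \<le> ennreal \<eta>"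
    proof -
      have "(\<integral>\<^sup>+ u. ennreal ((cmod (fourier f0 u))\<^sup>2 * exp (2 * \<alpha> * \<bar>u\<bar> powr r)) \<partial>lborel) \<le> (\<integral>\<^sup>+ u. ennreal (exp (2 * \<alpha>)) * indicator {-(1 / \<sigma>)..1 / \<sigma>} u \<partial>lborel)"
      proof (rule nn_integral_mono)
        fix u
        show "ennreal ((cmod (fourier f0 u))\<^sup>2 * exp (2 * \<alpha> * \<bar>u\<bar> powr r)) \<le> ennreal (exp (2 * \<alpha>)) * indicator {-(1 / \<sigma>)..1 / \<sigma>} u"
        proof (cases "u \<in> {-(1 / \<sigma>)..1 / \<sigma>}")
          case True
          then have "\<bar>u\<bar> \<le> 1 / \<sigma>" by (simp add: abs_le_iff)
          also have "\<dots> \<le> 1" using \<sigma> by simp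
          finally have "\<bar>u\<bar> powr r \<le> 1" using r by (metis abs_ge_zero powr_mono2 powr_one_eq_one less_imp_le)
          then have "exp (2 * \<alpha> * \<bar>u\<bar> powr r) \<le> exp (2 * \<alpha>)" using \<alpha> by simp
          moreover have "(cmod (fourier f0 u))\<^sup>2 \<le> 1"
            using Fb[of u] tri0[of u] True by (simp add: abs_square_le_1)
          ultimately have "(cmod (fourier f0 u))\<^sup>2 * exp (2 * \<alpha> * \<bar>u\<bar> powr r) \<le> 1 * exp (2 * \<alpha>)" by (intro mult_mono) auto
          then show ?thesis using True by (simp add: ennreal_leI)
        next
          case False
          then have "fourier f0 u = 0" using Fb[of u] tri0[of u] by simp
          then show ?thesis by simp
        qed
      qed
      also have "\<dots> = ennreal (exp (2 * \<alpha>)) * ennreal (2 / \<sigma>)"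
        using \<sigma> by (subst nn_integral_cmult_indicator) auto
      also have "\<dots> = ennreal (2 * exp (2 * \<alpha>) / \<sigma>)" by (subst ennreal_mult'[symmetric]) (auto simp: mult.commute)
      also have "\<dots> \<le> ennreal \<eta>" using \<sigma> \<eta> by (intro ennreal_leI) (simp add: field_simps)
      finally show ?thesis .
    qed
  qed
qed

section \<open>Band-limited perturbations\<close>

definition even_ext :: "real \<Rightarrow> real \<Rightarrow> (real \<Rightarrow> real) \<Rightarrow> real \<Rightarrow> real" where
  "even_ext a b v u = (if a \<le> \<bar>u\<bar> \<and> \<bar>u\<bar> \<le> b then v \<bar>u\<bar> else 0)"

text \<open>Inverse Fourier transform of \<open>even_ext a b v\<close>: as \<open>v\<close> is real,
  the frequencies u and -u contribute complex conjugates, and twice a real part over 2\<pi>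
  remains.\<close>

definition band :: "real \<Rightarrow> real \<Rightarrow> (real \<Rightarrow> real) \<Rightarrow> real \<Rightarrow> real" where
  "band a b v y = Re (LINT u|lborel. indicator {a..b} u *\<^sub>R (complex_of_real (v u) * cis (- (u * y)))) / pi"

lemma nn_integral_even_ext:
  fixes \<phi> :: "real \<Rightarrow> ennreal"
  assumes [measurable]: "\<phi> \<in> borel_measurable borel" and a: "0 < a"
  shows "(\<integral>\<^sup>+u. indicator {u. a \<le> \<bar>u\<bar> \<and> \<bar>u\<bar> \<le> b} u * \<phi> \<bar>u\<bar> \<partial>lborel) = 2 * (\<integral>\<^sup>+u. indicator {a..b} u * \<phi> u \<partial>lborel)"
proof -
  have "(\<integral>\<^sup>+u. indicator {u. a \<le> \<bar>u\<bar> \<and> \<bar>u\<bar> \<le> b} u * \<phi> \<bar>u\<bar> \<partial>lborel)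
     = (\<integral>\<^sup>+u. indicator {a..b} u * \<phi> u + indicator {a..b} (- u) * \<phi> (- u) \<partial>lborel)"
    using a by (intro nn_integral_cong) (auto simp: abs_if split: split_indicator)
  also have "\<dots> = (\<integral>\<^sup>+u. indicator {a..b} u * \<phi> u \<partial>lborel) + (\<integral>\<^sup>+u. indicator {a..b} (- u) * \<phi> (- u) \<partial>lborel)"
    by (rule nn_integral_add) measurable
  also have "(\<integral>\<^sup>+u. indicator {a..b} (- u) * \<phi> (- u) \<partial>lborel) = (\<integral>\<^sup>+u. indicator {a..b} u * \<phi> u \<partial>lborel)"
    by (subst (2) nn_integral_real_affine[where c="-1" and t=0]) auto
  finally show ?thesis by (simp add: mult_2)
qed

context
  fixes a b B :: real and v :: "real \<Rightarrow> real" and v1 v2 :: "real \<Rightarrow> complex"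
  assumes a: "0 < a" and ab: "a < b"
    and d: "\<And>u. u \<in> {a..b} \<Longrightarrow> ((\<lambda>u. complex_of_real (v u)) has_vector_derivative v1 u) (at u within {a..b})"
    and d1: "\<And>u. u \<in> {a..b} \<Longrightarrow> (v1 has_vector_derivative v2 u) (at u within {a..b})"
    and d2: "continuous_on {a..b} v2"
    and z: "v a = 0" "v b = 0" "v1 a = 0" "v1 b = 0"
    and B: "\<And>u. u \<in> {a..b} \<Longrightarrow> \<bar>v u\<bar> \<le> B" "\<And>u. u \<in> {a..b} \<Longrightarrow> cmod (v2 u) \<le> B"
begin

lemma continuous_on_band_profile: "continuous_on {a..b} v"
proof -
  have "continuous_on {a..b} (\<lambda>u. complex_of_real (v u))" using d by (rule continuous_on_vector_derivative)
  from continuous_on_Re[OF this] show ?thesis by simp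
qed

text \<open>Clamping |u| into the band gives the same function because \<open>v\<close> vanishes at
  both ends; in this form continuity on the whole line is visible.\<close>

lemma even_ext_eq: "even_ext a b v u = v (min b (max a \<bar>u\<bar>))"
  using z ab by (auto simp: even_ext_def min_def max_def)

lemma isCont_even_ext: "isCont (even_ext a b v) u"
proof -
  have "continuous_on UNIV (\<lambda>u. v (min b (max a \<bar>u\<bar>)))"
    by (rule continuous_on_compose2[OF continuous_on_band_profile]) (use ab in \<open>auto intro!: continuous_intros\<close>)
  then show ?thesis unfolding even_ext_eq[abs_def] by (simp add: continuous_on_eq_continuous_at)
qed

lemma borel_measurable_even_ext[measurable]: "even_ext a b v \<in> borel_measurable borel"
  using isCont_even_ext by (intro borel_measurable_continuous_onI continuous_at_imp_continuous_on) auto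

lemma band_profile_bound_nonneg: "0 \<le> B" using B(1)[of a] ab by auto

lemma even_ext_bound: "\<bar>even_ext a b v u\<bar> \<le> B * indicator {-b..b} u"
  using B(1)[of "\<bar>u\<bar>"] band_profile_bound_nonneg a ab by (auto simp: even_ext_def abs_le_iff split: split_indicator)

lemma integrable_even_ext: "integrable lborel (\<lambda>u. complex_of_real (even_ext a b v u))"
proof (rule Bochner_Integration.integrable_bound)
  show "integrable lborel (\<lambda>u. B * indicator {-b..b} u)" using a ab by auto
  show "AE u in lborel. cmod (complex_of_real (even_ext a b v u)) \<le> norm (B * indicator {-b..b} u)"
    using even_ext_bound by (intro AE_I2) (auto intro: order_trans[OF _ abs_ge_self])
qed measurable

lemma cft_even_ext: "cft (\<lambda>u. complex_of_real (even_ext a b v u)) y = 2 * pi * band a b v y"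
proof -
  let ?w = "\<lambda>u. indicator {a..b} u *\<^sub>R (complex_of_real (v u) * cis (- (u * y)))"
  have wi: "integrable lborel ?w"
    by (intro integrable_indicator_Icc continuous_intros continuous_on_band_profile)
  have wi': "integrable lborel (\<lambda>u. ?w (- u))"
    using lborel_integrable_real_affine[OF wi, of "-1" 0] by simp
  have "cft (\<lambda>u. complex_of_real (even_ext a b v u)) y = (LINT u|lborel. cnj (?w u) + ?w (- u))"
    unfolding cft_def using a
    by (intro Bochner_Integration.integral_cong refl) (auto simp: even_ext_def abs_if cis_cnj split: split_indicator)
  also have "\<dots> = (LINT u|lborel. cnj (?w u)) + (LINT u|lborel. ?w (- u))"
    by (rule Bochner_Integration.integral_add[OF integrable_cnj[OF wi] wi'])
  also have "(LINT u|lborel. cnj (?w u)) = cnj (LINT u|lborel. ?w u)" by (rule Bochner_Integration.integral_cnj)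
  also have "(LINT u|lborel. ?w (- u)) = (LINT u|lborel. ?w u)"
    by (subst (2) lborel_integral_real_affine[where c="-1" and t=0]) auto
  finally show ?thesis by (simp add: band_def complex_add_cnj add.commute)
qed

lemma band_bound: "\<bar>band a b v y\<bar> \<le> (2 * B * (b - a) / pi) / (1 + y\<^sup>2)"
proof -
  have "cmod (LINT u|lborel. indicator {a..b} u *\<^sub>R (complex_of_real (v u) * cis (- (u * y)))) \<le> 2 * B * (b - a) / (1 + y\<^sup>2)"
    by (rule oscillatory_integral_bound[OF less_imp_le[OF ab] d d1 d2]) (use z B in auto)
  then have "\<bar>Re (LINT u|lborel. indicator {a..b} u *\<^sub>R (complex_of_real (v u) * cis (- (u * y))))\<bar> \<le> 2 * B * (b - a) / (1 + y\<^sup>2)"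
    using abs_Re_le_cmod order_trans by blast
  from divide_right_mono[OF this, of pi] show ?thesis
    by (simp add: band_def abs_divide mult.commute[of pi])
qed

lemma continuous_on_band: "continuous_on S (band a b v)"
proof -
  have "band a b v y = Re (cft (\<lambda>u. complex_of_real (even_ext a b v u)) y) / (2 * pi)" for y by (simp add: cft_even_ext)
  then have eq: "band a b v = (\<lambda>y. Re (cft (\<lambda>u. complex_of_real (even_ext a b v u)) y) / (2 * pi))" by auto
  show ?thesis unfolding eq by (intro continuous_intros continuous_on_cft integrable_even_ext) auto
qed

lemma borel_measurable_band[measurable]: "band a b v \<in> borel_measurable borel"
  by (rule borel_measurable_continuous_onI[OF continuous_on_band])

lemma integrable_band: "integrable lborel (band a b v)"
proof (rule Bochner_Integration.integrable_bound)
  show "integrable lborel (\<lambda>y::real. (2 * B * (b - a) / pi) * (1 / (1 + y\<^sup>2)))"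
    by (rule integrable_mult_right[OF integrable_inverse_one_plus_square])
  show "AE y in lborel. norm (band a b v y) \<le> norm ((2 * B * (b - a) / pi) * (1 / (1 + y\<^sup>2)))"
  proof (rule AE_I2)
    fix y
    have "\<bar>band a b v y\<bar> \<le> (2 * B * (b - a) / pi) * (1 / (1 + y\<^sup>2))" using band_bound[of y] by simp
    then show "norm (band a b v y) \<le> norm ((2 * B * (b - a) / pi) * (1 / (1 + y\<^sup>2)))"
      unfolding real_norm_def by linarith
  qed
qed measurable

text \<open>Inversion in the opposite direction: the decay in \<open>band_bound\<close> makes
  \<open>band\<close> integrable, and evenness of the spectrum removes the sign of the
  argument.\<close>

lemma fourier_band: "fourier (band a b v) u = even_ext a b v u"
proof -
  let ?V = "\<lambda>u. complex_of_real (even_ext a b v u)"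
  have c: "cft ?V = (\<lambda>y. 2 * pi * band a b v y)" by (rule ext) (simp add: cft_even_ext)
  have "isCont ?V (- u)" by (intro continuous_intros isCont_even_ext)
  then have "(LINT y|lborel. cft ?V y * cis (- (y * - u))) = 2 * pi * ?V (- u)"
    by (rule fourier_inversion[OF integrable_even_ext]) (simp add: c integrable_band)
  then have "2 * pi * (LINT y|lborel. band a b v y * cis (y * u)) = 2 * pi * ?V (- u)"
    by (simp add: c mult.assoc)
  then show ?thesis by (simp add: fourier_def even_ext_def)
qed

lemma band_zero: "band a b v 0 = (LINT u|lborel. indicator {a..b} u * v u) / pi"
  unfolding band_def by (simp add: scaleR_conv_of_real flip: of_real_mult)

lemma integrable_band_profile_square: "integrable lborel (\<lambda>u. indicator {a..b} u * (v u)\<^sup>2)"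
  using borel_integrable_compact[of "{a..b}" "\<lambda>u. (v u)\<^sup>2"] continuous_on_band_profile by (auto intro!: continuous_intros)

text \<open>Here equality matters, since the L2 norm is to be bounded from below and
  \<open>plancherel_le\<close> points the other way. As \<open>band\<close> and its spectrum are
  both integrable, Fubini together with \<open>fourier_band\<close> yields it directly.\<close>

lemma band_square:
  shows "integrable lborel (\<lambda>y. (band a b v y)\<^sup>2)"
    and "(LINT y|lborel. (band a b v y)\<^sup>2) = (LINT u|lborel. indicator {a..b} u * (v u)\<^sup>2) / pi"
proof -
  let ?V = "\<lambda>u. complex_of_real (even_ext a b v u)"
  let ?C = "2 * B * (b - a) / pi"
  have bb: "\<bar>band a b v y\<bar> \<le> ?C" for y
  proof -
    have "?C / (1 + y\<^sup>2) \<le> ?C / 1" using band_profile_bound_nonneg ab by (intro divide_left_mono) (auto simp: add_pos_nonneg)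
    then show ?thesis using band_bound[of y] by linarith
  qed
  show "integrable lborel (\<lambda>y. (band a b v y)\<^sup>2)"
  proof (rule Bochner_Integration.integrable_bound)
    show "integrable lborel (\<lambda>y. ?C * band a b v y)" using integrable_band by (rule integrable_mult_right)
    show "AE y in lborel. norm ((band a b v y)\<^sup>2) \<le> norm (?C * band a b v y)"
    proof (rule AE_I2)
      fix y
      have "norm ((band a b v y)\<^sup>2) = \<bar>band a b v y\<bar> * \<bar>band a b v y\<bar>" by (simp add: power2_eq_square abs_mult)
      also have "\<dots> \<le> \<bar>?C\<bar> * \<bar>band a b v y\<bar>" using bb[of y] by (intro mult_right_mono) linarith+
      finally show "norm ((band a b v y)\<^sup>2) \<le> norm (?C * band a b v y)" by (simp only: real_norm_def abs_mult)
    qed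
  qed measurable
  have g: "complex_of_real (band a b v y) = cft ?V y / (2 * pi)" for y by (simp add: cft_even_ext)
  have "complex_of_real (LINT y|lborel. (band a b v y)\<^sup>2) = (LINT y|lborel. complex_of_real (band a b v y) * complex_of_real (band a b v y))"
    by (subst integral_complex_of_real[symmetric]) (simp add: power2_eq_square)
  also have "\<dots> = (LINT y|lborel. complex_of_real (band a b v y) * (cft ?V y / (2 * pi)))"
    by (simp only: g)
  also have "\<dots> = (LINT y|lborel. LINT u|lborel. ?V u * complex_of_real (band a b v y) * cis (u * y)) / (2 * pi)"
    unfolding cft_def by (simp add: mult_ac flip: integral_mult_right_zero)
  also have "(LINT y|lborel. LINT u|lborel. ?V u * complex_of_real (band a b v y) * cis (u * y))
      = (LINT u|lborel. LINT y|lborel. ?V u * complex_of_real (band a b v y) * cis (u * y))"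
    by (rule Fubini_mult_bounded) (use integrable_even_ext integrable_band in \<open>auto intro!: lborel.sigma_finite_measure_axioms\<close>)
  also have "\<dots> = (LINT u|lborel. ?V u * fourier (band a b v) u)"
    unfolding fourier_def by (simp add: mult_ac flip: integral_mult_right_zero)
  also have "\<dots> = complex_of_real (LINT u|lborel. (even_ext a b v u)\<^sup>2)"
    by (subst integral_complex_of_real[symmetric]) (simp add: fourier_band power2_eq_square)
  finally have 1: "(LINT y|lborel. (band a b v y)\<^sup>2) = (LINT u|lborel. (even_ext a b v u)\<^sup>2) / (2 * pi)"
    by (metis (no_types, lifting) of_real_divide of_real_eq_iff)
  have cm: "(\<lambda>u. indicator {a..b} u * (v u)\<^sup>2) \<in> borel_measurable borel"
    using borel_measurable_integrable[OF integrable_band_profile_square] by simp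
  have "(\<integral>\<^sup>+u. ennreal ((even_ext a b v u)\<^sup>2) \<partial>lborel) = (\<integral>\<^sup>+u. indicator {u. a \<le> \<bar>u\<bar> \<and> \<bar>u\<bar> \<le> b} u * ennreal (indicator {a..b} \<bar>u\<bar> * (v \<bar>u\<bar>)\<^sup>2) \<partial>lborel)"
    by (intro nn_integral_cong) (auto simp: even_ext_def split: split_indicator)
  also have "\<dots> = 2 * (\<integral>\<^sup>+u. indicator {a..b} u * ennreal (indicator {a..b} u * (v u)\<^sup>2) \<partial>lborel)"
    by (rule nn_integral_even_ext[OF _ a]) (use cm in measurable)
  also have "(\<integral>\<^sup>+u. indicator {a..b} u * ennreal (indicator {a..b} u * (v u)\<^sup>2) \<partial>lborel) = (\<integral>\<^sup>+u. ennreal (indicator {a..b} u * (v u)\<^sup>2) \<partial>lborel)"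
    by (intro nn_integral_cong) (simp split: split_indicator)
  also have "\<dots> = ennreal (LINT u|lborel. indicator {a..b} u * (v u)\<^sup>2)"
    by (rule nn_integral_eq_integral[OF integrable_band_profile_square]) auto
  finally have 2: "(\<integral>\<^sup>+u. ennreal ((even_ext a b v u)\<^sup>2) \<partial>lborel) = ennreal (2 * (LINT u|lborel. indicator {a..b} u * (v u)\<^sup>2))"
    by (simp add: ennreal_mult')
  have nn: "0 \<le> (LINT u|lborel. indicator {a..b} u * (v u)\<^sup>2)" by (intro integral_nonneg_AE AE_I2) auto
  have "(LINT u|lborel. (even_ext a b v u)\<^sup>2) = 2 * (LINT u|lborel. indicator {a..b} u * (v u)\<^sup>2)"
    using nn by (subst integral_eq_nn_integral) (auto simp: 2)
  with 1 show "(LINT y|lborel. (band a b v y)\<^sup>2) = (LINT u|lborel. indicator {a..b} u * (v u)\<^sup>2) / pi" by simp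
qed

lemma nn_integral_even_ext_weighted:
  "(\<integral>\<^sup>+u. ennreal ((even_ext a b v u)\<^sup>2 * exp (2 * \<alpha> * \<bar>u\<bar> powr r)) \<partial>lborel)
    = ennreal (2 * (LINT u|lborel. indicator {a..b} u * ((v u)\<^sup>2 * exp (2 * \<alpha> * u powr r))))"
proof -
  have i: "integrable lborel (\<lambda>u. indicator {a..b} u * ((v u)\<^sup>2 * exp (2 * \<alpha> * u powr r)))"
  proof -
    have "continuous_on {a..b} (\<lambda>u. (v u)\<^sup>2 * exp (2 * \<alpha> * u powr r))"
      using continuous_on_band_profile a by (intro continuous_intros) auto
    from borel_integrable_compact[OF _ this] show ?thesis by simp
  qed
  have cm: "(\<lambda>u. indicator {a..b} u * ((v u)\<^sup>2 * exp (2 * \<alpha> * u powr r))) \<in> borel_measurable borel"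
    using borel_measurable_integrable[OF i] by simp
  have "(\<integral>\<^sup>+u. ennreal ((even_ext a b v u)\<^sup>2 * exp (2 * \<alpha> * \<bar>u\<bar> powr r)) \<partial>lborel)
     = (\<integral>\<^sup>+u. indicator {u. a \<le> \<bar>u\<bar> \<and> \<bar>u\<bar> \<le> b} u * ennreal (indicator {a..b} \<bar>u\<bar> * ((v \<bar>u\<bar>)\<^sup>2 * exp (2 * \<alpha> * \<bar>u\<bar> powr r))) \<partial>lborel)"
    by (intro nn_integral_cong) (auto simp: even_ext_def split: split_indicator)
  also have "\<dots> = 2 * (\<integral>\<^sup>+u. indicator {a..b} u * ennreal (indicator {a..b} u * ((v u)\<^sup>2 * exp (2 * \<alpha> * u powr r))) \<partial>lborel)"
    by (rule nn_integral_even_ext[OF _ a]) (use cm in measurable)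
  also have "(\<integral>\<^sup>+u. indicator {a..b} u * ennreal (indicator {a..b} u * ((v u)\<^sup>2 * exp (2 * \<alpha> * u powr r))) \<partial>lborel) = (\<integral>\<^sup>+u. ennreal (indicator {a..b} u * ((v u)\<^sup>2 * exp (2 * \<alpha> * u powr r))) \<partial>lborel)"
    by (intro nn_integral_cong) (simp split: split_indicator)
  also have "\<dots> = ennreal (LINT u|lborel. indicator {a..b} u * ((v u)\<^sup>2 * exp (2 * \<alpha> * u powr r)))"
    by (rule nn_integral_eq_integral[OF i]) auto
  finally show ?thesis by (simp add: ennreal_mult')
qed

text \<open>In frequency the convolution multiplies \<open>v\<close> by the characteristic function
  of the noise. The result is again an oscillatory integral over \<open>{a..b}\<close>, so its decay
  reduces to derivative bounds for that product.\<close>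

lemma conv_band:
  assumes fe: "prob_density fe"
  shows "conv (band a b v) fe y = Re (LINT u|lborel. indicator {a..b} u *\<^sub>R (complex_of_real (v u) * fourier fe u * cis (- (u * y)))) / pi"
proof -
  note [measurable] = prob_densityD(1)[OF fe]
  let ?w = "\<lambda>u. indicator {a..b} u *\<^sub>R complex_of_real (v u)"
  have wi: "integrable lborel ?w"
    by (intro integrable_indicator_Icc continuous_intros continuous_on_band_profile)
  have fi: "integrable lborel (\<lambda>e. complex_of_real (fe e))" using prob_densityD(3)[OF fe] by simp
  let ?J = "\<lambda>e. LINT u|lborel. ?w u * complex_of_real (fe e) * cis (- (u * (y - e)))"
  have J: "band a b v (y - e) * fe e = Re (?J e) / pi" for e
  proof -
    have "?J e = (LINT u|lborel. indicator {a..b} u *\<^sub>R (complex_of_real (v u) * cis (- (u * (y - e))))) * complex_of_real (fe e)"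
      unfolding integral_mult_left_zero[symmetric] by (intro Bochner_Integration.integral_cong refl) (simp add: mult_ac)
    then show ?thesis by (simp add: band_def)
  qed
  have pi': "integrable (lborel \<Otimes>\<^sub>M lborel) (\<lambda>(u, e). ?w u * complex_of_real (fe e) * cis (- (u * (y - e))))"
    by (rule integrable_pair_mult_bounded) (use wi fi in \<open>auto intro!: lborel.sigma_finite_measure_axioms\<close>)
  have Ji: "integrable lborel ?J"
    using lborel_pair.integrable_snd[OF pi'] by simp
  have "conv (band a b v) fe y = (LINT e|lborel. Re (?J e) / pi)" unfolding conv_def by (simp only: J)
  also have "\<dots> = Re (LINT e|lborel. ?J e) / pi" using Ji by simp
  also have "(LINT e|lborel. ?J e) = (LINT u|lborel. LINT e|lborel. ?w u * complex_of_real (fe e) * cis (- (u * (y - e))))"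
    by (rule Fubini_mult_bounded) (use wi fi in \<open>auto intro!: lborel.sigma_finite_measure_axioms\<close>)
  also have "\<dots> = (LINT u|lborel. LINT e|lborel. ?w u * cis (- (u * y)) * (complex_of_real (fe e) * cis (e * u)))"
    by (intro Bochner_Integration.integral_cong refl) (simp add: cis_mult algebra_simps)
  also have "\<dots> = (LINT u|lborel. indicator {a..b} u *\<^sub>R (complex_of_real (v u) * fourier fe u * cis (- (u * y))))"
    unfolding integral_mult_right_zero fourier_def by (intro Bochner_Integration.integral_cong refl) (simp add: mult_ac)
  finally show ?thesis .
qed

end

section \<open>The two hypotheses\<close>

lemma fourier_shift: "fourier (\<lambda>y. g (y - x)) u = cis (x * u) * fourier g u"
proof -
  have "fourier (\<lambda>y. g (y - x)) u = (LINT y|lborel. complex_of_real (g y) * cis ((x + y) * u))"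
    unfolding fourier_def by (subst lborel_integral_real_affine[where c=1 and t=x]) auto
  also have "\<dots> = (LINT y|lborel. cis (x * u) * (complex_of_real (g y) * cis (y * u)))"
    by (intro Bochner_Integration.integral_cong refl) (simp add: cis_mult algebra_simps)
  finally show ?thesis by (simp add: fourier_def)
qed

lemma integrable_shift: "integrable lborel g \<Longrightarrow> integrable lborel (\<lambda>y::real. g (y - x) :: real)"
  using lborel_integrable_real_affine[of g 1 "-x"] by simp

lemma integral_shift: "(LINT y|lborel. g (y - x :: real)) = (LINT y|lborel. g y :: real)"
  by (subst lborel_integral_real_affine[where c=1 and t=x]) auto

context
  fixes a b B :: real and v :: "real \<Rightarrow> real" and v1 v2 :: "real \<Rightarrow> complex"
    and f0 fe :: "real \<Rightarrow> real" and c B0 m E \<alpha> r L \<eta> x :: real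
  assumes a: "1 < a" and ab: "a < b"
    and d: "\<And>u. u \<in> {a..b} \<Longrightarrow> ((\<lambda>u. complex_of_real (v u)) has_vector_derivative v1 u) (at u within {a..b})"
    and d1: "\<And>u. u \<in> {a..b} \<Longrightarrow> (v1 has_vector_derivative v2 u) (at u within {a..b})"
    and d2: "continuous_on {a..b} v2"
    and z: "v a = 0" "v b = 0" "v1 a = 0" "v1 b = 0"
    and B: "\<And>u. u \<in> {a..b} \<Longrightarrow> \<bar>v u\<bar> \<le> B" "\<And>u. u \<in> {a..b} \<Longrightarrow> cmod (v2 u) \<le> B"
    and f0: "prob_density f0" and f0cont: "continuous_on UNIV f0" and c: "0 < c"
    and f0c: "\<And>y. c / (1 + y\<^sup>2) \<le> f0 y" and B0: "\<And>y. f0 y \<le> B0"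
    and f0F: "\<And>u. 1 < \<bar>u\<bar> \<Longrightarrow> fourier f0 u = 0"
    and f0w: "(\<integral>\<^sup>+ u. ennreal ((cmod (fourier f0 u))\<^sup>2 * exp (2 * \<alpha> * \<bar>u\<bar> powr r)) \<partial>lborel) \<le> ennreal \<eta>"
    and \<eta>: "0 \<le> \<eta>"
    and fe: "prob_density fe" and m: "0 < m" "1 / 2 \<le> (LINT e|lborel. indicator {-m..m} e * fe e)"
    and E: "\<And>y. \<bar>conv (band a b v) fe y\<bar> \<le> E / (1 + y\<^sup>2)"
    and small: "2 * B * (b - a) / pi \<le> c"
    and weight: "\<eta> + 2 * (LINT u|lborel. indicator {a..b} u * ((v u)\<^sup>2 * exp (2 * \<alpha> * u powr r))) \<le> 2 * pi * L"
begin

lemma band_start_pos: "0 < a" using a by simp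

lemma fourier_band': "fourier (band a b v) u = even_ext a b v u"
  by (rule fourier_band[OF band_start_pos ab d d1 d2 z B])

text \<open>The spectrum of \<open>f0\<close> lies in |u| \<le> 1, that of the perturbation in |u|
  \<ge> a > 1. So for either sign the squared moduli add without a cross term and share the budget
  2\<pi>L, and the perturbation has integral 0 because its transform vanishes at 0. Positivity
  compares two bounds of order 1/(1 + y^2). The shift to \<open>x\<close> only rotates the
  transform.\<close>

lemma perturbed_density:
  assumes \<epsilon>: "\<epsilon> = 1 \<or> \<epsilon> = -1"
  shows "prob_density (\<lambda>y. f0 (y - x) + \<epsilon> * band a b v (y - x))"
    and "(\<lambda>y. f0 (y - x) + \<epsilon> * band a b v (y - x)) \<in> dens_class \<alpha> r L"
proof -
  note [measurable] = prob_densityD(1)[OF f0]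
  have [measurable]: "band a b v \<in> borel_measurable borel" by (rule borel_measurable_band[OF band_start_pos ab d d1 d2 z B])
  have bi: "integrable lborel (band a b v)" by (rule integrable_band[OF band_start_pos ab d d1 d2 z B])
  have b0: "(LINT y|lborel. band a b v y) = 0"
  proof -
    have "complex_of_real (LINT y|lborel. band a b v y) = fourier (band a b v) 0" by (simp add: fourier_def)
    also have "\<dots> = 0" using a by (simp add: fourier_band' even_ext_def)
    finally show ?thesis by (simp only: of_real_eq_0_iff)
  qed
  have bb: "\<bar>band a b v y\<bar> \<le> f0 y" for y
  proof -
    have "\<bar>band a b v y\<bar> \<le> (2 * B * (b - a) / pi) / (1 + y\<^sup>2)" by (rule band_bound[OF band_start_pos ab d d1 d2 z B])
    also have "\<dots> \<le> c / (1 + y\<^sup>2)" by (rule divide_right_mono[OF small]) simp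
    finally show ?thesis using f0c[of y] by linarith
  qed
  have nn: "0 \<le> f0 y + \<epsilon> * band a b v y" for y using bb[of y] \<epsilon> by auto
  let ?f = "\<lambda>y. f0 y + \<epsilon> * band a b v y"
  have fi: "integrable lborel ?f" using prob_densityD(3)[OF f0] bi by simp
  have f1: "(LINT y|lborel. ?f y) = 1" using prob_densityD(3,4)[OF f0] bi b0 by simp
  have [measurable]: "?f \<in> borel_measurable borel" by measurable
  have [measurable]: "(\<lambda>y. ?f (y - x)) \<in> borel_measurable borel" by measurable
  show pd: "prob_density (\<lambda>y. f0 (y - x) + \<epsilon> * band a b v (y - x))"
    unfolding prob_density_def using nn integrable_shift[OF fi, of x] integral_shift[of ?f x] f1 by simp
  have \<Phi>: "fourier (\<lambda>y. ?f (y - x)) u = cis (x * u) * (fourier f0 u + \<epsilon> * even_ext a b v u)" for u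
  proof -
    have "fourier ?f u = (LINT y|lborel. complex_of_real (f0 y) * cis (y * u) + complex_of_real \<epsilon> * (complex_of_real (band a b v y) * cis (y * u)))"
      unfolding fourier_def by (simp add: algebra_simps)
    also have "\<dots> = fourier f0 u + \<epsilon> * fourier (band a b v) u"
      unfolding fourier_def using prob_densityD(3)[OF f0] bi
      by (subst Bochner_Integration.integral_add) (auto intro!: integrable_mult_cis)
    finally show ?thesis unfolding fourier_shift[of ?f] by (simp add: fourier_band')
  qed
  have \<Phi>2: "(cmod (fourier (\<lambda>y. ?f (y - x)) u))\<^sup>2 = (cmod (fourier f0 u))\<^sup>2 + (even_ext a b v u)\<^sup>2" for u
  proof (cases "1 < \<bar>u\<bar>")
    case True
    then show ?thesis using \<epsilon> f0F[OF True] by (auto simp: \<Phi> norm_mult)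
  next
    case False
    then have "even_ext a b v u = 0" using a by (simp add: even_ext_def)
    then show ?thesis by (simp add: \<Phi> norm_mult)
  qed
  have [measurable]: "fourier f0 \<in> borel_measurable borel"
    using borel_measurable_cft[of "\<lambda>x. complex_of_real (f0 x)"] prob_densityD[OF f0]
    by (simp add: fourier_eq_cft[abs_def])
  have [measurable]: "even_ext a b v \<in> borel_measurable borel" by (rule borel_measurable_even_ext[OF band_start_pos ab d d1 d2 z B])
  have ew: "(\<integral>\<^sup>+u. ennreal ((even_ext a b v u)\<^sup>2 * exp (2 * \<alpha> * \<bar>u\<bar> powr r)) \<partial>lborel)
    = ennreal (2 * (LINT u|lborel. indicator {a..b} u * ((v u)\<^sup>2 * exp (2 * \<alpha> * u powr r))))"
    by (rule nn_integral_even_ext_weighted[OF band_start_pos ab d d1 d2 z B])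
  have "(\<integral>\<^sup>+ u. ennreal ((cmod (fourier (\<lambda>y. ?f (y - x)) u))\<^sup>2 * exp (2 * \<alpha> * \<bar>u\<bar> powr r)) \<partial>lborel)
     = (\<integral>\<^sup>+ u. ennreal ((cmod (fourier f0 u))\<^sup>2 * exp (2 * \<alpha> * \<bar>u\<bar> powr r)) + ennreal ((even_ext a b v u)\<^sup>2 * exp (2 * \<alpha> * \<bar>u\<bar> powr r)) \<partial>lborel)"
    unfolding \<Phi>2 by (simp add: distrib_right)
  also have "\<dots> = (\<integral>\<^sup>+ u. ennreal ((cmod (fourier f0 u))\<^sup>2 * exp (2 * \<alpha> * \<bar>u\<bar> powr r)) \<partial>lborel) + (\<integral>\<^sup>+ u. ennreal ((even_ext a b v u)\<^sup>2 * exp (2 * \<alpha> * \<bar>u\<bar> powr r)) \<partial>lborel)"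
    by (rule nn_integral_add) measurable
  also have "\<dots> \<le> ennreal \<eta> + ennreal (2 * (LINT u|lborel. indicator {a..b} u * ((v u)\<^sup>2 * exp (2 * \<alpha> * u powr r))))"
    unfolding ew by (rule add_mono[OF f0w order_refl])
  also have "\<dots> = ennreal (\<eta> + 2 * (LINT u|lborel. indicator {a..b} u * ((v u)\<^sup>2 * exp (2 * \<alpha> * u powr r))))"
    using \<eta> by (intro ennreal_plus[symmetric]) (auto intro!: integral_nonneg_AE)
  also have "\<dots> \<le> ennreal (2 * pi * L)" by (rule ennreal_leI[OF weight])
  finally have w: "(\<integral>\<^sup>+ u. ennreal ((cmod (fourier (\<lambda>y. ?f (y - x)) u))\<^sup>2 * exp (2 * \<alpha> * \<bar>u\<bar> powr r)) \<partial>lborel) \<le> ennreal (2 * pi * L)" .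
  have "continuous_on UNIV (\<lambda>y. f0 (y - x) + \<epsilon> * band a b v (y - x))"
    by (intro continuous_intros continuous_on_compose2[OF f0cont] continuous_on_compose2[OF continuous_on_band[OF band_start_pos ab d d1 d2 z B, of UNIV]]) auto
  then show "(\<lambda>y. f0 (y - x) + \<epsilon> * band a b v (y - x)) \<in> dens_class \<alpha> r L"
    unfolding dens_class_def using pd w by simp
qed

lemma conv_shift: "conv (\<lambda>y. g (y - x)) fe y = conv g fe (y - x)"
  unfolding conv_def by (simp add: algebra_simps)

lemma prob_density_base_shift: "prob_density (\<lambda>y. f0 (y - x))"
  using f0 integrable_shift[of f0 x] integral_shift[of f0 x] unfolding prob_density_def by auto

text \<open>With both hypotheses centred at \<open>x\<close>, the perturbation at \<open>x\<close>
  is the value of \<open>band\<close> at 0, where all frequencies are in phase; the bound is the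
  same for every \<open>x\<close>.\<close>

lemma minimax_risk_pt_lower:
  assumes "T \<in> estimators n"
  shows "ennreal ((band a b v 0)\<^sup>2 * (1 - 2 * sqrt ((1 + chi_bound c m E) ^ n - 1))) \<le> risk_pt fe \<alpha> r L n x T"
proof -
  have "ennreal ((band a b v (x - x))\<^sup>2 * (1 - 2 * sqrt ((1 + chi_bound c m E) ^ n - 1))) \<le> risk_pt fe \<alpha> r L n x T"
    by (rule risk_pt_lower_bound[where ?f0.0="\<lambda>y. f0 (y - x)" and G="\<lambda>y. band a b v (y - x)" and x=x, OF fe prob_density_base_shift _ _ B0 c f0c m])
       (use perturbed_density[of 1] perturbed_density[of "-1"] E assms in \<open>simp_all add: conv_shift\<close>)
  then show ?thesis by simp
qed

lemma minimax_risk_L2_lower: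
  assumes "T \<in> estimators n"
  shows "ennreal ((LINT u|lborel. indicator {a..b} u * (v u)\<^sup>2) / pi * (1 - 2 * sqrt ((1 + chi_bound c m E) ^ n - 1))) \<le> risk_L2 fe \<alpha> r L n T"
proof -
  have sq1: "integrable lborel (\<lambda>y. (band a b v y)\<^sup>2)" by (rule band_square(1)[OF band_start_pos ab d d1 d2 z B])
  have sq2: "(LINT y|lborel. (band a b v y)\<^sup>2) = (LINT u|lborel. indicator {a..b} u * (v u)\<^sup>2) / pi"
    by (rule band_square(2)[OF band_start_pos ab d d1 d2 z B])
  have "ennreal ((LINT y|lborel. (band a b v (y - x))\<^sup>2) * (1 - 2 * sqrt ((1 + chi_bound c m E) ^ n - 1))) \<le> risk_L2 fe \<alpha> r L n T"
    by (rule risk_L2_lower_bound[where ?f0.0="\<lambda>y. f0 (y - x)" and G="\<lambda>y. band a b v (y - x)" and x=x, OF fe prob_density_base_shift _ _ B0 c f0c m])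
       (use perturbed_density[of 1] perturbed_density[of "-1"] E assms integrable_shift[OF sq1] in \<open>simp_all add: conv_shift\<close>)
  then show ?thesis using integral_shift[of "\<lambda>y. (band a b v y)\<^sup>2" x] by (simp add: sq2)
qed

end

section \<open>The cut-off spectrum and its derivative bounds\<close>

lemma C2_bound_of_real:
  assumes "0 \<le> B" "0 \<le> k" "continuous_on S g2"
    and "\<And>u. u \<in> S \<Longrightarrow> (g has_real_derivative g1 u) (at u within S)"
    and "\<And>u. u \<in> S \<Longrightarrow> (g1 has_real_derivative g2 u) (at u within S)"
    and "\<And>u. u \<in> S \<Longrightarrow> \<bar>g u\<bar> \<le> B" "\<And>u. u \<in> S \<Longrightarrow> \<bar>g1 u\<bar> \<le> B * k" "\<And>u. u \<in> S \<Longrightarrow> \<bar>g2 u\<bar> \<le> B * k\<^sup>2"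
  shows "C2_bound S B k (\<lambda>u. complex_of_real (g u)) (\<lambda>u. complex_of_real (g1 u)) (\<lambda>u. complex_of_real (g2 u))"
  unfolding C2_bound_def using assms by (auto intro!: has_vector_derivative_of_real continuous_intros)

text \<open>The squares make the function and its first derivative vanish at both ends, as two
  integrations by parts require; away from the ends the value is exponentially close to 1. Each
  unsquared factor satisfies \<open>C2_bound\<close> with size 1 and price \<open>m\<close>.\<close>

definition cutoff :: "real \<Rightarrow> real \<Rightarrow> real \<Rightarrow> real \<Rightarrow> real" where
  "cutoff a b m u = (1 - exp (- m * (u - a)))\<^sup>2 * (1 - exp (- m * (b - u)))\<^sup>2"

definition bump :: "real \<Rightarrow> real \<Rightarrow> real \<Rightarrow> real \<Rightarrow> real \<Rightarrow> real \<Rightarrow> real \<Rightarrow> real" where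
  "bump \<alpha> r a b m A u = A * (cutoff a b m u * exp (- 2 * \<alpha> * u powr r))"

lemma C2_bound_one_minus_exp_left:
  assumes "0 \<le> m"
  shows "C2_bound {a..b} 1 m (\<lambda>u. complex_of_real (1 - exp (- m * (u - a))))
    (\<lambda>u. complex_of_real (m * exp (- m * (u - a)))) (\<lambda>u. complex_of_real (- (m\<^sup>2 * exp (- m * (u - a)))))"
proof (rule C2_bound_of_real)
  fix u assume u: "u \<in> {a..b}"
  then have le: "exp (- m * (u - a)) \<le> 1" using assms by simp
  show "((\<lambda>u. 1 - exp (- m * (u - a))) has_real_derivative m * exp (- m * (u - a))) (at u within {a..b})"
    by (auto intro!: derivative_eq_intros)
  show "((\<lambda>u. m * exp (- m * (u - a))) has_real_derivative - (m\<^sup>2 * exp (- m * (u - a)))) (at u within {a..b})"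
    by (auto intro!: derivative_eq_intros simp: power2_eq_square)
  show "\<bar>1 - exp (- m * (u - a))\<bar> \<le> 1" using le by simp
  show "\<bar>m * exp (- m * (u - a))\<bar> \<le> 1 * m" using le assms mult_left_le[OF le assms] by (simp add: abs_mult)
  show "\<bar>- (m\<^sup>2 * exp (- m * (u - a)))\<bar> \<le> 1 * m\<^sup>2" using mult_left_le[OF le, of "m\<^sup>2"] by (simp add: abs_mult)
qed (use assms in \<open>auto intro!: continuous_intros\<close>)

lemma C2_bound_one_minus_exp_right:
  assumes "0 \<le> m"
  shows "C2_bound {a..b} 1 m (\<lambda>u. complex_of_real (1 - exp (- m * (b - u))))
    (\<lambda>u. complex_of_real (- (m * exp (- m * (b - u))))) (\<lambda>u. complex_of_real (- (m\<^sup>2 * exp (- m * (b - u)))))"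
proof (rule C2_bound_of_real)
  fix u assume u: "u \<in> {a..b}"
  then have le: "exp (- m * (b - u)) \<le> 1" using assms by simp
  show "((\<lambda>u. 1 - exp (- m * (b - u))) has_real_derivative - (m * exp (- m * (b - u)))) (at u within {a..b})"
    by (auto intro!: derivative_eq_intros)
  show "((\<lambda>u. - (m * exp (- m * (b - u)))) has_real_derivative - (m\<^sup>2 * exp (- m * (b - u)))) (at u within {a..b})"
    by (auto intro!: derivative_eq_intros simp: power2_eq_square)
  show "\<bar>1 - exp (- m * (b - u))\<bar> \<le> 1" using le by simp
  show "\<bar>- (m * exp (- m * (b - u)))\<bar> \<le> 1 * m" using le assms mult_left_le[OF le assms] by (simp add: abs_mult)
  show "\<bar>- (m\<^sup>2 * exp (- m * (b - u)))\<bar> \<le> 1 * m\<^sup>2" using mult_left_le[OF le, of "m\<^sup>2"] by (simp add: abs_mult)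
qed (use assms in \<open>auto intro!: continuous_intros\<close>)

text \<open>Differentiation brings down 2\<alpha>r u^(r-1), which is at most 2\<alpha>r b because r
  < 2 and u \<ge> 1. The \<open>+ 1\<close> in the price absorbs the extra term with u^(r-2) in the
  second derivative.\<close>

lemma C2_bound_exp_powr:
  assumes \<alpha>: "0 < \<alpha>" and r: "0 < r" "r < 2" and a: "1 \<le> a" and ab: "a \<le> b"
  shows "C2_bound {a..b} (exp (- 2 * \<alpha> * a powr r)) ((2 * \<alpha> * r + 1) * b)
    (\<lambda>u. complex_of_real (exp (- 2 * \<alpha> * u powr r)))
    (\<lambda>u. complex_of_real (- (2 * \<alpha> * r * u powr (r - 1)) * exp (- 2 * \<alpha> * u powr r)))
    (\<lambda>u. complex_of_real (((2 * \<alpha> * r * u powr (r - 1))\<^sup>2 - 2 * \<alpha> * r * (r - 1) * u powr (r - 2)) * exp (- 2 * \<alpha> * u powr r)))"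
proof (rule C2_bound_of_real)
  let ?E = "exp (- 2 * \<alpha> * a powr r)"
  show "0 \<le> (2 * \<alpha> * r + 1) * b" using assms by simp
  show "continuous_on {a..b} (\<lambda>u. ((2 * \<alpha> * r * u powr (r - 1))\<^sup>2 - 2 * \<alpha> * r * (r - 1) * u powr (r - 2)) * exp (- 2 * \<alpha> * u powr r))"
    using a by (intro continuous_intros) auto
  fix u assume u: "u \<in> {a..b}"
  then have u1: "1 \<le> u" "u \<le> b" "0 < u" using a by auto
  have eE: "exp (- 2 * \<alpha> * u powr r) \<le> ?E" using u a r \<alpha> by (auto intro!: powr_mono2)
  have p1: "u powr (r - 1) \<le> b"
  proof -
    have "u powr (r - 1) \<le> u powr 1" using u1 r by (intro powr_mono) auto
    then show ?thesis using u1 by simp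
  qed
  have p2: "u powr (r - 2) \<le> 1" using powr_mono[of "r - 2" 0 u] u1 r by simp
  show "((\<lambda>u. exp (- 2 * \<alpha> * u powr r)) has_real_derivative - (2 * \<alpha> * r * u powr (r - 1)) * exp (- 2 * \<alpha> * u powr r)) (at u within {a..b})"
    using u1 by (auto intro!: derivative_eq_intros)
  show "((\<lambda>u. - (2 * \<alpha> * r * u powr (r - 1)) * exp (- 2 * \<alpha> * u powr r)) has_real_derivative
     ((2 * \<alpha> * r * u powr (r - 1))\<^sup>2 - 2 * \<alpha> * r * (r - 1) * u powr (r - 2)) * exp (- 2 * \<alpha> * u powr r)) (at u within {a..b})"
    using u1 by (auto intro!: derivative_eq_intros simp: power2_eq_square algebra_simps)
  show "\<bar>exp (- 2 * \<alpha> * u powr r)\<bar> \<le> ?E" using eE by simp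
  have q1: "\<bar>2 * \<alpha> * r * u powr (r - 1)\<bar> \<le> 2 * \<alpha> * r * b" using p1 \<alpha> r by (simp add: abs_mult)
  have b1: "1 \<le> b" using u1 by simp
  have "\<bar>- (2 * \<alpha> * r * u powr (r - 1)) * exp (- 2 * \<alpha> * u powr r)\<bar> \<le> (2 * \<alpha> * r + 1) * b * ?E"
    unfolding abs_mult abs_minus_cancel using q1 eE b1 \<alpha> r by (intro mult_mono) (auto simp: algebra_simps abs_mult)
  then show "\<bar>- (2 * \<alpha> * r * u powr (r - 1)) * exp (- 2 * \<alpha> * u powr r)\<bar> \<le> ?E * ((2 * \<alpha> * r + 1) * b)" by (simp add: mult_ac)
  have "\<bar>(2 * \<alpha> * r * u powr (r - 1))\<^sup>2 - 2 * \<alpha> * r * (r - 1) * u powr (r - 2)\<bar> \<le> (2 * \<alpha> * r * b)\<^sup>2 + 2 * \<alpha> * r"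
  proof -
    have "(2 * \<alpha> * r * u powr (r - 1))\<^sup>2 \<le> (2 * \<alpha> * r * b)\<^sup>2" using q1 by (simp add: abs_le_square_iff[symmetric])
    moreover have "\<bar>2 * \<alpha> * r * (r - 1) * u powr (r - 2)\<bar> \<le> 2 * \<alpha> * r"
    proof -
      have "\<bar>r - 1\<bar> * u powr (r - 2) \<le> 1 * 1" using p2 r by (intro mult_mono) auto
      then have "2 * \<alpha> * r * (\<bar>r - 1\<bar> * u powr (r - 2)) \<le> 2 * \<alpha> * r * 1" using \<alpha> r by (intro mult_left_mono) auto
      then show ?thesis using \<alpha> r by (simp add: abs_mult mult.assoc)
    qed
    moreover have "0 \<le> (2 * \<alpha> * r * u powr (r - 1))\<^sup>2" by simp
    ultimately show ?thesis by linarith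
  qed
  also have "\<dots> \<le> ((2 * \<alpha> * r + 1) * b)\<^sup>2"
  proof -
    have "1 \<le> b\<^sup>2" using b1 by (rule one_le_power)
    then have "2 * \<alpha> * r * 1 \<le> 2 * \<alpha> * r * b\<^sup>2" using \<alpha> r by (intro mult_left_mono) auto
    moreover have "((2 * \<alpha> * r + 1) * b)\<^sup>2 = (2 * \<alpha> * r * b)\<^sup>2 + 2 * (2 * \<alpha> * r * b\<^sup>2) + b\<^sup>2"
      by (simp add: power2_eq_square algebra_simps)
    moreover have "0 \<le> 2 * \<alpha> * r * b\<^sup>2" using \<alpha> r by simp
    ultimately show ?thesis using \<open>1 \<le> b\<^sup>2\<close> by linarith
  qed
  finally have "\<bar>(2 * \<alpha> * r * u powr (r - 1))\<^sup>2 - 2 * \<alpha> * r * (r - 1) * u powr (r - 2)\<bar> * exp (- 2 * \<alpha> * u powr r) \<le> ((2 * \<alpha> * r + 1) * b)\<^sup>2 * ?E"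
    using eE by (intro mult_mono) auto
  then show "\<bar>((2 * \<alpha> * r * u powr (r - 1))\<^sup>2 - 2 * \<alpha> * r * (r - 1) * u powr (r - 2)) * exp (- 2 * \<alpha> * u powr r)\<bar> \<le> ?E * ((2 * \<alpha> * r + 1) * b)\<^sup>2"
    by (simp only: abs_mult abs_exp_cancel mult.commute[of ?E])
qed simp

text \<open>The four exponential factors account for the price \<open>4 * m\<close>. In the
  derivative given by the product rule every term keeps a vanishing factor at each end, so it
  vanishes there too.\<close>

lemma C2_bound_bump:
  assumes \<alpha>: "0 < \<alpha>" and r: "0 < r" "r < 2" and a: "1 \<le> a" and ab: "a \<le> b" and m: "0 \<le> m" and A: "0 \<le> A"
  obtains v1 v2 where "C2_bound {a..b} (A * exp (- 2 * \<alpha> * a powr r)) (4 * m + (2 * \<alpha> * r + 1) * b)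
      (\<lambda>u. complex_of_real (bump \<alpha> r a b m A u)) v1 v2" "v1 a = 0" "v1 b = 0"
proof -
  note P = C2_bound_one_minus_exp_left[OF m, of a b] and Q = C2_bound_one_minus_exp_right[OF m, of a b]
  note E = C2_bound_exp_powr[OF \<alpha> r a ab]
  have C: "C2_bound {a..b} A 0 (\<lambda>u. complex_of_real A) (\<lambda>u. complex_of_real 0) (\<lambda>u. complex_of_real 0)"
    by (rule C2_bound_of_real) (use A in auto)
  note M = C2_bound_mult[OF C C2_bound_mult[OF C2_bound_mult[OF C2_bound_mult[OF P P] C2_bound_mult[OF Q Q]] E]]
  have 1: "A * (1 * 1 * (1 * 1) * exp (- 2 * \<alpha> * a powr r)) = A * exp (- 2 * \<alpha> * a powr r)" by simp
  have 2: "0 + (m + m + (m + m) + (2 * \<alpha> * r + 1) * b) = 4 * m + (2 * \<alpha> * r + 1) * b" by simp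
  have 3: "complex_of_real A * (complex_of_real (1 - exp (- m * (u - a))) * complex_of_real (1 - exp (- m * (u - a))) *
      (complex_of_real (1 - exp (- m * (b - u))) * complex_of_real (1 - exp (- m * (b - u)))) * complex_of_real (exp (- 2 * \<alpha> * u powr r)))
    = complex_of_real (bump \<alpha> r a b m A u)" for u
    by (simp add: bump_def cutoff_def power2_eq_square)
  show ?thesis by (rule that[OF M[unfolded 1 2 3]]) simp_all
qed

lemma bump_zero: "bump \<alpha> r a b m A a = 0" "bump \<alpha> r a b m A b = 0"
  by (simp_all add: bump_def cutoff_def)

text \<open>Raising the exponents to a natural number \<open>K\<close> makes the polynomial factors
  largest at \<open>b\<close>, while the exponential is largest at \<open>a\<close>. Price 1 is
  possible because (N) and (ND) bound the function and both derivatives by the same exponential up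
  to polynomial factors.\<close>

lemma noise_C2_bound:
  assumes N: "assumption_N \<beta> s \<Phi>" and ND: "assumption_ND \<beta> s \<Phi>"
  obtains C K a0 D1 D2 where "0 < C" "1 \<le> a0"
    "\<And>a b. a0 \<le> a \<Longrightarrow> a \<le> b \<Longrightarrow> C2_bound {a..b} (C * b ^ K * exp (- \<beta> * a powr s)) 1 \<Phi> D1 D2"
proof -
  obtain u0 bmin bmax \<gamma> \<gamma>' where N': "0 < u0" "0 < bmax" "0 < \<beta>" "0 < s"
     "\<And>u. u0 \<le> \<bar>u\<bar> \<Longrightarrow> cmod (\<Phi> u) \<le> bmax * \<bar>u\<bar> powr \<gamma>' * exp (- \<beta> * \<bar>u\<bar> powr s)"
    using N unfolding assumption_N_def by metis
  obtain u1 B \<gamma>1 D1 D2 where ND': "0 < u1" "0 < B"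
      "\<And>u. u1 \<le> \<bar>u\<bar> \<Longrightarrow> (\<Phi> has_vector_derivative D1 u) (at u within {v. u1 \<le> \<bar>v\<bar>})"
      "\<And>u. u1 \<le> \<bar>u\<bar> \<Longrightarrow> (D1 has_vector_derivative D2 u) (at u within {v. u1 \<le> \<bar>v\<bar>})"
      "\<And>u. u1 \<le> \<bar>u\<bar> \<Longrightarrow> max (cmod (D1 u)) (cmod (D2 u)) \<le> B * \<bar>u\<bar> powr \<gamma>1 * exp (- \<beta> * \<bar>u\<bar> powr s)"
      "continuous_on {v. u1 \<le> \<bar>v\<bar>} D2"
    using ND unfolding assumption_ND_def by metis
  obtain K where K: "max \<gamma>' \<gamma>1 \<le> real K" using real_arch_simple by blast
  define C where "C = max bmax B"
  have C: "bmax \<le> C" "B \<le> C" "0 < C" using N'(2) by (auto simp: C_def)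
  define a0 where "a0 = max 1 (max u0 u1)"
  have bd: "X \<le> C * b ^ K * exp (- \<beta> * a powr s)"
    if X: "X \<le> B' * \<bar>u\<bar> powr g * exp (- \<beta> * \<bar>u\<bar> powr s)" and "B' \<le> C" "0 < B'" "g \<le> real K" "1 \<le> a" "a \<le> u" "u \<le> b" for X B' u g a b
  proof -
    have "\<bar>u\<bar> powr g \<le> b ^ K"
    proof -
      have "\<bar>u\<bar> powr g \<le> u powr real K" using that by (simp add: powr_mono)
      also have "\<dots> = u ^ K" using that by (simp add: powr_realpow)
      also have "\<dots> \<le> b ^ K" using that by (intro power_mono) auto
      finally show ?thesis .
    qed
    moreover have "exp (- \<beta> * \<bar>u\<bar> powr s) \<le> exp (- \<beta> * a powr s)" using that N'(3,4) by (auto intro!: powr_mono2)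
    ultimately have "B' * \<bar>u\<bar> powr g * exp (- \<beta> * \<bar>u\<bar> powr s) \<le> C * b ^ K * exp (- \<beta> * a powr s)"
      using that C by (intro mult_mono) auto
    then show ?thesis using X by linarith
  qed
  show ?thesis
  proof (rule that[of C a0 K D1 D2])
    show "0 < C" "1 \<le> a0" using C by (auto simp: a0_def)
    fix a b :: real assume a: "a0 \<le> a" and ab: "a \<le> b"
    have sub: "{a..b} \<subseteq> {v. u1 \<le> \<bar>v\<bar>}" using a by (auto simp: a0_def)
    show "C2_bound {a..b} (C * b ^ K * exp (- \<beta> * a powr s)) 1 \<Phi> D1 D2"
      unfolding C2_bound_def
    proof (intro conjI ballI)
      show "0 \<le> C * b ^ K * exp (- \<beta> * a powr s)" using C a ab by (auto simp: a0_def)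
      show "continuous_on {a..b} D2" by (rule continuous_on_subset[OF ND'(6) sub])
      fix u assume u: "u \<in> {a..b}"
      then have uu: "u1 \<le> \<bar>u\<bar>" "u0 \<le> \<bar>u\<bar>" "1 \<le> a" "a \<le> u" "u \<le> b" using a by (auto simp: a0_def)
      show "(\<Phi> has_vector_derivative D1 u) (at u within {a..b})"
        by (rule has_vector_derivative_within_subset[OF ND'(3)[OF uu(1)] sub])
      show "(D1 has_vector_derivative D2 u) (at u within {a..b})"
        by (rule has_vector_derivative_within_subset[OF ND'(4)[OF uu(1)] sub])
      show "cmod (\<Phi> u) \<le> C * b ^ K * exp (- \<beta> * a powr s)"
        by (rule bd[OF N'(5)[OF uu(2)] C(1) N'(2) _ uu(3-5)]) (use K in simp)
      have D: "cmod (D1 u) \<le> B * \<bar>u\<bar> powr \<gamma>1 * exp (- \<beta> * \<bar>u\<bar> powr s)" "cmod (D2 u) \<le> B * \<bar>u\<bar> powr \<gamma>1 * exp (- \<beta> * \<bar>u\<bar> powr s)"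
        using ND'(5)[OF uu(1)] by auto
      have "cmod (D1 u) \<le> C * b ^ K * exp (- \<beta> * a powr s)"
        by (rule bd[OF D(1) C(2) ND'(2) _ uu(3-5)]) (use K in simp)
      then show "cmod (D1 u) \<le> C * b ^ K * exp (- \<beta> * a powr s) * 1" by simp
      have "cmod (D2 u) \<le> C * b ^ K * exp (- \<beta> * a powr s)"
        by (rule bd[OF D(2) C(2) ND'(2) _ uu(3-5)]) (use K in simp)
      then show "cmod (D2 u) \<le> C * b ^ K * exp (- \<beta> * a powr s) * 1\<^sup>2" by simp
    qed simp
  qed
qed

lemma cutoff_bounds:
  assumes "0 \<le> m" "a \<le> u" "u \<le> b" shows "0 \<le> cutoff a b m u" "cutoff a b m u \<le> 1"
proof -
  have e: "exp (- m * (u - a)) \<le> 1" "exp (- m * (b - u)) \<le> 1" using assms by auto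
  have "(1 - exp (- m * (u - a)))\<^sup>2 \<le> 1" "(1 - exp (- m * (b - u)))\<^sup>2 \<le> 1"
    using e by (auto simp: abs_square_le_1)
  then show "cutoff a b m u \<le> 1" unfolding cutoff_def by (intro mult_le_one) auto
  show "0 \<le> cutoff a b m u" by (simp add: cutoff_def)
qed

lemma cutoff_ge:
  assumes "0 \<le> m" "0 \<le> t" "a + t \<le> u" "u \<le> b - t"
  shows "(1 - exp (- m * t)) ^ 4 \<le> cutoff a b m u"
proof -
  have e: "exp (- m * t) \<le> 1" "exp (- m * (u - a)) \<le> exp (- m * t)" "exp (- m * (b - u)) \<le> exp (- m * t)"
    using assms by (auto intro!: mult_left_mono)
  then have "(1 - exp (- m * t))\<^sup>2 * (1 - exp (- m * t))\<^sup>2 \<le> cutoff a b m u"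
    unfolding cutoff_def by (intro mult_mono power_mono) auto
  then show ?thesis by (simp flip: power_add)
qed

lemma continuous_on_cutoff: "continuous_on S (cutoff a b m)"
  unfolding cutoff_def by (intro continuous_intros)

section \<open>The two-point bound for a fixed band\<close>

text \<open>Up to the amplitude, \<open>j = 1\<close> gives the value of the perturbation at its
  centre and \<open>j = 2\<close> its weighted norm. The steepness a^2 makes the transition zones of
  width about 1/a^2, thinner than the steps of order 1/a by which intervals are trimmed.\<close>

definition cut_int :: "real \<Rightarrow> real \<Rightarrow> nat \<Rightarrow> real \<Rightarrow> real \<Rightarrow> real" where
  "cut_int \<alpha> r j a b = (LINT u|lborel. indicator {a..b} u * (cutoff a b (a\<^sup>2) u ^ j * exp (- 2 * \<alpha> * u powr r)))"

lemma integrable_cut: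
  assumes "0 < a'"
  shows "integrable lborel (\<lambda>u. indicator {a'..b'} u * (cutoff a b m u ^ j * exp (- 2 * \<alpha> * u powr r)))"
proof -
  have "continuous_on {a'..b'} (\<lambda>u. cutoff a b m u ^ j * exp (- 2 * \<alpha> * u powr r))"
    using assms by (intro continuous_intros continuous_on_cutoff) auto
  from borel_integrable_compact[OF _ this] show ?thesis by simp
qed

lemma cut_int_ge:
  assumes a: "1 \<le> a" and t: "0 \<le> t" and bb: "a + t \<le> b'" "b' \<le> b - t" and \<alpha>: "0 < \<alpha>" and r: "0 < r"
  shows "(1 - exp (- a\<^sup>2 * t)) ^ (4 * j) * (LINT u|lborel. indicator {a + t..b'} u * exp (- 2 * \<alpha> * u powr r)) \<le> cut_int \<alpha> r j a b"
proof -
  have i: "integrable lborel (\<lambda>u. indicator {a + t..b'} u * exp (- 2 * \<alpha> * u powr r))"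
    using integrable_cut[of "a + t" b' a b m 0] a t by simp
  have "(1 - exp (- a\<^sup>2 * t)) ^ (4 * j) * (LINT u|lborel. indicator {a + t..b'} u * exp (- 2 * \<alpha> * u powr r))
     = (LINT u|lborel. (1 - exp (- a\<^sup>2 * t)) ^ (4 * j) * (indicator {a + t..b'} u * exp (- 2 * \<alpha> * u powr r)))" by simp
  also have "\<dots> \<le> cut_int \<alpha> r j a b"
    unfolding cut_int_def
  proof (rule integral_mono)
    show "integrable lborel (\<lambda>u. (1 - exp (- a\<^sup>2 * t)) ^ (4 * j) * (indicator {a + t..b'} u * exp (- 2 * \<alpha> * u powr r)))"
      using i by (rule integrable_mult_right)
    show "integrable lborel (\<lambda>u. indicator {a..b} u * (cutoff a b (a\<^sup>2) u ^ j * exp (- 2 * \<alpha> * u powr r)))"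
      by (rule integrable_cut) (use a in simp)
    fix u
    show "(1 - exp (- a\<^sup>2 * t)) ^ (4 * j) * (indicator {a + t..b'} u * exp (- 2 * \<alpha> * u powr r))
      \<le> indicator {a..b} u * (cutoff a b (a\<^sup>2) u ^ j * exp (- 2 * \<alpha> * u powr r))"
    proof (cases "u \<in> {a + t..b'}")
      case True
      then have u: "a + t \<le> u" "u \<le> b - t" "u \<in> {a..b}" using bb t by auto
      have "((1 - exp (- a\<^sup>2 * t)) ^ 4) ^ j \<le> cutoff a b (a\<^sup>2) u ^ j"
        by (intro power_mono cutoff_ge) (use t u in auto)
      then show ?thesis using True u by (simp add: power_mult mult_right_mono)
    next
      case False
      have "0 \<le> indicator {a..b} u * (cutoff a b (a\<^sup>2) u ^ j * exp (- 2 * \<alpha> * u powr r))"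
        by (auto simp: cutoff_def split: split_indicator)
      then show ?thesis using False by simp
    qed
  qed
  finally show ?thesis .
qed

text \<open>The amplitude A is fixed by A^2 I = \<pi> L1 with I =
  \<open>cut_int \<alpha> r 2 a b\<close>, so that the two bands together use the budget 2\<pi>L1;
  the value at the centre is then A \<open>cut_int \<alpha> r 1 a b\<close> / \<pi>. Positivity and
  the chi-square bound only require growth bounds in powers of \<open>a\<close>. The end
  \<open>b\<close> stays free because the two risks call for different bands.\<close>

lemma minimax_lower_cutoff:
  fixes \<alpha> \<beta> r s L L1 :: real and fe :: "real \<Rightarrow> real"
  assumes \<alpha>: "0 < \<alpha>" and r: "0 < r" "r < 2" and L1: "0 < L1" "L1 < L" and fe: "prob_density fe"
    and N: "assumption_N \<beta> s (fourier fe)" and ND: "assumption_ND \<beta> s (fourier fe)"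
  obtains C K where "0 \<le> C" "\<forall>\<^sub>F a in at_top. \<forall>b n x T. a + 1 / a \<le> b \<longrightarrow> b \<le> 2 * a \<longrightarrow> T \<in> estimators n \<longrightarrow>
     ennreal (L1 / pi * ((cut_int \<alpha> r 1 a b)\<^sup>2 / cut_int \<alpha> r 2 a b) * (1 - 2 * sqrt ((1 + C * (a ^ K * exp (- 2 * \<alpha> * a powr r - 2 * \<beta> * a powr s))) ^ n - 1))) \<le> risk_pt fe \<alpha> r L n x T
   \<and> ennreal (L1 * exp (- 2 * \<alpha> * b powr r) * (1 - 2 * sqrt ((1 + C * (a ^ K * exp (- 2 * \<alpha> * a powr r - 2 * \<beta> * a powr s))) ^ n - 1))) \<le> risk_L2 fe \<alpha> r L n T"
proof -
  \<comment> \<open>The part of the budget 2\<pi>L reserved for the base density.\<close>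
  define \<eta> where "\<eta> = 2 * pi * (L - L1)"
  have \<eta>: "0 < \<eta>" using L1 by (simp add: \<eta>_def)
  obtain f0 c B0 where f0: "prob_density f0" "continuous_on UNIV f0" "0 < c" "\<And>y. c / (1 + y\<^sup>2) \<le> f0 y" "\<And>y. f0 y \<le> B0"
    "\<And>u. 1 < \<bar>u\<bar> \<Longrightarrow> fourier f0 u = 0"
    "(\<integral>\<^sup>+ u. ennreal ((cmod (fourier f0 u))\<^sup>2 * exp (2 * \<alpha> * \<bar>u\<bar> powr r)) \<partial>lborel) \<le> ennreal \<eta>"
    by (rule exists_base_density[OF \<alpha> r(1) \<eta>]) (rule that; (assumption | blast))
  obtain m where m: "0 < m" "1 / 2 \<le> (LINT e|lborel. indicator {-m..m} e * fe e)" by (rule prob_density_tight[OF fe])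
  obtain C1 K a0 D1 D2 where nb: "0 < C1" "1 \<le> a0"
    "\<And>a b. a0 \<le> a \<Longrightarrow> a \<le> b \<Longrightarrow> C2_bound {a..b} (C1 * b ^ K * exp (- \<beta> * a powr s)) 1 (fourier fe) D1 D2"
    by (rule noise_C2_bound[OF N ND]) (rule that; (assumption | blast))
  \<comment> \<open>\<open>c2 * a^2\<close> bounds k + 1, the price of the bump times the noise
    transform: 4a^2 + (2\<alpha>r + 1) 2a^2 + a^2 = (7 + 4\<alpha>r) a^2.\<close>
  define c2 where "c2 = 7 + 4 * \<alpha> * r"
  \<comment> \<open>\<open>C4 * a * exp (\<alpha> * a powr r)\<close> will bound the amplitude; the
    12 comes from the crude lower bound 1/(12a) for the integral \<open>I\<close>.\<close>
  define C4 where "C4 = sqrt (12 * pi * L1 * exp (2 * \<alpha>))"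
  define CE where "CE = 2 * C4 * C1 * c2\<^sup>2 * 2 ^ K"
  define P0 :: real where "P0 = (LINT y|lborel. 1 / (1 + y\<^sup>2))"
  define C where "C = CE\<^sup>2 * (4 * (1 + m\<^sup>2) / c) * P0"
  have c2: "7 \<le> c2" using \<alpha> r by (simp add: c2_def)
  have C4: "0 \<le> C4" using L1 by (simp add: C4_def)
  have CE: "0 \<le> CE" using C4 nb(1) by (simp add: CE_def)
  have P0: "0 \<le> P0" unfolding P0_def by (intro integral_nonneg_AE AE_I2) (simp add: add_nonneg_nonneg)
  \<comment> \<open>Three conditions on \<open>a\<close>: over a step 1/a the power u^r grows by at
    most 1, which rests on r < 2; the cut-off is already large at distance 1/(3a) from the ends; the
    hypotheses are positive.\<close>
  have ev1: "\<forall>\<^sub>F a::real in at_top. (a + 1 / a) powr r \<le> a powr r + 1"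
  proof -
    have "((\<lambda>a::real. (a + 1 / a) powr r - a powr r) \<longlongrightarrow> 0) at_top" using r by real_asymp
    then have "\<forall>\<^sub>F a in at_top. (a + 1 / a) powr r - a powr r < 1" by (rule order_tendstoD) simp
    then show ?thesis by eventually_elim simp
  qed
  have ev2: "\<forall>\<^sub>F a::real in at_top. 1 / 2 \<le> (1 - exp (- a\<^sup>2 * (1 / (3 * a)))) ^ 8"
  proof -
    have "((\<lambda>a::real. (1 - exp (- a\<^sup>2 * (1 / (3 * a)))) ^ 8) \<longlongrightarrow> 1) at_top" by real_asymp
    then have "\<forall>\<^sub>F a::real in at_top. 1 / 2 < (1 - exp (- a\<^sup>2 * (1 / (3 * a)))) ^ 8" by (rule order_tendstoD) simp
    then show ?thesis by eventually_elim simp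
  qed
  have ev3: "\<forall>\<^sub>F a::real in at_top. 2 * (C4 * c2\<^sup>2 * (a ^ 6 * exp (- \<alpha> * a powr r))) \<le> c"
  proof -
    have "((\<lambda>a::real. a ^ 6 * exp (- \<alpha> * a powr r)) \<longlongrightarrow> 0) at_top" using \<alpha> r by real_asymp
    then have "((\<lambda>a::real. 2 * (C4 * c2\<^sup>2 * (a ^ 6 * exp (- \<alpha> * a powr r)))) \<longlongrightarrow> 2 * (C4 * c2\<^sup>2 * 0)) at_top" by (intro tendsto_intros)
    then have "\<forall>\<^sub>F a in at_top. 2 * (C4 * c2\<^sup>2 * (a ^ 6 * exp (- \<alpha> * a powr r))) < c" by (rule order_tendstoD) (use f0(3) in simp)
    then show ?thesis by eventually_elim simp
  qed
  have "\<forall>\<^sub>F a in at_top. \<forall>b n x T. a + 1 / a \<le> b \<longrightarrow> b \<le> 2 * a \<longrightarrow> T \<in> estimators n \<longrightarrow>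
     ennreal (L1 / pi * ((cut_int \<alpha> r 1 a b)\<^sup>2 / cut_int \<alpha> r 2 a b) * (1 - 2 * sqrt ((1 + C * (a ^ (12 + 2 * K) * exp (- 2 * \<alpha> * a powr r - 2 * \<beta> * a powr s))) ^ n - 1))) \<le> risk_pt fe \<alpha> r L n x T
   \<and> ennreal (L1 * exp (- 2 * \<alpha> * b powr r) * (1 - 2 * sqrt ((1 + C * (a ^ (12 + 2 * K) * exp (- 2 * \<alpha> * a powr r - 2 * \<beta> * a powr s))) ^ n - 1))) \<le> risk_L2 fe \<alpha> r L n T"
    using ev1 ev2 ev3 eventually_ge_at_top[of a0] eventually_ge_at_top[of 2]
  proof eventually_elim
    case (elim a)
    show ?case
    proof (intro allI impI)
      fix b x :: real and n :: nat and T
      assume b: "a + 1 / a \<le> b" "b \<le> 2 * a" and T: "T \<in> estimators n"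
      have a1: "1 \<le> a" "1 < a" "0 < a" using elim by auto
      have ab: "a < b" using b(1) a1 by (smt (verit) divide_pos_pos)
      define I where "I = cut_int \<alpha> r 2 a b"
      \<comment> \<open>Only the middle third of \<open>{a..a + 1/a}\<close> is used: it keeps
        distance 1/(3a) from both ends of the band, so the squared cut-off is at least 1/2
        there.\<close>
      have I: "1 / (12 * a) * exp (- 2 * \<alpha> * (a powr r + 1)) \<le> I"
      proof -
        define t where "t = 1 / (3 * a)"
        have t0: "0 < t" using a1 by (simp add: t_def)
        have t3: "3 * t = 1 / a" by (simp add: t_def)
        have t: "0 < t" "a + 2 * t \<le> b - t" using b(1) t0 t3 by linarith+
        have t2: "a + 2 * t \<le> a + 1 / a" using t0 t3 by linarith
        have q1: "1 / (12 * a) * exp (- 2 * \<alpha> * (a powr r + 1)) \<le> (1 / 2) * (t * exp (- 2 * \<alpha> * (a + 1 / a) powr r))"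
        proof -
          have "exp (- 2 * \<alpha> * (a powr r + 1)) \<le> exp (- 2 * \<alpha> * (a + 1 / a) powr r)" using elim(1) \<alpha> by simp
          then have "1 / (12 * a) * exp (- 2 * \<alpha> * (a powr r + 1)) \<le> 1 / (6 * a) * exp (- 2 * \<alpha> * (a + 1 / a) powr r)"
            using a1 by (intro mult_mono frac_le) auto
          then show ?thesis by (simp add: t_def)
        qed
        have "t * exp (- 2 * \<alpha> * (a + 1 / a) powr r) = (LINT u|lborel. indicator {a + t..a + 2 * t} u * exp (- 2 * \<alpha> * (a + 1 / a) powr r))"
          using t by simp
        also have "\<dots> \<le> (LINT u|lborel. indicator {a + t..a + 2 * t} u * exp (- 2 * \<alpha> * u powr r))"
        proof (rule integral_mono)
          show "integrable lborel (\<lambda>u. indicator {a + t..a + 2 * t} u * exp (- 2 * \<alpha> * u powr r))"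
            using integrable_cut[of "a + t" "a + 2 * t" a b 0 0] a1 t by simp
          fix u
          show "indicator {a + t..a + 2 * t} u * exp (- 2 * \<alpha> * (a + 1 / a) powr r) \<le> indicator {a + t..a + 2 * t} u * exp (- 2 * \<alpha> * u powr r)"
          proof (cases "u \<in> {a + t..a + 2 * t}")
            case True
            then have "u powr r \<le> (a + 1 / a) powr r" using a1 t t2 r by (intro powr_mono2) auto
            then show ?thesis using True \<alpha> by simp
          qed simp
        qed (use t in auto)
        finally have "1 / (12 * a) * exp (- 2 * \<alpha> * (a powr r + 1)) \<le> 1 / 2 * (LINT u|lborel. indicator {a + t..a + 2 * t} u * exp (- 2 * \<alpha> * u powr r))"
          using q1 by linarith
        also have "\<dots> \<le> (1 - exp (- a\<^sup>2 * t)) ^ (4 * 2) * (LINT u|lborel. indicator {a + t..a + 2 * t} u * exp (- 2 * \<alpha> * u powr r))"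
          using elim(2) by (intro mult_right_mono integral_nonneg_AE AE_I2) (auto simp: t_def)
        also have "\<dots> \<le> I" unfolding I_def by (rule cut_int_ge) (use t a1 \<alpha> r in auto)
        finally show ?thesis .
      qed
      have I0: "0 < I" by (rule less_le_trans[OF _ I]) (use a1 in simp)
      define A where "A = sqrt (pi * L1 / I)"
      have A0: "0 \<le> A" using L1 I0 by (simp add: A_def)
      have A2: "A\<^sup>2 = pi * L1 / I" using L1 I0 by (simp add: A_def)
      have Ab: "A \<le> C4 * a * exp (\<alpha> * a powr r)"
      proof -
        have "A\<^sup>2 \<le> pi * L1 / (1 / (12 * a) * exp (- 2 * \<alpha> * (a powr r + 1)))"
          unfolding A2 using I L1 a1 I0 by (intro divide_left_mono mult_pos_pos) auto
        also have "\<dots> = 12 * pi * L1 * exp (2 * \<alpha>) * a * exp (2 * (\<alpha> * a powr r))"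
          by (simp add: exp_minus exp_add[symmetric] field_simps)
        also have "\<dots> \<le> 12 * pi * L1 * exp (2 * \<alpha>) * a\<^sup>2 * exp (2 * (\<alpha> * a powr r))"
          using L1 a1 by (intro mult_right_mono mult_left_mono) (auto simp: power2_eq_square)
        also have "\<dots> = (C4 * a * exp (\<alpha> * a powr r))\<^sup>2"
          using L1 by (simp add: C4_def power_mult_distrib exp_double)
        finally show ?thesis by (rule power2_le_imp_le) (use C4 a1 in auto)
      qed
      let ?v = "bump \<alpha> r a b (a\<^sup>2) A"
      define k where "k = 4 * a\<^sup>2 + (2 * \<alpha> * r + 1) * b"
      define B' where "B' = A * exp (- 2 * \<alpha> * a powr r)"
      obtain v1 v2 where V: "C2_bound {a..b} B' k (\<lambda>u. complex_of_real (?v u)) v1 v2" "v1 a = 0" "v1 b = 0"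
        unfolding B'_def k_def using C2_bound_bump[OF \<alpha> r a1(1) less_imp_le[OF ab], of "a\<^sup>2" A] A0 by auto
      have B'0: "0 \<le> B'" using A0 by (simp add: B'_def)
      have B'b: "B' \<le> C4 * a * exp (- \<alpha> * a powr r)"
      proof -
        have "B' \<le> C4 * a * exp (\<alpha> * a powr r) * exp (- 2 * \<alpha> * a powr r)" unfolding B'_def by (intro mult_right_mono Ab) simp
        also have "\<dots> = C4 * a * exp (- \<alpha> * a powr r)" by (simp add: mult.assoc flip: exp_add)
        finally show ?thesis .
      qed
      have k1: "1 \<le> k" "k + 1 \<le> c2 * a\<^sup>2"
      proof -
        have aa: "1 \<le> a\<^sup>2" "a \<le> a\<^sup>2"
          using a1 one_le_power[of a 2] power_increasing[of 1 2 a] by simp_all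
        have "0 \<le> (2 * \<alpha> * r + 1) * b" using \<alpha> r a1 ab by auto
        then show "1 \<le> k" unfolding k_def using aa by linarith
        have "(2 * \<alpha> * r + 1) * b \<le> (2 * \<alpha> * r + 1) * (2 * a\<^sup>2)" using b aa \<alpha> r by (intro mult_left_mono) auto
        then show "k + 1 \<le> c2 * a\<^sup>2" unfolding k_def c2_def using aa by (simp add: algebra_simps)
      qed
      have k2: "k\<^sup>2 \<le> c2\<^sup>2 * a ^ 4" "(k + 1)\<^sup>2 \<le> c2\<^sup>2 * a ^ 4"
      proof -
        have "(k + 1)\<^sup>2 \<le> (c2 * a\<^sup>2)\<^sup>2" using k1 by (intro power_mono) auto
        then show "(k + 1)\<^sup>2 \<le> c2\<^sup>2 * a ^ 4" by (simp add: power_mult_distrib)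
        moreover have "k\<^sup>2 \<le> (k + 1)\<^sup>2" using k1 by (intro power_mono) auto
        ultimately show "k\<^sup>2 \<le> c2\<^sup>2 * a ^ 4" by linarith
      qed
      define B where "B = B' * k\<^sup>2"
      have Bv: "\<bar>?v u\<bar> \<le> B" "cmod (v2 u) \<le> B" if "u \<in> {a..b}" for u
      proof -
        have "B' * 1 \<le> B' * k\<^sup>2" using B'0 k1 by (intro mult_left_mono one_le_power) auto
        then show "\<bar>?v u\<bar> \<le> B" "cmod (v2 u) \<le> B" using V(1) that unfolding C2_bound_def B_def by force+
      qed
      have ba: "0 \<le> b - a" "b - a \<le> a" using ab b by auto
      have pi1: "1 \<le> pi" using pi_ge_two by linarith
      have divpi: "X / pi \<le> X" if "0 \<le> X" for X using that pi1 by (simp add: divide_le_eq mult_left_le mult_le_cancel_left1)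
      \<comment> \<open>Positivity of the hypotheses. Amplitude times spectrum leaves
        exp(-\<alpha>a^r), which beats a^6: one power from the amplitude, four from the second
        derivative, one from the length of the band.\<close>
      have small: "2 * B * (b - a) / pi \<le> c"
      proof -
        have "2 * B * (b - a) / pi \<le> 2 * B * (b - a)" using B'0 ba by (intro divpi) (simp add: B_def)
        also have "\<dots> \<le> 2 * (C4 * a * exp (- \<alpha> * a powr r) * (c2\<^sup>2 * a ^ 4)) * a"
          unfolding B_def using B'0 B'b k2 ba C4 a1 by (intro mult_mono order_refl) auto
        also have "\<dots> = 2 * (C4 * c2\<^sup>2 * (a ^ 6 * exp (- \<alpha> * a powr r)))" by (simp add: power_numeral_reduce mult_ac)
        also have "\<dots> \<le> c" by (rule elim(3))
        finally show ?thesis .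
      qed
      \<comment> \<open>The square of the spectrum times the class weight is the extremal
        exponential once more, so the weighted norm is \<open>cut_int\<close> with
        \<open>j = 2\<close>.\<close>
      have v2e: "(?v u)\<^sup>2 * exp (2 * \<alpha> * u powr r) = A\<^sup>2 * (cutoff a b (a\<^sup>2) u ^ 2 * exp (- 2 * \<alpha> * u powr r))" for u
      proof -
        have "(exp (- 2 * \<alpha> * u powr r))\<^sup>2 * exp (2 * \<alpha> * u powr r) = exp (- 2 * \<alpha> * u powr r)"
          by (simp add: power2_eq_square flip: exp_add)
        then show ?thesis unfolding bump_def by (simp add: power_mult_distrib mult_ac)
      qed
      have wI: "(LINT u|lborel. indicator {a..b} u * ((?v u)\<^sup>2 * exp (2 * \<alpha> * u powr r))) = pi * L1"
      proof -
        have "(LINT u|lborel. indicator {a..b} u * ((?v u)\<^sup>2 * exp (2 * \<alpha> * u powr r))) = (LINT u|lborel. A\<^sup>2 * (indicator {a..b} u * (cutoff a b (a\<^sup>2) u ^ 2 * exp (- 2 * \<alpha> * u powr r))))"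
          unfolding v2e by (simp add: mult_ac)
        also have "\<dots> = A\<^sup>2 * I" unfolding I_def cut_int_def by (rule integral_mult_right_zero)
        also have "\<dots> = pi * L1" unfolding A2 using I0 by simp
        finally show ?thesis .
      qed
      have weight: "\<eta> + 2 * (LINT u|lborel. indicator {a..b} u * ((?v u)\<^sup>2 * exp (2 * \<alpha> * u powr r))) \<le> 2 * pi * L"
        unfolding wI \<eta>_def by (simp add: algebra_simps)
      \<comment> \<open>The powers of the positivity estimate, times the size of the noise transform
        on the band, of order a^K exp(-\<beta>a^s).\<close>
      define E where "E = CE * (a ^ (6 + K) * exp (- \<alpha> * a powr r - \<beta> * a powr s))"
      note d = V(1)[unfolded C2_bound_def]
      have dv: "\<And>u. u \<in> {a..b} \<Longrightarrow> ((\<lambda>u. complex_of_real (?v u)) has_vector_derivative v1 u) (at u within {a..b})"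
        and dv1: "\<And>u. u \<in> {a..b} \<Longrightarrow> (v1 has_vector_derivative v2 u) (at u within {a..b})"
        and dv2: "continuous_on {a..b} v2" using d by auto
      note z = bump_zero[of \<alpha> r a b "a\<^sup>2" A] V(2,3)
      have E: "\<bar>conv (band a b ?v) fe y\<bar> \<le> E / (1 + y\<^sup>2)" for y
      proof -
        let ?w = "\<lambda>u. complex_of_real (?v u) * fourier fe u"
        define Bw where "Bw = B' * (C1 * b ^ K * exp (- \<beta> * a powr s)) * (k + 1)\<^sup>2"
        note W = C2_bound_mult[OF V(1) nb(3)[OF elim(4) less_imp_le[OF ab]]]
        note W' = W[unfolded C2_bound_def]
        have Bw0: "0 \<le> B' * (C1 * b ^ K * exp (- \<beta> * a powr s))" using W' by simp
        have "B' * (C1 * b ^ K * exp (- \<beta> * a powr s)) * 1 \<le> Bw"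
          unfolding Bw_def using Bw0 k1 by (intro mult_left_mono one_le_power) auto
        then have "cmod (LINT u|lborel. indicator {a..b} u *\<^sub>R (?w u * cis (- (u * y)))) \<le> 2 * Bw * (b - a) / (1 + y\<^sup>2)"
          using W' z ab by (intro oscillatory_integral_bound[where ?w1.0="\<lambda>u. complex_of_real (?v u) * D1 u + v1 u * fourier fe u"
             and ?w2.0="\<lambda>u. complex_of_real (?v u) * D2 u + 2 * (v1 u * D1 u) + v2 u * fourier fe u"]) (auto simp: Bw_def intro: order_trans)
        then have "\<bar>Re (LINT u|lborel. indicator {a..b} u *\<^sub>R (?w u * cis (- (u * y))))\<bar> \<le> 2 * Bw * (b - a) / (1 + y\<^sup>2)"
          using abs_Re_le_cmod order_trans by blast
        then have "\<bar>Re (LINT u|lborel. indicator {a..b} u *\<^sub>R (?w u * cis (- (u * y))))\<bar> / pi \<le> 2 * Bw * (b - a) / (1 + y\<^sup>2) / pi"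
          by (rule divide_right_mono) simp
        moreover have "conv (band a b ?v) fe y = Re (LINT u|lborel. indicator {a..b} u *\<^sub>R (?w u * cis (- (u * y)))) / pi"
          by (rule conv_band[OF a1(3) ab dv dv1 dv2 z Bv fe])
        ultimately have "\<bar>conv (band a b ?v) fe y\<bar> \<le> 2 * Bw * (b - a) / (1 + y\<^sup>2) / pi"
          by (simp only: abs_divide abs_of_pos[OF pi_gt_zero])
        also have "\<dots> \<le> 2 * Bw * (b - a) / (1 + y\<^sup>2)"
          using Bw0 ba by (intro divpi divide_nonneg_nonneg) (auto simp: Bw_def)
        also have "\<dots> \<le> E / (1 + y\<^sup>2)"
        proof (rule divide_right_mono)
          have "2 * Bw * (b - a) \<le> 2 * (C4 * a * exp (- \<alpha> * a powr r) * (C1 * (2 * a) ^ K * exp (- \<beta> * a powr s)) * (c2\<^sup>2 * a ^ 4)) * a"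
            unfolding Bw_def using B'0 B'b k2 ba C4 a1 nb(1) b ab by (intro mult_mono order_refl power_mono) auto
          also have "\<dots> = E" unfolding E_def CE_def
            by (simp add: power_mult_distrib power_add exp_diff exp_minus power_numeral_reduce field_simps)
          finally show "2 * Bw * (b - a) \<le> E" .
        qed (simp add: add_nonneg_nonneg)
        finally show ?thesis .
      qed
      have chi: "chi_bound c m E = C * (a ^ (12 + 2 * K) * exp (- 2 * \<alpha> * a powr r - 2 * \<beta> * a powr s))"
      proof -
        have "E\<^sup>2 = CE\<^sup>2 * (a ^ (12 + 2 * K) * exp (- 2 * \<alpha> * a powr r - 2 * \<beta> * a powr s))"
        proof -
          have "(a ^ (6 + K))\<^sup>2 = a ^ (12 + 2 * K)" by (simp flip: power_mult add: algebra_simps)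
          moreover have "(exp (- \<alpha> * a powr r - \<beta> * a powr s))\<^sup>2 = exp (- 2 * \<alpha> * a powr r - 2 * \<beta> * a powr s)"
            by (simp flip: exp_double add: algebra_simps)
          ultimately show ?thesis unfolding E_def by (simp only: power_mult_distrib)
        qed
        then show ?thesis unfolding chi_bound_def C_def P0_def by (simp add: mult_ac)
      qed
      note args = a1(2) ab dv dv1 dv2 z Bv f0 less_imp_le[OF \<eta>] fe m E small weight T
      have p: "ennreal ((band a b ?v 0)\<^sup>2 * (1 - 2 * sqrt ((1 + chi_bound c m E) ^ n - 1))) \<le> risk_pt fe \<alpha> r L n x T"
        by (rule minimax_risk_pt_lower[OF args])
      have l: "ennreal ((LINT u|lborel. indicator {a..b} u * (?v u)\<^sup>2) / pi * (1 - 2 * sqrt ((1 + chi_bound c m E) ^ n - 1))) \<le> risk_L2 fe \<alpha> r L n T"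
        by (rule minimax_risk_L2_lower[OF args])
      have b0: "band a b ?v 0 = A * cut_int \<alpha> r 1 a b / pi"
      proof -
        have "band a b ?v 0 = (LINT u|lborel. indicator {a..b} u * ?v u) / pi" by (rule band_zero[OF a1(3) ab dv dv1 dv2 z Bv])
        also have "(LINT u|lborel. indicator {a..b} u * ?v u) = (LINT u|lborel. A * (indicator {a..b} u * (cutoff a b (a\<^sup>2) u ^ 1 * exp (- 2 * \<alpha> * u powr r))))"
          by (simp add: bump_def mult_ac)
        also have "\<dots> = A * cut_int \<alpha> r 1 a b" unfolding cut_int_def by (rule integral_mult_right_zero)
        finally show ?thesis .
      qed
      have b2: "(band a b ?v 0)\<^sup>2 = L1 / pi * ((cut_int \<alpha> r 1 a b)\<^sup>2 / cut_int \<alpha> r 2 a b)"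
        unfolding b0 I_def[symmetric] power_divide power_mult_distrib A2 using I0 by (simp add: power2_eq_square field_simps)
      \<comment> \<open>On the band the class weight is at most exp(2\<alpha>b^r), so the prescribed
        weighted norm bounds the plain one from below; on a narrow band little is lost.\<close>
      have l2: "L1 * exp (- 2 * \<alpha> * b powr r) \<le> (LINT u|lborel. indicator {a..b} u * (?v u)\<^sup>2) / pi"
      proof -
        have cv: "continuous_on {a..b} ?v" by (rule continuous_on_band_profile[OF a1(3) ab dv dv1 dv2 z Bv])
        have i1: "integrable lborel (\<lambda>u. indicator {a..b} u * (?v u)\<^sup>2)" by (rule integrable_band_profile_square[OF a1(3) ab dv dv1 dv2 z Bv])
        have "exp (- 2 * \<alpha> * b powr r) * (pi * L1) = (LINT u|lborel. exp (- 2 * \<alpha> * b powr r) * (indicator {a..b} u * ((?v u)\<^sup>2 * exp (2 * \<alpha> * u powr r))))"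
          unfolding wI[symmetric] by (rule integral_mult_right_zero[symmetric])
        also have "\<dots> \<le> (LINT u|lborel. indicator {a..b} u * (?v u)\<^sup>2)"
        proof (rule integral_mono[OF _ i1])
          have "continuous_on {a..b} (\<lambda>u. (?v u)\<^sup>2 * exp (2 * \<alpha> * u powr r))" using cv a1 by (intro continuous_intros) auto
          from borel_integrable_compact[OF _ this]
          show "integrable lborel (\<lambda>u. exp (- 2 * \<alpha> * b powr r) * (indicator {a..b} u * ((?v u)\<^sup>2 * exp (2 * \<alpha> * u powr r))))" by simp
          fix u
          show "exp (- 2 * \<alpha> * b powr r) * (indicator {a..b} u * ((?v u)\<^sup>2 * exp (2 * \<alpha> * u powr r))) \<le> indicator {a..b} u * (?v u)\<^sup>2"
          proof (cases "u \<in> {a..b}")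
            case True
            then have "u powr r \<le> b powr r" using a1 r by (intro powr_mono2) auto
            then have "exp (- 2 * \<alpha> * b powr r) * exp (2 * \<alpha> * u powr r) \<le> 1" using \<alpha> by (simp flip: exp_add)
            then have "(?v u)\<^sup>2 * (exp (- 2 * \<alpha> * b powr r) * exp (2 * \<alpha> * u powr r)) \<le> (?v u)\<^sup>2" by (intro mult_left_le) auto
            then show ?thesis using True by (simp add: mult_ac)
          qed simp
        qed
        finally show ?thesis by (simp add: field_simps)
      qed
      show "ennreal (L1 / pi * ((cut_int \<alpha> r 1 a b)\<^sup>2 / cut_int \<alpha> r 2 a b) * (1 - 2 * sqrt ((1 + C * (a ^ (12 + 2 * K) * exp (- 2 * \<alpha> * a powr r - 2 * \<beta> * a powr s))) ^ n - 1))) \<le> risk_pt fe \<alpha> r L n x T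
        \<and> ennreal (L1 * exp (- 2 * \<alpha> * b powr r) * (1 - 2 * sqrt ((1 + C * (a ^ (12 + 2 * K) * exp (- 2 * \<alpha> * a powr r - 2 * \<beta> * a powr s))) ^ n - 1))) \<le> risk_L2 fe \<alpha> r L n T"
      proof (rule conjI)
        show "ennreal (L1 / pi * ((cut_int \<alpha> r 1 a b)\<^sup>2 / cut_int \<alpha> r 2 a b) * (1 - 2 * sqrt ((1 + C * (a ^ (12 + 2 * K) * exp (- 2 * \<alpha> * a powr r - 2 * \<beta> * a powr s))) ^ n - 1))) \<le> risk_pt fe \<alpha> r L n x T"
          using p unfolding b2 chi .
        define \<rho> where "\<rho> = 1 - 2 * sqrt ((1 + C * (a ^ (12 + 2 * K) * exp (- 2 * \<alpha> * a powr r - 2 * \<beta> * a powr s))) ^ n - 1)"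
        have "ennreal (L1 * exp (- 2 * \<alpha> * b powr r) * \<rho>) \<le> ennreal ((LINT u|lborel. indicator {a..b} u * (?v u)\<^sup>2) / pi * \<rho>)"
        proof (cases "0 \<le> \<rho>")
          case True
          then show ?thesis using l2 by (intro ennreal_leI mult_right_mono)
        next
          case False
          then have "L1 * exp (- 2 * \<alpha> * b powr r) * \<rho> \<le> 0" using L1 by (intro mult_nonneg_nonpos) auto
          then show ?thesis by (simp add: ennreal_neg)
        qed
        then show "ennreal (L1 * exp (- 2 * \<alpha> * b powr r) * (1 - 2 * sqrt ((1 + C * (a ^ (12 + 2 * K) * exp (- 2 * \<alpha> * a powr r - 2 * \<beta> * a powr s))) ^ n - 1))) \<le> risk_L2 fe \<alpha> r L n T"
          using l unfolding chi \<rho>_def by (rule order_trans)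
      qed
    qed
  qed
  moreover have "0 \<le> C" unfolding C_def using P0 f0(3) by simp
  ultimately show ?thesis by (rule that[rotated])
qed

section \<open>Asymptotics of the bias integral\<close>

text \<open>An approximate antiderivative of \<open>-exp(-2\<alpha>u\<^sup>r)\<close>, whose value at \<open>1/h\<^sub>*\<close> is the pointwise rate up to the factor \<open>L/\<pi>\<close>.\<close>

definition Psi :: "real \<Rightarrow> real \<Rightarrow> real \<Rightarrow> real" where
  "Psi \<alpha> r u = u powr (1 - r) * exp (- 2 * \<alpha> * u powr r) / (2 * \<alpha> * r)"

text \<open>Bounds the relative error of \<open>- Psi\<close> as an antiderivative, see
  \<open>Psi_deriv\<close>; it decreases in \<open>u\<close>, so on an interval its value at the
  left end serves.\<close>

definition Psi_err :: "real \<Rightarrow> real \<Rightarrow> real \<Rightarrow> real" where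
  "Psi_err \<alpha> r u = \<bar>1 - r\<bar> / (2 * \<alpha> * r) * u powr (- r)"

definition exp_int :: "real \<Rightarrow> real \<Rightarrow> real \<Rightarrow> real \<Rightarrow> real" where
  "exp_int \<alpha> r a b = (LINT u|lborel. indicator {a..b} u * exp (- 2 * \<alpha> * u powr r))"

context
  fixes \<alpha> r :: real
  assumes \<alpha>: "0 < \<alpha>" and r: "0 < r"
begin

lemma Psi_pos: "0 < u \<Longrightarrow> 0 < Psi \<alpha> r u"
  using \<alpha> r by (simp add: Psi_def)

lemma Psi_deriv:
  assumes u: "0 < u"
  shows "(Psi \<alpha> r has_real_derivative - (exp (- 2 * \<alpha> * u powr r) * (1 - (1 - r) / (2 * \<alpha> * r) * u powr (- r)))) (at u)"
proof -
  let ?e = "exp (- 2 * \<alpha> * u powr r)"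
  have X: "u powr (1 - r) * u powr (r - 1) = 1" using u by (simp flip: powr_add)
  have d1: "((\<lambda>u. u powr (1 - r)) has_real_derivative (1 - r) * u powr (- r)) (at u)"
    using has_real_derivative_powr[OF u, of "1 - r"] by simp
  have d2: "((\<lambda>u. exp (- 2 * \<alpha> * u powr r)) has_real_derivative - (2 * \<alpha> * r * u powr (r - 1)) * ?e) (at u)"
    using u by (auto intro!: derivative_eq_intros)
  have "- (2 * \<alpha> * r * u powr (r - 1)) * ?e * u powr (1 - r) = - (2 * \<alpha> * r) * ?e * (u powr (1 - r) * u powr (r - 1))"
    by (simp add: mult_ac)
  then have Y: "- (2 * \<alpha> * r * u powr (r - 1)) * ?e * u powr (1 - r) = - (2 * \<alpha> * r) * ?e" unfolding X by simp
  have "((1 - r) * u powr (- r) * ?e + - (2 * \<alpha> * r * u powr (r - 1)) * ?e * u powr (1 - r)) / (2 * \<alpha> * r)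
      = - (?e * (1 - (1 - r) / (2 * \<alpha> * r) * u powr (- r)))"
    unfolding Y using \<alpha> r by (simp add: field_simps)
  from DERIV_cong[OF DERIV_cdivide[OF DERIV_mult[OF d1 d2]] this]
  show ?thesis unfolding Psi_def[abs_def] .
qed

lemma integrable_exp_int: "0 < a \<Longrightarrow> integrable lborel (\<lambda>u. indicator {a..b} u * exp (- 2 * \<alpha> * u powr r))"
  using integrable_cut[of a b 0 0 0 0] by simp

lemma exp_int_nonneg: "0 \<le> exp_int \<alpha> r a b"
  unfolding exp_int_def by (intro integral_nonneg_AE AE_I2) auto

lemma exp_int_bounds:
  assumes a: "0 < a" and ab: "a \<le> b"
  shows "(1 - Psi_err \<alpha> r a) * exp_int \<alpha> r a b \<le> Psi \<alpha> r a - Psi \<alpha> r b"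
    and "Psi \<alpha> r a - Psi \<alpha> r b \<le> (1 + Psi_err \<alpha> r a) * exp_int \<alpha> r a b"
proof -
  let ?e = "\<lambda>u. exp (- 2 * \<alpha> * u powr r)" and ?d = "\<lambda>u. (1 - r) / (2 * \<alpha> * r) * u powr (- r)"
  have c: "continuous_on {a..b} (\<lambda>u. ?e u * (1 - ?d u))" using a by (intro continuous_intros) auto
  have i: "integrable lborel (\<lambda>u. indicator {a..b} u * (?e u * (1 - ?d u)))"
    using borel_integrable_compact[OF _ c] by simp
  have F: "(LINT u|lborel. indicator {a..b} u * (?e u * (1 - ?d u))) = Psi \<alpha> r a - Psi \<alpha> r b"
  proof -
    have "(LINT u|lborel. indicator {a..b} u *\<^sub>R (?e u * (1 - ?d u))) = - Psi \<alpha> r b - (- Psi \<alpha> r a)"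
    proof (rule integral_FTC_Icc[OF ab _ c])
      fix u assume "a \<le> u" "u \<le> b"
      then have "((\<lambda>u. - Psi \<alpha> r u) has_real_derivative - (- (?e u * (1 - ?d u)))) (at u within {a..b})"
        using a by (intro DERIV_minus has_field_derivative_at_within[OF Psi_deriv]) auto
      then show "((\<lambda>u. - Psi \<alpha> r u) has_vector_derivative ?e u * (1 - ?d u)) (at u within {a..b})"
        by (simp add: has_real_derivative_iff_has_vector_derivative)
    qed
    then show ?thesis by simp
  qed
  have d: "\<bar>?d u\<bar> \<le> Psi_err \<alpha> r a" if "a \<le> u" for u
  proof -
    have "u powr (- r) \<le> a powr (- r)" using that a r by (intro powr_mono2') auto
    then have "\<bar>1 - r\<bar> / (2 * \<alpha> * r) * u powr (- r) \<le> Psi_err \<alpha> r a"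
      unfolding Psi_err_def using \<alpha> r by (intro mult_left_mono) auto
    then show ?thesis using \<alpha> r by (simp add: abs_mult abs_divide)
  qed
  have "(1 - Psi_err \<alpha> r a) * exp_int \<alpha> r a b = (LINT u|lborel. (1 - Psi_err \<alpha> r a) * (indicator {a..b} u * ?e u))"
    unfolding exp_int_def by simp
  also have "\<dots> \<le> (LINT u|lborel. indicator {a..b} u * (?e u * (1 - ?d u)))"
  proof (rule integral_mono[OF integrable_mult_right[OF integrable_exp_int[OF a]] i])
    fix u
    show "(1 - Psi_err \<alpha> r a) * (indicator {a..b} u * ?e u) \<le> indicator {a..b} u * (?e u * (1 - ?d u))"
    proof (cases "u \<in> {a..b}")
      case True
      then have "?d u \<le> Psi_err \<alpha> r a" by (intro order_trans[OF abs_ge_self d]) auto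
      then have "1 - Psi_err \<alpha> r a \<le> 1 - ?d u" by linarith
      then have "(1 - Psi_err \<alpha> r a) * ?e u \<le> (1 - ?d u) * ?e u" by (rule mult_right_mono) simp
      then show ?thesis using True by (simp add: mult.commute)
    qed simp
  qed
  finally show "(1 - Psi_err \<alpha> r a) * exp_int \<alpha> r a b \<le> Psi \<alpha> r a - Psi \<alpha> r b" unfolding F .
  have "(LINT u|lborel. indicator {a..b} u * (?e u * (1 - ?d u))) \<le> (LINT u|lborel. (1 + Psi_err \<alpha> r a) * (indicator {a..b} u * ?e u))"
  proof (rule integral_mono[OF i integrable_mult_right[OF integrable_exp_int[OF a]]])
    fix u
    show "indicator {a..b} u * (?e u * (1 - ?d u)) \<le> (1 + Psi_err \<alpha> r a) * (indicator {a..b} u * ?e u)"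
    proof (cases "u \<in> {a..b}")
      case True
      then have "- ?d u \<le> Psi_err \<alpha> r a" by (intro order_trans[OF abs_ge_minus_self d]) auto
      then have "1 - ?d u \<le> 1 + Psi_err \<alpha> r a" by linarith
      then have "(1 - ?d u) * ?e u \<le> (1 + Psi_err \<alpha> r a) * ?e u" by (rule mult_right_mono) simp
      then show ?thesis using True by (simp add: mult.commute)
    qed simp
  qed
  also have "\<dots> = (1 + Psi_err \<alpha> r a) * exp_int \<alpha> r a b" unfolding exp_int_def by simp
  finally show "Psi \<alpha> r a - Psi \<alpha> r b \<le> (1 + Psi_err \<alpha> r a) * exp_int \<alpha> r a b" unfolding F .
qed

lemma exp_tail_le:
  assumes a: "0 < a" and e: "Psi_err \<alpha> r a < 1"
  shows "exp_tail (2 * \<alpha>) r a \<le> 2 * Psi \<alpha> r a / (1 - Psi_err \<alpha> r a)"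
proof -
  let ?e = "\<lambda>u. exp (- 2 * \<alpha> * u powr r)"
  define R where "R = Psi \<alpha> r a / (1 - Psi_err \<alpha> r a)"
  have i: "integrable lborel (\<lambda>u. indicator {u. a < \<bar>u\<bar>} u * exp (- (2 * \<alpha>) * \<bar>u\<bar> powr r))"
    by (rule integrable_exp_tail) (use \<alpha> r in auto)
  let ?f = "\<lambda>n u. indicator {u. a \<le> \<bar>u\<bar> \<and> \<bar>u\<bar> \<le> a + real n} u * ennreal (?e \<bar>u\<bar>)"
  have f: "(\<integral>\<^sup>+u. ?f n u \<partial>lborel) \<le> ennreal (2 * R)" for n
  proof -
    have "(\<integral>\<^sup>+u. ?f n u \<partial>lborel) = 2 * (\<integral>\<^sup>+u. indicator {a..a + real n} u * ennreal (?e u) \<partial>lborel)"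
      by (rule nn_integral_even_ext[OF _ a]) measurable
    also have "(\<integral>\<^sup>+u. indicator {a..a + real n} u * ennreal (?e u) \<partial>lborel) = (\<integral>\<^sup>+u. ennreal (indicator {a..a + real n} u * ?e u) \<partial>lborel)"
      by (intro nn_integral_cong) (simp split: split_indicator)
    also have "\<dots> = ennreal (exp_int \<alpha> r a (a + real n))"
      unfolding exp_int_def by (rule nn_integral_eq_integral[OF integrable_exp_int[OF a]]) auto
    finally have 1: "(\<integral>\<^sup>+u. ?f n u \<partial>lborel) = ennreal (2 * exp_int \<alpha> r a (a + real n))" using exp_int_nonneg by (simp add: ennreal_mult)
    have "(1 - Psi_err \<alpha> r a) * exp_int \<alpha> r a (a + real n) \<le> Psi \<alpha> r a"
      using exp_int_bounds(1)[OF a, of "a + real n"] Psi_pos[of "a + real n"] a by simp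
    then have "exp_int \<alpha> r a (a + real n) \<le> R" unfolding R_def using e by (simp add: field_simps)
    then show ?thesis unfolding 1 by (intro ennreal_leI) simp
  qed
  have "(\<integral>\<^sup>+u. ennreal (indicator {u. a < \<bar>u\<bar>} u * exp (- (2 * \<alpha>) * \<bar>u\<bar> powr r)) \<partial>lborel) \<le> (\<integral>\<^sup>+u. liminf (\<lambda>n. ?f n u) \<partial>lborel)"
  proof (rule nn_integral_mono)
    fix u :: real
    have "ennreal (indicator {u. a < \<bar>u\<bar>} u * exp (- (2 * \<alpha>) * \<bar>u\<bar> powr r)) \<le> liminf (\<lambda>n. ?f n u)"
    proof (cases "a < \<bar>u\<bar>")
      case True
      obtain N where N: "\<bar>u\<bar> \<le> real N" using real_arch_simple by blast
      have "\<forall>\<^sub>F n in sequentially. ennreal (?e \<bar>u\<bar>) \<le> ?f n u"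
        using eventually_ge_at_top[of N] by eventually_elim (use True N a in auto)
      from Liminf_bounded[OF this] show ?thesis using True by simp
    qed simp
    then show "ennreal (indicator {u. a < \<bar>u\<bar>} u * exp (- (2 * \<alpha>) * \<bar>u\<bar> powr r)) \<le> liminf (\<lambda>n. ?f n u)" .
  qed
  also have "\<dots> \<le> liminf (\<lambda>n. \<integral>\<^sup>+u. ?f n u \<partial>lborel)" by (rule nn_integral_liminf) measurable
  also have "\<dots> \<le> liminf (\<lambda>n::nat. ennreal (2 * R))" by (rule Liminf_mono, rule always_eventually, rule allI, rule f)
  also have "\<dots> = ennreal (2 * R)" by (simp add: Liminf_const)
  finally have "ennreal (exp_tail (2 * \<alpha>) r a) \<le> ennreal (2 * R)"
    unfolding exp_tail_def by (subst nn_integral_eq_integral[OF i, symmetric]) auto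
  moreover have "0 \<le> R" unfolding R_def using Psi_pos[OF a] e by simp
  ultimately show ?thesis by (simp add: R_def ennreal_le_iff)
qed

end

lemma tendsto_Psi_err: "0 < r \<Longrightarrow> (Psi_err \<alpha> r \<longlongrightarrow> 0) at_top"
proof -
  assume r: "0 < r"
  have "((\<lambda>u::real. u powr (- r)) \<longlongrightarrow> 0) at_top" using r by real_asymp
  from tendsto_mult_left[OF this, of "\<bar>1 - r\<bar> / (2 * \<alpha> * r)"] show ?thesis unfolding Psi_err_def[abs_def] by simp
qed

section \<open>The lower bound to first order\<close>

text \<open>What the two-point bound retains after the chi-square correction; it is useful only when
  close to 1 and may be negative.\<close>

definition lik_loss :: "real \<Rightarrow> real \<Rightarrow> real \<Rightarrow> real \<Rightarrow> real \<Rightarrow> nat \<Rightarrow> real \<Rightarrow> nat \<Rightarrow> real" where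
  "lik_loss \<alpha> r \<beta> s C K a n = 1 - 2 * sqrt ((1 + C * (a ^ K * exp (- 2 * \<alpha> * a powr r - 2 * \<beta> * a powr s))) ^ n - 1)"

text \<open>Used with \<open>z\<close> a value of \<open>lik_loss\<close>; when that is negative,
  the left side is truncated to 0.\<close>

lemma ennreal_mult_right_mono_pos:
  assumes "0 \<le> x" "x \<le> y" shows "ennreal (x * z) \<le> ennreal (y * z)"
proof (cases "0 \<le> z")
  case True
  then show ?thesis using assms by (intro ennreal_leI mult_right_mono)
next
  case False
  then have "x * z \<le> 0" using assms by (intro mult_nonneg_nonpos) auto
  then show ?thesis by (simp add: ennreal_neg)
qed

lemma tendsto_exp_shift:
  assumes \<alpha>: "0 < \<alpha>" and r: "0 < r" "r < 2"
  shows "((\<lambda>a::real. exp (- 2 * \<alpha> * ((a + 1 / a) powr r - a powr r))) \<longlongrightarrow> 1) at_top"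
proof -
  have "((\<lambda>a::real. (a + 1 / a) powr r - a powr r) \<longlongrightarrow> 0) at_top" using r by real_asymp
  then have "((\<lambda>a::real. exp (- 2 * \<alpha> * ((a + 1 / a) powr r - a powr r))) \<longlongrightarrow> exp (- 2 * \<alpha> * 0)) at_top"
    by (intro tendsto_intros)
  then show ?thesis by simp
qed

text \<open>At a point the band must carry almost all of the integral of exp(-2\<alpha>u^r) beyond
  \<open>a\<close>, and \<open>{a..2 * a}\<close> does. In L2 the class weight must be almost
  constant on the band, and \<open>{a..a + 1/a}\<close> achieves this because (a + 1/a)^r - a^r
  tends to 0 for r < 2. The corrections are collected in \<open>\<omega>1\<close> and
  \<open>\<omega>2\<close>.\<close>

lemma minimax_lower:
  fixes \<alpha> \<beta> r s L L1 :: real and fe :: "real \<Rightarrow> real"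
  assumes \<alpha>: "0 < \<alpha>" and r: "0 < r" "r < 2" and L1: "0 < L1" "L1 < L" and fe: "prob_density fe"
    and N: "assumption_N \<beta> s (fourier fe)" and ND: "assumption_ND \<beta> s (fourier fe)"
  obtains C K \<omega>1 \<omega>2 where "0 \<le> C" "(\<omega>1 \<longlongrightarrow> 1) at_top" "(\<omega>2 \<longlongrightarrow> 1) at_top"
    "\<forall>\<^sub>F a in at_top. \<forall>n x. \<forall>T\<in>estimators n.
     ennreal (L1 / pi * (Psi \<alpha> r a * \<omega>1 a) * lik_loss \<alpha> r \<beta> s C K a n) \<le> risk_pt fe \<alpha> r L n x T
   \<and> ennreal (L1 * (exp (- 2 * \<alpha> * a powr r) * \<omega>2 a) * lik_loss \<alpha> r \<beta> s C K a n) \<le> risk_L2 fe \<alpha> r L n T"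
proof -
  obtain C K where C: "0 \<le> C" and ev: "\<forall>\<^sub>F a in at_top. \<forall>b n x T. a + 1 / a \<le> b \<longrightarrow> b \<le> 2 * a \<longrightarrow> T \<in> estimators n \<longrightarrow>
     ennreal (L1 / pi * ((cut_int \<alpha> r 1 a b)\<^sup>2 / cut_int \<alpha> r 2 a b) * lik_loss \<alpha> r \<beta> s C K a n) \<le> risk_pt fe \<alpha> r L n x T
   \<and> ennreal (L1 * exp (- 2 * \<alpha> * b powr r) * lik_loss \<alpha> r \<beta> s C K a n) \<le> risk_L2 fe \<alpha> r L n T"
    unfolding lik_loss_def by (rule minimax_lower_cutoff[OF assms])
  define \<omega>2 where "\<omega>2 a = exp (- 2 * \<alpha> * ((a + 1 / a) powr r - a powr r))" for a :: real
  have w2: "(\<omega>2 \<longlongrightarrow> 1) at_top" unfolding \<omega>2_def[abs_def] by (rule tendsto_exp_shift[OF \<alpha> r])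
  \<comment> \<open>The fraction of the mass, measured by \<open>Psi\<close>, that is left after
    trimming 1/a from both ends of \<open>{a..2 * a}\<close>.\<close>
  define Q where "Q a = (Psi \<alpha> r (a + 1 / a) - Psi \<alpha> r (2 * a - 1 / a)) / Psi \<alpha> r a" for a
  \<comment> \<open>At distance 1/a from the ends the cut-off is at least (1 - exp(-a))^4, since a^2
    times 1/a is a. This factor and \<open>Q\<close> occur squared because they come from the
    squared integral with \<open>j = 1\<close>; the error terms convert \<open>exp_int\<close> into
    \<open>Psi\<close>.\<close>
  define \<omega>1 where "\<omega>1 a = (1 - exp (- a)) ^ 8 * (Q a)\<^sup>2 * (1 - Psi_err \<alpha> r a) / (1 + Psi_err \<alpha> r a)\<^sup>2" for a
  have err0: "(Psi_err \<alpha> r \<longlongrightarrow> 0) at_top" by (rule tendsto_Psi_err[OF r(1)])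
  have Q1: "((\<lambda>a. Psi \<alpha> r (a + 1 / a) / Psi \<alpha> r a) \<longlongrightarrow> 1) at_top"
  proof -
    have "((\<lambda>a::real. (1 + 1 / a\<^sup>2) powr (1 - r)) \<longlongrightarrow> 1) at_top" by real_asymp
    from tendsto_mult[OF this w2] have "((\<lambda>a. (1 + 1 / a\<^sup>2) powr (1 - r) * \<omega>2 a) \<longlongrightarrow> 1) at_top" by simp
    moreover have "\<forall>\<^sub>F a in at_top. (1 + 1 / a\<^sup>2) powr (1 - r) * \<omega>2 a = Psi \<alpha> r (a + 1 / a) / Psi \<alpha> r a"
      using eventually_gt_at_top[of 0]
    proof eventually_elim
      case (elim a)
      have "a + 1 / a = a * (1 + 1 / a\<^sup>2)" using elim by (simp add: power2_eq_square field_simps)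
      then have "(a + 1 / a) powr (1 - r) = a powr (1 - r) * (1 + 1 / a\<^sup>2) powr (1 - r)" using elim by (simp add: powr_mult)
      then show ?case unfolding Psi_def \<omega>2_def using elim \<alpha> r by (simp add: exp_diff right_diff_distrib exp_minus field_simps)
    qed
    ultimately show ?thesis by (rule Lim_transform_eventually)
  qed
  have Q2: "((\<lambda>a. Psi \<alpha> r (2 * a - 1 / a) / Psi \<alpha> r a) \<longlongrightarrow> 0) at_top"
  proof (rule Lim_null_comparison)
    \<comment> \<open>For a \<ge> 2 the trimmed end 2a - 1/a is at least 3a/2, so there u^r exceeds
      a^r by at least the fixed fraction \<open>q\<close> of a^r.\<close>
    define q where "q = (3 / 2) powr r - (1 :: real)"
    have q: "0 < q" using r unfolding q_def by simp
    show "((\<lambda>a::real. 2 powr \<bar>1 - r\<bar> * exp (- 2 * \<alpha> * (q * a powr r))) \<longlongrightarrow> 0) at_top"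
    proof -
      have "((\<lambda>a::real. exp (- (2 * \<alpha> * q) * a powr r)) \<longlongrightarrow> 0) at_top" using \<alpha> q r by real_asymp
      from tendsto_mult_left[OF this, of "2 powr \<bar>1 - r\<bar>"] show ?thesis by (simp add: mult_ac)
    qed
    show "\<forall>\<^sub>F a in at_top. norm (Psi \<alpha> r (2 * a - 1 / a) / Psi \<alpha> r a) \<le> 2 powr \<bar>1 - r\<bar> * exp (- 2 * \<alpha> * (q * a powr r))"
      using eventually_ge_at_top[of 2]
    proof eventually_elim
      case (elim a)
      define t where "t = 2 - 1 / a\<^sup>2"
      have "4 \<le> a\<^sup>2" using power_mono[OF elim, of 2] by simp
      then have "1 / a\<^sup>2 \<le> 1 / 4" by (intro divide_left_mono) auto
      then have t: "3 / 2 \<le> t" "t \<le> 2" unfolding t_def by auto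
      have e: "2 * a - 1 / a = a * t" using elim by (simp add: t_def power2_eq_square field_simps)
      have p1: "t powr (1 - r) \<le> 2 powr \<bar>1 - r\<bar>"
      proof -
        have "t powr (1 - r) \<le> t powr \<bar>1 - r\<bar>" using t by (intro powr_mono) auto
        also have "\<dots> \<le> 2 powr \<bar>1 - r\<bar>" using t by (intro powr_mono2) auto
        finally show ?thesis .
      qed
      have p2: "exp (- 2 * \<alpha> * ((a * t) powr r - a powr r)) \<le> exp (- 2 * \<alpha> * (q * a powr r))"
      proof -
        have "(3 / 2) powr r \<le> t powr r" using t r by (intro powr_mono2) auto
        then have "q * a powr r \<le> (t powr r - 1) * a powr r" unfolding q_def by (intro mult_right_mono) auto
        also have "\<dots> = (a * t) powr r - a powr r" using elim t by (simp add: powr_mult algebra_simps)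
        finally show ?thesis using \<alpha> by simp
      qed
      have "Psi \<alpha> r (2 * a - 1 / a) / Psi \<alpha> r a = t powr (1 - r) * exp (- 2 * \<alpha> * ((a * t) powr r - a powr r))"
        unfolding e Psi_def using elim t \<alpha> r by (simp add: powr_mult exp_diff right_diff_distrib exp_minus field_simps)
      also have "\<dots> \<le> 2 powr \<bar>1 - r\<bar> * exp (- 2 * \<alpha> * (q * a powr r))" by (intro mult_mono p1 p2) auto
      finally have "Psi \<alpha> r (2 * a - 1 / a) / Psi \<alpha> r a \<le> 2 powr \<bar>1 - r\<bar> * exp (- 2 * \<alpha> * (q * a powr r))" .
      moreover have "0 \<le> Psi \<alpha> r (2 * a - 1 / a) / Psi \<alpha> r a"
        unfolding e using Psi_pos[OF \<alpha> r(1), of "a * t"] Psi_pos[OF \<alpha> r(1), of a] elim t by simp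
      ultimately show ?case by simp
    qed
  qed
  have Ql: "(Q \<longlongrightarrow> 1) at_top"
    using tendsto_diff[OF Q1 Q2] unfolding Q_def[abs_def] by (simp add: diff_divide_distrib)
  have w1: "(\<omega>1 \<longlongrightarrow> 1) at_top"
  proof -
    have e: "((\<lambda>a::real. exp (- a)) \<longlongrightarrow> 0) at_top" by real_asymp
    have "(\<omega>1 \<longlongrightarrow> (1 - 0) ^ 8 * 1\<^sup>2 * (1 - 0) / (1 + 0)\<^sup>2) at_top"
      unfolding \<omega>1_def[abs_def] by (intro tendsto_intros e Ql err0) auto
    then show ?thesis by simp
  qed
  have errlt: "\<forall>\<^sub>F a in at_top. Psi_err \<alpha> r a < 1" using err0 by (rule order_tendstoD) simp
  have Qpos: "\<forall>\<^sub>F a in at_top. 0 < Q a" using Ql by (rule order_tendstoD) simp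
  have "\<forall>\<^sub>F a in at_top. \<forall>n x. \<forall>T\<in>estimators n.
     ennreal (L1 / pi * (Psi \<alpha> r a * \<omega>1 a) * lik_loss \<alpha> r \<beta> s C K a n) \<le> risk_pt fe \<alpha> r L n x T
   \<and> ennreal (L1 * (exp (- 2 * \<alpha> * a powr r) * \<omega>2 a) * lik_loss \<alpha> r \<beta> s C K a n) \<le> risk_L2 fe \<alpha> r L n T"
    using ev errlt Qpos eventually_ge_at_top[of 2]
  proof eventually_elim
    case (elim a)
    show ?case
    proof (intro allI ballI conjI)
      fix n :: nat and x :: real and T assume T: "T \<in> estimators n"
      have a: "0 < a" "1 \<le> a" using elim by auto
      have "1 / a \<le> 1" using elim by simp
      then have b: "a + 1 / a \<le> 2 * a" using elim by linarith
      \<comment> \<open>Without the cut-off both integrals would be the same integral, and their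
        quotient would be close to \<open>Psi \<alpha> r a\<close>. The numerator is bounded below
        on the trimmed band, the denominator above with the cut-off replaced by 1.\<close>
      have *: "Psi \<alpha> r a * \<omega>1 a \<le> (cut_int \<alpha> r 1 a (2 * a))\<^sup>2 / cut_int \<alpha> r 2 a (2 * a)"
      proof -
        define \<epsilon> where "\<epsilon> = Psi_err \<alpha> r a"
        have \<epsilon>: "0 \<le> \<epsilon>" "\<epsilon> < 1" using elim \<alpha> r by (auto simp: \<epsilon>_def Psi_err_def)
        have P: "0 < Psi \<alpha> r a" by (rule Psi_pos[OF \<alpha> r(1) a(1)])
        have J1: "(1 - exp (- a)) ^ 4 * exp_int \<alpha> r (a + 1 / a) (2 * a - 1 / a) \<le> cut_int \<alpha> r 1 a (2 * a)"
        proof -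
          have "a\<^sup>2 * (1 / a) = a" using a by (simp add: power2_eq_square)
          moreover have "a + 1 / a \<le> 2 * a - 1 / a" using \<open>1 / a \<le> 1\<close> elim by linarith
          ultimately show ?thesis using cut_int_ge[of a "1 / a" "2 * a - 1 / a" "2 * a" \<alpha> r 1] a \<alpha> r unfolding exp_int_def by simp
        qed
        have aa1: "0 < a + 1 / a" using a by (simp add: add_pos_pos)
        have aa2: "a + 1 / a \<le> 2 * a - 1 / a" using \<open>1 / a \<le> 1\<close> elim(4) by linarith
        note aa = aa1 aa2
        have "Psi_err \<alpha> r (a + 1 / a) \<le> \<epsilon>"
          unfolding \<epsilon>_def Psi_err_def using \<alpha> r a by (intro mult_left_mono powr_mono2') auto
        then have "Psi \<alpha> r (a + 1 / a) - Psi \<alpha> r (2 * a - 1 / a) \<le> (1 + \<epsilon>) * exp_int \<alpha> r (a + 1 / a) (2 * a - 1 / a)"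
          using exp_int_bounds(2)[OF \<alpha> r(1) aa] exp_int_nonneg[OF \<alpha> r(1), of "a + 1 / a" "2 * a - 1 / a"]
          by (meson add_left_mono mult_right_mono order_trans)
        then have J2: "Q a * Psi \<alpha> r a / (1 + \<epsilon>) \<le> exp_int \<alpha> r (a + 1 / a) (2 * a - 1 / a)"
          unfolding Q_def using P \<epsilon> by (simp add: divide_le_eq mult.commute)
        have J3: "(1 - exp (- a)) ^ 4 * (Q a * Psi \<alpha> r a / (1 + \<epsilon>)) \<le> cut_int \<alpha> r 1 a (2 * a)"
          by (rule order_trans[OF mult_left_mono[OF J2] J1]) simp
        have J4: "cut_int \<alpha> r 2 a (2 * a) \<le> Psi \<alpha> r a / (1 - \<epsilon>)"
        proof -
          have "cut_int \<alpha> r 2 a (2 * a) \<le> exp_int \<alpha> r a (2 * a)"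
            unfolding cut_int_def exp_int_def
          proof (rule integral_mono[OF integrable_cut[OF a(1)] integrable_exp_int[OF \<alpha> r(1) a(1)]])
            fix u
            show "indicator {a..2 * a} u * ((cutoff a (2 * a) (a\<^sup>2) u)\<^sup>2 * exp (- 2 * \<alpha> * u powr r)) \<le> indicator {a..2 * a} u * exp (- 2 * \<alpha> * u powr r)"
            proof (cases "u \<in> {a..2 * a}")
              case True
              then have "(cutoff a (2 * a) (a\<^sup>2) u)\<^sup>2 \<le> 1" using cutoff_bounds[of "a\<^sup>2" a u "2 * a"] by (simp add: abs_square_le_1)
              then show ?thesis using True by (simp add: mult_le_cancel_right2)
            qed simp
          qed
          also have "(1 - \<epsilon>) * exp_int \<alpha> r a (2 * a) \<le> Psi \<alpha> r a"
            using exp_int_bounds(1)[OF \<alpha> r(1) a(1), of "2 * a"] Psi_pos[OF \<alpha> r(1), of "2 * a"] a unfolding \<epsilon>_def by simp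
          then have "exp_int \<alpha> r a (2 * a) \<le> Psi \<alpha> r a / (1 - \<epsilon>)" using \<epsilon> by (simp add: field_simps)
          finally show ?thesis .
        qed
        have J5: "0 < (1 - exp (- a)) ^ 4 * (Q a * Psi \<alpha> r a / (1 + \<epsilon>))" using a elim P \<epsilon> by (intro mult_pos_pos divide_pos_pos) auto
        have I0: "0 < cut_int \<alpha> r 2 a (2 * a)"
        proof -
          have "0 < (1 - exp (- a)) ^ 8 * exp_int \<alpha> r (a + 1 / a) (2 * a - 1 / a)"
          proof -
            have "0 < Q a * Psi \<alpha> r a / (1 + \<epsilon>)" using elim P \<epsilon> by (intro mult_pos_pos divide_pos_pos) auto
            then have "0 < exp_int \<alpha> r (a + 1 / a) (2 * a - 1 / a)" using J2 by linarith
            then show ?thesis using a by simp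
          qed
          also have "\<dots> \<le> cut_int \<alpha> r 2 a (2 * a)"
          proof -
            have "a\<^sup>2 * (1 / a) = a" using a by (simp add: power2_eq_square)
            then show ?thesis using cut_int_ge[of a "1 / a" "2 * a - 1 / a" "2 * a" \<alpha> r 2] a aa \<alpha> r unfolding exp_int_def by simp
          qed
          finally show ?thesis .
        qed
        have "Psi \<alpha> r a * \<omega>1 a = ((1 - exp (- a)) ^ 4 * (Q a * Psi \<alpha> r a / (1 + \<epsilon>)))\<^sup>2 / (Psi \<alpha> r a / (1 - \<epsilon>))"
          unfolding \<omega>1_def \<epsilon>_def[symmetric] using P \<epsilon> by (simp add: power_mult_distrib power_divide power2_eq_square flip: power_add)
        also have "\<dots> \<le> (cut_int \<alpha> r 1 a (2 * a))\<^sup>2 / cut_int \<alpha> r 2 a (2 * a)"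
          using J3 J4 J5 I0 by (intro frac_le power_mono) auto
        finally show ?thesis .
      qed
      have \<omega>1n: "0 \<le> Psi \<alpha> r a * \<omega>1 a" unfolding \<omega>1_def using Psi_pos[OF \<alpha> r(1) a(1)] elim a by (auto intro!: mult_nonneg_nonneg divide_nonneg_nonneg)
      have "ennreal (L1 / pi * (Psi \<alpha> r a * \<omega>1 a) * lik_loss \<alpha> r \<beta> s C K a n)
         \<le> ennreal (L1 / pi * ((cut_int \<alpha> r 1 a (2 * a))\<^sup>2 / cut_int \<alpha> r 2 a (2 * a)) * lik_loss \<alpha> r \<beta> s C K a n)"
        using * \<omega>1n L1 by (intro ennreal_mult_right_mono_pos mult_left_mono) auto
      also have "\<dots> \<le> risk_pt fe \<alpha> r L n x T" using elim(1) b T by blast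
      finally show "ennreal (L1 / pi * (Psi \<alpha> r a * \<omega>1 a) * lik_loss \<alpha> r \<beta> s C K a n) \<le> risk_pt fe \<alpha> r L n x T" .
      have "exp (- 2 * \<alpha> * a powr r) * \<omega>2 a = exp (- 2 * \<alpha> * (a + 1 / a) powr r)"
        unfolding \<omega>2_def by (simp add: algebra_simps flip: exp_add)
      then show "ennreal (L1 * (exp (- 2 * \<alpha> * a powr r) * \<omega>2 a) * lik_loss \<alpha> r \<beta> s C K a n) \<le> risk_L2 fe \<alpha> r L n T"
        using elim(1) b T by auto
    qed
  qed
  with C w1 w2 show ?thesis by (rule that)
qed

section \<open>Growth of the inverse noise transform\<close>

text \<open>Near 0 the transform is continuous without zeros, so compactness bounds its inverse;
  beyond \<open>u0\<close> assumption (N) takes over. This controls the spectrum of the kernel and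
  hence the variance.\<close>

lemma noise_inverse_bound:
  assumes fe: "prob_density fe" and N: "assumption_N \<beta> s (fourier fe)" and nz: "\<And>u. fourier fe u \<noteq> 0"
  obtains C K where "0 < C" "\<And>a u. 1 \<le> a \<Longrightarrow> \<bar>u\<bar> \<le> a \<Longrightarrow> 1 / cmod (fourier fe u) \<le> C * a ^ K * exp (\<beta> * a powr s)"
proof -
  obtain u0 bmin bmax \<gamma> \<gamma>' where N': "0 < u0" "0 < bmin" "0 < \<beta>" "0 < s"
     "\<And>u. u0 \<le> \<bar>u\<bar> \<Longrightarrow> bmin * \<bar>u\<bar> powr \<gamma> * exp (- \<beta> * \<bar>u\<bar> powr s) \<le> cmod (fourier fe u)"
    using N unfolding assumption_N_def by metis
  have "continuous_on {-u0..u0} (\<lambda>u. 1 / cmod (fourier fe u))"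
  proof -
    have "continuous_on {-u0..u0} (fourier fe)"
      using continuous_on_cft[of "\<lambda>x. complex_of_real (fe x)"] prob_densityD(3)[OF fe] by (simp add: fourier_eq_cft[abs_def])
    then show ?thesis by (intro continuous_intros) (auto simp: nz)
  qed
  then have "bounded ((\<lambda>u. 1 / cmod (fourier fe u)) ` {-u0..u0})"
    by (intro compact_imp_bounded compact_continuous_image) auto
  then obtain C0 where C0: "0 < C0" "\<And>u. u \<in> {-u0..u0} \<Longrightarrow> 1 / cmod (fourier fe u) \<le> C0"
    unfolding bounded_pos by (auto simp: abs_le_iff)
  obtain K where K: "- \<gamma> \<le> real K" using real_arch_simple by blast
  \<comment> \<open>Beyond \<open>u0\<close> the factor |u|^(-\<gamma>) is at most its value at u0
    for \<gamma> \<ge> 0, and at most a^K for \<gamma> < 0; the sum covers both signs.\<close>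
  define C where "C = C0 + (u0 powr (- \<gamma>) + 1) / bmin"
  show ?thesis
  proof (rule that[of C K])
    show "0 < C" using C0 N' by (simp add: C_def add_pos_nonneg)
    fix a u :: real assume a: "1 \<le> a" and u: "\<bar>u\<bar> \<le> a"
    have aK: "1 \<le> a ^ K" using a by (rule one_le_power)
    have eb: "1 \<le> exp (\<beta> * a powr s)" using N' by simp
    show "1 / cmod (fourier fe u) \<le> C * a ^ K * exp (\<beta> * a powr s)"
    proof (cases "\<bar>u\<bar> \<le> u0")
      case True
      then have "1 / cmod (fourier fe u) \<le> C0 * 1 * 1" using C0(2)[of u] by (auto simp: abs_le_iff)
      also have "\<dots> \<le> C * a ^ K * exp (\<beta> * a powr s)"
        using C0 aK eb N' by (intro mult_mono) (auto simp: C_def)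
      finally show ?thesis .
    next
      case False
      then have u0: "u0 \<le> \<bar>u\<bar>" "0 < \<bar>u\<bar>" using N' by auto
      have p: "\<bar>u\<bar> powr (- \<gamma>) \<le> (u0 powr (- \<gamma>) + 1) * a ^ K"
      proof (cases "0 \<le> \<gamma>")
        case True
        then have "\<bar>u\<bar> powr (- \<gamma>) \<le> u0 powr (- \<gamma>)" using u0 N' by (intro powr_mono2') auto
        also have "\<dots> \<le> (u0 powr (- \<gamma>) + 1) * 1" by simp
        also have "\<dots> \<le> (u0 powr (- \<gamma>) + 1) * a ^ K" using aK by (intro mult_left_mono) auto
        finally show ?thesis .
      next
        case False
        have "\<bar>u\<bar> powr (- \<gamma>) \<le> a powr (- \<gamma>)" using u u0 False by (intro powr_mono2) auto
        also have "\<dots> \<le> a powr real K" using a K by (intro powr_mono) auto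
        also have "\<dots> = 1 * a ^ K" using a by (simp add: powr_realpow)
        also have "\<dots> \<le> (u0 powr (- \<gamma>) + 1) * a ^ K" using aK by (intro mult_right_mono) auto
        finally show ?thesis .
      qed
      have "1 / cmod (fourier fe u) \<le> 1 / (bmin * \<bar>u\<bar> powr \<gamma> * exp (- \<beta> * \<bar>u\<bar> powr s))"
        using N'(5)[OF u0(1)] N'(2) u0(2) nz[of u] by (intro divide_left_mono mult_pos_pos) auto
      also have "\<dots> = \<bar>u\<bar> powr (- \<gamma>) * exp (\<beta> * \<bar>u\<bar> powr s) / bmin"
        by (simp add: powr_minus exp_minus field_simps)
      also have "\<dots> \<le> (u0 powr (- \<gamma>) + 1) * a ^ K * exp (\<beta> * a powr s) / bmin"
        using p N' u aK by (intro divide_right_mono mult_mono) (auto intro!: powr_mono2)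
      also have "\<dots> = (u0 powr (- \<gamma>) + 1) / bmin * a ^ K * exp (\<beta> * a powr s)" by simp
      also have "\<dots> \<le> C * a ^ K * exp (\<beta> * a powr s)"
        using C0 aK by (intro mult_right_mono) (auto simp: C_def)
      finally show ?thesis .
    qed
  qed
qed

section \<open>Bandwidths and rates\<close>

text \<open>As a function of 1/h the left side is continuous and strictly increasing, starts at 0
  and is unbounded. This gives the definite description in \<open>h_star\<close> its
  meaning.\<close>

lemma bandwidth_equation_unique:
  fixes \<alpha> \<beta> r s y :: real
  assumes "0 < \<alpha>" "0 < \<beta>" "0 < r" "0 < s" "0 < y"
  shows "\<exists>!h. 0 < h \<and> 2 * \<beta> / h powr s + 2 * \<alpha> / h powr r = y"
proof -
  define g where "g a = 2 * \<beta> * a powr s + 2 * \<alpha> * a powr r" for a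
  have mono: "g a < g b" if "0 < a" "a < b" for a b
    unfolding g_def using assms that by (intro add_strict_mono mult_strict_left_mono powr_less_mono2) auto
  have inv: "2 * \<beta> / h powr s + 2 * \<alpha> / h powr r = g (1 / h)" if "0 < h" for h
    using that by (simp add: g_def powr_divide)
  define M where "M = (y / (2 * \<beta>)) powr (1 / s)"
  have M: "0 \<le> M" "y \<le> g M" using assms by (auto simp: M_def g_def powr_powr)
  have "continuous_on {0..M} g"
    unfolding g_def using assms by (intro continuous_intros continuous_on_powr') auto
  then obtain a where a: "0 \<le> a" "g a = y" using IVT'[of g 0 y M] M assms by (auto simp: g_def)
  have "a \<noteq> 0" using a(2) assms by (auto simp: g_def)
  then have a0: "0 < a" using a by simp
  show ?thesis
  proof (rule ex1I[of _ "1 / a"])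
    show "0 < 1 / a \<and> 2 * \<beta> / (1 / a) powr s + 2 * \<alpha> / (1 / a) powr r = y"
      using a0 a(2) by (simp add: inv)
    fix h assume h: "0 < h \<and> 2 * \<beta> / h powr s + 2 * \<alpha> / h powr r = y"
    then have "g (1 / h) = g a" using inv[of h] a by simp
    then have "1 / h = a" using mono[of a "1 / h"] mono[of "1 / h" a] a0 h by (metis less_irrefl linorder_neqE zero_less_divide_1_iff)
    then show "h = 1 / a" using a0 h by auto
  qed
qed

lemma h_star_spec:
  fixes \<alpha> \<beta> r s :: real
  assumes "0 < \<alpha>" "0 < \<beta>" "0 < r" "0 < s" "0 < ln (real n) - (ln (ln (real n)))\<^sup>2"
  shows "0 < h_star \<alpha> \<beta> r s n"
    and "2 * \<beta> * (1 / h_star \<alpha> \<beta> r s n) powr s + 2 * \<alpha> * (1 / h_star \<alpha> \<beta> r s n) powr r = ln (real n) - (ln (ln (real n)))\<^sup>2"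
proof -
  have *: "0 < h_star \<alpha> \<beta> r s n \<and> 2 * \<beta> / h_star \<alpha> \<beta> r s n powr s + 2 * \<alpha> / h_star \<alpha> \<beta> r s n powr r = ln (real n) - (ln (ln (real n)))\<^sup>2"
    unfolding h_star_def by (rule theI'[OF bandwidth_equation_unique[OF assms]])
  then show "0 < h_star \<alpha> \<beta> r s n" by simp
  with * show "2 * \<beta> * (1 / h_star \<alpha> \<beta> r s n) powr s + 2 * \<alpha> * (1 / h_star \<alpha> \<beta> r s n) powr r = ln (real n) - (ln (ln (real n)))\<^sup>2"
    by (simp add: powr_divide)
qed

lemma filterlim_ln_nat: "filterlim (\<lambda>n. ln (real n)) at_top sequentially"
  by (rule filterlim_compose[OF ln_at_top filterlim_real_sequentially])

text \<open>Write a = 1/h. If a < 1, the left side of the equation would be at most 2(\<alpha> +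
  \<beta>), too small for large n; once a \<ge> 1 the term with a^s dominates since r < s, so a^s is
  of exact order log n.\<close>

lemma eventually_h_star:
  fixes \<alpha> \<beta> r s :: real
  assumes \<alpha>: "0 < \<alpha>" and \<beta>: "0 < \<beta>" and r: "0 < r" and s: "r < s"
  shows "\<forall>\<^sub>F n in sequentially. 0 < h_star \<alpha> \<beta> r s n \<and>
    2 * \<beta> * (1 / h_star \<alpha> \<beta> r s n) powr s + 2 * \<alpha> * (1 / h_star \<alpha> \<beta> r s n) powr r = ln (real n) - (ln (ln (real n)))\<^sup>2 \<and>
    1 \<le> 1 / h_star \<alpha> \<beta> r s n \<and>
    ln (real n) / (4 * (\<alpha> + \<beta>)) \<le> (1 / h_star \<alpha> \<beta> r s n) powr s \<and> (1 / h_star \<alpha> \<beta> r s n) powr s \<le> ln (real n) / (2 * \<beta>)"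
proof -
  have "\<forall>\<^sub>F l::real in at_top. l / 2 < l - (ln l)\<^sup>2" by real_asymp
  moreover have "\<forall>\<^sub>F l::real in at_top. 4 * (\<alpha> + \<beta>) < l" by (rule eventually_gt_at_top)
  ultimately have "\<forall>\<^sub>F l::real in at_top. l / 2 < l - (ln l)\<^sup>2 \<and> 4 * (\<alpha> + \<beta>) < l" by (rule eventually_conj)
  from eventually_compose_filterlim[OF this filterlim_ln_nat] show ?thesis
  proof eventually_elim
    case (elim n)
    define l where "l = ln (real n)"
    define a where "a = 1 / h_star \<alpha> \<beta> r s n"
    have l: "l / 2 < l - (ln l)\<^sup>2" "4 * (\<alpha> + \<beta>) < l" using elim by (auto simp: l_def)
    have "0 < 4 * (\<alpha> + \<beta>)" using \<alpha> \<beta> by simp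
    then have l0: "0 < l" using l(2) by (rule less_trans)
    then have "0 < l / 2" by simp
    then have y: "0 < l - (ln l)\<^sup>2" using l(1) by (rule less_trans)
    note sp = h_star_spec[OF \<alpha> \<beta> r _ y[unfolded l_def]]
    have h: "0 < h_star \<alpha> \<beta> r s n" using sp(1) r s by simp
    have eq: "2 * \<beta> * a powr s + 2 * \<alpha> * a powr r = l - (ln l)\<^sup>2" unfolding a_def l_def using sp(2) r s by simp
    have a0: "0 < a" using h by (simp add: a_def)
    have a1: "1 \<le> a"
    proof (rule ccontr)
      assume "\<not> 1 \<le> a"
      then have "a powr s \<le> 1" "a powr r \<le> 1" using a0 r s by (auto intro!: powr_le1)
      then have "2 * \<beta> * a powr s + 2 * \<alpha> * a powr r \<le> 2 * \<beta> * 1 + 2 * \<alpha> * 1" using \<alpha> \<beta> by (intro add_mono mult_left_mono) auto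
      then have "l - (ln l)\<^sup>2 \<le> 2 * (\<alpha> + \<beta>)" using eq by (simp add: algebra_simps)
      then have "l / 2 < 2 * (\<alpha> + \<beta>)" using l(1) by (rule less_le_trans[rotated])
      then show False using l(2) by simp
    qed
    have "a powr r \<le> a powr s" using a1 s by (intro powr_mono) auto
    then have "2 * \<alpha> * a powr r \<le> 2 * \<alpha> * a powr s" using \<alpha> by simp
    then have "l / 2 \<le> 2 * (\<alpha> + \<beta>) * a powr s" using eq l by (simp add: algebra_simps)
    then have lo: "l / (4 * (\<alpha> + \<beta>)) \<le> a powr s" using \<alpha> \<beta> by (simp add: field_simps)
    have "0 \<le> 2 * \<alpha> * a powr r" using \<alpha> by simp
    moreover have "0 \<le> (ln l)\<^sup>2" by simp
    ultimately have "2 * \<beta> * a powr s \<le> l" using eq by linarith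
    then have "a powr s \<le> l / (2 * \<beta>)" using \<beta> by (simp add: field_simps)
    then show ?case using h eq a1 lo unfolding a_def l_def by simp
  qed
qed

text \<open>Concavity in a crude form: (x/y)^p \<le> x/y for x \<ge> y.\<close>

lemma powr_diff_le:
  fixes x y p :: real assumes "0 < y" "y \<le> x" "0 < p" "p \<le> 1"
  shows "x powr p - y powr p \<le> y powr (p - 1) * (x - y)"
proof -
  have "(x / y) powr p \<le> (x / y) powr 1" using assms by (intro powr_mono) auto
  then have "y powr p * (x / y) powr p \<le> y powr p * (x / y)" using assms by (intro mult_left_mono) auto
  moreover have "y powr p * (x / y) powr p = x powr p" using assms by (simp flip: powr_mult)
  ultimately have "x powr p - y powr p \<le> y powr p * (x / y) - y powr p" by simp
  also have "\<dots> = y powr (p - 1) * (x - y)" using assms by (simp add: powr_diff field_simps)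
  finally show ?thesis .
qed

text \<open>The rates depend on r-th powers of frequencies, while the s-th powers are what is known:
  of order \<open>l\<close>, with difference at most \<open>D\<close>. Passing to the exponent r/s <
  1 multiplies the difference by l^(r/s - 1), so even errors that grow with \<open>l\<close> may
  vanish in the limit.\<close>

lemma powr_close:
  fixes a b l D :: "nat \<Rightarrow> real" and r s c :: real
  assumes r: "0 < r" "r < s" and c: "0 < c"
    and ev: "\<forall>\<^sub>F n in sequentially. 0 < a n \<and> 0 < b n \<and> 1 \<le> l n \<and> c * l n \<le> a n powr s \<and> c * l n \<le> b n powr s \<and> \<bar>a n powr s - b n powr s\<bar> \<le> D n"
    and D: "(\<lambda>n. l n powr (r / s - 1) * D n) \<longlonglongrightarrow> 0"
  shows "(\<lambda>n. a n powr r - b n powr r) \<longlonglongrightarrow> 0" and "(\<lambda>n. a n / b n) \<longlonglongrightarrow> 1"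
proof -
  define p where "p = r / s"
  have p: "0 < p" "p < 1" using r by (auto simp: p_def)
  show "(\<lambda>n. a n powr r - b n powr r) \<longlonglongrightarrow> 0"
  proof (rule Lim_null_comparison)
    show "\<forall>\<^sub>F n in sequentially. norm (a n powr r - b n powr r) \<le> c powr (p - 1) * (l n powr (r / s - 1) * D n)"
      using ev
    proof eventually_elim
      case (elim n)
      have key: "x powr p - y powr p \<le> c powr (p - 1) * (l n powr (p - 1) * D n)" if "c * l n \<le> y" "y \<le> x" "x - y \<le> D n" for x y
      proof -
        have cl: "0 < c * l n" using c elim by simp
        have "x powr p - y powr p \<le> y powr (p - 1) * (x - y)" using that cl p by (intro powr_diff_le) auto
        also have "\<dots> \<le> (c * l n) powr (p - 1) * D n" using that cl p by (intro mult_mono powr_mono2') auto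
        finally show ?thesis using c elim by (simp add: powr_mult mult.assoc)
      qed
      have ar: "a n powr r = (a n powr s) powr p" "b n powr r = (b n powr s) powr p" using r by (auto simp: powr_powr p_def)
      show ?case
      proof (cases "b n powr s \<le> a n powr s")
        case True
        then have "b n powr r \<le> a n powr r" unfolding ar by (rule powr_mono2[OF less_imp_le[OF p(1)] powr_ge_zero])
        then show ?thesis using key[of "b n powr s" "a n powr s"] True elim unfolding ar p_def by auto
      next
        case False
        then have "a n powr r \<le> b n powr r" unfolding ar by (intro powr_mono2[OF less_imp_le[OF p(1)] powr_ge_zero]) simp
        then show ?thesis using key[of "a n powr s" "b n powr s"] False elim unfolding ar p_def by auto
      qed
    qed
    show "(\<lambda>n. c powr (p - 1) * (l n powr (r / s - 1) * D n)) \<longlonglongrightarrow> 0"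
      using tendsto_mult_left[OF D, of "c powr (p - 1)"] by simp
  qed
  have "(\<lambda>n. a n powr s / b n powr s - 1) \<longlonglongrightarrow> 0"
  proof (rule Lim_null_comparison)
    show "\<forall>\<^sub>F n in sequentially. norm (a n powr s / b n powr s - 1) \<le> 1 / c * (l n powr (r / s - 1) * D n)"
      using ev
    proof eventually_elim
      case (elim n)
      have cl: "0 < c * l n" using c elim by simp
      have bs: "0 < b n powr s" using elim by simp
      have D0: "0 \<le> D n" using elim by (meson abs_ge_zero order_trans)
      have "a n powr s / b n powr s - 1 = (a n powr s - b n powr s) / b n powr s" using bs by (simp add: diff_divide_distrib)
      then have "norm (a n powr s / b n powr s - 1) = \<bar>a n powr s - b n powr s\<bar> / b n powr s" by simp
      also have "\<dots> \<le> D n / (c * l n)" using elim cl D0 by (intro frac_le) auto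
      also have "\<dots> = 1 / c * (l n powr (-1) * D n)" using c elim by (simp add: powr_minus_divide)
      also have "\<dots> \<le> 1 / c * (l n powr (r / s - 1) * D n)" using c elim D0 p by (intro mult_left_mono mult_right_mono powr_mono) (auto simp: p_def)
      finally show ?case .
    qed
    show "(\<lambda>n. 1 / c * (l n powr (r / s - 1) * D n)) \<longlonglongrightarrow> 0" using tendsto_mult_left[OF D, of "1 / c"] by simp
  qed
  then have "(\<lambda>n. a n powr s / b n powr s) \<longlonglongrightarrow> 1" by (simp add: LIM_zero_iff)
  then have "(\<lambda>n. (a n powr s / b n powr s) powr (1 / s)) \<longlonglongrightarrow> 1 powr (1 / s)" by (intro tendsto_powr tendsto_const) auto
  moreover have "\<forall>\<^sub>F n in sequentially. (a n powr s / b n powr s) powr (1 / s) = a n / b n"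
    using ev by eventually_elim (use r in \<open>simp add: powr_divide powr_powr\<close>)
  ultimately show "(\<lambda>n. a n / b n) \<longlonglongrightarrow> 1" by (simp add: Lim_transform_eventually)
qed

lemma rate_ratio_tendsto:
  fixes a b :: "nat \<Rightarrow> real"
  assumes ev: "\<forall>\<^sub>F n in sequentially. 0 < a n \<and> 0 < b n" and \<alpha>: "0 < \<alpha>" and r: "0 < r"
    and d: "(\<lambda>n. a n powr r - b n powr r) \<longlonglongrightarrow> 0" and q: "(\<lambda>n. a n / b n) \<longlonglongrightarrow> 1"
  shows "(\<lambda>n. exp (- 2 * \<alpha> * a n powr r) / exp (- 2 * \<alpha> * b n powr r)) \<longlonglongrightarrow> 1"
    and "(\<lambda>n. Psi \<alpha> r (a n) / Psi \<alpha> r (b n)) \<longlonglongrightarrow> 1"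
proof -
  have "(\<lambda>n. exp (- 2 * \<alpha> * (a n powr r - b n powr r))) \<longlonglongrightarrow> exp (- 2 * \<alpha> * 0)" by (intro tendsto_intros d)
  then show e: "(\<lambda>n. exp (- 2 * \<alpha> * a n powr r) / exp (- 2 * \<alpha> * b n powr r)) \<longlonglongrightarrow> 1" by (simp add: exp_diff[symmetric] algebra_simps)
  have "(\<lambda>n. (a n / b n) powr (1 - r)) \<longlonglongrightarrow> 1 powr (1 - r)" by (intro tendsto_powr tendsto_const q) auto
  from tendsto_mult[OF this e] have "(\<lambda>n. (a n / b n) powr (1 - r) * (exp (- 2 * \<alpha> * a n powr r) / exp (- 2 * \<alpha> * b n powr r))) \<longlonglongrightarrow> 1" by simp
  moreover have "\<forall>\<^sub>F n in sequentially. (a n / b n) powr (1 - r) * (exp (- 2 * \<alpha> * a n powr r) / exp (- 2 * \<alpha> * b n powr r)) = Psi \<alpha> r (a n) / Psi \<alpha> r (b n)"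
    using ev by eventually_elim (use \<alpha> r in \<open>simp add: Psi_def powr_divide\<close>)
  ultimately show "(\<lambda>n. Psi \<alpha> r (a n) / Psi \<alpha> r (b n)) \<longlonglongrightarrow> 1" by (rule Lim_transform_eventually)
qed

lemma rate_pt_eq: "0 < h_star \<alpha> \<beta> r s n \<Longrightarrow> rate_pt \<alpha> \<beta> r s L n = L / pi * Psi \<alpha> r (1 / h_star \<alpha> \<beta> r s n)"
  by (simp add: rate_pt_def Psi_def powr_divide powr_diff field_simps)

lemma rate_L2_eq: "0 < h_star \<alpha> \<beta> r s n \<Longrightarrow> rate_L2 \<alpha> \<beta> r s L n = L * exp (- 2 * \<alpha> * (1 / h_star \<alpha> \<beta> r s n) powr r)"
  by (simp add: rate_L2_def powr_divide)

text \<open>The bound (1 + x)^n \<le> exp(n x) reduces the merging of the product laws to n times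
  the chi-square distance tending to 0.\<close>

lemma tendsto_lik_loss:
  assumes C: "0 \<le> C" and a: "\<forall>\<^sub>F n in sequentially. 0 \<le> a n"
    and z: "(\<lambda>n. real n * (a n ^ K * exp (- 2 * \<alpha> * a n powr r - 2 * \<beta> * a n powr s))) \<longlonglongrightarrow> 0"
  shows "(\<lambda>n. lik_loss \<alpha> r \<beta> s C K (a n) n) \<longlonglongrightarrow> 1"
proof -
  define x where "x n = C * (a n ^ K * exp (- 2 * \<alpha> * a n powr r - 2 * \<beta> * a n powr s))" for n
  have "(\<lambda>n. real n * x n) \<longlonglongrightarrow> 0" using tendsto_mult_left[OF z, of C] by (simp add: x_def mult_ac)
  then have e: "(\<lambda>n. exp (real n * x n) - 1) \<longlonglongrightarrow> exp 0 - 1" by (intro tendsto_intros)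
  have "(\<lambda>n. (1 + x n) ^ n - 1) \<longlonglongrightarrow> 0"
  proof (rule tendsto_sandwich[OF _ _ tendsto_const])
    show "\<forall>\<^sub>F n in sequentially. 0 \<le> (1 + x n) ^ n - 1"
      using a by eventually_elim (use C in \<open>simp add: x_def\<close>)
    show "\<forall>\<^sub>F n in sequentially. (1 + x n) ^ n - 1 \<le> exp (real n * x n) - 1"
      using a
    proof eventually_elim
      case (elim n)
      then have "0 \<le> x n" using C by (simp add: x_def)
      then have "(1 + x n) ^ n \<le> exp (x n) ^ n" by (intro power_mono) (auto simp: exp_ge_add_one_self)
      then show ?case by (simp add: exp_of_nat_mult)
    qed
    show "(\<lambda>n. exp (real n * x n) - 1) \<longlonglongrightarrow> 0" using e by simp
  qed
  then have "(\<lambda>n. 1 - 2 * sqrt ((1 + x n) ^ n - 1)) \<longlonglongrightarrow> 1 - 2 * sqrt 0" by (intro tendsto_intros)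
  then show ?thesis by (simp add: lik_loss_def x_def)
qed

section \<open>From one-sided bounds to limits\<close>

text \<open>The lower bounds reach only a fraction \<delta> < 1 of the rate, with a sequence
  depending on \<delta>, because part of the norm budget goes to the base density; as \<delta> is
  arbitrary, this still fixes the limit.\<close>

lemma ennreal_tendsto_oneI:
  fixes f :: "nat \<Rightarrow> ennreal"
  assumes up: "u \<longlonglongrightarrow> 1" "\<forall>\<^sub>F n in sequentially. f n \<le> ennreal (u n)"
    and lo: "\<And>\<delta>::real. 0 < \<delta> \<Longrightarrow> \<delta> < 1 \<Longrightarrow> \<exists>v. v \<longlonglongrightarrow> \<delta> \<and> (\<forall>\<^sub>F n in sequentially. ennreal (v n) \<le> f n)"
  shows "(f \<longlongrightarrow> 1) sequentially"
proof (rule order_tendstoI)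
  fix y :: ennreal assume y: "1 < y"
  have "(\<lambda>n. ennreal (u n)) \<longlonglongrightarrow> ennreal 1" by (intro tendsto_intros up)
  then have "\<forall>\<^sub>F n in sequentially. ennreal (u n) < y" by (rule order_tendstoD) (use y in simp)
  with up(2) show "\<forall>\<^sub>F n in sequentially. f n < y" by eventually_elim simp
next
  fix y :: ennreal assume y: "y < 1"
  then obtain t where t: "y = ennreal t" "0 \<le> t" by (cases y) auto
  have t1: "t < 1" using y t by (simp add: ennreal_less_one_iff)
  define \<delta> where "\<delta> = (t + 1) / 2"
  have \<delta>: "0 < \<delta>" "\<delta> < 1" "t < \<delta>" using t t1 by (auto simp: \<delta>_def)
  from lo[OF \<delta>(1,2)] obtain v where v: "v \<longlonglongrightarrow> \<delta>" "\<forall>\<^sub>F n in sequentially. ennreal (v n) \<le> f n" by blast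
  have "\<forall>\<^sub>F n in sequentially. t < v n" using v(1) \<delta>(3) by (rule order_tendstoD)
  with v(2) show "\<forall>\<^sub>F n in sequentially. y < f n"
  proof eventually_elim
    case (elim n)
    have "ennreal t < ennreal (v n)" using elim(2) t(2) by (simp add: ennreal_less_iff)
    then show ?case using elim(1) t(1) by (auto intro: less_le_trans)
  qed
qed


lemma ennreal_mult_divide_le:
  assumes "x \<le> ennreal y" "0 < R" "y / R \<le> u"
  shows "x * ennreal (1 / R) \<le> ennreal u"
proof -
  have "x * ennreal (1 / R) \<le> ennreal y * ennreal (1 / R)" using assms(1) by (rule mult_right_mono) simp
  also have "\<dots> = ennreal (y / R)" using assms(2) by (subst ennreal_mult''[symmetric]) auto
  also have "\<dots> \<le> ennreal u" by (rule ennreal_leI[OF assms(3)])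
  finally show ?thesis .
qed

lemma ennreal_le_mult_divide:
  assumes "ennreal y \<le> x" "0 < R" "v = y / R"
  shows "ennreal v \<le> x * ennreal (1 / R)"
proof -
  have "ennreal v = ennreal y * ennreal (1 / R)" unfolding assms(3) using assms(2) by (subst ennreal_mult''[symmetric]) auto
  also have "\<dots> \<le> x * ennreal (1 / R)" using assms(1) by (rule mult_right_mono) simp
  finally show ?thesis .
qed

text \<open>Treats both bandwidths at once. Hypotheses \<open>d\<close> and \<open>q\<close> make
  the rates at 1/h and at 1/\<open>h_star\<close> equivalent, so the bias is right to first order.
  Hypothesis \<open>neg\<close> makes the variance negligible even after multiplication by any power
  of log n, and \<open>k0\<close> converts powers of the frequencies into such powers.\<close>

lemma kernel_risk_upper:
  fixes \<alpha> L r s \<beta> x :: real and fe :: "real \<Rightarrow> real" and h :: "nat \<Rightarrow> real"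
  defines "as \<equiv> \<lambda>n. 1 / h_star \<alpha> \<beta> r s n" and "a \<equiv> \<lambda>n. 1 / h n"
  assumes \<alpha>: "0 < \<alpha>" and L: "0 < L" and r: "0 < r" "r < 2" and fe: "prob_density fe"
    and N: "assumption_N \<beta> s (fourier fe)" and nz: "\<And>u. fourier fe u \<noteq> 0"
    and ev: "\<forall>\<^sub>F n in sequentially. 0 < h_star \<alpha> \<beta> r s n \<and> 1 \<le> as n \<and> 0 < h n \<and> 1 \<le> a n \<and> 1 \<le> ln (real n) \<and> a n \<le> ln (real n) ^ k0 \<and> as n \<le> ln (real n) ^ k0"
    and d: "(\<lambda>n. a n powr r - as n powr r) \<longlonglongrightarrow> 0" and q: "(\<lambda>n. a n / as n) \<longlonglongrightarrow> 1"
    and inf: "filterlim a at_top sequentially"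
    and neg: "\<And>k. (\<lambda>n. ln (real n) ^ k * exp (2 * \<beta> * a n powr s + 2 * \<alpha> * as n powr r) / real n) \<longlonglongrightarrow> 0"
  shows "\<exists>u. u \<longlonglongrightarrow> 1 \<and> (\<forall>\<^sub>F n in sequentially. risk_pt fe \<alpha> r L n x (\<lambda>Y z. kernel_est fe n (h n) Y z) * ennreal (1 / rate_pt \<alpha> \<beta> r s L n) \<le> ennreal (u n))"
    and "\<exists>u. u \<longlonglongrightarrow> 1 \<and> (\<forall>\<^sub>F n in sequentially. risk_L2 fe \<alpha> r L n (\<lambda>Y z. kernel_est fe n (h n) Y z) * ennreal (1 / rate_L2 \<alpha> \<beta> r s L n) \<le> ennreal (u n))"
    and "\<forall>\<^sub>F n in sequentially. (\<lambda>Y z. kernel_est fe n (h n) Y z) \<in> estimators n"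
proof -
  obtain C K where C: "0 < C" "\<And>a u. 1 \<le> a \<Longrightarrow> \<bar>u\<bar> \<le> a \<Longrightarrow> 1 / cmod (fourier fe u) \<le> C * a ^ K * exp (\<beta> * a powr s)"
    by (rule noise_inverse_bound[OF fe N nz]) (rule that; (assumption | blast))
  define M where "M n = C * a n ^ K * exp (\<beta> * a n powr s)" for n
  define X where "X n = exp (2 * \<beta> * a n powr s + 2 * \<alpha> * as n powr r) / real n" for n
  have Mb: "1 / cmod (fourier fe u) \<le> M n" if "1 \<le> a n" "\<bar>u\<bar> \<le> 1 / h n" for u n
    unfolding M_def using C(2)[OF that(1), of u] that(2) by (simp add: a_def)
  have M2: "(M n)\<^sup>2 = C\<^sup>2 * a n ^ (2 * K) * exp (2 * \<beta> * a n powr s)" for n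
    unfolding M_def by (simp add: power_mult_distrib exp_double[symmetric] power_mult[symmetric] mult.commute mult.left_commute)
  have pos: "\<forall>\<^sub>F n in sequentially. 0 < n" by (rule eventually_gt_at_top)
  have ev': "\<forall>\<^sub>F n in sequentially. 0 < a n \<and> 0 < as n" using ev by eventually_elim auto
  show "\<forall>\<^sub>F n in sequentially. (\<lambda>Y z. kernel_est fe n (h n) Y z) \<in> estimators n"
    using ev pos
  proof eventually_elim
    case (elim n)
    have Mn: "\<And>u. \<bar>u\<bar> \<le> 1 / h n \<Longrightarrow> 1 / cmod (fourier fe u) \<le> M n" by (rule Mb) (use elim in auto)
    show ?case by (rule kernel_est_in_estimators[OF fe Mn nz _ _ \<alpha> r(1) L]) (use elim in auto)
  qed
  have err: "(\<lambda>n. Psi_err \<alpha> r (a n)) \<longlonglongrightarrow> 0" by (rule filterlim_compose[OF tendsto_Psi_err[OF r(1)] inf])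
  have errlt: "\<forall>\<^sub>F n in sequentially. Psi_err \<alpha> r (a n) < 1" using err by (rule order_tendstoD) simp
  note rr = rate_ratio_tendsto[OF ev' \<alpha> r(1) d q]
  have poly: "a n ^ i * as n ^ j \<le> ln (real n) ^ (k0 * (i + j))" if "1 \<le> a n" "1 \<le> as n" "a n \<le> ln (real n) ^ k0" "as n \<le> ln (real n) ^ k0" for n i j
  proof -
    have "a n ^ i * as n ^ j \<le> (ln (real n) ^ k0) ^ i * (ln (real n) ^ k0) ^ j" using that by (intro mult_mono power_mono) auto
    then show ?thesis by (simp add: power_mult[symmetric] power_add[symmetric] distrib_left)
  qed
  define c1 where "c1 = C\<^sup>2 * (2 * \<alpha> * r) / (pi * L)"
  have c1: "0 \<le> c1" using \<alpha> r L by (simp add: c1_def)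
  \<comment> \<open>Powers of the frequencies in variance over rate: 2K from the square of
    \<open>M\<close>, 2 from the sup norm of the kernel, and 1 from 1/\<open>Psi\<close>, whose
    factor as^(r-1) is at most \<open>as\<close> because r < 2.\<close>
  define u1 where "u1 n = c1 * (ln (real n) ^ (k0 * (2 * K + 2 + 1)) * X n) + Psi \<alpha> r (a n) / Psi \<alpha> r (as n) / (1 - Psi_err \<alpha> r (a n))" for n
  have "(\<lambda>n. ln (real n) ^ k * X n) \<longlonglongrightarrow> 0" for k using neg[of k] by (simp add: X_def)
  note X0 = this
  have "u1 \<longlonglongrightarrow> c1 * 0 + 1 / (1 - 0)" unfolding u1_def by (intro tendsto_intros X0 rr(2) err) simp
  then have u1: "u1 \<longlonglongrightarrow> 1" by simp
  moreover have "\<forall>\<^sub>F n in sequentially. risk_pt fe \<alpha> r L n x (\<lambda>Y z. kernel_est fe n (h n) Y z) * ennreal (1 / rate_pt \<alpha> \<beta> r s L n) \<le> ennreal (u1 n)"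
    using ev pos errlt
  proof eventually_elim
    case (elim n)
    have Mn: "\<And>u. \<bar>u\<bar> \<le> 1 / h n \<Longrightarrow> 1 / cmod (fourier fe u) \<le> M n" by (rule Mb) (use elim in auto)
    have P: "0 < Psi \<alpha> r (as n)" "0 < Psi \<alpha> r (a n)" using Psi_pos[OF \<alpha> r(1)] elim by auto
    have R: "rate_pt \<alpha> \<beta> r s L n = L / pi * Psi \<alpha> r (as n)" unfolding as_def by (rule rate_pt_eq) (use elim in auto)
    have R0: "0 < L / pi * Psi \<alpha> r (as n)" using L P by simp
    have 1: "risk_pt fe \<alpha> r L n x (\<lambda>Y z. kernel_est fe n (h n) Y z) \<le> ennreal ((a n * M n / pi)\<^sup>2 / real n + L / (2 * pi) * exp_tail (2 * \<alpha>) r (a n))"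
      unfolding a_def by (rule risk_pt_kernel_est_le[OF fe Mn nz _ _ \<alpha> r(1) L]) (use elim in auto)
    have V: "(a n * M n / pi)\<^sup>2 / real n / (L / pi * Psi \<alpha> r (as n)) \<le> c1 * (ln (real n) ^ (k0 * (2 * K + 2 + 1)) * X n)"
    proof -
      have ip: "1 / Psi \<alpha> r (as n) = 2 * \<alpha> * r * as n powr (r - 1) * exp (2 * \<alpha> * as n powr r)"
        unfolding Psi_def using \<alpha> r elim by (simp add: powr_diff exp_minus field_simps)
      have "(a n * M n / pi)\<^sup>2 / real n / (L / pi * Psi \<alpha> r (as n)) = (a n)\<^sup>2 * (M n)\<^sup>2 / (pi * L) / real n * (1 / Psi \<alpha> r (as n))"
        using L by (simp add: power_mult_distrib power_divide power2_eq_square field_simps)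
      also have "\<dots> = c1 * (a n ^ (2 * K + 2) * as n powr (r - 1)) * X n"
        unfolding ip M2 X_def c1_def exp_add by (simp add: power_add power2_eq_square mult_ac)
      also have "\<dots> \<le> c1 * (a n ^ (2 * K + 2) * as n ^ 1) * X n"
      proof (intro mult_right_mono mult_left_mono)
        have "as n powr (r - 1) \<le> as n powr 1" using elim r by (intro powr_mono) auto
        then show "as n powr (r - 1) \<le> as n ^ 1" using elim by simp
      qed (use elim c1 in \<open>auto simp: X_def\<close>)
      also have "\<dots> \<le> c1 * ln (real n) ^ (k0 * (2 * K + 2 + 1)) * X n"
        using elim c1 by (intro mult_right_mono mult_left_mono poly) (auto simp: X_def)
      finally show ?thesis by (simp add: mult.assoc)
    qed
    have Tl: "L / (2 * pi) * exp_tail (2 * \<alpha>) r (a n) / (L / pi * Psi \<alpha> r (as n)) \<le> Psi \<alpha> r (a n) / Psi \<alpha> r (as n) / (1 - Psi_err \<alpha> r (a n))"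
    proof -
      have "L / (2 * pi) * exp_tail (2 * \<alpha>) r (a n) / (L / pi * Psi \<alpha> r (as n)) = exp_tail (2 * \<alpha>) r (a n) / (2 * Psi \<alpha> r (as n))"
        using L by simp
      also have "\<dots> \<le> 2 * Psi \<alpha> r (a n) / (1 - Psi_err \<alpha> r (a n)) / (2 * Psi \<alpha> r (as n))"
        using exp_tail_le[OF \<alpha> r(1) _ elim(3)] elim P by (intro divide_right_mono) auto
      also have "\<dots> = Psi \<alpha> r (a n) / Psi \<alpha> r (as n) / (1 - Psi_err \<alpha> r (a n))" by (simp add: mult.commute)
      finally show ?thesis .
    qed
    show ?case unfolding R
      by (rule ennreal_mult_divide_le[OF 1 R0]) (unfold u1_def add_divide_distrib, rule add_mono[OF V Tl])
  qed
  ultimately show "\<exists>u. u \<longlonglongrightarrow> 1 \<and> (\<forall>\<^sub>F n in sequentially. risk_pt fe \<alpha> r L n x (\<lambda>Y z. kernel_est fe n (h n) Y z) * ennreal (1 / rate_pt \<alpha> \<beta> r s L n) \<le> ennreal (u n))" by blast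
  define c2 where "c2 = C\<^sup>2 / (pi * L)"
  have c2: "0 \<le> c2" using L by (simp add: c2_def)
  \<comment> \<open>In L2 the norm of the kernel contributes one power of the frequency besides
    those of \<open>M\<close>, and the rate contributes none.\<close>
  define u2 where "u2 n = c2 * (ln (real n) ^ (k0 * (2 * K + 1 + 0)) * X n) + exp (- 2 * \<alpha> * a n powr r) / exp (- 2 * \<alpha> * as n powr r)" for n
  have "u2 \<longlonglongrightarrow> c2 * 0 + 1" unfolding u2_def by (intro tendsto_add tendsto_mult_left X0 rr(1))
  then have u2: "u2 \<longlonglongrightarrow> 1" by simp
  moreover have "\<forall>\<^sub>F n in sequentially. risk_L2 fe \<alpha> r L n (\<lambda>Y z. kernel_est fe n (h n) Y z) * ennreal (1 / rate_L2 \<alpha> \<beta> r s L n) \<le> ennreal (u2 n)"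
    using ev pos
  proof eventually_elim
    case (elim n)
    have Mn: "\<And>u. \<bar>u\<bar> \<le> 1 / h n \<Longrightarrow> 1 / cmod (fourier fe u) \<le> M n" by (rule Mb) (use elim in auto)
    have R: "rate_L2 \<alpha> \<beta> r s L n = L * exp (- 2 * \<alpha> * as n powr r)" unfolding as_def by (rule rate_L2_eq) (use elim in auto)
    have R0: "0 < L * exp (- 2 * \<alpha> * as n powr r)" using L by simp
    have 1: "risk_L2 fe \<alpha> r L n (\<lambda>Y z. kernel_est fe n (h n) Y z) \<le> ennreal ((a n * (M n)\<^sup>2 / pi) / real n + L * exp (- 2 * \<alpha> * a n powr r))"
      unfolding a_def by (rule risk_L2_kernel_est_le[OF fe Mn nz _ _ \<alpha> r(1) L]) (use elim in auto)
    have V: "(a n * (M n)\<^sup>2 / pi) / real n / (L * exp (- 2 * \<alpha> * as n powr r)) \<le> c2 * (ln (real n) ^ (k0 * (2 * K + 1 + 0)) * X n)"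
    proof -
      have "(a n * (M n)\<^sup>2 / pi) / real n / (L * exp (- 2 * \<alpha> * as n powr r)) = c2 * (a n ^ (2 * K + 1) * as n ^ 0) * X n"
        unfolding M2 X_def c2_def exp_add using L by (simp add: exp_minus field_simps)
      also have "\<dots> \<le> c2 * ln (real n) ^ (k0 * (2 * K + 1 + 0)) * X n"
        using elim c2 by (intro mult_right_mono mult_left_mono poly) (auto simp: X_def)
      finally show ?thesis by (simp only: mult.assoc)
    qed
    have Tl: "L * exp (- 2 * \<alpha> * a n powr r) / (L * exp (- 2 * \<alpha> * as n powr r)) \<le> exp (- 2 * \<alpha> * a n powr r) / exp (- 2 * \<alpha> * as n powr r)"
      using L by simp
    show ?case unfolding R
      by (rule ennreal_mult_divide_le[OF 1 R0]) (unfold u2_def add_divide_distrib, rule add_mono[OF V Tl])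
  qed
  ultimately show "\<exists>u. u \<longlonglongrightarrow> 1 \<and> (\<forall>\<^sub>F n in sequentially. risk_L2 fe \<alpha> r L n (\<lambda>Y z. kernel_est fe n (h n) Y z) * ennreal (1 / rate_L2 \<alpha> \<beta> r s L n) \<le> ennreal (u n))" by blast
qed

section \<open>Sharp asymptotics\<close>

text \<open>The reason for (log log n)^2 in the bandwidth equation: its exponential outgrows every
  power of log n and so pays for the polynomial losses in variance and chi-square distance.\<close>

lemma log_power_exp_tendsto:
  "(\<lambda>n. ln (real n) ^ k * exp (- (ln (ln (real n)))\<^sup>2)) \<longlonglongrightarrow> 0"
proof -
  have "((\<lambda>t::real. exp (real k * t - t\<^sup>2)) \<longlongrightarrow> 0) at_top" by real_asymp
  from filterlim_compose[OF filterlim_compose[OF this ln_at_top] filterlim_ln_nat]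
  have "(\<lambda>n. exp (real k * ln (ln (real n)) - (ln (ln (real n)))\<^sup>2)) \<longlonglongrightarrow> 0" by simp
  moreover have "\<forall>\<^sub>F n in sequentially. exp (real k * ln (ln (real n)) - (ln (ln (real n)))\<^sup>2) = ln (real n) ^ k * exp (- (ln (ln (real n)))\<^sup>2)"
    using eventually_compose_filterlim[OF eventually_gt_at_top[of 0] filterlim_ln_nat]
    by eventually_elim (simp add: exp_diff exp_minus exp_of_nat_mult divide_inverse)
  ultimately show ?thesis by (rule Lim_transform_eventually)
qed

lemma powr_le_log_power:
  fixes s :: real and a :: "nat \<Rightarrow> real"
  assumes s: "0 < s" and ev: "\<forall>\<^sub>F n in sequentially. 0 < a n \<and> a n powr s \<le> (ln (real n))\<^sup>2" and k: "2 / s \<le> real k"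
  shows "\<forall>\<^sub>F n in sequentially. a n \<le> ln (real n) ^ k"
  using ev eventually_compose_filterlim[OF eventually_ge_at_top[of 1] filterlim_ln_nat]
proof eventually_elim
  case (elim n)
  define l where "l = ln (real n)"
  have l: "1 \<le> l" using elim by (simp add: l_def)
  have "a n = (a n powr s) powr (1 / s)" using elim s by (simp add: powr_powr)
  also have "\<dots> \<le> (l\<^sup>2) powr (1 / s)" using elim s by (intro powr_mono2) (auto simp: l_def)
  also have "\<dots> = l powr (2 / s)" using l by (simp add: powr_powr flip: powr_numeral)
  also have "\<dots> \<le> l powr real k" using l k by (intro powr_mono) auto
  also have "\<dots> = l ^ k" using l by (simp add: powr_realpow)
  finally show ?case by (simp add: l_def)
qed

lemma filterlim_powr_imp:
  fixes a :: "nat \<Rightarrow> real"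
  assumes c: "0 < c" and s: "0 < s" and ev: "\<forall>\<^sub>F n in sequentially. 0 < a n \<and> c * ln (real n) \<le> a n powr s"
  shows "filterlim a at_top sequentially"
proof -
  have "filterlim (\<lambda>l::real. (c * l) powr (1 / s)) at_top at_top" using c s by real_asymp
  from filterlim_compose[OF this filterlim_ln_nat]
  have *: "filterlim (\<lambda>n. (c * ln (real n)) powr (1 / s)) at_top sequentially" .
  show ?thesis
  proof (rule filterlim_at_top_mono[OF *])
    show "\<forall>\<^sub>F n in sequentially. (c * ln (real n)) powr (1 / s) \<le> a n"
      using ev eventually_compose_filterlim[OF eventually_gt_at_top[of 0] filterlim_ln_nat]
    proof eventually_elim
      case (elim n)
      have "(c * ln (real n)) powr (1 / s) \<le> (a n powr s) powr (1 / s)" using elim c s by (intro powr_mono2) auto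
      also have "\<dots> = a n" using elim s by (simp add: powr_powr)
      finally show ?case .
    qed
  qed
qed

text \<open>The frequency cut-off of the two hypotheses is chosen beyond \<open>1/h\<^sub>*\<close>, so far that the two product
  laws merge and so little that the bias does not change to first order.\<close>

lemma minimax_risk_lower:
  fixes \<alpha> \<beta> r s L \<delta> :: real and fe :: "real \<Rightarrow> real"
  assumes \<alpha>: "0 < \<alpha>" and L: "0 < L" and r: "0 < r" "r < s" "s \<le> 2" and fe: "prob_density fe"
    and N: "assumption_N \<beta> s (fourier fe)" and ND: "assumption_ND \<beta> s (fourier fe)" and \<delta>: "0 < \<delta>" "\<delta> < 1"
  shows "\<exists>v. v \<longlonglongrightarrow> \<delta> \<and> (\<forall>\<^sub>F n in sequentially. \<forall>x. \<forall>T\<in>estimators n. ennreal (v n) \<le> risk_pt fe \<alpha> r L n x T * ennreal (1 / rate_pt \<alpha> \<beta> r s L n))"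
    and "\<exists>v. v \<longlonglongrightarrow> \<delta> \<and> (\<forall>\<^sub>F n in sequentially. \<forall>T\<in>estimators n. ennreal (v n) \<le> risk_L2 fe \<alpha> r L n T * ennreal (1 / rate_L2 \<alpha> \<beta> r s L n))"
proof -
  have \<beta>: "0 < \<beta>" using N by (simp add: assumption_N_def)
  have s: "0 < s" "r < 2" using r by auto
  \<comment> \<open>Spending the budget \<delta>L on the perturbation is what produces the fraction
    \<delta> of the rate.\<close>
  obtain C K \<omega>1 \<omega>2 where lw: "0 \<le> C" "(\<omega>1 \<longlongrightarrow> 1) at_top" "(\<omega>2 \<longlongrightarrow> 1) at_top"
    "\<forall>\<^sub>F a in at_top. \<forall>n x. \<forall>T\<in>estimators n.
     ennreal (\<delta> * L / pi * (Psi \<alpha> r a * \<omega>1 a) * lik_loss \<alpha> r \<beta> s C K a n) \<le> risk_pt fe \<alpha> r L n x T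
   \<and> ennreal (\<delta> * L * (exp (- 2 * \<alpha> * a powr r) * \<omega>2 a) * lik_loss \<alpha> r \<beta> s C K a n) \<le> risk_L2 fe \<alpha> r L n T"
    by (rule minimax_lower[OF \<alpha> r(1) s(2) _ _ fe N ND, of "\<delta> * L" L]) (use \<delta> L in auto)
  define l where "l n = ln (real n)" for n
  define as where "as n = 1 / h_star \<alpha> \<beta> r s n" for n
  \<comment> \<open>Relative to 1/\<open>h_star\<close> this raises 2\<beta>a^s by 2(log log n)^2,
    which turns the value log n - (log log n)^2 of the bandwidth equation into at least log n + (log
    log n)^2.\<close>
  define b where "b n = (as n powr s + (ln (l n))\<^sup>2 / \<beta>) powr (1 / s)" for n
  have hs: "\<forall>\<^sub>F n in sequentially. 0 < h_star \<alpha> \<beta> r s n \<and> 2 * \<beta> * as n powr s + 2 * \<alpha> * as n powr r = l n - (ln (l n))\<^sup>2 \<and>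
    1 \<le> as n \<and> l n / (4 * (\<alpha> + \<beta>)) \<le> as n powr s \<and> as n powr s \<le> l n / (2 * \<beta>)"
    unfolding l_def as_def by (rule eventually_h_star[OF \<alpha> \<beta> r(1,2)])
  have l1: "\<forall>\<^sub>F n in sequentially. 1 \<le> l n" unfolding l_def by (rule eventually_compose_filterlim[OF eventually_ge_at_top filterlim_ln_nat])
  have l2: "\<forall>\<^sub>F n in sequentially. l n / (2 * \<beta>) + (ln (l n))\<^sup>2 / \<beta> \<le> (l n)\<^sup>2"
  proof -
    have "\<forall>\<^sub>F l::real in at_top. l / (2 * \<beta>) + (ln l)\<^sup>2 / \<beta> \<le> l\<^sup>2" using \<beta> by real_asymp
    from eventually_compose_filterlim[OF this filterlim_ln_nat] show ?thesis by (simp add: l_def)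
  qed
  have bs: "\<forall>\<^sub>F n in sequentially. 0 < as n \<and> 0 < b n \<and> b n powr s = as n powr s + (ln (l n))\<^sup>2 / \<beta> \<and> as n \<le> b n"
    using hs
  proof eventually_elim
    case (elim n)
    have p: "0 < as n powr s + (ln (l n))\<^sup>2 / \<beta>" using elim \<beta> by (intro add_pos_nonneg) auto
    have "as n = (as n powr s) powr (1 / s)" using elim s by (simp add: powr_powr)
    also have "\<dots> \<le> b n" unfolding b_def using \<beta> s by (intro powr_mono2) auto
    finally have "as n \<le> b n" .
    moreover have "b n powr s = as n powr s + (ln (l n))\<^sup>2 / \<beta>" using p s by (simp add: b_def powr_powr)
    ultimately show ?case using elim by auto
  qed
  \<comment> \<open>Here r < s enters: the shift of the s-th powers is of order (log log n)^2 and is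
    multiplied by a negative power of log n.\<close>
  have D: "(\<lambda>n. l n powr (r / s - 1) * ((ln (l n))\<^sup>2 / \<beta>)) \<longlonglongrightarrow> 0"
  proof -
    define p where "p = r / s"
    have p: "p < 1" using r by (simp add: p_def)
    have "((\<lambda>t::real. t powr (p - 1) * (ln t)\<^sup>2) \<longlongrightarrow> 0) at_top" using p by real_asymp
    from tendsto_mult_left[OF filterlim_compose[OF this filterlim_ln_nat], of "1 / \<beta>"]
    show ?thesis by (simp add: l_def p_def)
  qed
  have cl: "\<forall>\<^sub>F n in sequentially. 0 < b n \<and> 0 < as n \<and> 1 \<le> l n \<and> 1 / (4 * (\<alpha> + \<beta>)) * l n \<le> b n powr s \<and> 1 / (4 * (\<alpha> + \<beta>)) * l n \<le> as n powr s \<and> \<bar>b n powr s - as n powr s\<bar> \<le> (ln (l n))\<^sup>2 / \<beta>"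
    using hs bs l1
  proof eventually_elim
    case (elim n)
    have "0 \<le> (ln (l n))\<^sup>2 / \<beta>" using \<beta> by simp
    then show ?case using elim by auto
  qed
  have c0: "0 < 1 / (4 * (\<alpha> + \<beta>))" using \<alpha> \<beta> by simp
  note pc = powr_close[OF r(1,2) c0 cl D]
  have pos: "\<forall>\<^sub>F n in sequentially. 0 < b n \<and> 0 < as n" using bs by eventually_elim auto
  note rr = rate_ratio_tendsto[OF pos \<alpha> r(1) pc]
  have binf: "filterlim b at_top sequentially"
  proof (rule filterlim_powr_imp[OF c0 s(1)])
    show "\<forall>\<^sub>F n in sequentially. 0 < b n \<and> 1 / (4 * (\<alpha> + \<beta>)) * ln (real n) \<le> b n powr s"
      using cl by eventually_elim (simp add: l_def)
  qed
  obtain k0 :: nat where k0: "2 / s \<le> real k0" using real_arch_simple by blast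
  have bk: "\<forall>\<^sub>F n in sequentially. b n \<le> ln (real n) ^ k0"
  proof (rule powr_le_log_power[OF s(1) _ k0])
    show "\<forall>\<^sub>F n in sequentially. 0 < b n \<and> b n powr s \<le> (ln (real n))\<^sup>2"
      using hs bs l2
    proof eventually_elim
      case (elim n)
      have "b n powr s \<le> l n / (2 * \<beta>) + (ln (l n))\<^sup>2 / \<beta>" using elim by simp
      then show ?case using elim unfolding l_def by linarith
    qed
  qed
  \<comment> \<open>The factor n cancels exp(-log n), leaving at most a power of log n times
    exp(-(log log n)^2).\<close>
  have z: "(\<lambda>n. real n * (b n ^ K * exp (- 2 * \<alpha> * b n powr r - 2 * \<beta> * b n powr s))) \<longlonglongrightarrow> 0"
  proof (rule Lim_null_comparison[OF _ log_power_exp_tendsto[of "k0 * K"]])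
    show "\<forall>\<^sub>F n in sequentially. norm (real n * (b n ^ K * exp (- 2 * \<alpha> * b n powr r - 2 * \<beta> * b n powr s))) \<le> ln (real n) ^ (k0 * K) * exp (- (ln (ln (real n)))\<^sup>2)"
      using hs bs bk eventually_gt_at_top[of 0]
    proof eventually_elim
      case (elim n)
      have "as n powr r \<le> b n powr r" using elim r by (intro powr_mono2) auto
      then have "2 * \<alpha> * as n powr r \<le> 2 * \<alpha> * b n powr r" using \<alpha> by simp
      moreover have "2 * \<beta> * b n powr s = 2 * \<beta> * as n powr s + 2 * (ln (l n))\<^sup>2" using elim \<beta> by (simp add: algebra_simps)
      ultimately have e: "- 2 * \<alpha> * b n powr r - 2 * \<beta> * b n powr s \<le> - l n - (ln (l n))\<^sup>2" using elim by simp
      have "real n * (b n ^ K * exp (- 2 * \<alpha> * b n powr r - 2 * \<beta> * b n powr s)) \<le> exp (l n) * ((ln (real n) ^ k0) ^ K * exp (- l n - (ln (l n))\<^sup>2))"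
        using elim e by (intro mult_mono power_mono) (auto simp: l_def)
      also have "\<dots> = ln (real n) ^ (k0 * K) * exp (- (ln (ln (real n)))\<^sup>2)"
        by (simp add: l_def power_mult[symmetric] exp_diff exp_minus field_simps)
      finally show ?case using elim by (simp add: abs_of_nonneg)
    qed
  qed
  have rho: "(\<lambda>n. lik_loss \<alpha> r \<beta> s C K (b n) n) \<longlonglongrightarrow> 1"
  proof (rule tendsto_lik_loss[OF lw(1) _ z])
    show "\<forall>\<^sub>F n in sequentially. 0 \<le> b n" using bs by eventually_elim simp
  qed
  note ew = eventually_compose_filterlim[OF lw(4) binf]
  note w1 = filterlim_compose[OF lw(2) binf] and w2 = filterlim_compose[OF lw(3) binf]
  define v1 where "v1 n = \<delta> * (Psi \<alpha> r (b n) / Psi \<alpha> r (as n)) * \<omega>1 (b n) * lik_loss \<alpha> r \<beta> s C K (b n) n" for n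
  have "v1 \<longlonglongrightarrow> \<delta> * 1 * 1 * 1" unfolding v1_def by (intro tendsto_mult tendsto_const rr(2) w1 rho)
  then have v1: "v1 \<longlonglongrightarrow> \<delta>" by simp
  moreover have "\<forall>\<^sub>F n in sequentially. \<forall>x. \<forall>T\<in>estimators n. ennreal (v1 n) \<le> risk_pt fe \<alpha> r L n x T * ennreal (1 / rate_pt \<alpha> \<beta> r s L n)"
    using ew hs
  proof eventually_elim
    case (elim n)
    show ?case
    proof (intro allI ballI)
      fix x T assume T: "T \<in> estimators n"
      have R: "rate_pt \<alpha> \<beta> r s L n = L / pi * Psi \<alpha> r (as n)" unfolding as_def by (rule rate_pt_eq) (use elim in auto)
      have P: "0 < Psi \<alpha> r (as n)" using Psi_pos[OF \<alpha> r(1)] elim by auto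
      have lb: "ennreal (\<delta> * L / pi * (Psi \<alpha> r (b n) * \<omega>1 (b n)) * lik_loss \<alpha> r \<beta> s C K (b n) n) \<le> risk_pt fe \<alpha> r L n x T" using elim(1) T by blast
      show "ennreal (v1 n) \<le> risk_pt fe \<alpha> r L n x T * ennreal (1 / rate_pt \<alpha> \<beta> r s L n)"
        unfolding R by (rule ennreal_le_mult_divide[OF lb]) (use L P in \<open>auto simp: v1_def field_simps\<close>)
    qed
  qed
  ultimately show "\<exists>v. v \<longlonglongrightarrow> \<delta> \<and> (\<forall>\<^sub>F n in sequentially. \<forall>x. \<forall>T\<in>estimators n. ennreal (v n) \<le> risk_pt fe \<alpha> r L n x T * ennreal (1 / rate_pt \<alpha> \<beta> r s L n))" by blast
  define v2 where "v2 n = \<delta> * (exp (- 2 * \<alpha> * b n powr r) / exp (- 2 * \<alpha> * as n powr r)) * \<omega>2 (b n) * lik_loss \<alpha> r \<beta> s C K (b n) n" for n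
  have "v2 \<longlonglongrightarrow> \<delta> * 1 * 1 * 1" unfolding v2_def by (intro tendsto_mult tendsto_const rr(1) w2 rho)
  then have v2: "v2 \<longlonglongrightarrow> \<delta>" by simp
  moreover have "\<forall>\<^sub>F n in sequentially. \<forall>T\<in>estimators n. ennreal (v2 n) \<le> risk_L2 fe \<alpha> r L n T * ennreal (1 / rate_L2 \<alpha> \<beta> r s L n)"
    using ew hs
  proof eventually_elim
    case (elim n)
    show ?case
    proof (intro ballI)
      fix T assume T: "T \<in> estimators n"
      have R: "rate_L2 \<alpha> \<beta> r s L n = L * exp (- 2 * \<alpha> * as n powr r)" unfolding as_def by (rule rate_L2_eq) (use elim in auto)
      have lb: "ennreal (\<delta> * L * (exp (- 2 * \<alpha> * b n powr r) * \<omega>2 (b n)) * lik_loss \<alpha> r \<beta> s C K (b n) n) \<le> risk_L2 fe \<alpha> r L n T" using elim(1) T by blast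
      show "ennreal (v2 n) \<le> risk_L2 fe \<alpha> r L n T * ennreal (1 / rate_L2 \<alpha> \<beta> r s L n)"
        unfolding R by (rule ennreal_le_mult_divide[OF lb]) (use L in \<open>auto simp: v2_def\<close>)
    qed
  qed
  ultimately show "\<exists>v. v \<longlonglongrightarrow> \<delta> \<and> (\<forall>\<^sub>F n in sequentially. \<forall>T\<in>estimators n. ennreal (v n) \<le> risk_L2 fe \<alpha> r L n T * ennreal (1 / rate_L2 \<alpha> \<beta> r s L n))" by blast
qed


section \<open>Comparison of the two bandwidths\<close>

text \<open>Provides what \<open>kernel_risk_upper\<close> asks of \<open>h_star\<close>; the
  variance condition is the bandwidth equation itself, which leaves exp(-(log log n)^2) after
  division by n.\<close>

lemma h_star_comparison:
  fixes \<alpha> \<beta> r s :: real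
  assumes \<alpha>: "0 < \<alpha>" and \<beta>: "0 < \<beta>" and r: "0 < r" "r < s"
  defines "as \<equiv> \<lambda>n. 1 / h_star \<alpha> \<beta> r s n"
  shows "filterlim as at_top sequentially"
    and "2 / s \<le> real k \<Longrightarrow> \<forall>\<^sub>F n in sequentially. as n \<le> ln (real n) ^ k"
    and "(\<lambda>n. as n / as n) \<longlonglongrightarrow> 1"
    and "(\<lambda>n. ln (real n) ^ j * exp (2 * \<beta> * as n powr s + 2 * \<alpha> * as n powr r) / real n) \<longlonglongrightarrow> 0"
proof -
  have s: "0 < s" using r by simp
  have hs: "\<forall>\<^sub>F n in sequentially. 0 < h_star \<alpha> \<beta> r s n \<and> 2 * \<beta> * as n powr s + 2 * \<alpha> * as n powr r = ln (real n) - (ln (ln (real n)))\<^sup>2 \<and>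
    1 \<le> as n \<and> ln (real n) / (4 * (\<alpha> + \<beta>)) \<le> as n powr s \<and> as n powr s \<le> ln (real n) / (2 * \<beta>)"
    unfolding as_def by (rule eventually_h_star[OF \<alpha> \<beta> r])
  show "filterlim as at_top sequentially"
  proof (rule filterlim_powr_imp[of "1 / (4 * (\<alpha> + \<beta>))" s])
    show "\<forall>\<^sub>F n in sequentially. 0 < as n \<and> 1 / (4 * (\<alpha> + \<beta>)) * ln (real n) \<le> as n powr s"
      using hs by eventually_elim simp
  qed (use \<alpha> \<beta> s in simp_all)
  show "\<forall>\<^sub>F n in sequentially. as n \<le> ln (real n) ^ k" if "2 / s \<le> real k"
  proof (rule powr_le_log_power[OF s _ that])
    have "\<forall>\<^sub>F l::real in at_top. l / (2 * \<beta>) \<le> l\<^sup>2" using \<beta> by real_asymp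
    from eventually_compose_filterlim[OF this filterlim_ln_nat] hs
    show "\<forall>\<^sub>F n in sequentially. 0 < as n \<and> as n powr s \<le> (ln (real n))\<^sup>2" by eventually_elim auto
  qed
  have "\<forall>\<^sub>F n in sequentially. 1 = as n / as n" using hs by eventually_elim auto
  then show "(\<lambda>n. as n / as n) \<longlonglongrightarrow> 1" by (rule Lim_transform_eventually[OF tendsto_const])
  have "\<forall>\<^sub>F n in sequentially. ln (real n) ^ j * exp (- (ln (ln (real n)))\<^sup>2) = ln (real n) ^ j * exp (2 * \<beta> * as n powr s + 2 * \<alpha> * as n powr r) / real n"
    using hs eventually_gt_at_top[of 0]
  proof eventually_elim
    case (elim n)
    have "2 * \<beta> * as n powr s + 2 * \<alpha> * as n powr r = ln (real n) - (ln (ln (real n)))\<^sup>2" using elim by blast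
    then have "exp (2 * \<beta> * as n powr s + 2 * \<alpha> * as n powr r) = exp (ln (real n)) * exp (- (ln (ln (real n)))\<^sup>2)"
      by (simp only: exp_add[symmetric] diff_conv_add_uminus)
    moreover have "exp (ln (real n)) = real n" "real n \<noteq> 0" using elim(2) by simp_all
    ultimately show ?case by simp
  qed
  then show "(\<lambda>n. ln (real n) ^ j * exp (2 * \<beta> * as n powr s + 2 * \<alpha> * as n powr r) / real n) \<longlonglongrightarrow> 0"
    by (rule Lim_transform_eventually[OF log_power_exp_tendsto])
qed

text \<open>With l = log n, a^s is l/(2\<beta>) minus its square root, while the bandwidth equation
  gives l/(2\<beta>) up to terms of order l^(r/s) and (log l)^2. The condition r < s/2 acts twice:
  for the bias, l^(1/2) times l^(r/s - 1) must vanish; for the variance, l^(r/s) must be dominated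
  by the l^(1/2) that the square root saves.\<close>

lemma h_a_comparison:
  fixes \<alpha> \<beta> r s :: real
  assumes \<alpha>: "0 < \<alpha>" and \<beta>: "0 < \<beta>" and r: "0 < r" "r < s / 2"
  defines "as \<equiv> \<lambda>n. 1 / h_star \<alpha> \<beta> r s n" and "a \<equiv> \<lambda>n. 1 / h_a \<beta> s n"
  shows "filterlim a at_top sequentially"
    and "\<forall>\<^sub>F n in sequentially. 0 < h_a \<beta> s n"
    and "2 / s \<le> real k \<Longrightarrow> \<forall>\<^sub>F n in sequentially. a n \<le> ln (real n) ^ k"
    and "(\<lambda>n. a n powr r - as n powr r) \<longlonglongrightarrow> 0" and "(\<lambda>n. a n / as n) \<longlonglongrightarrow> 1"
    and "(\<lambda>n. ln (real n) ^ j * exp (2 * \<beta> * a n powr s + 2 * \<alpha> * as n powr r) / real n) \<longlonglongrightarrow> 0"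
proof -
  have s: "0 < s" "r < s" using r by auto
  define l where "l n = ln (real n)" for n
  define p where "p = r / s"
  have p: "0 < p" "p < 1 / 2" using r s by (auto simp: p_def field_simps)
  have hs: "\<forall>\<^sub>F n in sequentially. 0 < h_star \<alpha> \<beta> r s n \<and> 2 * \<beta> * as n powr s + 2 * \<alpha> * as n powr r = l n - (ln (l n))\<^sup>2 \<and>
    1 \<le> as n \<and> l n / (4 * (\<alpha> + \<beta>)) \<le> as n powr s \<and> as n powr s \<le> l n / (2 * \<beta>)"
    unfolding as_def l_def by (rule eventually_h_star[OF \<alpha> \<beta> r(1) s(2)])
  define X where "X n = l n / (2 * \<beta>) - sqrt (l n / (2 * \<beta>))" for n
  have "\<forall>\<^sub>F l::real in at_top. l / (4 * \<beta>) \<le> l / (2 * \<beta>) - sqrt (l / (2 * \<beta>))" using \<beta> by real_asymp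
  from eventually_compose_filterlim[OF this filterlim_ln_nat]
  have X1: "\<forall>\<^sub>F n in sequentially. l n / (4 * \<beta>) \<le> X n" by (simp add: X_def l_def)
  have l1: "\<forall>\<^sub>F n in sequentially. 1 \<le> l n" unfolding l_def by (rule eventually_compose_filterlim[OF eventually_ge_at_top filterlim_ln_nat])
  have aX: "\<forall>\<^sub>F n in sequentially. 0 < X n \<and> 0 < h_a \<beta> s n \<and> 0 < a n \<and> a n powr s = X n"
    using X1 l1
  proof eventually_elim
    case (elim n)
    have "0 < l n / (4 * \<beta>)" using elim \<beta> by simp
    then have X0: "0 < X n" using elim by linarith
    have ha: "h_a \<beta> s n = X n powr (- 1 / s)" by (simp add: h_a_def X_def l_def)
    have "a n = X n powr (1 / s)" unfolding a_def ha by (simp add: powr_minus_divide)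
    then show ?case using X0 s by (simp add: ha powr_powr)
  qed
  have c0: "0 < 1 / (4 * (\<alpha> + \<beta>))" using \<alpha> \<beta> by simp
  have lo: "\<forall>\<^sub>F n in sequentially. 1 / (4 * (\<alpha> + \<beta>)) * l n \<le> a n powr s"
    using aX X1 l1
  proof eventually_elim
    case (elim n)
    have "l n / (4 * (\<alpha> + \<beta>)) \<le> l n / (4 * \<beta>)" using elim \<alpha> \<beta> by (intro divide_left_mono) auto
    then show ?case using elim by simp
  qed
  show "\<forall>\<^sub>F n in sequentially. 0 < h_a \<beta> s n" using aX by eventually_elim auto
  have "\<forall>\<^sub>F n in sequentially. 0 < a n \<and> 1 / (4 * (\<alpha> + \<beta>)) * ln (real n) \<le> a n powr s"
    using aX lo by eventually_elim (auto simp: l_def)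
  then show "filterlim a at_top sequentially" by (rule filterlim_powr_imp[OF c0 s(1)])
  show "\<forall>\<^sub>F n in sequentially. a n \<le> ln (real n) ^ k" if "2 / s \<le> real k"
  proof (rule powr_le_log_power[OF s(1) _ that])
    have "\<forall>\<^sub>F l::real in at_top. l / (2 * \<beta>) - sqrt (l / (2 * \<beta>)) \<le> l\<^sup>2" using \<beta> by real_asymp
    from eventually_compose_filterlim[OF this filterlim_ln_nat] aX
    show "\<forall>\<^sub>F n in sequentially. 0 < a n \<and> a n powr s \<le> (ln (real n))\<^sup>2" by eventually_elim (auto simp: X_def l_def)
  qed
  \<comment> \<open>Triangle inequality for the two s-th powers: the square root from
    \<open>h_a\<close>, then the two lower-order terms of the bandwidth equation.\<close>
  define D where "D n = sqrt (l n / (2 * \<beta>)) + \<alpha> / \<beta> * (l n / (2 * \<beta>)) powr p + (ln (l n))\<^sup>2 / (2 * \<beta>)" for n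
  have asr: "\<forall>\<^sub>F n in sequentially. as n powr r \<le> (l n / (2 * \<beta>)) powr p"
    using hs
  proof eventually_elim
    case (elim n)
    have "as n powr r = (as n powr s) powr p" using s by (simp add: powr_powr p_def)
    also have "\<dots> \<le> (l n / (2 * \<beta>)) powr p" using elim p by (intro powr_mono2[OF less_imp_le[OF p(1)] powr_ge_zero]) auto
    finally show ?case .
  qed
  have "\<forall>\<^sub>F n in sequentially. 0 < a n \<and> 0 < as n \<and> 1 \<le> l n \<and> 1 / (4 * (\<alpha> + \<beta>)) * l n \<le> a n powr s \<and> 1 / (4 * (\<alpha> + \<beta>)) * l n \<le> as n powr s \<and> \<bar>a n powr s - as n powr s\<bar> \<le> D n"
    using hs aX lo l1 asr
  proof eventually_elim
    case (elim n)
    have *: "2 * \<beta> * as n powr s = l n - (ln (l n))\<^sup>2 - 2 * \<alpha> * as n powr r" using elim by simp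
    have e: "as n powr s = l n / (2 * \<beta>) - (ln (l n))\<^sup>2 / (2 * \<beta>) - \<alpha> / \<beta> * as n powr r"
    proof -
      have "as n powr s = (2 * \<beta> * as n powr s) / (2 * \<beta>)" using \<beta> by simp
      also have "\<dots> = l n / (2 * \<beta>) - (ln (l n))\<^sup>2 / (2 * \<beta>) - \<alpha> / \<beta> * as n powr r"
        unfolding * using \<beta> by (simp add: diff_divide_distrib)
      finally show ?thesis .
    qed
    have q1: "\<alpha> / \<beta> * as n powr r \<le> \<alpha> / \<beta> * (l n / (2 * \<beta>)) powr p" using elim \<alpha> \<beta> by (intro mult_left_mono) auto
    have q2: "0 \<le> \<alpha> / \<beta> * as n powr r" "0 \<le> (ln (l n))\<^sup>2 / (2 * \<beta>)" "0 \<le> sqrt (l n / (2 * \<beta>))" using \<alpha> \<beta> elim by auto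
    have "\<bar>X n - as n powr s\<bar> \<le> D n"
    proof -
      define A1 where "A1 = (ln (l n))\<^sup>2 / (2 * \<beta>)"
      show ?thesis unfolding X_def D_def e A1_def[symmetric] using q1 q2[folded A1_def] by linarith
    qed
    then show ?case using elim by auto
  qed
  moreover have "(\<lambda>n. l n powr (r / s - 1) * D n) \<longlonglongrightarrow> 0"
  proof -
    have "((\<lambda>t::real. t powr (p - 1) * sqrt (t / (2 * \<beta>))) \<longlongrightarrow> 0) at_top" using p \<beta> by real_asymp
    moreover have "((\<lambda>t::real. t powr (p - 1) * (t / (2 * \<beta>)) powr p) \<longlongrightarrow> 0) at_top" using p \<beta> by real_asymp
    moreover have "((\<lambda>t::real. t powr (p - 1) * (ln t)\<^sup>2) \<longlongrightarrow> 0) at_top" using p by real_asymp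
    ultimately have "((\<lambda>t::real. t powr (p - 1) * sqrt (t / (2 * \<beta>)) + \<alpha> / \<beta> * (t powr (p - 1) * (t / (2 * \<beta>)) powr p) + 1 / (2 * \<beta>) * (t powr (p - 1) * (ln t)\<^sup>2)) \<longlongrightarrow> 0 + \<alpha> / \<beta> * 0 + 1 / (2 * \<beta>) * 0) at_top"
      by (intro tendsto_add tendsto_mult_left)
    from filterlim_compose[OF this filterlim_ln_nat] show ?thesis
      by (simp add: D_def l_def p_def algebra_simps)
  qed
  ultimately show "(\<lambda>n. a n powr r - as n powr r) \<longlonglongrightarrow> 0" "(\<lambda>n. a n / as n) \<longlonglongrightarrow> 1"
    by (rule powr_close[OF r(1) s(2) c0])+
  show "(\<lambda>n. ln (real n) ^ j * exp (2 * \<beta> * a n powr s + 2 * \<alpha> * as n powr r) / real n) \<longlonglongrightarrow> 0"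
  proof (rule Lim_null_comparison)
    \<comment> \<open>The square root in \<open>h_a\<close> saves 2\<beta> sqrt t in the exponent.
      Half of it pays for the term 2\<alpha>t^p of the rate, the other half beats every power of
      t.\<close>
    have "((\<lambda>t::real. t powr (p - 1 / 2)) \<longlongrightarrow> 0) at_top" using p by real_asymp
    then have "\<forall>\<^sub>F t::real in at_top. t powr (p - 1 / 2) < \<beta> / (2 * \<alpha>)" by (rule order_tendstoD) (use \<alpha> \<beta> in simp)
    then have e: "\<forall>\<^sub>F t::real in at_top. 2 * \<alpha> * t powr p \<le> \<beta> * sqrt t"
      using eventually_gt_at_top[of 0]
    proof eventually_elim
      case (elim t)
      have "t powr p = t powr (p - 1 / 2) * sqrt t" using elim by (simp add: powr_half_sqrt[symmetric] flip: powr_add)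
      also have "\<dots> \<le> \<beta> / (2 * \<alpha>) * sqrt t" using elim by (intro mult_right_mono) auto
      finally show ?case using \<alpha> by (simp add: field_simps)
    qed
    have f: "filterlim (\<lambda>n. l n / (2 * \<beta>)) at_top sequentially"
    proof -
      have "filterlim (\<lambda>t::real. t / (2 * \<beta>)) at_top at_top" using \<beta> by real_asymp
      from filterlim_compose[OF this filterlim_ln_nat] show ?thesis by (simp add: l_def)
    qed
    show "\<forall>\<^sub>F n in sequentially. norm (ln (real n) ^ j * exp (2 * \<beta> * a n powr s + 2 * \<alpha> * as n powr r) / real n)
      \<le> (2 * \<beta>) ^ j * ((l n / (2 * \<beta>)) ^ j * exp (- \<beta> * sqrt (l n / (2 * \<beta>))))"
      using aX asr eventually_compose_filterlim[OF e f] l1 eventually_gt_at_top[of 0]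
    proof eventually_elim
      case (elim n)
      define t where "t = l n / (2 * \<beta>)"
      have lt: "l n = 2 * \<beta> * t" using \<beta> by (simp add: t_def)
      have "2 * \<alpha> * as n powr r \<le> 2 * \<alpha> * t powr p" using elim \<alpha> by (simp add: t_def)
      also have "\<dots> \<le> \<beta> * sqrt t" using elim by (simp add: t_def)
      finally have 1: "2 * \<alpha> * as n powr r \<le> \<beta> * sqrt t" .
      have ast: "a n powr s = t - sqrt t" using elim by (simp add: X_def t_def)
      have "2 * \<beta> * a n powr s = l n - 2 * (\<beta> * sqrt t)" unfolding lt ast by (simp add: algebra_simps)
      then have "2 * \<beta> * a n powr s + 2 * \<alpha> * as n powr r \<le> l n + - \<beta> * sqrt t" using 1 by linarith
      then have "exp (2 * \<beta> * a n powr s + 2 * \<alpha> * as n powr r) \<le> exp (l n) * exp (- \<beta> * sqrt t)" by (simp flip: exp_add)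
      also have "exp (l n) = real n" using elim by (simp add: l_def)
      finally have "exp (2 * \<beta> * a n powr s + 2 * \<alpha> * as n powr r) / real n \<le> exp (- \<beta> * sqrt t)" using elim by (simp add: field_simps)
      then have "l n ^ j * (exp (2 * \<beta> * a n powr s + 2 * \<alpha> * as n powr r) / real n) \<le> l n ^ j * exp (- \<beta> * sqrt t)"
        using elim by (intro mult_left_mono) auto
      also have "l n ^ j = (2 * \<beta>) ^ j * t ^ j" by (simp only: lt power_mult_distrib)
      finally have "l n ^ j * (exp (2 * \<beta> * a n powr s + 2 * \<alpha> * as n powr r) / real n) \<le> (2 * \<beta>) ^ j * (t ^ j * exp (- \<beta> * sqrt t))"
        by (simp add: mult.assoc lt power_mult_distrib)
      moreover have "0 \<le> l n ^ j * (exp (2 * \<beta> * a n powr s + 2 * \<alpha> * as n powr r) / real n)" using elim by simp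
      ultimately show ?case unfolding t_def l_def by simp
    qed
    have "((\<lambda>t::real. t ^ j * exp (- \<beta> * sqrt t)) \<longlongrightarrow> 0) at_top"
    proof -
      have "((\<lambda>t::real. exp (real j * ln t - \<beta> * sqrt t)) \<longlongrightarrow> 0) at_top" using \<beta> by real_asymp
      moreover have "\<forall>\<^sub>F t::real in at_top. exp (real j * ln t - \<beta> * sqrt t) = t ^ j * exp (- \<beta> * sqrt t)"
        using eventually_gt_at_top[of 0] by eventually_elim (simp add: exp_diff exp_minus exp_of_nat_mult divide_inverse)
      ultimately show ?thesis by (rule Lim_transform_eventually)
    qed
    from tendsto_mult_left[OF filterlim_compose[OF this f], of "(2 * \<beta>) ^ j"]
    show "(\<lambda>n. (2 * \<beta>) ^ j * ((l n / (2 * \<beta>)) ^ j * exp (- \<beta> * sqrt (l n / (2 * \<beta>))))) \<longlonglongrightarrow> 0" by simp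
  qed
qed

text \<open>Two one-sided estimates give all four limits: the upper bound for the kernel estimator
  also bounds the infimum, and the lower bound valid for all estimators applies to the kernel
  estimator, which belongs to \<open>estimators n\<close> for large n.\<close>

theorem theorem5:
  fixes \<alpha> L r s \<beta> x :: real and fe :: "real \<Rightarrow> real" and h :: "nat \<Rightarrow> real"
  assumes "0 < \<alpha>" and "0 < L" and "0 < r" and "r < s" and "s \<le> 2"
    and "prob_density fe"
    and "assumption_N \<beta> s (fourier fe)"
    and "assumption_ND \<beta> s (fourier fe)"
    and "\<forall>u. fourier fe u \<noteq> 0"
    and "h = h_star \<alpha> \<beta> r s \<or> (r < s / 2 \<and> h = h_a \<beta> s)"
  shows "((\<lambda>n. risk_pt fe \<alpha> r L n x (\<lambda>Y z. kernel_est fe n (h n) Y z)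
              * ennreal (1 / rate_pt \<alpha> \<beta> r s L n)) \<longlongrightarrow> 1) sequentially
       \<and> ((\<lambda>n. (INF T \<in> estimators n. risk_pt fe \<alpha> r L n x T)
              * ennreal (1 / rate_pt \<alpha> \<beta> r s L n)) \<longlongrightarrow> 1) sequentially
       \<and> ((\<lambda>n. risk_L2 fe \<alpha> r L n (\<lambda>Y z. kernel_est fe n (h n) Y z)
              * ennreal (1 / rate_L2 \<alpha> \<beta> r s L n)) \<longlongrightarrow> 1) sequentially
       \<and> ((\<lambda>n. (INF T \<in> estimators n. risk_L2 fe \<alpha> r L n T)
              * ennreal (1 / rate_L2 \<alpha> \<beta> r s L n)) \<longlongrightarrow> 1) sequentially"
proof -
  have \<beta>: "0 < \<beta>" and s: "0 < s" "r < 2" using assms by (auto simp: assumption_N_def)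
  have nz: "\<And>u. fourier fe u \<noteq> 0" using assms by blast
  obtain k0 :: nat where k0: "2 / s \<le> real k0" using real_arch_simple by blast
  have hs: "\<forall>\<^sub>F n in sequentially. 0 < h_star \<alpha> \<beta> r s n \<and> 1 \<le> 1 / h_star \<alpha> \<beta> r s n"
    using eventually_h_star[OF assms(1) \<beta> assms(3,4)] by eventually_elim simp
  note sc = h_star_comparison[OF assms(1) \<beta> assms(3,4)]
  \<comment> \<open>One list of properties for either choice of bandwidth; beyond this point the two
    cases are no longer distinguished.\<close>
  have cmp: "filterlim (\<lambda>n. 1 / h n) at_top sequentially \<and> (\<forall>\<^sub>F n in sequentially. 0 < h n) \<and> (\<forall>\<^sub>F n in sequentially. 1 / h n \<le> ln (real n) ^ k0)
     \<and> (\<lambda>n. (1 / h n) powr r - (1 / h_star \<alpha> \<beta> r s n) powr r) \<longlonglongrightarrow> 0 \<and> (\<lambda>n. (1 / h n) / (1 / h_star \<alpha> \<beta> r s n)) \<longlonglongrightarrow> 1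
     \<and> (\<forall>k. (\<lambda>n. ln (real n) ^ k * exp (2 * \<beta> * (1 / h n) powr s + 2 * \<alpha> * (1 / h_star \<alpha> \<beta> r s n) powr r) / real n) \<longlonglongrightarrow> 0)"
    using assms(10)
  proof
    assume h: "h = h_star \<alpha> \<beta> r s"
    have "\<forall>\<^sub>F n in sequentially. 0 < h n" using hs unfolding h by eventually_elim simp
    then show ?thesis using sc(1) sc(2)[OF k0] sc(3) sc(4) unfolding h by simp
  next
    assume h: "r < s / 2 \<and> h = h_a \<beta> s"
    note ac = h_a_comparison[OF assms(1) \<beta> assms(3) conjunct1[OF h]]
    show ?thesis using ac(1,2) ac(3)[OF k0] ac(4,5,6) h by simp
  qed
  have up: "(\<exists>u. u \<longlonglongrightarrow> 1 \<and> (\<forall>\<^sub>F n in sequentially. risk_pt fe \<alpha> r L n x (\<lambda>Y z. kernel_est fe n (g n) Y z) * ennreal (1 / rate_pt \<alpha> \<beta> r s L n) \<le> ennreal (u n)))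
     \<and> (\<exists>u. u \<longlonglongrightarrow> 1 \<and> (\<forall>\<^sub>F n in sequentially. risk_L2 fe \<alpha> r L n (\<lambda>Y z. kernel_est fe n (g n) Y z) * ennreal (1 / rate_L2 \<alpha> \<beta> r s L n) \<le> ennreal (u n)))
     \<and> (\<forall>\<^sub>F n in sequentially. (\<lambda>Y z. kernel_est fe n (g n) Y z) \<in> estimators n)"
    if g: "filterlim (\<lambda>n. 1 / g n) at_top sequentially" "\<forall>\<^sub>F n in sequentially. 0 < g n" "\<forall>\<^sub>F n in sequentially. 1 / g n \<le> ln (real n) ^ k0"
      "(\<lambda>n. (1 / g n) powr r - (1 / h_star \<alpha> \<beta> r s n) powr r) \<longlonglongrightarrow> 0" "(\<lambda>n. (1 / g n) / (1 / h_star \<alpha> \<beta> r s n)) \<longlonglongrightarrow> 1"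
      "\<And>k. (\<lambda>n. ln (real n) ^ k * exp (2 * \<beta> * (1 / g n) powr s + 2 * \<alpha> * (1 / h_star \<alpha> \<beta> r s n) powr r) / real n) \<longlonglongrightarrow> 0" for g
  proof -
    have "\<forall>\<^sub>F n in sequentially. 1 \<le> 1 / g n" using g(1) by (simp add: filterlim_at_top)
    moreover have "\<forall>\<^sub>F n in sequentially. 1 \<le> ln (real n)" by (rule eventually_compose_filterlim[OF eventually_ge_at_top filterlim_ln_nat])
    ultimately have ev: "\<forall>\<^sub>F n in sequentially. 0 < h_star \<alpha> \<beta> r s n \<and> 1 \<le> 1 / h_star \<alpha> \<beta> r s n \<and> 0 < g n \<and> 1 \<le> 1 / g n \<and> 1 \<le> ln (real n) \<and> 1 / g n \<le> ln (real n) ^ k0 \<and> 1 / h_star \<alpha> \<beta> r s n \<le> ln (real n) ^ k0"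
      using hs g(2,3) sc(2)[OF k0] by eventually_elim simp
    note U = kernel_risk_upper[OF assms(1,2,3) s(2) assms(6,7) nz ev g(4,5,1,6)]
    show ?thesis using U by blast
  qed
  have uh: "(\<exists>u. u \<longlonglongrightarrow> 1 \<and> (\<forall>\<^sub>F n in sequentially. risk_pt fe \<alpha> r L n x (\<lambda>Y z. kernel_est fe n (h n) Y z) * ennreal (1 / rate_pt \<alpha> \<beta> r s L n) \<le> ennreal (u n)))
     \<and> (\<exists>u. u \<longlonglongrightarrow> 1 \<and> (\<forall>\<^sub>F n in sequentially. risk_L2 fe \<alpha> r L n (\<lambda>Y z. kernel_est fe n (h n) Y z) * ennreal (1 / rate_L2 \<alpha> \<beta> r s L n) \<le> ennreal (u n)))
     \<and> (\<forall>\<^sub>F n in sequentially. (\<lambda>Y z. kernel_est fe n (h n) Y z) \<in> estimators n)"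
    by (rule up) (use cmp in auto)
  obtain u1 u2 where u1: "u1 \<longlonglongrightarrow> 1" "\<forall>\<^sub>F n in sequentially. risk_pt fe \<alpha> r L n x (\<lambda>Y z. kernel_est fe n (h n) Y z) * ennreal (1 / rate_pt \<alpha> \<beta> r s L n) \<le> ennreal (u1 n)"
    and u2: "u2 \<longlonglongrightarrow> 1" "\<forall>\<^sub>F n in sequentially. risk_L2 fe \<alpha> r L n (\<lambda>Y z. kernel_est fe n (h n) Y z) * ennreal (1 / rate_L2 \<alpha> \<beta> r s L n) \<le> ennreal (u2 n)"
    and est: "\<forall>\<^sub>F n in sequentially. (\<lambda>Y z. kernel_est fe n (h n) Y z) \<in> estimators n"
    using uh by blast
  note lo = minimax_risk_lower[OF assms(1-8)]
  have pt_le: "\<forall>\<^sub>F n in sequentially. (INF T \<in> estimators n. risk_pt fe \<alpha> r L n x T) \<le> risk_pt fe \<alpha> r L n x (\<lambda>Y z. kernel_est fe n (h n) Y z)"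
    using est by eventually_elim (rule INF_lower)
  have L2_le: "\<forall>\<^sub>F n in sequentially. (INF T \<in> estimators n. risk_L2 fe \<alpha> r L n T) \<le> risk_L2 fe \<alpha> r L n (\<lambda>Y z. kernel_est fe n (h n) Y z)"
    using est by eventually_elim (rule INF_lower)
  \<comment> \<open>For R > 0 a common bound passes to the infimum by division. For R \<le> 0 the
    factor is 0, and a single member of \<open>A\<close> already forces \<open>ennreal v\<close> to
    be 0; the kernel estimator supplies such a member.\<close>
  have INF_mult: "ennreal v \<le> (INF T \<in> A. F T) * ennreal R" if *: "\<And>T. T \<in> A \<Longrightarrow> ennreal v \<le> F T * ennreal R" and "A \<noteq> {}" for v R and F :: "((nat \<Rightarrow> real) \<Rightarrow> real \<Rightarrow> real) \<Rightarrow> ennreal" and A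
  proof -
    show ?thesis
    proof (cases "0 < R")
      case True
      have "ennreal (v * (1 / R)) \<le> F T" if "T \<in> A" for T
      proof -
        have "ennreal v * ennreal (1 / R) \<le> F T * ennreal R * ennreal (1 / R)" by (rule mult_right_mono[OF *[OF that]]) simp
        also have "\<dots> = F T" using True by (simp add: mult.assoc flip: ennreal_mult)
        finally show ?thesis using True by (subst ennreal_mult'') auto
      qed
      then have "ennreal (v * (1 / R)) \<le> (INF T\<in>A. F T)" by (rule INF_greatest)
      then have "ennreal (v * (1 / R)) * ennreal R \<le> (INF T\<in>A. F T) * ennreal R" by (rule mult_right_mono) simp
      then show ?thesis using True by (simp flip: ennreal_mult'')
    next
      case False
      then have "ennreal R = 0" by (simp add: ennreal_neg)
      then show ?thesis using * \<open>A \<noteq> {}\<close> by auto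
    qed
  qed
  show ?thesis
  proof (intro conjI)
    show "((\<lambda>n. risk_pt fe \<alpha> r L n x (\<lambda>Y z. kernel_est fe n (h n) Y z) * ennreal (1 / rate_pt \<alpha> \<beta> r s L n)) \<longlongrightarrow> 1) sequentially"
    proof (rule ennreal_tendsto_oneI[OF u1])
      fix \<delta> :: real assume \<delta>: "0 < \<delta>" "\<delta> < 1"
      obtain v where v: "v \<longlonglongrightarrow> \<delta>" "\<forall>\<^sub>F n in sequentially. \<forall>x. \<forall>T\<in>estimators n. ennreal (v n) \<le> risk_pt fe \<alpha> r L n x T * ennreal (1 / rate_pt \<alpha> \<beta> r s L n)"
        using lo(1)[OF \<delta>] by blast
      have "\<forall>\<^sub>F n in sequentially. ennreal (v n) \<le> risk_pt fe \<alpha> r L n x (\<lambda>Y z. kernel_est fe n (h n) Y z) * ennreal (1 / rate_pt \<alpha> \<beta> r s L n)"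
        using v(2) est by eventually_elim blast
      with v(1) show "\<exists>v. v \<longlonglongrightarrow> \<delta> \<and> (\<forall>\<^sub>F n in sequentially. ennreal (v n) \<le> risk_pt fe \<alpha> r L n x (\<lambda>Y z. kernel_est fe n (h n) Y z) * ennreal (1 / rate_pt \<alpha> \<beta> r s L n))" by blast
    qed
    show "((\<lambda>n. (INF T \<in> estimators n. risk_pt fe \<alpha> r L n x T) * ennreal (1 / rate_pt \<alpha> \<beta> r s L n)) \<longlongrightarrow> 1) sequentially"
    proof (rule ennreal_tendsto_oneI[OF u1(1)])
      show "\<forall>\<^sub>F n in sequentially. (INF T \<in> estimators n. risk_pt fe \<alpha> r L n x T) * ennreal (1 / rate_pt \<alpha> \<beta> r s L n) \<le> ennreal (u1 n)"
        using pt_le u1(2) by eventually_elim (meson mult_right_mono order_trans zero_le)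
      fix \<delta> :: real assume \<delta>: "0 < \<delta>" "\<delta> < 1"
      obtain v where v: "v \<longlonglongrightarrow> \<delta>" "\<forall>\<^sub>F n in sequentially. \<forall>x. \<forall>T\<in>estimators n. ennreal (v n) \<le> risk_pt fe \<alpha> r L n x T * ennreal (1 / rate_pt \<alpha> \<beta> r s L n)"
        using lo(1)[OF \<delta>] by blast
      have "\<forall>\<^sub>F n in sequentially. ennreal (v n) \<le> (INF T \<in> estimators n. risk_pt fe \<alpha> r L n x T) * ennreal (1 / rate_pt \<alpha> \<beta> r s L n)"
        using v(2) est by eventually_elim (rule INF_mult; blast)
      with v(1) show "\<exists>v. v \<longlonglongrightarrow> \<delta> \<and> (\<forall>\<^sub>F n in sequentially. ennreal (v n) \<le> (INF T \<in> estimators n. risk_pt fe \<alpha> r L n x T) * ennreal (1 / rate_pt \<alpha> \<beta> r s L n))" by blast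
    qed
    show "((\<lambda>n. risk_L2 fe \<alpha> r L n (\<lambda>Y z. kernel_est fe n (h n) Y z) * ennreal (1 / rate_L2 \<alpha> \<beta> r s L n)) \<longlongrightarrow> 1) sequentially"
    proof (rule ennreal_tendsto_oneI[OF u2])
      fix \<delta> :: real assume \<delta>: "0 < \<delta>" "\<delta> < 1"
      obtain v where v: "v \<longlonglongrightarrow> \<delta>" "\<forall>\<^sub>F n in sequentially. \<forall>T\<in>estimators n. ennreal (v n) \<le> risk_L2 fe \<alpha> r L n T * ennreal (1 / rate_L2 \<alpha> \<beta> r s L n)"
        using lo(2)[OF \<delta>] by blast
      have "\<forall>\<^sub>F n in sequentially. ennreal (v n) \<le> risk_L2 fe \<alpha> r L n (\<lambda>Y z. kernel_est fe n (h n) Y z) * ennreal (1 / rate_L2 \<alpha> \<beta> r s L n)"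
        using v(2) est by eventually_elim blast
      with v(1) show "\<exists>v. v \<longlonglongrightarrow> \<delta> \<and> (\<forall>\<^sub>F n in sequentially. ennreal (v n) \<le> risk_L2 fe \<alpha> r L n (\<lambda>Y z. kernel_est fe n (h n) Y z) * ennreal (1 / rate_L2 \<alpha> \<beta> r s L n))" by blast
    qed
    show "((\<lambda>n. (INF T \<in> estimators n. risk_L2 fe \<alpha> r L n T) * ennreal (1 / rate_L2 \<alpha> \<beta> r s L n)) \<longlongrightarrow> 1) sequentially"
    proof (rule ennreal_tendsto_oneI[OF u2(1)])
      show "\<forall>\<^sub>F n in sequentially. (INF T \<in> estimators n. risk_L2 fe \<alpha> r L n T) * ennreal (1 / rate_L2 \<alpha> \<beta> r s L n) \<le> ennreal (u2 n)"
        using L2_le u2(2) by eventually_elim (meson mult_right_mono order_trans zero_le)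
      fix \<delta> :: real assume \<delta>: "0 < \<delta>" "\<delta> < 1"
      obtain v where v: "v \<longlonglongrightarrow> \<delta>" "\<forall>\<^sub>F n in sequentially. \<forall>T\<in>estimators n. ennreal (v n) \<le> risk_L2 fe \<alpha> r L n T * ennreal (1 / rate_L2 \<alpha> \<beta> r s L n)"
        using lo(2)[OF \<delta>] by blast
      have "\<forall>\<^sub>F n in sequentially. ennreal (v n) \<le> (INF T \<in> estimators n. risk_L2 fe \<alpha> r L n T) * ennreal (1 / rate_L2 \<alpha> \<beta> r s L n)"
        using v(2) est by eventually_elim (rule INF_mult; blast)
      with v(1) show "\<exists>v. v \<longlonglongrightarrow> \<delta> \<and> (\<forall>\<^sub>F n in sequentially. ennreal (v n) \<le> (INF T \<in> estimators n. risk_L2 fe \<alpha> r L n T) * ennreal (1 / rate_L2 \<alpha> \<beta> r s L n))" by blast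
    qed
  qed
qed

end
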